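(* Let $E$ be an energy form on $L^0(m)$ and let $\mathcal N$ be a special $E$-nest. The functional $E^{(w)}_{\mathcal N}:D(E)_{w,\mathcal N}\times D(E)_{\mathcal N}\to\mathbb R$, $(f,\psi)\mapsto E^{(w)}_{\mathcal N}(f,\psi)$, is a bilinear form that extends the bilinear form $E:D(E)\times D(E)_{\mathcal N}\to\mathbb R$, $(f,g)\mapsto E(f,g)$. That is, $D(E)_{w,\mathcal N}$ is a vector space containing $D(E)$, $E^{(w)}_{\mathcal N}$ is bilinear, and $E^{(w)}_{\mathcal N}(f,\psi)=E(f,\psi)$ for all $f\in D(E)$, $\psi\in D(E)_{\mathcal N}$.
   Context: $(X,\mathcal B,m)$ is a measure space with $m$ localizable: $m$ is semi-finite and every family $\mathcal A\subseteq\mathcal B$ has an essential supremum $S\in\mathcal B$, i.e. $m(A\setminus S)=0$ for all $A\in\mathcal A$, and $m(S\setminus G)=0$ whenever $G\in\mathcal B$ satisfies $m(A\setminus G)=0$ for all $A\in\mathcal A$. $L^0(m)$ is the space of real-valued measurable functions modulo $m$-a.e. equality, with the topology $\tau(m)$ of local convergence in measure: $f_i\to f$ iff $\int_U|f_i-f|\wedge1\,dm\to0$ for every measurable $U$ with $m(U)<\infty$. A quadratic form on $L^0(m)$ is a map $q:L^0(m)\to[0,\infty]$ with $2q(u)+2q(v)=q(u+v)+q(u-v)$ and $q(\lambda u)=|\lambda|^2q(u)$ ($0\cdot\infty=0$); $D(q)=\{q<\infty\}$, and $q(u,v)=\frac14(q(u+v)-q(u-v))$ is the induced bilinear form on $D(q)$.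 The form topology on $D(q)$ is the smallest topology containing the subspace topology of $\tau(m)$ and the topology of the seminorm $q^{1/2}$; $q$ is closed if $D(q)$ is complete in it. If $q$ has a closed extension, its closure is its smallest closed extension, given by $\bar q(u)=\lim_iq(u_i)$ if there is a $q$-Cauchy net $(u_i)$ in $D(q)$ with $u_i\to u$, and $\infty$ otherwise. An $\varepsilon$-cutoff is a monotone increasing map $C:\mathbb R\to[-\varepsilon,1+\varepsilon]$ with $|C(x)-C(y)|\le|x-y|$ and $C(x)=x$ for $x\in[0,1]$. A quadratic form $E$ on $L^0(m)$ is Markovian if for each $\varepsilon>0$ there is an $\varepsilon$-cutoff $C_\varepsilon$ with $E(C_\varepsilon\circ f)\le E(f)$ for all $f\in L^0(m)$; an energy form is a closed Markovian form on $L^0(m)$. For $\varphi\in D(E)$ with $0\le\varphi\le1$ let $\widehat E_\varphi(f)=E(\varphi f)-E(\varphi f^2,\varphi)$ if $f\in L^\infty(m)$ and $\varphi f,\varphi f^2\in D(E)$, and $\widehat E_\varphi(f)=\infty$ for all other $f\in L^0(m)$; this form is closable and $E_\varphi$ denotes its closure. Let $E^{(M)}(f)=\sup\{E_\varphi(f):\varphi\in D(E),0\le\varphi\le1\}$, which is finite on $D(E)$, and let $E^{(k)}(f)=E(f)-E^{(M)}(f)$ for $f\in D(E)$, a nonnegative quadratic form on $D(E)$. An $E$-nest is a collection $\mathcal N$ of measurable sets such that $D(E)_{\mathcal N}=\{f\in D(E):\exists N\in\mathcal N,\ f1_{X\setminus N}=0\}$ is a dense subspace of $D(E)$ with respect to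 the form topology; it is special if for each $N\in\mathcal N$ there is $g_N\in D(E)_{\mathcal N}$ with $g_N\ge1_N$. $D(E)_{{\rm loc},\mathcal N}=\{f\in L^0(m):\forall N\in\mathcal N\ \exists f_N\in D(E),\ f1_N=f_N1_N\}$. For $f\in D(E)_{{\rm loc},\mathcal N}$ and $\psi\in D(E)_{\mathcal N}$ put $E^{(k)}(f,\psi)=E^{(k)}(f_\psi,\psi)$, where $f_\psi\in D(E)$ is any function with $f_\psi\psi=f\psi$ (independent of the choice). Let $I_{\mathcal N}=\{\varphi\in D(E)_{\mathcal N}:0\le\varphi\le1\}$, directed by the pointwise order. One has $D(E)_{{\rm loc},\mathcal N}\subseteq D(E_\varphi)$ for $\varphi\in I_{\mathcal N}$. The weak form domain is $D(E)_{w,\mathcal N}=\{f\in D(E)_{{\rm loc},\mathcal N}:\lim_{\varphi\in I_{\mathcal N}}E_\varphi(f,\psi)\text{ exists for all }\psi\in D(E)_{\mathcal N}\}$ and $E^{(w)}_{\mathcal N}(f,\psi)=\lim_{\varphi\in I_{\mathcal N}}E_\varphi(f,\psi)+E^{(k)}(f,\psi)$ for $f\in D(E)_{w,\mathcal N}$, $\psi\in D(E)_{\mathcal N}$. *)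

theory Defs
  imports "HOL-Analysis.Analysis"
begin

text \<open>
  Elements of \<open>L\<^sup>0(m)\<close> are represented by functions in \<^term>\<open>borel_measurable M\<close>; equality, order and
  support conditions between them are understood almost everywhere.  Subsets of \<open>L\<^sup>0(m)\<close> are
  sets of measurable functions saturated under a.e. equality, and functionals on \<open>L\<^sup>0(m)\<close> are
  functionals on representatives that respect a.e. equality.
\<close>

definition localizable :: "'a measure \<Rightarrow> bool" where
  "localizable M \<longleftrightarrow>
     (\<forall>A\<in>sets M. emeasure M A = \<infinity> \<longrightarrow>
        (\<exists>B\<in>sets M. B \<subseteq> A \<and> 0 < emeasure M B \<and> emeasure M B < \<infinity>)) \<and>
     (\<forall>\<A>. \<A> \<subseteq> sets M \<longrightarrow>
        (\<exists>S\<in>sets M. (\<forall>A\<in>\<A>. emeasure M (A - S) = 0) \<and>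
           (\<forall>G\<in>sets M. (\<forall>A\<in>\<A>. emeasure M (A - G) = 0) \<longrightarrow> emeasure M (S - G) = 0)))"

definition L0_subspace :: "'a measure \<Rightarrow> ('a \<Rightarrow> real) set \<Rightarrow> bool" where
  "L0_subspace M V \<longleftrightarrow>
     V \<subseteq> borel_measurable M \<and>
     (\<forall>u\<in>V. \<forall>v\<in>borel_measurable M. (AE x in M. u x = v x) \<longrightarrow> v \<in> V) \<and>
     (\<lambda>x. 0) \<in> V \<and>
     (\<forall>u\<in>V. \<forall>v\<in>V. (\<lambda>x. u x + v x) \<in> V) \<and>
     (\<forall>c. \<forall>u\<in>V. (\<lambda>x. c * u x) \<in> V)"

definition L0_bilinear ::
  "'a measure \<Rightarrow> ('a \<Rightarrow> real) set \<Rightarrow> ('a \<Rightarrow> real) set \<Rightarrow> (('a \<Rightarrow> real) \<Rightarrow> ('a \<Rightarrow> real) \<Rightarrow> real) \<Rightarrow> bool" where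
  "L0_bilinear M V W B \<longleftrightarrow>
     (\<forall>u\<in>V. \<forall>u'\<in>V. \<forall>w\<in>W. \<forall>w'\<in>W.
        (AE x in M. u x = u' x) \<and> (AE x in M. w x = w' x) \<longrightarrow> B u w = B u' w') \<and>
     (\<forall>u\<in>V. \<forall>v\<in>V. \<forall>w\<in>W. B (\<lambda>x. u x + v x) w = B u w + B v w) \<and>
     (\<forall>c. \<forall>u\<in>V. \<forall>w\<in>W. B (\<lambda>x. c * u x) w = c * B u w) \<and>
     (\<forall>u\<in>V. \<forall>w\<in>W. \<forall>z\<in>W. B u (\<lambda>x. w x + z x) = B u w + B u z) \<and>
     (\<forall>c. \<forall>u\<in>V. \<forall>w\<in>W. B u (\<lambda>x. c * w x) = c * B u w)"


subsection \<open>Local convergence in measure\<close>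

definition local_dist :: "'a measure \<Rightarrow> 'a set \<Rightarrow> ('a \<Rightarrow> real) \<Rightarrow> ('a \<Rightarrow> real) \<Rightarrow> real" where
  "local_dist M U f g = (LINT x:U|M. min \<bar>f x - g x\<bar> 1)"

definition local_measure_topology :: "'a measure \<Rightarrow> ('a \<Rightarrow> real) topology" where
  "local_measure_topology M = topology_generated_by
     {{g \<in> borel_measurable M. local_dist M U f g < e} | f U e.
        f \<in> borel_measurable M \<and> U \<in> sets M \<and> emeasure M U < \<infinity> \<and> e > 0}"

lemma local_dist_set_integrable:
  fixes f g :: "'a \<Rightarrow> real"
  assumes [measurable]: "f \<in> borel_measurable M" "g \<in> borel_measurable M" "U \<in> sets M"
    and "emeasure M U < \<infinity>"
  shows "set_integrable M U (\<lambda>x. min \<bar>f x - g x\<bar> 1)"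
proof -
  have i: "integrable M (indicator U :: 'a \<Rightarrow> real)"
    using assms by simp
  show ?thesis
    unfolding set_integrable_def
    by (rule Bochner_Integration.integrable_bound[OF i]) (auto simp: indicator_def)
qed

lemma local_dist_triangle:
  assumes "f \<in> borel_measurable M" "g \<in> borel_measurable M" "h \<in> borel_measurable M"
    and "U \<in> sets M" "emeasure M U < \<infinity>"
  shows "local_dist M U f h \<le> local_dist M U f g + local_dist M U g h"
proof -
  have "local_dist M U f h \<le> (LINT x:U|M. (min \<bar>f x - g x\<bar> 1) + (min \<bar>g x - h x\<bar> 1))"
    unfolding local_dist_def
    by (intro set_integral_mono local_dist_set_integrable set_integral_add assms) auto
  also have "\<dots> = local_dist M U f g + local_dist M U g h"
    unfolding local_dist_def
    by (intro set_integral_add local_dist_set_integrable assms)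
  finally show ?thesis .
qed

lemma local_dist_nonneg: "0 \<le> local_dist M U f g"
  unfolding local_dist_def set_lebesgue_integral_def
  by (intro Bochner_Integration.integral_nonneg) (auto simp: indicator_def)

lemma local_dist_commute: "local_dist M U f g = local_dist M U g f"
  unfolding local_dist_def by (simp add: abs_minus_commute)

lemma limitin_local_measure_topology:
  assumes X: "\<And>i. X i \<in> borel_measurable M" and f: "f \<in> borel_measurable M"
  shows "limitin (local_measure_topology M) X f F \<longleftrightarrow>
    (\<forall>U\<in>sets M. emeasure M U < \<infinity> \<longrightarrow> ((\<lambda>i. LINT x:U|M. min \<bar>X i x - f x\<bar> 1) \<longlongrightarrow> 0) F)"
    (is "?lhs \<longleftrightarrow> ?rhs")
proof -
  let ?S = "{{g \<in> borel_measurable M. local_dist M U f g < e} | f U e.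
        f \<in> borel_measurable M \<and> U \<in> sets M \<and> emeasure M U < \<infinity> \<and> e > 0}"
  have self: "local_dist M U f f = 0" for U
    by (simp add: local_dist_def)
  show ?thesis
  proof
    assume l: ?lhs
    show ?rhs
    proof (intro ballI impI tendstoI)
      fix U and e :: real
      assume U: "U \<in> sets M" "emeasure M U < \<infinity>" and e: "0 < e"
      let ?B = "{g \<in> borel_measurable M. local_dist M U f g < e}"
      have "openin (local_measure_topology M) ?B"
        unfolding local_measure_topology_def using U e f
        by (intro topology_generated_by_Basis) blast
      moreover have "f \<in> ?B" using f e self by simp
      ultimately have "\<forall>\<^sub>F i in F. X i \<in> ?B"
        using l unfolding limitin_def by blast
      then show "\<forall>\<^sub>F i in F. dist (LINT x:U|M. min \<bar>X i x - f x\<bar> 1) 0 < e"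
      proof eventually_elim
        case (elim i)
        then show ?case
          using local_dist_nonneg[of M U "X i" f] local_dist_commute[of M U "X i" f]
          by (simp add: dist_real_def) (simp add: local_dist_def)
      qed
    qed
  next
    assume r: ?rhs
    have "generate_topology_on ?S V \<Longrightarrow> f \<in> V \<longrightarrow> (\<forall>\<^sub>F i in F. X i \<in> V)" for V
    proof (induction rule: generate_topology_on.induct)
      case Empty
      then show ?case by simp
    next
      case (Int a b)
      then show ?case by (auto simp: eventually_conj_iff)
    next
      case (UN K)
      show ?case
      proof
        assume "f \<in> \<Union>K"
        then obtain k where "k \<in> K" "f \<in> k" by blast
        with UN have "\<forall>\<^sub>F i in F. X i \<in> k" by blast
        then show "\<forall>\<^sub>F i in F. X i \<in> \<Union>K"
          by (rule eventually_mono) (use \<open>k \<in> K\<close> in blast)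
      qed
    next
      case (Basis s)
      then obtain h U e where s: "s = {g \<in> borel_measurable M. local_dist M U h g < e}"
        and h: "h \<in> borel_measurable M" and U: "U \<in> sets M" "emeasure M U < \<infinity>" by blast
      show ?case
      proof
        assume "f \<in> s"
        then have *: "0 < e - local_dist M U h f" by (simp add: s)
        have "((\<lambda>i. local_dist M U (X i) f) \<longlongrightarrow> 0) F"
          using r U by (simp add: local_dist_def)
        from order_tendstoD(2)[OF this *]
        show "\<forall>\<^sub>F i in F. X i \<in> s"
        proof eventually_elim
          case (elim i)
          then show ?case
            using local_dist_triangle[OF h f X[of i] U] X[of i] local_dist_commute[of M U f "X i"]
            by (simp add: s)
        qed
      qed
    qed
    moreover have "f \<in> topspace (local_measure_topology M)"
    proof -
      have "openin (local_measure_topology M) {g \<in> borel_measurable M. local_dist M {} f g < 1}"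
        unfolding local_measure_topology_def using f
        by (intro topology_generated_by_Basis CollectI exI[of _ f] exI[of _ "{}"] exI[of _ 1]) simp
      moreover have "f \<in> {g \<in> borel_measurable M. local_dist M {} f g < 1}"
        using f self by simp
      ultimately show ?thesis using openin_subset by blast
    qed
    ultimately show ?lhs
      unfolding limitin_def by (simp add: local_measure_topology_def openin_topology_generated_by_iff)
  qed
qed


subsection \<open>Quadratic forms\<close>

text \<open>
  A quadratic form on \<open>L\<^sup>0(m)\<close> is normalised to be \<open>\<infinity>\<close> outside of \<^term>\<open>borel_measurable M\<close>, so that
  forms on \<open>L\<^sup>0(m)\<close> correspond one-to-one to functions satisfying \<open>quadratic_form\<close>.
\<close>

definition quadratic_form :: "'a measure \<Rightarrow> (('a \<Rightarrow> real) \<Rightarrow> ereal) \<Rightarrow> bool" where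
  "quadratic_form M q \<longleftrightarrow>
     (\<forall>u. 0 \<le> q u) \<and>
     (\<forall>u. u \<notin> borel_measurable M \<longrightarrow> q u = \<infinity>) \<and>
     (\<forall>u\<in>borel_measurable M. \<forall>v\<in>borel_measurable M. (AE x in M. u x = v x) \<longrightarrow> q u = q v) \<and>
     (\<forall>u\<in>borel_measurable M. \<forall>v\<in>borel_measurable M.
        2 * q u + 2 * q v = q (\<lambda>x. u x + v x) + q (\<lambda>x. u x - v x)) \<and>
     (\<forall>c. \<forall>u\<in>borel_measurable M. q (\<lambda>x. c * u x) = ereal (\<bar>c\<bar>\<^sup>2) * q u)"

definition form_domain :: "(('a \<Rightarrow> real) \<Rightarrow> ereal) \<Rightarrow> ('a \<Rightarrow> real) set" where
  "form_domain q = {u. q u < \<infinity>}"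

definition form_bilinear ::
  "(('a \<Rightarrow> real) \<Rightarrow> ereal) \<Rightarrow> ('a \<Rightarrow> real) \<Rightarrow> ('a \<Rightarrow> real) \<Rightarrow> real" where
  "form_bilinear q u v =
     (real_of_ereal (q (\<lambda>x. u x + v x)) - real_of_ereal (q (\<lambda>x. u x - v x))) / 4"

definition form_seminorm_topology :: "(('a \<Rightarrow> real) \<Rightarrow> ereal) \<Rightarrow> ('a \<Rightarrow> real) topology" where
  "form_seminorm_topology q = topology_generated_by
     {{v \<in> form_domain q. sqrt (real_of_ereal (q (\<lambda>x. u x - v x))) < e} | u e.
        u \<in> form_domain q \<and> e > 0}"

definition form_topology ::
  "'a measure \<Rightarrow> (('a \<Rightarrow> real) \<Rightarrow> ereal) \<Rightarrow> ('a \<Rightarrow> real) topology" where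
  "form_topology M q = topology_generated_by
     ({V. openin (subtopology (local_measure_topology M) (form_domain q)) V} \<union>
      {V. openin (form_seminorm_topology q) V})"

text \<open>
  Completeness of a vector space of functions with a vector space topology, in terms of Cauchy
  filters for the uniformity given by the neighbourhoods of \<open>0\<close>.  The topologies here are not
  Hausdorff on representatives, so limits are unique only up to a.e. equality.
\<close>

definition Cauchy_filter_in :: "('a \<Rightarrow> real) topology \<Rightarrow> ('a \<Rightarrow> real) filter \<Rightarrow> bool" where
  "Cauchy_filter_in T F \<longleftrightarrow>
     F \<noteq> bot \<and> F \<le> principal (topspace T) \<and>
     (\<forall>V. openin T V \<and> (\<lambda>x. 0) \<in> V \<longrightarrow> (\<forall>\<^sub>F (u, v) in F \<times>\<^sub>F F. (\<lambda>x. u x - v x) \<in> V))"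

definition complete_function_topology :: "('a \<Rightarrow> real) topology \<Rightarrow> bool" where
  "complete_function_topology T \<longleftrightarrow>
     (\<forall>F. Cauchy_filter_in T F \<longrightarrow> (\<exists>u. limitin T (\<lambda>v. v) u F))"

definition closed_form :: "'a measure \<Rightarrow> (('a \<Rightarrow> real) \<Rightarrow> ereal) \<Rightarrow> bool" where
  "closed_form M q \<longleftrightarrow> quadratic_form M q \<and> complete_function_topology (form_topology M q)"

definition form_extends ::
  "(('a \<Rightarrow> real) \<Rightarrow> ereal) \<Rightarrow> (('a \<Rightarrow> real) \<Rightarrow> ereal) \<Rightarrow> bool" where
  "form_extends p q \<longleftrightarrow> (\<forall>u\<in>form_domain q. p u = q u)"

definition is_form_closure ::
  "'a measure \<Rightarrow> (('a \<Rightarrow> real) \<Rightarrow> ereal) \<Rightarrow> (('a \<Rightarrow> real) \<Rightarrow> ereal) \<Rightarrow> bool" where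
  "is_form_closure M q p \<longleftrightarrow>
     closed_form M p \<and> form_extends p q \<and>
     (\<forall>p'. closed_form M p' \<and> form_extends p' q \<longrightarrow> form_extends p' p)"

lemma is_form_closure_unique:
  assumes "is_form_closure M q p" "is_form_closure M q p'"
  shows "p = p'"
proof
  fix u
  have "form_extends p' p" "form_extends p p'"
    using assms unfolding is_form_closure_def by blast+
  then show "p u = p' u"
    unfolding form_extends_def form_domain_def
    by (metis mem_Collect_eq ereal_infty_less(1))
qed

definition form_closure ::
  "'a measure \<Rightarrow> (('a \<Rightarrow> real) \<Rightarrow> ereal) \<Rightarrow> ('a \<Rightarrow> real) \<Rightarrow> ereal" where
  "form_closure M q = (THE p. is_form_closure M q p)"


subsection \<open>Energy forms\<close>

definition eps_cutoff :: "real \<Rightarrow> (real \<Rightarrow> real) \<Rightarrow> bool" where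
  "eps_cutoff \<epsilon> C \<longleftrightarrow>
     mono C \<and> range C \<subseteq> {-\<epsilon>..1 + \<epsilon>} \<and> (\<forall>x y. \<bar>C x - C y\<bar> \<le> \<bar>x - y\<bar>) \<and> (\<forall>x\<in>{0..1}. C x = x)"

definition markovian :: "'a measure \<Rightarrow> (('a \<Rightarrow> real) \<Rightarrow> ereal) \<Rightarrow> bool" where
  "markovian M E \<longleftrightarrow>
     (\<forall>\<epsilon>>0. \<exists>C. eps_cutoff \<epsilon> C \<and> (\<forall>f\<in>borel_measurable M. E (C \<circ> f) \<le> E f))"

definition energy_form :: "'a measure \<Rightarrow> (('a \<Rightarrow> real) \<Rightarrow> ereal) \<Rightarrow> bool" where
  "energy_form M E \<longleftrightarrow> closed_form M E \<and> markovian M E"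

definition Linfty :: "'a measure \<Rightarrow> ('a \<Rightarrow> real) set" where
  "Linfty M = {f \<in> borel_measurable M. \<exists>c. AE x in M. \<bar>f x\<bar> \<le> c}"

definition unit_functions :: "'a measure \<Rightarrow> ('a \<Rightarrow> real) set \<Rightarrow> ('a \<Rightarrow> real) set" where
  "unit_functions M V = {\<phi> \<in> V. AE x in M. 0 \<le> \<phi> x \<and> \<phi> x \<le> 1}"

definition pre_local_form ::
  "'a measure \<Rightarrow> (('a \<Rightarrow> real) \<Rightarrow> ereal) \<Rightarrow> ('a \<Rightarrow> real) \<Rightarrow> ('a \<Rightarrow> real) \<Rightarrow> ereal" where
  "pre_local_form M E \<phi> f =
     (if f \<in> Linfty M \<and> (\<lambda>x. \<phi> x * f x) \<in> form_domain E \<and> (\<lambda>x. \<phi> x * (f x)\<^sup>2) \<in> form_domain E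
      then E (\<lambda>x. \<phi> x * f x) - ereal (form_bilinear E (\<lambda>x. \<phi> x * (f x)\<^sup>2) \<phi>)
      else \<infinity>)"

definition local_form ::
  "'a measure \<Rightarrow> (('a \<Rightarrow> real) \<Rightarrow> ereal) \<Rightarrow> ('a \<Rightarrow> real) \<Rightarrow> ('a \<Rightarrow> real) \<Rightarrow> ereal" where
  "local_form M E \<phi> = form_closure M (pre_local_form M E \<phi>)"

definition main_part ::
  "'a measure \<Rightarrow> (('a \<Rightarrow> real) \<Rightarrow> ereal) \<Rightarrow> ('a \<Rightarrow> real) \<Rightarrow> ereal" where
  "main_part M E f = (SUP \<phi>\<in>unit_functions M (form_domain E). local_form M E \<phi> f)"

text \<open>Only meaningful on \<^term>\<open>form_domain E\<close>, where both terms are finite.\<close>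

definition killing_part ::
  "'a measure \<Rightarrow> (('a \<Rightarrow> real) \<Rightarrow> ereal) \<Rightarrow> ('a \<Rightarrow> real) \<Rightarrow> ereal" where
  "killing_part M E f = E f - main_part M E f"


subsection \<open>Nests and the weak form\<close>

definition nest_domain ::
  "'a measure \<Rightarrow> (('a \<Rightarrow> real) \<Rightarrow> ereal) \<Rightarrow> 'a set set \<Rightarrow> ('a \<Rightarrow> real) set" where
  "nest_domain M E \<N> =
     {f \<in> form_domain E. \<exists>N\<in>\<N>. AE x in M. f x * indicator (space M - N) x = 0}"

definition nest :: "'a measure \<Rightarrow> (('a \<Rightarrow> real) \<Rightarrow> ereal) \<Rightarrow> 'a set set \<Rightarrow> bool" where
  "nest M E \<N> \<longleftrightarrow>
     \<N> \<subseteq> sets M \<and> L0_subspace M (nest_domain M E \<N>) \<and>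
     form_topology M E closure_of nest_domain M E \<N> = form_domain E"

definition special_nest :: "'a measure \<Rightarrow> (('a \<Rightarrow> real) \<Rightarrow> ereal) \<Rightarrow> 'a set set \<Rightarrow> bool" where
  "special_nest M E \<N> \<longleftrightarrow>
     nest M E \<N> \<and> (\<forall>N\<in>\<N>. \<exists>g\<in>nest_domain M E \<N>. AE x in M. g x \<ge> indicator N x)"

definition local_domain ::
  "'a measure \<Rightarrow> (('a \<Rightarrow> real) \<Rightarrow> ereal) \<Rightarrow> 'a set set \<Rightarrow> ('a \<Rightarrow> real) set" where
  "local_domain M E \<N> =
     {f \<in> borel_measurable M. \<forall>N\<in>\<N>. \<exists>g\<in>form_domain E.
        AE x in M. f x * indicator N x = g x * indicator N x}"

text \<open>The value does not depend on the choice of \<open>g\<close> with \<open>g \<psi> = f \<psi>\<close>.\<close>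

definition killing_bilinear ::
  "'a measure \<Rightarrow> (('a \<Rightarrow> real) \<Rightarrow> ereal) \<Rightarrow> ('a \<Rightarrow> real) \<Rightarrow> ('a \<Rightarrow> real) \<Rightarrow> real" where
  "killing_bilinear M E f \<psi> =
     form_bilinear (killing_part M E)
       (SOME g. g \<in> form_domain E \<and> (AE x in M. g x * \<psi> x = f x * \<psi> x)) \<psi>"

text \<open>
  The filter of the net of all \<open>\<phi>\<close> in \<open>I\<close>, the functions in \<^term>\<open>nest_domain M E \<N>\<close> with values
  in \<open>[0,1]\<close>, directed by the a.e. pointwise order.
\<close>

definition nest_filter ::
  "'a measure \<Rightarrow> (('a \<Rightarrow> real) \<Rightarrow> ereal) \<Rightarrow> 'a set set \<Rightarrow> ('a \<Rightarrow> real) filter" where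
  "nest_filter M E \<N> =
     (let I = unit_functions M (nest_domain M E \<N>)
      in INF \<phi>\<^sub>0\<in>I. principal {\<phi>\<in>I. AE x in M. \<phi>\<^sub>0 x \<le> \<phi> x})"

definition weak_domain ::
  "'a measure \<Rightarrow> (('a \<Rightarrow> real) \<Rightarrow> ereal) \<Rightarrow> 'a set set \<Rightarrow> ('a \<Rightarrow> real) set" where
  "weak_domain M E \<N> =
     {f \<in> local_domain M E \<N>. \<forall>\<psi>\<in>nest_domain M E \<N>.
        \<exists>l. ((\<lambda>\<phi>. form_bilinear (local_form M E \<phi>) f \<psi>) \<longlongrightarrow> l) (nest_filter M E \<N>)}"

definition weak_form ::
  "'a measure \<Rightarrow> (('a \<Rightarrow> real) \<Rightarrow> ereal) \<Rightarrow> 'a set set \<Rightarrow> ('a \<Rightarrow> real) \<Rightarrow> ('a \<Rightarrow> real) \<Rightarrow> real" where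
  "weak_form M E \<N> f \<psi> =
     Lim (nest_filter M E \<N>) (\<lambda>\<phi>. form_bilinear (local_form M E \<phi>) f \<psi>) +
     killing_bilinear M E f \<psi>"

end

theory Submission
  imports Defs "HOL-Library.Function_Algebras"
begin

text \<open>
  The Moreau approximations \<open>f \<mapsto> inf\<^sub>g E(g) + n \<integral>\<^sub>U (f - g)\<^sup>2\<close> of \<open>E\<close> are finite on bounded functions,
  Markovian, and converge to \<open>E\<close>.  On simple functions such a form is
  \<open>1/2 \<Sum> w\<^sub>j\<^sub>k (a\<^sub>j - a\<^sub>k) (b\<^sub>j - b\<^sub>k) + \<Sum> c\<^sub>j a\<^sub>j b\<^sub>j\<close> with nonnegative weights, so that inequalities which hold
  pointwise for these expressions pass to \<open>E\<close>.  In this way \<open>E(\<phi> f) - E(\<phi> f\<^sup>2, \<phi>)\<close> is seen to be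
  nonnegative, increasing in \<open>\<phi>\<close>, bounded by \<open>E(f)\<close> and decreasing under truncation of \<open>f\<close>.

  A quadratic form on \<open>L\<^sup>0\<close> is closed if and only if it is lower semicontinuous, and its closure is
  the lower semicontinuous envelope; this makes \<open>E\<^sub>\<phi>\<close> explicit.  The killing part depends on \<open>\<bar>f\<bar>\<close>
  only, whence \<open>E\<^sup>(\<^sup>k\<^sup>)(g, \<psi>) = 0\<close> if \<open>g \<psi> = 0\<close>, and \<open>E\<^sup>(\<^sup>k\<^sup>)(f, \<psi>)\<close> is well defined for local \<open>f\<close>.  Finally
  monotonicity in \<open>\<phi>\<close> and density of the nest domain show \<open>E\<^sub>\<phi>(f, \<psi>) \<rightarrow> E\<^sup>(\<^sup>M\<^sup>)(f, \<psi>)\<close> for \<open>f\<close> in \<open>D(E)\<close>.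
\<close>

section \<open>Abstract quadratic forms\<close>

text \<open>The reason why E_\<phi> is accessible to discretisation is the identity (a b - a' b')^2
  - (a b^2 - a' b'^2) (a - a') = a a' (b - b')^2, together with its diagonal counterpart (a b)^2 -
  (a b^2) a = 0. In the discrete picture E_\<phi> is the jump part of E with the weight between two
  points multiplied by the values of \<phi> at both, and without killing; sign, monotonicity in
  \<phi>, domination by E and behaviour under truncation are all read off a a' (b - b')^2. Two
  obstacles shape the rest. The measure need not be sigma-finite, so recovery and density arguments
  run along nets indexed by pairs of a finite-measure set and a precision. And discretisation needs
  functions with values in a compact set, whereas the forms are wanted on unbounded functions:
  estimates are proved for bounded functions and carried over by truncation, where convergence in
  energy comes from lower semicontinuity and the parallelogram law instead of a Hilbert space
  structure.\<close>

instantiation "fun" :: (type, real_vector) real_vector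
begin

definition "scaleR c f = (\<lambda>x. c *\<^sub>R f x)"

instance
  by standard (auto simp: scaleR_fun_def fun_eq_iff algebra_simps)

end

lemma scaleR_fun_apply [simp]: "(c *\<^sub>R f) x = c *\<^sub>R f x"
  by (simp add: scaleR_fun_def)

text \<open>Subtracting \<open>t * g 1\<close> leaves an additive \<open>h\<close> that vanishes on
  the integers, so \<open>h t = h (frac t)\<close> is bounded on the whole line; since
  \<open>h (n * t) = n * h t\<close>, boundedness forces \<open>h = 0\<close>.\<close>

lemma additive_bounded_imp_linear:
  fixes g :: "real \<Rightarrow> real"
  assumes add: "\<And>s t. g (s + t) = g s + g t" and bnd: "\<And>t. \<bar>t\<bar> \<le> 1 \<Longrightarrow> \<bar>g t\<bar> \<le> C"
  shows "g t = t * g 1"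
proof -
  define h where "h t = g t - t * g 1" for t
  have hadd: "h (s + t) = h s + h t" for s t
    by (simp add: h_def add algebra_simps)
  have h1: "h 1 = 0" by (simp add: h_def)
  have h0: "h 0 = 0" using hadd[of 0 0] by simp
  have hneg: "h (- t) = - h t" for t using hadd[of t "- t"] h0 by simp
  have hnat: "h (real n * t) = real n * h t" for n t
    by (induction n) (simp_all add: h0 hadd distrib_right)
  have hint: "h (of_int k) = 0" for k
  proof (cases k)
    case (nonneg n)
    then show ?thesis using hnat[of n 1] h1 by simp
  next
    case (neg n)
    then show ?thesis using hnat[of "Suc n" 1] hneg[of "real (Suc n)"] h1 by simp
  qed
  have hb: "\<bar>h t\<bar> \<le> C + \<bar>g 1\<bar>" for t
  proof -
    have "h t = h (of_int \<lfloor>t\<rfloor> + frac t)" by (simp add: frac_def)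
    then have "h t = h (frac t)" using hadd hint by simp
    moreover have f: "\<bar>frac t\<bar> \<le> 1" using frac_ge_0[of t] frac_lt_1[of t] by linarith
    have "\<bar>h (frac t)\<bar> \<le> \<bar>g (frac t)\<bar> + \<bar>frac t\<bar> * \<bar>g 1\<bar>"
      unfolding h_def by (metis abs_triangle_ineq4 abs_mult)
    moreover have "\<bar>frac t\<bar> * \<bar>g 1\<bar> \<le> \<bar>g 1\<bar>"
      using f by (simp add: mult_left_le_one_le)
    ultimately show ?thesis using bnd[OF f] by linarith
  qed
  have "h t = 0"
  proof (rule ccontr)
    assume "h t \<noteq> 0"
    then obtain n where "C + \<bar>g 1\<bar> < real n * \<bar>h t\<bar>"
      using reals_Archimedean3[of "\<bar>h t\<bar>"] by auto
    then show False using hb[of "real n * t"] by (simp add: hnat abs_mult)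
  qed
  then show ?thesis by (simp add: h_def)
qed

text \<open>Only the parallelogram law and homogeneity are assumed, because suprema, infimal
  convolutions and envelopes of forms are built without a bilinear form at hand; \<open>B\<close>
  and its bilinearity are recovered by polarisation (Jordan-von Neumann). Nothing is required of
  \<open>Q\<close> outside \<open>D\<close>.\<close>

locale quad_space =
  fixes D :: "'v::real_vector set" and Q :: "'v \<Rightarrow> real"
  assumes sub: "subspace D"
    and nonneg: "u \<in> D \<Longrightarrow> 0 \<le> Q u"
    and par: "u \<in> D \<Longrightarrow> v \<in> D \<Longrightarrow> Q (u + v) + Q (u - v) = 2 * Q u + 2 * Q v"
    and hom: "u \<in> D \<Longrightarrow> Q (c *\<^sub>R u) = c\<^sup>2 * Q u"
begin

definition B :: "'v \<Rightarrow> 'v \<Rightarrow> real" where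
  "B u v = (Q (u + v) - Q (u - v)) / 4"

lemmas mem [simp, intro] = subspace_add[OF sub] subspace_diff[OF sub] subspace_scale[OF sub]
  subspace_0[OF sub] subspace_sum[OF sub] subspace_neg[OF sub]

lemma Q_minus: "u \<in> D \<Longrightarrow> Q (- u) = Q u"
  using hom[of u "-1"] by simp

lemma Q_zero [simp]: "Q 0 = 0"
  using hom[of 0 0] by simp

lemma Q_minus_commute: "u \<in> D \<Longrightarrow> v \<in> D \<Longrightarrow> Q (u - v) = Q (v - u)"
  using Q_minus[of "u - v"] by simp

lemma B_commute: "u \<in> D \<Longrightarrow> v \<in> D \<Longrightarrow> B u v = B v u"
  unfolding B_def by (simp add: add.commute Q_minus_commute)

lemma B_self: "u \<in> D \<Longrightarrow> B u u = Q u"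
  unfolding B_def using hom[of u 2] by (simp add: scaleR_2)

text \<open>The Jordan-von Neumann computation: in the alternating sum of the four parallelogram
  laws the mixed terms cancel because \<open>Q\<close> is even.\<close>

lemma B_add_left:
  assumes "u \<in> D" "v \<in> D" "w \<in> D"
  shows "B (u + w) v = B u v + B w v"
proof -
  have "Q (u + v + w) + Q (u + v - w) = 2 * Q (u + v) + 2 * Q w"
    "Q (u - v + w) + Q (u - v - w) = 2 * Q (u - v) + 2 * Q w"
    "Q (w + v + u) + Q (w + v - u) = 2 * Q (w + v) + 2 * Q u"
    "Q (w - v + u) + Q (w - v - u) = 2 * Q (w - v) + 2 * Q u"
    using assms by (auto intro!: par)
  moreover have "Q (u + v - w) = Q (w - v - u)" "Q (u - v - w) = Q (w + v - u)"
    using Q_minus[of "u + v - w"] Q_minus[of "u - v - w"] assms by (auto simp: algebra_simps)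
  moreover have "w + v + u = u + v + w" "w - v + u = u - v + w"
    by (simp_all add: algebra_simps)
  ultimately have "Q (u + v + w) - Q (u - v + w) = Q (u + v) - Q (u - v) + (Q (w + v) - Q (w - v))"
    by (simp only:)
  moreover have "u + w + v = u + v + w" "u + w - v = u - v + w"
    by (simp_all add: algebra_simps)
  ultimately show ?thesis unfolding B_def by (simp only: add_divide_distrib)
qed

lemma B_bound: "u \<in> D \<Longrightarrow> v \<in> D \<Longrightarrow> \<bar>B u v\<bar> \<le> (Q u + Q v) / 2"
  using par[of u v] nonneg[of "u + v"] nonneg[of "u - v"] unfolding B_def by auto

text \<open>Additivity alone handles rational scalars; boundedness of
  \<open>B (t *\<^sub>R u) v\<close> for \<open>\<bar>t\<bar> \<le> 1\<close> supplies the
  regularity needed for real ones.\<close>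

lemma B_scale_left:
  assumes "u \<in> D" "v \<in> D"
  shows "B (c *\<^sub>R u) v = c * B u v"
proof -
  have "B (t *\<^sub>R u) v = t * B (1 *\<^sub>R u) v" for t
  proof (rule additive_bounded_imp_linear[where C = "(Q u + Q v) / 2"])
    show "B ((s + t) *\<^sub>R u) v = B (s *\<^sub>R u) v + B (t *\<^sub>R u) v" for s t
      using assms by (simp add: scaleR_add_left B_add_left)
    show "\<bar>B (t *\<^sub>R u) v\<bar> \<le> (Q u + Q v) / 2" if "\<bar>t\<bar> \<le> 1" for t
    proof -
      have "t\<^sup>2 \<le> 1" using that by (simp add: abs_square_le_1)
      then have "t\<^sup>2 * Q u \<le> Q u"
        using nonneg[OF assms(1)] by (simp add: mult_left_le_one_le)
      then show ?thesis using B_bound[of "t *\<^sub>R u" v] assms hom[of u t] by auto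
    qed
  qed
  then show ?thesis by simp
qed

lemma B_add_right: "u \<in> D \<Longrightarrow> v \<in> D \<Longrightarrow> w \<in> D \<Longrightarrow> B u (v + w) = B u v + B u w"
  using B_add_left[of v u w] by (simp add: B_commute[of u])

lemma B_scale_right: "u \<in> D \<Longrightarrow> v \<in> D \<Longrightarrow> B u (c *\<^sub>R v) = c * B u v"
  using B_scale_left[of v u c] by (simp add: B_commute[of u])

lemma B_minus_left: "u \<in> D \<Longrightarrow> v \<in> D \<Longrightarrow> B (- u) v = - B u v"
  using B_scale_left[of u v "-1"] by simp

lemma B_diff_left: "u \<in> D \<Longrightarrow> v \<in> D \<Longrightarrow> w \<in> D \<Longrightarrow> B (u - w) v = B u v - B w v"
  using B_add_left[of u v "- w"] B_minus_left[of w v] by simp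

lemma B_diff_right: "u \<in> D \<Longrightarrow> v \<in> D \<Longrightarrow> w \<in> D \<Longrightarrow> B u (v - w) = B u v - B u w"
  using B_diff_left[of v u w] by (simp add: B_commute[of u])

lemma B_zero_left [simp]: "v \<in> D \<Longrightarrow> B 0 v = 0"
  using B_scale_left[of 0 v 0] by simp

lemma B_zero_right [simp]: "v \<in> D \<Longrightarrow> B v 0 = 0"
  using B_commute[of v 0] by simp

lemma B_sum_left: "(\<And>i. i \<in> I \<Longrightarrow> f i \<in> D) \<Longrightarrow> v \<in> D \<Longrightarrow> B (sum f I) v = (\<Sum>i\<in>I. B (f i) v)"
  by (induction I rule: infinite_finite_induct) (auto simp: B_add_left)

lemma B_sum_right: "(\<And>i. i \<in> I \<Longrightarrow> f i \<in> D) \<Longrightarrow> v \<in> D \<Longrightarrow> B v (sum f I) = (\<Sum>i\<in>I. B v (f i))"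
  by (induction I rule: infinite_finite_induct) (auto simp: B_add_right)

lemma Q_add: "u \<in> D \<Longrightarrow> v \<in> D \<Longrightarrow> Q (u + v) = Q u + 2 * B u v + Q v"
  using par[of u v] unfolding B_def by (simp add: field_simps)

lemma Q_diff: "u \<in> D \<Longrightarrow> v \<in> D \<Longrightarrow> Q (u - v) = Q u - 2 * B u v + Q v"
  using par[of u v] unfolding B_def by (simp add: field_simps)

lemma Q_add_le: "u \<in> D \<Longrightarrow> v \<in> D \<Longrightarrow> Q (u + v) \<le> 2 * Q u + 2 * Q v"
  using par[of u v] nonneg[of "u - v"] by simp

lemma Q_diff_le: "u \<in> D \<Longrightarrow> v \<in> D \<Longrightarrow> Q (u - v) \<le> 2 * Q u + 2 * Q v"
  using par[of u v] nonneg[of "u + v"] by simp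

lemma B_Cauchy_Schwarz:
  assumes "u \<in> D" "v \<in> D"
  shows "\<bar>B u v\<bar> \<le> sqrt (Q u) * sqrt (Q v)"
proof -
  have q: "0 \<le> Q u + 2 * t * B u v + t\<^sup>2 * Q v" for t
    using nonneg[of "u + t *\<^sub>R v"] Q_add[of u "t *\<^sub>R v"] assms hom[of v t] B_scale_right[of u v t]
    by auto
  \<comment> \<open>\<open>Q\<close> may vanish on nonzero vectors. If \<open>Q v = 0\<close> the
    polynomial in \<open>q\<close> is affine and nonnegative, so its slope is zero; otherwise its
    minimum at \<open>t = - B u v / Q v\<close> gives the inequality.\<close>
  have "(B u v)\<^sup>2 \<le> Q u * Q v"
  proof (cases "Q v = 0")
    case True
    have "B u v = 0"
    proof (rule ccontr)
      assume n: "B u v \<noteq> 0"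
      have "2 * (-(Q u + 1) / (2 * B u v)) * B u v = - (Q u + 1)"
        using n by (simp add: field_simps)
      then show False using q[of "-(Q u + 1) / (2 * B u v)"] True by simp
    qed
    then show ?thesis using True by simp
  next
    case False
    then have p: "Q v > 0" using nonneg[OF assms(2)] by simp
    have "Q u + 2 * (- B u v / Q v) * B u v + (- B u v / Q v)\<^sup>2 * Q v = Q u - (B u v)\<^sup>2 / Q v"
      using p by (simp add: field_simps power2_eq_square)
    then have "0 \<le> Q u - (B u v)\<^sup>2 / Q v" using q[of "- B u v / Q v"] by simp
    then show ?thesis using p by (simp add: field_simps)
  qed
  then show ?thesis
    using nonneg[OF assms(1)] nonneg[OF assms(2)]
    by (metis real_sqrt_abs real_sqrt_le_iff real_sqrt_mult)
qed

lemma sqrt_Q_triangle: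
  assumes "u \<in> D" "v \<in> D"
  shows "sqrt (Q (u + v)) \<le> sqrt (Q u) + sqrt (Q v)"
proof (rule real_le_lsqrt)
  show "Q (u + v) \<le> (sqrt (Q u) + sqrt (Q v))\<^sup>2"
    using B_Cauchy_Schwarz[OF assms] Q_add[OF assms] nonneg[OF assms(1)] nonneg[OF assms(2)]
    by (simp add: power2_sum)
qed (use assms nonneg in auto)

lemma tendsto_B:
  assumes "\<And>i. X i \<in> D" "\<And>i. Y i \<in> D" "x \<in> D" "y \<in> D"
    and X: "((\<lambda>i. Q (X i - x)) \<longlongrightarrow> 0) F" and Y: "((\<lambda>i. Q (Y i - y)) \<longlongrightarrow> 0) F"
  shows "((\<lambda>i. B (X i) (Y i)) \<longlongrightarrow> B x y) F"
proof -
  define g where "g i = sqrt (Q (X i - x)) * sqrt (Q (Y i - y)) + sqrt (Q x) * sqrt (Q (Y i - y)) +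
      sqrt (Q (X i - x)) * sqrt (Q y)" for i
  have "(g \<longlongrightarrow> sqrt 0 * sqrt 0 + sqrt (Q x) * sqrt 0 + sqrt 0 * sqrt (Q y)) F"
    unfolding g_def by (intro tendsto_intros X Y)
  then have g: "(g \<longlongrightarrow> 0) F" by simp
  have le: "norm (B (X i) (Y i) - B x y) \<le> g i" for i
  proof -
    have "B (X i) (Y i) - B x y = B (X i - x) (Y i - y) + B x (Y i - y) + B (X i - x) y"
      using assms(1-4) by (simp add: B_diff_left B_diff_right)
    moreover have "\<bar>B (X i - x) (Y i - y)\<bar> \<le> sqrt (Q (X i - x)) * sqrt (Q (Y i - y))"
      "\<bar>B x (Y i - y)\<bar> \<le> sqrt (Q x) * sqrt (Q (Y i - y))"
      "\<bar>B (X i - x) y\<bar> \<le> sqrt (Q (X i - x)) * sqrt (Q y)"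
      using assms(1-4) by (simp_all add: B_Cauchy_Schwarz)
    ultimately show ?thesis unfolding g_def real_norm_def by linarith
  qed
  have "((\<lambda>i. B (X i) (Y i) - B x y) \<longlongrightarrow> 0) F"
    by (rule Lim_null_comparison[OF always_eventually[OF allI[OF le]] g])
  then show ?thesis by (rule LIM_zero_cancel)
qed

lemma tendsto_Q:
  assumes "\<And>i. X i \<in> D" "x \<in> D" and "((\<lambda>i. Q (X i - x)) \<longlongrightarrow> 0) F"
  shows "((\<lambda>i. Q (X i)) \<longlongrightarrow> Q x) F"
  using tendsto_B[OF assms(1) assms(1) assms(2,2,3,3)] assms by (simp add: B_self)

text \<open>A discrete Beurling-Deny decomposition: when the products of differences are expanded,
  symmetry of \<open>B\<close> leaves the mixed terms and a diagonal part, and the latter is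
  cancelled by the first sum. The numbers \<open>- B (e j) (e k)\<close> act as jump weights and
  \<open>B (e j) (\<Sum>k\<in>J. e k)\<close> as killing weights; their signs come later from the
  Markov property.\<close>

lemma B_step_expansion:
  assumes "finite J" and e: "\<And>j. j \<in> J \<Longrightarrow> e j \<in> D"
  shows "B (\<Sum>j\<in>J. a j *\<^sub>R e j) (\<Sum>j\<in>J. b j *\<^sub>R e j) =
    (\<Sum>j\<in>J. a j * b j * B (e j) (\<Sum>k\<in>J. e k)) +
    (\<Sum>j\<in>J. \<Sum>k\<in>J. - B (e j) (e k) * ((a j - a k) * (b j - b k))) / 2"
proof -
  let ?S = "\<lambda>f. \<Sum>j\<in>J. \<Sum>k\<in>J. f j k :: real"
  have 1: "B (\<Sum>j\<in>J. a j *\<^sub>R e j) (\<Sum>j\<in>J. b j *\<^sub>R e j) = ?S (\<lambda>j k. a j * b k * B (e j) (e k))"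
  proof -
    have "B (\<Sum>j\<in>J. a j *\<^sub>R e j) (\<Sum>j\<in>J. b j *\<^sub>R e j) =
        (\<Sum>j\<in>J. B (a j *\<^sub>R e j) (\<Sum>j\<in>J. b j *\<^sub>R e j))"
      using e by (intro B_sum_left) auto
    also have "\<dots> = ?S (\<lambda>j k. B (a j *\<^sub>R e j) (b k *\<^sub>R e k))"
      using e by (intro sum.cong B_sum_right) auto
    also have "\<dots> = ?S (\<lambda>j k. a j * b k * B (e j) (e k))"
      using e by (intro sum.cong) (auto simp: B_scale_left B_scale_right)
    finally show ?thesis .
  qed
  have 2: "(\<Sum>j\<in>J. a j * b j * B (e j) (\<Sum>k\<in>J. e k)) = ?S (\<lambda>j k. a j * b j * B (e j) (e k))"
    using e by (simp add: B_sum_right sum_distrib_left)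
  have sym: "?S (\<lambda>j k. f k j * B (e j) (e k)) = ?S (\<lambda>j k. f j k * B (e j) (e k))" for f
    using e by (subst sum.swap) (auto intro!: sum.cong simp: B_commute)
  have "?S (\<lambda>j k. - B (e j) (e k) * ((a j - a k) * (b j - b k))) =
     ?S (\<lambda>j k. a j * b k * B (e j) (e k)) + ?S (\<lambda>j k. a k * b j * B (e j) (e k)) -
     ?S (\<lambda>j k. a j * b j * B (e j) (e k)) - ?S (\<lambda>j k. a k * b k * B (e j) (e k))"
    unfolding sum.distrib[symmetric] sum_subtractf[symmetric]
    by (intro sum.cong refl) (simp add: algebra_simps)
  also have "\<dots> = 2 * ?S (\<lambda>j k. a j * b k * B (e j) (e k)) - 2 * ?S (\<lambda>j k. a j * b j * B (e j) (e k))"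
    using sym[of "\<lambda>j k. a j * b k"] sym[of "\<lambda>j k. a j * b j"] by simp
  finally show ?thesis unfolding 1 2 by (simp add: diff_divide_distrib)
qed

end

section \<open>Local convergence in measure\<close>

definition fin_sets :: "'a measure \<Rightarrow> 'a set set" where
  "fin_sets M = {U \<in> sets M. emeasure M U < \<infinity>}"

lemma fin_sets_empty [simp]: "{} \<in> fin_sets M"
  by (simp add: fin_sets_def)

lemma fin_sets_Un: "U \<in> fin_sets M \<Longrightarrow> V \<in> fin_sets M \<Longrightarrow> U \<union> V \<in> fin_sets M"
  unfolding fin_sets_def
  by (auto intro: le_less_trans[OF emeasure_subadditive])

lemma fin_sets_Int: "U \<in> fin_sets M \<Longrightarrow> V \<in> fin_sets M \<Longrightarrow> U \<inter> V \<in> fin_sets M"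
  unfolding fin_sets_def
  by (auto intro: le_less_trans[OF emeasure_mono[of _ U]])

lemma fin_sets_sets: "U \<in> fin_sets M \<Longrightarrow> U \<in> sets M"
  by (simp add: fin_sets_def)

lemma local_dist_integrable:
  fixes f g :: "'a \<Rightarrow> real"
  assumes "f \<in> borel_measurable M" "g \<in> borel_measurable M" "U \<in> fin_sets M"
  shows "integrable M (\<lambda>x. indicator U x *\<^sub>R min \<bar>f x - g x\<bar> 1)"
  using local_dist_set_integrable[of f M g U] assms
  by (simp add: fin_sets_def set_integrable_def)

lemma local_dist_mono:
  assumes f: "f \<in> borel_measurable M" and g: "g \<in> borel_measurable M"
    and U: "U \<in> fin_sets M" and V: "V \<in> fin_sets M" and "U \<subseteq> V"
  shows "local_dist M U f g \<le> local_dist M V f g"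
  unfolding local_dist_def set_lebesgue_integral_def
  by (rule integral_mono[OF local_dist_integrable[OF f g U] local_dist_integrable[OF f g V]])
    (use \<open>U \<subseteq> V\<close> in \<open>auto simp: indicator_def\<close>)

lemma local_dist_cong_AE:
  assumes [measurable]: "f \<in> borel_measurable M" "g \<in> borel_measurable M"
    "f' \<in> borel_measurable M" "g' \<in> borel_measurable M" and "U \<in> fin_sets M"
    and "AE x in M. f x = f' x" "AE x in M. g x = g' x"
  shows "local_dist M U f g = local_dist M U f' g'"
proof -
  have [measurable]: "U \<in> sets M" using assms by (simp add: fin_sets_def)
  show ?thesis
    unfolding local_dist_def set_lebesgue_integral_def
  proof (rule integral_cong_AE)
    show "AE x in M. indicator U x *\<^sub>R min \<bar>f x - g x\<bar> 1 = indicator U x *\<^sub>R min \<bar>f' x - g' x\<bar> 1"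
      using assms(6,7) by eventually_elim simp
  qed measurable
qed

text \<open>One estimate behind the continuity of sums, multiples and contractions: if both
  differences on the right are at most 1, the cut at 1 is inactive there, and otherwise the
  right-hand side is already at least \<open>c \<ge> 1\<close>.\<close>

lemma local_dist_compare:
  fixes c :: real
  assumes m: "f \<in> borel_measurable M" "f' \<in> borel_measurable M" "g \<in> borel_measurable M"
      "g' \<in> borel_measurable M" "h \<in> borel_measurable M" "h' \<in> borel_measurable M"
    and U: "U \<in> fin_sets M" and c: "1 \<le> c"
    and le: "AE x in M. \<bar>h x - h' x\<bar> \<le> c * (\<bar>f x - f' x\<bar> + \<bar>g x - g' x\<bar>)"
  shows "local_dist M U h h' \<le> c * (local_dist M U f f' + local_dist M U g g')"
proof -
  have "local_dist M U h h' \<le> (LINT x|M. c * (indicator U x *\<^sub>R min \<bar>f x - f' x\<bar> 1 +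
      indicator U x *\<^sub>R min \<bar>g x - g' x\<bar> 1))"
    unfolding local_dist_def set_lebesgue_integral_def
  proof (rule integral_mono_AE)
    show "AE x in M. indicator U x *\<^sub>R min \<bar>h x - h' x\<bar> 1 \<le>
       c * (indicator U x *\<^sub>R min \<bar>f x - f' x\<bar> 1 + indicator U x *\<^sub>R min \<bar>g x - g' x\<bar> 1)"
      using le
    proof eventually_elim
      case (elim x)
      have "min \<bar>h x - h' x\<bar> 1 \<le> c * (min \<bar>f x - f' x\<bar> 1 + min \<bar>g x - g' x\<bar> 1)"
      proof (cases "\<bar>f x - f' x\<bar> \<le> 1 \<and> \<bar>g x - g' x\<bar> \<le> 1")
        case True
        then have "min \<bar>f x - f' x\<bar> 1 + min \<bar>g x - g' x\<bar> 1 = \<bar>f x - f' x\<bar> + \<bar>g x - g' x\<bar>"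
          by auto
        then show ?thesis using elim by (metis min.coboundedI1)
      next
        case False
        then have "1 \<le> min \<bar>f x - f' x\<bar> 1 + min \<bar>g x - g' x\<bar> 1" by auto
        then have "1 * 1 \<le> c * (min \<bar>f x - f' x\<bar> 1 + min \<bar>g x - g' x\<bar> 1)"
          using c by (intro mult_mono) auto
        then show ?thesis by (simp add: min.coboundedI2)
      qed
      then show ?case by (auto simp: indicator_def)
    qed
  qed (intro local_dist_integrable m U integrable_mult_right Bochner_Integration.integrable_add)+
  also have "\<dots> = c * (local_dist M U f f' + local_dist M U g g')"
    unfolding local_dist_def set_lebesgue_integral_def
    by (subst integral_mult_right_zero, subst Bochner_Integration.integral_add)
      (intro local_dist_integrable m U refl)+
  finally show ?thesis .
qed

lemma local_dist_tendsto_AE: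
  assumes X: "\<And>n::nat. X n \<in> borel_measurable M" and f: "f \<in> borel_measurable M"
    and U: "U \<in> fin_sets M" and ae: "AE x in M. x \<in> U \<longrightarrow> (\<lambda>n. X n x) \<longlonglongrightarrow> f x"
  shows "(\<lambda>n. local_dist M U (X n) f) \<longlonglongrightarrow> 0"
proof -
  note [measurable] = X f fin_sets_sets[OF U]
  have "(\<lambda>n. LINT x|M. indicator U x *\<^sub>R min \<bar>X n x - f x\<bar> 1) \<longlonglongrightarrow> (LINT x|M. 0)"
  proof (rule integral_dominated_convergence[where w = "indicator U"])
    show "integrable M (indicator U :: 'a \<Rightarrow> real)"
      using U by (simp add: fin_sets_def)
    show "AE x in M. (\<lambda>n. indicator U x *\<^sub>R min \<bar>X n x - f x\<bar> 1) \<longlonglongrightarrow> 0"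
      using ae
    proof eventually_elim
      case (elim x)
      show ?case
      proof (cases "x \<in> U")
        case True
        then have "(\<lambda>n. min \<bar>X n x - f x\<bar> 1) \<longlonglongrightarrow> min \<bar>f x - f x\<bar> 1"
          using elim by (intro tendsto_intros) auto
        then show ?thesis using True by simp
      qed simp
    qed
  qed (auto simp: indicator_def)
  then show ?thesis by (simp add: local_dist_def set_lebesgue_integral_def)
qed

lemma local_dist_zero_AE:
  assumes [measurable]: "f \<in> borel_measurable M" "g \<in> borel_measurable M"
    and U: "U \<in> fin_sets M" and z: "local_dist M U f g = 0"
  shows "AE x in M. x \<in> U \<longrightarrow> f x = g x"
proof -
  have "AE x in M. indicator U x *\<^sub>R min \<bar>f x - g x\<bar> 1 = 0"
    using z local_dist_integrable[OF assms(1,2) U]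
    unfolding local_dist_def set_lebesgue_integral_def
    by (subst (asm) integral_nonneg_eq_0_iff_AE) auto
  then show ?thesis by eventually_elim (auto simp: indicator_def min_def split: if_splits)
qed

lemma local_dist_AE_subseq:
  assumes X: "\<And>n::nat. X n \<in> borel_measurable M" and f: "f \<in> borel_measurable M"
    and U: "U \<in> fin_sets M" and lim: "(\<lambda>n. local_dist M U (X n) f) \<longlonglongrightarrow> 0"
  obtains r :: "nat \<Rightarrow> nat" where "strict_mono r"
    "AE x in M. x \<in> U \<longrightarrow> (\<lambda>n. X (r n) x) \<longlonglongrightarrow> f x"
proof -
  let ?u = "\<lambda>n x. indicator U x *\<^sub>R min \<bar>X n x - f x\<bar> 1"
  have "\<exists>r::nat\<Rightarrow>nat. strict_mono r \<and> (AE x in M. (\<lambda>n. ?u (r n) x) \<longlonglongrightarrow> 0)"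
  proof (rule tendsto_L1_AE_subseq)
    show "integrable M (?u n)" for n by (rule local_dist_integrable[OF X f U])
    have "norm (?u n x) = ?u n x" for n x by (simp add: indicator_def)
    then show "(\<lambda>n. \<integral>x. norm (?u n x) \<partial>M) \<longlonglongrightarrow> 0"
      using lim by (simp add: local_dist_def set_lebesgue_integral_def)
  qed
  then obtain r :: "nat \<Rightarrow> nat" where r: "strict_mono r" "AE x in M. (\<lambda>n. ?u (r n) x) \<longlonglongrightarrow> 0"
    by blast
  have "AE x in M. x \<in> U \<longrightarrow> (\<lambda>n. X (r n) x) \<longlonglongrightarrow> f x"
    using r(2)
  proof eventually_elim
    case (elim x)
    show ?case
    proof
      assume "x \<in> U"
      then have l: "(\<lambda>n. min \<bar>X (r n) x - f x\<bar> 1) \<longlonglongrightarrow> 0" using elim by simp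
      then have "\<forall>\<^sub>F n in sequentially. min \<bar>X (r n) x - f x\<bar> 1 < 1"
        by (rule order_tendstoD) simp
      then have "\<forall>\<^sub>F n in sequentially. min \<bar>X (r n) x - f x\<bar> 1 = \<bar>X (r n) x - f x\<bar>"
        by eventually_elim auto
      then have "(\<lambda>n. \<bar>X (r n) x - f x\<bar>) \<longlonglongrightarrow> 0"
        using l by (rule Lim_transform_eventually[rotated])
      then show "(\<lambda>n. X (r n) x) \<longlonglongrightarrow> f x"
        by (simp add: tendsto_rabs_zero_iff LIM_zero_iff)
    qed
  qed
  then show ?thesis using that r(1) by blast
qed

section \<open>Nets converging locally in measure\<close>

definition tconv :: "'a measure \<Rightarrow> ('i \<Rightarrow> 'a \<Rightarrow> real) \<Rightarrow> ('a \<Rightarrow> real) \<Rightarrow> 'i filter \<Rightarrow> bool" where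
  "tconv M X f F \<longleftrightarrow> (\<forall>U\<in>fin_sets M. ((\<lambda>i. local_dist M U (X i) f) \<longlongrightarrow> 0) F)"

lemma tconv_compare:
  fixes c :: real
  assumes X: "tconv M X f F" and Y: "tconv M Y g F"
    and m: "\<And>i. X i \<in> borel_measurable M" "f \<in> borel_measurable M"
      "\<And>i. Y i \<in> borel_measurable M" "g \<in> borel_measurable M"
      "\<And>i. Z i \<in> borel_measurable M" "h \<in> borel_measurable M"
    and le: "\<And>i. AE x in M. \<bar>Z i x - h x\<bar> \<le> c * (\<bar>X i x - f x\<bar> + \<bar>Y i x - g x\<bar>)"
  shows "tconv M Z h F"
  unfolding tconv_def
proof
  fix U assume U: "U \<in> fin_sets M"
  \<comment> \<open>The comparison of cut differences needs a constant of at least 1.\<close>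
  define d where "d = max c 1"
  have le': "norm (local_dist M U (Z i) h) \<le> d * (local_dist M U (X i) f + local_dist M U (Y i) g)" for i
  proof -
    have "AE x in M. \<bar>Z i x - h x\<bar> \<le> d * (\<bar>X i x - f x\<bar> + \<bar>Y i x - g x\<bar>)"
      using le[of i]
    proof eventually_elim
      case (elim x)
      have "c * (\<bar>X i x - f x\<bar> + \<bar>Y i x - g x\<bar>) \<le> d * (\<bar>X i x - f x\<bar> + \<bar>Y i x - g x\<bar>)"
        by (intro mult_right_mono) (auto simp: d_def)
      then show ?case using elim by simp
    qed
    then show ?thesis
      using local_dist_compare[OF m(1)[of i] m(2) m(3)[of i] m(4) m(5)[of i] m(6) U, of d]
      by (simp add: d_def local_dist_nonneg)
  qed
  have "((\<lambda>i. d * (local_dist M U (X i) f + local_dist M U (Y i) g)) \<longlongrightarrow> d * (0 + 0)) F"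
    using X Y U unfolding tconv_def by (intro tendsto_intros) auto
  then have "((\<lambda>i. d * (local_dist M U (X i) f + local_dist M U (Y i) g)) \<longlongrightarrow> 0) F"
    by simp
  then show "((\<lambda>i. local_dist M U (Z i) h) \<longlongrightarrow> 0) F"
    by (rule Lim_null_comparison[OF always_eventually[OF allI[OF le']]])
qed

lemma tconv_const: "tconv M (\<lambda>i. f) f F"
  unfolding tconv_def local_dist_def by simp

lemma tconv_contract:
  assumes "tconv M X f F" "\<And>i. X i \<in> borel_measurable M" "f \<in> borel_measurable M"
    "\<And>i. Z i \<in> borel_measurable M" "h \<in> borel_measurable M"
    and "\<And>i. AE x in M. \<bar>Z i x - h x\<bar> \<le> c * \<bar>X i x - f x\<bar>"
  shows "tconv M Z h F"
  using assms by (intro tconv_compare[OF assms(1) tconv_const[of M f], where c = c]) auto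

lemma tconv_add:
  assumes "tconv M X f F" "tconv M Y g F" "\<And>i. X i \<in> borel_measurable M" "f \<in> borel_measurable M"
    "\<And>i. Y i \<in> borel_measurable M" "g \<in> borel_measurable M"
  shows "tconv M (\<lambda>i. X i + Y i) (f + g) F"
  using assms by (intro tconv_compare[OF assms(1,2), where c = 1])
    (auto simp: plus_fun_def)

lemma tconv_diff:
  assumes "tconv M X f F" "tconv M Y g F" "\<And>i. X i \<in> borel_measurable M" "f \<in> borel_measurable M"
    "\<And>i. Y i \<in> borel_measurable M" "g \<in> borel_measurable M"
  shows "tconv M (\<lambda>i. X i - Y i) (f - g) F"
  using assms by (intro tconv_compare[OF assms(1,2), where c = 1])
    (auto simp: fun_diff_def)

lemma tconv_scale:
  assumes "tconv M X f F" "\<And>i. X i \<in> borel_measurable M" "f \<in> borel_measurable M"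
  shows "tconv M (\<lambda>i. c *\<^sub>R X i) (c *\<^sub>R f) F"
  using assms by (intro tconv_contract[OF assms(1), where c = "\<bar>c\<bar>"])
    (auto simp: scaleR_fun_def abs_mult[symmetric] right_diff_distrib)

lemma tconv_pointwise:
  assumes "\<And>n::nat. X n \<in> borel_measurable M" "f \<in> borel_measurable M"
    and "\<And>x. (\<lambda>n. X n x) \<longlonglongrightarrow> f x"
  shows "tconv M X f sequentially"
  unfolding tconv_def using assms by (auto intro!: local_dist_tendsto_AE)

text \<open>This is where semi-finiteness enters: a non-null exceptional set contains a set of
  positive finite measure, on which \<open>P\<close> fails everywhere although it should hold almost
  everywhere.\<close>

lemma localizable_AE_iff:
  assumes "localizable M" and [measurable]: "Measurable.pred M P"
    and "\<And>U. U \<in> fin_sets M \<Longrightarrow> AE x in M. x \<in> U \<longrightarrow> P x"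
  shows "AE x in M. P x"
proof (rule ccontr)
  assume n: "\<not> (AE x in M. P x)"
  let ?A = "{x \<in> space M. \<not> P x}"
  have A: "?A \<in> sets M" by simp
  have pos: "emeasure M ?A \<noteq> 0"
    using n by (simp add: AE_iff_measurable[OF A refl])
  obtain B where B: "B \<in> sets M" "B \<subseteq> ?A" "0 < emeasure M B" "emeasure M B < \<infinity>"
  proof (cases "emeasure M ?A = \<infinity>")
    case True
    then show ?thesis using assms(1) A that unfolding localizable_def by blast
  next
    case False
    then show ?thesis using that[of ?A] A pos
      by (auto simp: zero_less_iff_neq_zero less_top[symmetric])
  qed
  then have "AE x in M. x \<in> B \<longrightarrow> P x"
    using assms(3)[of B] by (simp add: fin_sets_def)
  then have "AE x in M. x \<notin> B"
    by (rule AE_mp) (use B(2) in \<open>auto intro!: AE_I2\<close>)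
  then have "emeasure M B = 0"
    using AE_iff_null_sets[OF B(1)] by auto
  then show False using B(3) by simp
qed

lemma tconv_unique:
  assumes L: "localizable M" and "tconv M X f F" "tconv M X g F" "F \<noteq> bot"
    and m: "\<forall>\<^sub>F i in F. X i \<in> borel_measurable M" "f \<in> borel_measurable M" "g \<in> borel_measurable M"
  shows "AE x in M. f x = g x"
proof (rule localizable_AE_iff[OF L])
  show "Measurable.pred M (\<lambda>x. f x = g x)" using m by measurable
  fix U assume U: "U \<in> fin_sets M"
  have "((\<lambda>i. local_dist M U (X i) f + local_dist M U (X i) g) \<longlongrightarrow> 0 + 0) F"
    using assms(2,3) U unfolding tconv_def by (intro tendsto_intros) auto
  moreover have "\<forall>\<^sub>F i in F. local_dist M U f g \<le> local_dist M U (X i) f + local_dist M U (X i) g"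
    using m(1)
    by eventually_elim (use local_dist_triangle[of f M _ g U] m(2,3) U in
      \<open>auto simp: fin_sets_def local_dist_commute[of M U f]\<close>)
  ultimately have "local_dist M U f g \<le> 0 + 0"
    using assms(4) by (intro tendsto_lowerbound) auto
  then have "local_dist M U f g = 0" using local_dist_nonneg[of M U f g] by simp
  then show "AE x in M. x \<in> U \<longrightarrow> f x = g x" by (rule local_dist_zero_AE[OF m(2,3) U])
qed

text \<open>Pairs of a finite-measure set and a precision index a neighbourhood base of every point
  of L0, since \<open>local_dist\<close> grows with the set. Without sigma-finiteness there is in
  general no cofinal sequence. Only pairs with \<open>fst r \<in> fin_sets M\<close> count, so the
  values of a net at other indices do not affect limits.\<close>

definition fin_filter :: "'a measure \<Rightarrow> ('a set \<times> nat) filter" where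
  "fin_filter M = (INF p\<in>fin_sets M \<times> UNIV.
     principal {r. fst r \<in> fin_sets M \<and> fst p \<subseteq> fst r \<and> snd p \<le> snd r})"

lemma eventually_fin_filter:
  "eventually P (fin_filter M) \<longleftrightarrow>
    (\<exists>U\<in>fin_sets M. \<exists>n. \<forall>V\<in>fin_sets M. \<forall>k\<ge>n. U \<subseteq> V \<longrightarrow> P (V, k))"
proof -
  have "eventually P (fin_filter M) \<longleftrightarrow> (\<exists>p\<in>fin_sets M \<times> UNIV. eventually P
     (principal {r. fst r \<in> fin_sets M \<and> fst p \<subseteq> fst r \<and> snd p \<le> snd r}))"
    unfolding fin_filter_def
  proof (rule eventually_INF_base)
    show "fin_sets M \<times> (UNIV :: nat set) \<noteq> {}" using fin_sets_empty[of M] by blast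
    fix a b assume "a \<in> fin_sets M \<times> (UNIV :: nat set)" "b \<in> fin_sets M \<times> (UNIV :: nat set)"
    then show "\<exists>x\<in>fin_sets M \<times> UNIV. principal {r. fst r \<in> fin_sets M \<and> fst x \<subseteq> fst r \<and> snd x \<le> snd r}
      \<le> inf (principal {r. fst r \<in> fin_sets M \<and> fst a \<subseteq> fst r \<and> snd a \<le> snd r})
        (principal {r. fst r \<in> fin_sets M \<and> fst b \<subseteq> fst r \<and> snd b \<le> snd r})"
      by (intro bexI[of _ "(fst a \<union> fst b, max (snd a) (snd b))"]) (auto intro: fin_sets_Un)
  qed
  then show ?thesis by (simp add: eventually_principal Bex_def) blast
qed

lemma fin_filter_not_bot [simp]: "fin_filter M \<noteq> bot"
  unfolding trivial_limit_def eventually_fin_filter by auto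

lemma tendsto_fin_filter_snd: "((\<lambda>p. 1 / real (Suc (snd p))) \<longlongrightarrow> 0) (fin_filter M)"
proof (rule tendstoI)
  fix e :: real assume "0 < e"
  then obtain n where n: "1 / real (Suc n) < e" using reals_Archimedean by (auto simp: inverse_eq_divide)
  show "\<forall>\<^sub>F p in fin_filter M. dist (1 / real (Suc (snd p))) 0 < e"
    unfolding eventually_fin_filter
  proof (intro bexI[of _ "{}"] exI[of _ n] ballI allI impI)
    fix V and k :: nat assume "n \<le> k"
    then have "1 / real (Suc k) \<le> 1 / real (Suc n)" by (intro divide_left_mono) auto
    then show "dist (1 / real (Suc (snd (V, k)))) 0 < e" using n by simp
  qed simp
qed

text \<open>Control on the index set itself suffices, because every fixed finite-measure set is
  eventually contained in the index set.\<close>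

lemma tconv_fin_filter:
  assumes m: "\<And>p. X p \<in> borel_measurable M" "f \<in> borel_measurable M"
    and le: "\<And>U n. U \<in> fin_sets M \<Longrightarrow> local_dist M U (X (U, n)) f \<le> 1 / real (Suc n)"
  shows "tconv M X f (fin_filter M)"
  unfolding tconv_def
proof
  fix U assume U: "U \<in> fin_sets M"
  have "\<forall>\<^sub>F p in fin_filter M. norm (local_dist M U (X p) f) \<le> 1 / real (Suc (snd p))"
    unfolding eventually_fin_filter
  proof (intro bexI[of _ U] exI[of _ 0] ballI allI impI U)
    fix V and k :: nat assume V: "V \<in> fin_sets M" "U \<subseteq> V"
    have "local_dist M U (X (V, k)) f \<le> local_dist M V (X (V, k)) f"
      by (rule local_dist_mono[OF m(1) m(2) U V])
    then show "norm (local_dist M U (X (V, k)) f) \<le> 1 / real (Suc (snd (V, k)))"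
      using le[OF V(1), of k] local_dist_nonneg[of M U "X (V,k)" f] by simp
  qed
  then show "((\<lambda>p. local_dist M U (X p) f) \<longlongrightarrow> 0) (fin_filter M)"
    by (rule Lim_null_comparison[OF _ tendsto_fin_filter_snd])
qed

section \<open>Lower semicontinuity\<close>

text \<open>Basic neighbourhoods and a threshold \<open>c\<close> take the place of limits inferior
  along nets.\<close>

definition lower_semicont :: "'a measure \<Rightarrow> (('a \<Rightarrow> real) \<Rightarrow> ereal) \<Rightarrow> bool" where
  "lower_semicont M q \<longleftrightarrow> (\<forall>u\<in>borel_measurable M. \<forall>c<q u.
     \<exists>U\<in>fin_sets M. \<exists>e>0. \<forall>v\<in>borel_measurable M. local_dist M U u v < e \<longrightarrow> c < q v)"

lemma lower_semicontD:
  assumes "lower_semicont M q" "\<forall>\<^sub>F i in F. X i \<in> borel_measurable M" "u \<in> borel_measurable M" "tconv M X u F"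
    and "c < q u"
  shows "\<forall>\<^sub>F i in F. c < q (X i)"
proof -
  obtain U e where U: "U \<in> fin_sets M" "e > 0"
    and *: "\<And>v. v \<in> borel_measurable M \<Longrightarrow> local_dist M U u v < e \<Longrightarrow> c < q v"
    using assms(1,3,5) unfolding lower_semicont_def by blast
  have "\<forall>\<^sub>F i in F. local_dist M U (X i) u < e"
    using assms(4) U unfolding tconv_def by (auto intro: order_tendstoD)
  then show ?thesis using assms(2)
    by eventually_elim (use * in \<open>auto simp: local_dist_commute\<close>)
qed

lemma lower_semicont_le:
  assumes "lower_semicont M q" "\<forall>\<^sub>F i in F. X i \<in> borel_measurable M" "u \<in> borel_measurable M" "tconv M X u F"
    and "F \<noteq> bot" "\<forall>\<^sub>F i in F. q (X i) \<le> f i" "(f \<longlongrightarrow> c) F"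
  shows "q u \<le> c"
proof (rule dense_le)
  fix a assume "a < q u"
  then have "\<forall>\<^sub>F i in F. a < q (X i)" using lower_semicontD[OF assms(1-4)] by blast
  with assms(6) have "\<forall>\<^sub>F i in F. a \<le> f i" by eventually_elim auto
  then show "a \<le> c" using assms(5,7) by (metis tendsto_lowerbound)
qed

section \<open>Completeness of local convergence in measure\<close>

text \<open>The summands are eventually below 1, so the cut is inactive and the increments are
  absolutely summable.\<close>

lemma convergent_if_summable_min_diff:
  fixes g :: "nat \<Rightarrow> real"
  assumes "summable (\<lambda>n. min \<bar>g n - g (Suc n)\<bar> 1)"
  shows "convergent g"
proof -
  have "(\<lambda>n. min \<bar>g n - g (Suc n)\<bar> 1) \<longlonglongrightarrow> 0" using assms by (rule summable_LIMSEQ_zero)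
  then have "\<forall>\<^sub>F n in sequentially. min \<bar>g n - g (Suc n)\<bar> 1 < 1"
    by (rule order_tendstoD) simp
  then have "\<forall>\<^sub>F n in sequentially. min \<bar>g n - g (Suc n)\<bar> 1 = \<bar>g (Suc n) - g n\<bar>"
    by eventually_elim auto
  then have "summable (\<lambda>n. \<bar>g (Suc n) - g n\<bar>)"
    using assms summable_cong by fast
  then have "summable (\<lambda>n. g (Suc n) - g n)" by (rule summable_rabs_cancel)
  then have "convergent (\<lambda>n. g n - g 0)"
    by (simp add: summable_iff_convergent sum_lessThan_telescope)
  then have "convergent (\<lambda>n. (g n - g 0) + g 0)"
    by (intro convergent_add convergent_const)
  then show ?thesis by simp
qed

lemma local_dist_complete:
  assumes F: "F \<noteq> bot" and ev: "\<forall>\<^sub>F f in F. f \<in> borel_measurable M" and U: "U \<in> fin_sets M"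
    and C: "\<And>e. e > 0 \<Longrightarrow> \<exists>P. eventually P F \<and> (\<forall>f g. P f \<longrightarrow> P g \<longrightarrow> local_dist M U f g < e)"
  obtains f where "f \<in> borel_measurable M" "((\<lambda>v. local_dist M U v f) \<longlongrightarrow> 0) F"
proof -
  have "\<exists>P. eventually P F \<and> (\<forall>f g. P f \<longrightarrow> P g \<longrightarrow> local_dist M U f g < (1/2)^n)" for n :: nat
    by (rule C) simp
  then obtain P where P: "\<And>n. eventually (P n) F"
    and PC: "\<And>n f g. P n f \<Longrightarrow> P n g \<Longrightarrow> local_dist M U f g < (1/2)^n" by metis
  \<comment> \<open>Intersecting the first Cauchy sets puts \<open>g n\<close> and
    \<open>g (Suc n)\<close> both into the n-th one, so their distance is below
    \<open>(1/2)^n\<close> and the cut increments are summable almost everywhere.\<close>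
  define R where "R n f \<longleftrightarrow> (\<forall>k\<in>{..n}. P k f) \<and> f \<in> borel_measurable M" for n f
  have evR: "eventually (R n) F" for n
    unfolding R_def using P ev by (intro eventually_conj eventually_ball_finite) auto
  have "\<exists>f. R n f" for n
    using eventually_happens'[OF F evR] .
  then obtain g where g: "\<And>n. R n (g n)" by metis
  have gm: "g n \<in> borel_measurable M" for n using g[of n] by (simp add: R_def)
  note [measurable] = gm fin_sets_sets[OF U]
  define u where "u n x = indicator U x * min \<bar>g n x - g (Suc n) x\<bar> 1" for n x
  have um [measurable]: "u n \<in> borel_measurable M" for n unfolding u_def by measurable
  have u0: "0 \<le> u n x" for n x by (simp add: u_def indicator_def)
  have ui: "integrable M (u n)" for n
    using local_dist_integrable[OF gm gm U, of n "Suc n"] unfolding u_def[abs_def] by simp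
  have ub: "(\<integral>\<^sup>+x. ennreal (u n x) \<partial>M) \<le> ennreal ((1/2)^n)" for n
  proof -
    have "(LINT x|M. u n x) = local_dist M U (g n) (g (Suc n))"
      by (simp add: u_def local_dist_def set_lebesgue_integral_def)
    also have "\<dots> < (1/2)^n"
      by (rule PC) (use g[of n] g[of "Suc n"] in \<open>auto simp: R_def\<close>)
    finally have "(LINT x|M. u n x) \<le> (1/2)^n" by simp
    moreover have "(\<integral>\<^sup>+x. ennreal (u n x) \<partial>M) = ennreal (LINT x|M. u n x)"
      by (rule nn_integral_eq_integral[OF ui]) (simp add: u0)
    ultimately show ?thesis by (simp add: ennreal_leI)
  qed
  have "(\<integral>\<^sup>+x. (\<Sum>n. ennreal (u n x)) \<partial>M) = (\<Sum>n. \<integral>\<^sup>+x. ennreal (u n x) \<partial>M)"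
    by (rule nn_integral_suminf) measurable
  also have "\<dots> \<le> (\<Sum>n. ennreal ((1/2)^n))"
    by (intro suminf_le ub) auto
  also have "\<dots> = ennreal (\<Sum>n. (1/2)^n)"
    by (rule suminf_ennreal2) (auto intro: summable_geometric)
  finally have "(\<integral>\<^sup>+x. (\<Sum>n. ennreal (u n x)) \<partial>M) \<noteq> \<infinity>"
    by (auto simp: top_unique)
  then have "AE x in M. (\<Sum>n. ennreal (u n x)) \<noteq> \<infinity>"
    by (intro nn_integral_noteq_infinite) auto
  then have conv: "AE x in M. x \<in> U \<longrightarrow> convergent (\<lambda>n. g n x)"
  proof eventually_elim
    case (elim x)
    have "summable (\<lambda>n. u n x)"
      by (rule summable_suminf_not_top) (use elim u0 in auto)
    then show ?case by (auto simp: u_def intro: convergent_if_summable_min_diff)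
  qed
  define f where "f x = lim (\<lambda>n. g n x)" for x
  have fm: "f \<in> borel_measurable M" unfolding f_def by measurable
  have "(\<lambda>n. local_dist M U (g n) f) \<longlonglongrightarrow> 0"
  proof (rule local_dist_tendsto_AE[OF gm fm U])
    show "AE x in M. x \<in> U \<longrightarrow> (\<lambda>n. g n x) \<longlonglongrightarrow> f x"
      using conv by eventually_elim (simp add: f_def convergent_LIMSEQ_iff)
  qed
  note gf = this
  \<comment> \<open>Every member of the n-th set is close to \<open>g n\<close>, hence to
    \<open>f\<close>: convergence passes from the chosen sequence to the whole filter.\<close>
  have "((\<lambda>v. local_dist M U v f) \<longlongrightarrow> 0) F"
  proof (rule tendstoI)
    fix e :: real assume e: "0 < e"
    have "\<forall>\<^sub>F n in sequentially. local_dist M U (g n) f < e/2"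
      using gf e by (intro order_tendstoD) auto
    moreover have "\<forall>\<^sub>F n in sequentially. (1/2::real)^n < e/2"
      by (rule order_tendstoD(2)[OF LIMSEQ_power_zero]) (use e in auto)
    ultimately obtain n where n: "local_dist M U (g n) f < e/2" "(1/2::real)^n < e/2"
      by (metis (mono_tags, lifting) eventually_conj eventually_happens' sequentially_bot)
    show "\<forall>\<^sub>F v in F. dist (local_dist M U v f) 0 < e"
      using evR[of n]
    proof eventually_elim
      case (elim v)
      have "local_dist M U v (g n) < (1/2)^n"
        by (rule PC) (use g[of n] elim in \<open>auto simp: R_def\<close>)
      moreover have "local_dist M U v f \<le> local_dist M U v (g n) + local_dist M U (g n) f"
        using elim fm gm U by (intro local_dist_triangle) (auto simp: R_def fin_sets_def)
      ultimately show ?case using n local_dist_nonneg[of M U v f] by simp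
    qed
  qed
  then show ?thesis using that fm by blast
qed

text \<open>For each r the superlevel sets \<open>{f U > r}\<close> have an essential supremum
  \<open>S r\<close>, which agrees on every \<open>U\<close> with \<open>{f U > r}\<close> up to a
  null set; the glued function is read off the countably many \<open>S r\<close> with rational r.
  Pointwise gluing would not be possible, since the exceptional null sets belong to uncountably many
  pairs of sets in general.\<close>

lemma localizable_glue:
  fixes f :: "'a set \<Rightarrow> 'a \<Rightarrow> real"
  assumes L: "localizable M" and fm: "\<And>U. U \<in> fin_sets M \<Longrightarrow> f U \<in> borel_measurable M"
    and cons: "\<And>U V. U \<in> fin_sets M \<Longrightarrow> V \<in> fin_sets M \<Longrightarrow> AE x in M. x \<in> U \<inter> V \<longrightarrow> f U x = f V x"
  obtains g where "g \<in> borel_measurable M" "\<And>U. U \<in> fin_sets M \<Longrightarrow> AE x in M. x \<in> U \<longrightarrow> g x = f U x"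
proof -
  define A where "A r U = {x \<in> space M. x \<in> U \<and> r < f U x}" for r U
  have Am: "A r U \<in> sets M" if U: "U \<in> fin_sets M" for r U
  proof -
    note [measurable] = fm[OF U] fin_sets_sets[OF U]
    show ?thesis unfolding A_def by measurable
  qed
  have "\<exists>S. S \<in> sets M \<and> (\<forall>B\<in>A r ` fin_sets M. emeasure M (B - S) = 0) \<and>
      (\<forall>G\<in>sets M. (\<forall>B\<in>A r ` fin_sets M. emeasure M (B - G) = 0) \<longrightarrow> emeasure M (S - G) = 0)" for r
  proof -
    have "A r ` fin_sets M \<subseteq> sets M" using Am by blast
    then show ?thesis using L unfolding localizable_def by (metis (lifting))
  qed
  then obtain S where S: "\<And>r. S r \<in> sets M \<and> (\<forall>B\<in>A r ` fin_sets M. emeasure M (B - S r) = 0) \<and>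
      (\<forall>G\<in>sets M. (\<forall>B\<in>A r ` fin_sets M. emeasure M (B - G) = 0) \<longrightarrow> emeasure M (S r - G) = 0)"
    by metis
  have Sm: "S r \<in> sets M" for r using S[of r] by simp
  have S1: "emeasure M (A r U - S r) = 0" if "U \<in> fin_sets M" for r U using S[of r] that by simp
  have S2: "emeasure M (S r - G) = 0" if "G \<in> sets M" "\<And>U. U \<in> fin_sets M \<Longrightarrow> emeasure M (A r U - G) = 0" for r G
    using S[of r] that by simp
  have key: "AE x in M. x \<in> U \<longrightarrow> (x \<in> S r \<longleftrightarrow> r < f U x)" if U: "U \<in> fin_sets M" for U r
  proof -
    have n1: "A r U - S r \<in> null_sets M"
      using S1[OF U, of r] Am[OF U] Sm by (auto intro: null_setsI)
    \<comment> \<open>The largest set that meets \<open>U\<close> only in \<open>{f U > r}\<close>;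
      by consistency it is an essential upper bound of the whole family, so \<open>S r\<close>
      exceeds it by a null set at most.\<close>
    let ?G = "A r U \<union> (space M - U)"
    have Gm: "?G \<in> sets M" using Am[OF U] fin_sets_sets[OF U] by auto
    have "emeasure M (S r - ?G) = 0"
    proof (rule S2[OF Gm])
      fix V assume V: "V \<in> fin_sets M"
      have "A r V - ?G \<in> sets M" using Am[OF V] Gm by auto
      moreover have "AE x in M. x \<notin> A r V - ?G"
        using cons[OF U V] AE_space by eventually_elim (auto simp: A_def)
      ultimately have "A r V - ?G \<in> null_sets M" using AE_iff_null_sets by blast
      then show "emeasure M (A r V - ?G) = 0" by auto
    qed
    then have n2: "S r - ?G \<in> null_sets M" using Sm Gm by (auto intro: null_setsI)
    show ?thesis
      using AE_not_in[OF n1] AE_not_in[OF n2] AE_space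
      by eventually_elim (auto simp: A_def)
  qed
  define h where "h x = (SUP r\<in>\<rat>. if x \<in> S r then ereal r else -\<infinity>)" for x
  have [measurable]: "S r \<in> sets M" for r by (rule Sm)
  have hm: "h \<in> borel_measurable M"
    unfolding h_def by (intro borel_measurable_SUP countable_rat) measurable
  \<comment> \<open>Where the supremum is infinite \<open>real_of_ereal\<close> returns 0; within
    each finite-measure set this concerns only a null set.\<close>
  define g where "g x = real_of_ereal (h x)" for x
  have gm: "g \<in> borel_measurable M" unfolding g_def using hm by measurable
  have "AE x in M. x \<in> U \<longrightarrow> g x = f U x" if U: "U \<in> fin_sets M" for U
  proof -
    have "AE x in M. \<forall>r\<in>\<rat>. x \<in> U \<longrightarrow> (x \<in> S r \<longleftrightarrow> r < f U x)"
      using key[OF U] by (intro AE_ball_countable[THEN iffD2] countable_rat) auto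
    then show ?thesis
    proof eventually_elim
      case (elim x)
      show ?case
      proof
        assume x: "x \<in> U"
        have "h x = (SUP r\<in>\<rat>. if r < f U x then ereal r else -\<infinity>)"
          unfolding h_def using elim x by (intro SUP_cong) auto
        also have "\<dots> = ereal (f U x)"
        proof (rule SUP_eqI)
          fix y assume y: "\<And>i. i \<in> \<rat> \<Longrightarrow> (if i < f U x then ereal i else - \<infinity>) \<le> y"
          show "ereal (f U x) \<le> y"
          proof (rule ccontr)
            assume "\<not> ereal (f U x) \<le> y"
            then obtain r where r: "y < ereal (real_of_rat r)" "ereal (real_of_rat r) < ereal (f U x)"
              using ereal_dense3[of y "ereal (f U x)"] by (auto simp: not_le)
            then show False using y[of "real_of_rat r"] by auto
          qed
        qed auto
        finally show "g x = f U x" by (simp add: g_def)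
      qed
    qed
  qed
  then show ?thesis using that gm by blast
qed

text \<open>Limits are taken on each finite-measure set separately; they agree on intersections and
  are glued by localizability.\<close>

lemma L0_complete:
  assumes L: "localizable M" and F: "F \<noteq> bot" and ev: "\<forall>\<^sub>F f in F. f \<in> borel_measurable M"
    and C: "\<And>U e. U \<in> fin_sets M \<Longrightarrow> e > 0 \<Longrightarrow>
      \<exists>P. eventually P F \<and> (\<forall>f g. P f \<longrightarrow> P g \<longrightarrow> local_dist M U f g < e)"
  obtains f where "f \<in> borel_measurable M" "tconv M (\<lambda>v. v) f F"
proof -
  have "\<exists>f. f \<in> borel_measurable M \<and> ((\<lambda>v. local_dist M U v f) \<longlongrightarrow> 0) F" if "U \<in> fin_sets M" for U
    using local_dist_complete[OF F ev that C[OF that]] by metis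
  then obtain f where fm: "\<And>U. U \<in> fin_sets M \<Longrightarrow> f U \<in> borel_measurable M"
    and fl: "\<And>U. U \<in> fin_sets M \<Longrightarrow> ((\<lambda>v. local_dist M U v (f U)) \<longlongrightarrow> 0) F"
    by metis
  have cons: "AE x in M. x \<in> U \<inter> V \<longrightarrow> f U x = f V x" if U: "U \<in> fin_sets M" and V: "V \<in> fin_sets M" for U V
  proof -
    have W: "U \<inter> V \<in> fin_sets M" using fin_sets_Int U V by blast
    have "((\<lambda>v. local_dist M U v (f U) + local_dist M V v (f V)) \<longlongrightarrow> 0 + 0) F"
      by (intro tendsto_intros fl U V)
    moreover have "\<forall>\<^sub>F v in F. local_dist M (U \<inter> V) (f U) (f V) \<le> local_dist M U v (f U) + local_dist M V v (f V)"
      using ev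
    proof eventually_elim
      case (elim v)
      have "local_dist M (U \<inter> V) (f U) (f V) \<le> local_dist M (U \<inter> V) (f U) v + local_dist M (U \<inter> V) v (f V)"
        using elim fm U V W by (intro local_dist_triangle) (auto simp: fin_sets_def)
      also have "local_dist M (U \<inter> V) (f U) v \<le> local_dist M U (f U) v"
        using elim fm U V W by (intro local_dist_mono) auto
      also have "local_dist M (U \<inter> V) v (f V) \<le> local_dist M V v (f V)"
        using elim fm U V W by (intro local_dist_mono) auto
      finally show ?case by (simp add: local_dist_commute[of M U])
    qed
    ultimately have "local_dist M (U \<inter> V) (f U) (f V) \<le> 0 + 0"
      using F by (rule tendsto_lowerbound)
    then have "local_dist M (U \<inter> V) (f U) (f V) = 0"
      using local_dist_nonneg[of M "U \<inter> V" "f U" "f V"] by simp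
    then show ?thesis by (rule local_dist_zero_AE[OF fm[OF U] fm[OF V] W])
  qed
  obtain g where g: "g \<in> borel_measurable M" "\<And>U. U \<in> fin_sets M \<Longrightarrow> AE x in M. x \<in> U \<longrightarrow> g x = f U x"
    using localizable_glue[OF L fm cons] by blast
  have "tconv M (\<lambda>v. v) g F"
    unfolding tconv_def
  proof
    fix U assume U: "U \<in> fin_sets M"
    have gf: "local_dist M U (f U) g = 0"
    proof -
      have "(\<lambda>n::nat. local_dist M U (f U) g) \<longlonglongrightarrow> 0"
        by (rule local_dist_tendsto_AE[of "\<lambda>_. f U", OF fm[OF U] g(1) U]) (use g(2)[OF U] in auto)
      then show ?thesis by (simp add: LIMSEQ_const_iff)
    qed
    show "((\<lambda>v. local_dist M U v g) \<longlongrightarrow> 0) F"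
    proof (rule Lim_null_comparison[OF _ fl[OF U]])
      show "\<forall>\<^sub>F v in F. norm (local_dist M U v g) \<le> local_dist M U v (f U)"
        using ev
      proof eventually_elim
        case (elim v)
        have "local_dist M U v g \<le> local_dist M U v (f U) + local_dist M U (f U) g"
          using elim fm g U by (intro local_dist_triangle) (auto simp: fin_sets_def)
        then show ?case using gf local_dist_nonneg[of M U v g] by simp
      qed
    qed
  qed
  then show ?thesis using that g(1) by blast
qed

section \<open>The form topology\<close>

abbreviation real_form :: "(('a \<Rightarrow> real) \<Rightarrow> ereal) \<Rightarrow> ('a \<Rightarrow> real) \<Rightarrow> real" where
  "real_form q u \<equiv> real_of_ereal (q u)"

context
  fixes M :: "'a measure" and q :: "('a \<Rightarrow> real) \<Rightarrow> ereal"
  assumes qf: "quadratic_form M q"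
begin

lemma quadratic_form_nonneg: "0 \<le> q u"
  using qf by (simp add: quadratic_form_def)

lemma form_domain_measurable: "u \<in> form_domain q \<Longrightarrow> u \<in> borel_measurable M"
  using qf unfolding quadratic_form_def form_domain_def by (metis less_irrefl mem_Collect_eq)

lemma form_domain_eq: "u \<in> form_domain q \<Longrightarrow> q u = ereal (real_form q u)"
  using quadratic_form_nonneg[of u] by (auto simp: form_domain_def ereal_real)

lemma real_form_nonneg: "0 \<le> real_form q u"
  using quadratic_form_nonneg by (simp add: real_of_ereal_pos)

lemma quadratic_form_cong_AE:
  "u \<in> borel_measurable M \<Longrightarrow> v \<in> borel_measurable M \<Longrightarrow> AE x in M. u x = v x \<Longrightarrow> q u = q v"
  using qf unfolding quadratic_form_def by blast

lemma quadratic_form_parallelogram: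
  "u \<in> borel_measurable M \<Longrightarrow> v \<in> borel_measurable M \<Longrightarrow> q (u + v) + q (u - v) = 2 * q u + 2 * q v"
  using qf unfolding quadratic_form_def plus_fun_def fun_diff_def by metis

lemma quadratic_form_scale:
  "u \<in> borel_measurable M \<Longrightarrow> q (c *\<^sub>R u) = ereal (c\<^sup>2) * q u"
  using qf unfolding quadratic_form_def scaleR_fun_def real_scaleR_def power2_abs by blast

lemma subspace_form_domain: "subspace (form_domain q)"
proof (rule subspaceI)
  have "(0 :: 'a \<Rightarrow> real) = 0 *\<^sub>R 0" by simp
  then have "q 0 = 0" using quadratic_form_scale[of 0 0] by (simp add: zero_fun_def zero_ereal_def[symmetric])
  then show "0 \<in> form_domain q" by (simp add: form_domain_def)
next
  fix u v assume uv: "u \<in> form_domain q" "v \<in> form_domain q"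
  have "q (u + v) + q (u - v) = 2 * q u + 2 * q v"
    using uv form_domain_measurable by (intro quadratic_form_parallelogram) auto
  moreover obtain a b where "q u = ereal a" "q v = ereal b"
    using form_domain_eq uv by blast
  moreover have "2 = ereal 2" by simp
  ultimately have "q (u + v) + q (u - v) = ereal (2 * a + 2 * b)"
    by (simp only: times_ereal.simps plus_ereal.simps)
  then show "u + v \<in> form_domain q"
    using quadratic_form_nonneg[of "u - v"] quadratic_form_nonneg[of "u + v"]
    by (cases "q (u + v)") (auto simp: form_domain_def)
next
  fix c u assume u: "u \<in> form_domain q"
  have "q (c *\<^sub>R u) = ereal (c\<^sup>2) * q u"
    using u form_domain_measurable by (intro quadratic_form_scale) auto
  moreover obtain a where "q u = ereal a" using form_domain_eq u by blast
  ultimately show "c *\<^sub>R u \<in> form_domain q" by (simp add: form_domain_def)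
qed

lemma quad_space_form: "quad_space (form_domain q) (real_form q)"
proof
  show "subspace (form_domain q)" by (rule subspace_form_domain)
  show "0 \<le> real_form q u" for u by (rule real_form_nonneg)
next
  fix u v assume uv: "u \<in> form_domain q" "v \<in> form_domain q"
  have s: "u + v \<in> form_domain q" "u - v \<in> form_domain q"
    using subspace_form_domain uv by (auto intro: subspace_add subspace_diff)
  have "q (u + v) + q (u - v) = 2 * q u + 2 * q v"
    using uv form_domain_measurable by (intro quadratic_form_parallelogram) auto
  then have "ereal (real_form q (u + v) + real_form q (u - v)) = ereal (2 * real_form q u + 2 * real_form q v)"
    using form_domain_eq uv s
    by (metis numeral_eq_ereal plus_ereal.simps(1) times_ereal.simps(1))
  then show "real_form q (u + v) + real_form q (u - v) = 2 * real_form q u + 2 * real_form q v"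
    by simp
next
  fix u c assume u: "u \<in> form_domain q"
  have "q (c *\<^sub>R u) = ereal (c\<^sup>2) * q u"
    using u form_domain_measurable by (intro quadratic_form_scale) auto
  then show "real_form q (c *\<^sub>R u) = c\<^sup>2 * real_form q u" by simp
qed

lemma form_bilinear_eq_B: "form_bilinear q = quad_space.B (real_form q)"
  by (intro ext)
    (simp add: form_bilinear_def quad_space.B_def[OF quad_space_form] plus_fun_def fun_diff_def)

lemma openin_local_measure_topologyD:
  assumes "openin (local_measure_topology M) V" "u \<in> V"
  shows "\<exists>U\<in>fin_sets M. \<exists>e>0. \<forall>v\<in>borel_measurable M. local_dist M U u v < e \<longrightarrow> v \<in> V"
proof -
  let ?S = "{{g \<in> borel_measurable M. local_dist M U f g < e} | f U e.
        f \<in> borel_measurable M \<and> U \<in> sets M \<and> emeasure M U < \<infinity> \<and> e > 0}"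
  have "generate_topology_on ?S V"
    using assms(1) unfolding local_measure_topology_def by (simp add: openin_topology_generated_by_iff)
  then show ?thesis using assms(2)
  proof (induction rule: generate_topology_on.induct)
    case (Int a b)
    obtain U e where 1: "U \<in> fin_sets M" "0 < e"
        "\<And>v. v \<in> borel_measurable M \<Longrightarrow> local_dist M U u v < e \<Longrightarrow> v \<in> a"
      using Int.IH(1) Int.prems by blast
    obtain U' e' where 2: "U' \<in> fin_sets M" "0 < e'"
        "\<And>v. v \<in> borel_measurable M \<Longrightarrow> local_dist M U' u v < e' \<Longrightarrow> v \<in> b"
      using Int.IH(2) Int.prems by blast
    have um: "u \<in> borel_measurable M"
    proof -
      have "generate_topology_on ?S W \<Longrightarrow> W \<subseteq> borel_measurable M" for W
        by (induction rule: generate_topology_on.induct) auto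
      then show ?thesis using Int by blast
    qed
    show ?case
    proof (intro bexI exI conjI ballI impI)
      show "U \<union> U' \<in> fin_sets M" using 1 2 fin_sets_Un by blast
      show "0 < min e e'" using 1 2 by simp
      fix v assume v: "v \<in> borel_measurable M" "local_dist M (U \<union> U') u v < min e e'"
      have "local_dist M U u v \<le> local_dist M (U \<union> U') u v" "local_dist M U' u v \<le> local_dist M (U \<union> U') u v"
        using um v 1 2 fin_sets_Un by (auto intro!: local_dist_mono)
      then show "v \<in> a \<inter> b" using 1(3)[OF v(1)] 2(3)[OF v(1)] v(2) by auto
    qed
  next
    case (UN K)
    then obtain k where k: "k \<in> K" "u \<in> k" by blast
    from UN.IH[OF k] k(1) show ?case by (meson UnionI)
  next
    case (Basis s)
    then obtain f U e where s: "s = {g \<in> borel_measurable M. local_dist M U f g < e}"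
      and f: "f \<in> borel_measurable M" and U: "U \<in> fin_sets M"
      by (auto simp: fin_sets_def)
    then have u: "u \<in> borel_measurable M" "local_dist M U f u < e" using Basis by auto
    show ?case
    proof (intro bexI[OF _ U] exI[of _ "e - local_dist M U f u"] conjI ballI impI)
      fix v assume v: "v \<in> borel_measurable M" "local_dist M U u v < e - local_dist M U f u"
      have "local_dist M U f v \<le> local_dist M U f u + local_dist M U u v"
        using f u v U by (intro local_dist_triangle) (auto simp: fin_sets_def)
      then show "v \<in> s" using s v by auto
    qed (use u in auto)
  qed auto
qed

lemma openin_form_seminorm_topologyD:
  assumes "openin (form_seminorm_topology q) V" "u \<in> V"
  shows "u \<in> form_domain q \<and> (\<exists>e>0. \<forall>v\<in>form_domain q. real_form q (u - v) < e \<longrightarrow> v \<in> V)"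
proof -
  interpret quad_space "form_domain q" "real_form q" by (rule quad_space_form)
  let ?S = "{{v \<in> form_domain q. sqrt (real_of_ereal (q (\<lambda>x. u x - v x))) < e} | u e.
        u \<in> form_domain q \<and> e > 0}"
  have "generate_topology_on ?S V"
    using assms(1) unfolding form_seminorm_topology_def by (simp add: openin_topology_generated_by_iff)
  then show ?thesis using assms(2)
  proof (induction rule: generate_topology_on.induct)
    case (Int a b)
    obtain e where "u \<in> form_domain q" "0 < e"
      "\<And>v. v \<in> form_domain q \<Longrightarrow> real_form q (u - v) < e \<Longrightarrow> v \<in> a"
      using Int.IH(1) Int.prems by blast
    moreover obtain e' where "0 < e'"
      "\<And>v. v \<in> form_domain q \<Longrightarrow> real_form q (u - v) < e' \<Longrightarrow> v \<in> b"
      using Int.IH(2) Int.prems by blast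
    ultimately show ?case
      by (intro conjI exI[of _ "min e e'"] ballI impI IntI) (simp_all only: min_less_iff_conj)
  next
    case (UN K)
    then obtain k where k: "k \<in> K" "u \<in> k" by blast
    from UN.IH[OF k] k(1) show ?case by (meson UnionI)
  next
    case (Basis s)
    then obtain f e where s: "s = {v \<in> form_domain q. sqrt (real_form q (f - v)) < e}"
      and f: "f \<in> form_domain q" and e: "e > 0"
      by (auto simp: fun_diff_def)
    then have u: "u \<in> form_domain q" "sqrt (real_form q (f - u)) < e" using Basis by auto
    \<comment> \<open>The radius left over for the seminorm. It is squared below because
      neighbourhoods are measured by \<open>q\<close> and not by its square root.\<close>
    let ?d = "e - sqrt (real_form q (f - u))"
    show ?case
    proof (intro conjI exI[of _ "?d\<^sup>2"] ballI impI)
      fix v assume v: "v \<in> form_domain q" "real_form q (u - v) < ?d\<^sup>2"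
      have "sqrt (real_form q (u - v)) < ?d"
        using u v by (intro real_less_lsqrt) auto
      moreover have "sqrt (real_form q ((f - u) + (u - v))) \<le> sqrt (real_form q (f - u)) + sqrt (real_form q (u - v))"
        using f u v by (intro sqrt_Q_triangle) auto
      ultimately show "v \<in> s" using s v by simp
    qed (use u in auto)
  qed auto
qed

text \<open>The topology generated by two families is reduced to neighbourhoods with one
  finite-measure set and one radius for both distances. Completeness and limits are handled through
  this description.\<close>

lemma openin_form_topology:
  "openin (form_topology M q) V \<longleftrightarrow> V \<subseteq> form_domain q \<and>
    (\<forall>u\<in>V. \<exists>U\<in>fin_sets M. \<exists>e>0. \<forall>v\<in>form_domain q.
       local_dist M U u v < e \<longrightarrow> real_form q (u - v) < e \<longrightarrow> v \<in> V)" (is "_ \<longleftrightarrow> ?R V")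
proof
  interpret quad_space "form_domain q" "real_form q" by (rule quad_space_form)
  let ?T = "{V. openin (subtopology (local_measure_topology M) (form_domain q)) V}"
  let ?S = "{V. openin (form_seminorm_topology q) V}"
  assume "openin (form_topology M q) V"
  then have "generate_topology_on (?T \<union> ?S) V"
    unfolding form_topology_def by (simp add: openin_topology_generated_by_iff)
  then show "?R V"
  proof (induction rule: generate_topology_on.induct)
    case Empty
    show ?case by simp
  next
    case (Int a b)
    show ?case
    proof (intro conjI ballI)
      show "a \<inter> b \<subseteq> form_domain q" using Int by blast
      fix u assume "u \<in> a \<inter> b"
      then have uab: "u \<in> a" "u \<in> b" by auto
      obtain U e where 1: "U \<in> fin_sets M" "0 < e"
          "\<And>v. v \<in> form_domain q \<Longrightarrow> local_dist M U u v < e \<Longrightarrow> real_form q (u - v) < e \<Longrightarrow> v \<in> a"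
        using conjunct2[OF Int.IH(1)] uab by blast
      obtain U' e' where 2: "U' \<in> fin_sets M" "0 < e'"
          "\<And>v. v \<in> form_domain q \<Longrightarrow> local_dist M U' u v < e' \<Longrightarrow> real_form q (u - v) < e' \<Longrightarrow> v \<in> b"
        using conjunct2[OF Int.IH(2)] uab by blast
      have um: "u \<in> borel_measurable M" using \<open>u \<in> a \<inter> b\<close> Int form_domain_measurable by blast
      show "\<exists>U\<in>fin_sets M. \<exists>e>0. \<forall>v\<in>form_domain q.
          local_dist M U u v < e \<longrightarrow> real_form q (u - v) < e \<longrightarrow> v \<in> a \<inter> b"
      proof (intro bexI exI conjI ballI impI)
        show "U \<union> U' \<in> fin_sets M" using 1 2 fin_sets_Un by blast
        show "0 < min e e'" using 1 2 by simp
        fix v assume v: "v \<in> form_domain q" "local_dist M (U \<union> U') u v < min e e'"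
          "real_form q (u - v) < min e e'"
        have "local_dist M U u v \<le> local_dist M (U \<union> U') u v" "local_dist M U' u v \<le> local_dist M (U \<union> U') u v"
          using um form_domain_measurable[OF v(1)] 1 2 fin_sets_Un by (auto intro!: local_dist_mono)
        then show "v \<in> a \<inter> b" using 1(3)[OF v(1)] 2(3)[OF v(1)] v(2,3) by auto
      qed
    qed
  next
    case (UN K)
    show ?case
    proof (intro conjI ballI)
      show "\<Union>K \<subseteq> form_domain q" using UN by blast
      fix u assume "u \<in> \<Union>K"
      then obtain k where k: "k \<in> K" "u \<in> k" by blast
      show "\<exists>U\<in>fin_sets M. \<exists>e>0. \<forall>v\<in>form_domain q.
          local_dist M U u v < e \<longrightarrow> real_form q (u - v) < e \<longrightarrow> v \<in> \<Union>K"
        using bspec[OF conjunct2[OF UN.IH[OF k(1)]] k(2)] k(1) by (meson UnionI)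
    qed
  next
    case (Basis s)
    then consider T where "openin (local_measure_topology M) T" "s = T \<inter> form_domain q"
      | "openin (form_seminorm_topology q) s"
      by (auto simp: openin_subtopology)
    then show ?case
    proof cases
      case (1 T)
      show ?thesis
      proof (intro conjI ballI)
        fix u assume "u \<in> s"
        then obtain U e where "U \<in> fin_sets M" "e > 0"
          "\<And>v. v \<in> borel_measurable M \<Longrightarrow> local_dist M U u v < e \<Longrightarrow> v \<in> T"
          using openin_local_measure_topologyD[OF 1(1), of u] 1(2) by blast
        then show "\<exists>U\<in>fin_sets M. \<exists>e>0. \<forall>v\<in>form_domain q.
          local_dist M U u v < e \<longrightarrow> real_form q (u - v) < e \<longrightarrow> v \<in> s"
          using 1(2) form_domain_measurable by (metis IntI)
      qed (use 1 in auto)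
    next
      case 2
      show ?thesis
        using openin_form_seminorm_topologyD[OF 2] fin_sets_empty[of M] by (meson subsetI)
    qed
  qed
next
  interpret quad_space "form_domain q" "real_form q" by (rule quad_space_form)
  assume R: "?R V"
  show "openin (form_topology M q) V"
  proof (subst openin_subopen, intro ballI)
    fix u assume u: "u \<in> V"
    then obtain U e where U: "U \<in> fin_sets M" "e > 0" and
      *: "\<And>v. v \<in> form_domain q \<Longrightarrow> local_dist M U u v < e \<Longrightarrow> real_form q (u - v) < e \<Longrightarrow> v \<in> V"
      using R by meson
    have ud: "u \<in> form_domain q" using R u by blast
    let ?A = "{v \<in> borel_measurable M. local_dist M U u v < e} \<inter> form_domain q"
    let ?B = "{v \<in> form_domain q. sqrt (real_of_ereal (q (\<lambda>x. u x - v x))) < sqrt e}"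
    have A: "openin (subtopology (local_measure_topology M) (form_domain q)) ?A"
      unfolding local_measure_topology_def
      by (intro openin_subtopology_Int topology_generated_by_Basis)
        (use U ud form_domain_measurable in \<open>auto simp: fin_sets_def\<close>)
    have B: "openin (form_seminorm_topology q) ?B"
      unfolding form_seminorm_topology_def
      by (intro topology_generated_by_Basis CollectI exI[of _ u] exI[of _ "sqrt e"])
        (use U ud in auto)
    have "openin (form_topology M q) (?A \<inter> ?B)"
      unfolding form_topology_def
      by (intro openin_Int topology_generated_by_Basis) (use A B in auto)
    moreover have "u \<in> ?A \<inter> ?B"
      using ud U form_domain_measurable[OF ud] Q_zero
      by (auto simp: local_dist_def zero_fun_def)
    moreover have "?A \<inter> ?B \<subseteq> V" using * by (auto simp: fun_diff_def)
    ultimately show "\<exists>T. openin (form_topology M q) T \<and> u \<in> T \<and> T \<subseteq> V" by blast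
  qed
qed

lemma topspace_form_topology: "topspace (form_topology M q) = form_domain q"
proof
  show "topspace (form_topology M q) \<subseteq> form_domain q"
    using openin_form_topology[of "topspace (form_topology M q)"] by simp
  have "openin (form_topology M q) (form_domain q)"
    unfolding openin_form_topology 
    by (intro conjI subset_refl ballI bexI[OF _ fin_sets_empty] exI[of _ 1] impI zero_less_one)
  then show "form_domain q \<subseteq> topspace (form_topology M q)" by (rule openin_subset)
qed

lemma openin_form_ball:
  assumes "u \<in> form_domain q" "U \<in> fin_sets M"
  shows "openin (form_topology M q) {v \<in> form_domain q. local_dist M U u v < e \<and> real_form q (u - v) < d}"
proof -
  interpret quad_space "form_domain q" "real_form q" by (rule quad_space_form)
  show ?thesis
    unfolding openin_form_topology
  proof (intro conjI ballI)
    fix v assume v: "v \<in> {v \<in> form_domain q. local_dist M U u v < e \<and> real_form q (u - v) < d}"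
    then have vd: "v \<in> form_domain q" by simp
    have d: "sqrt (real_form q (u - v)) < sqrt d" using v by simp
    define r where "r = min (e - local_dist M U u v) ((sqrt d - sqrt (real_form q (u - v)))\<^sup>2)"
    show "\<exists>U'\<in>fin_sets M. \<exists>r>0. \<forall>w\<in>form_domain q. local_dist M U' v w < r \<longrightarrow> real_form q (v - w) < r \<longrightarrow>
        w \<in> {v \<in> form_domain q. local_dist M U u v < e \<and> real_form q (u - v) < d}"
    proof (intro bexI[OF _ assms(2)] exI[of _ r] conjI ballI impI)
      show "0 < r" using v d by (auto simp: r_def)
      fix w assume w: "w \<in> form_domain q" "local_dist M U v w < r" "real_form q (v - w) < r"
      have "local_dist M U u w \<le> local_dist M U u v + local_dist M U v w"
        using assms vd w form_domain_measurable by (intro local_dist_triangle) (auto simp: fin_sets_def)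
      then have 1: "local_dist M U u w < e" using w by (simp add: r_def)
      have "sqrt (real_form q (v - w)) < sqrt d - sqrt (real_form q (u - v))"
        using w d by (intro real_less_lsqrt) (auto simp: r_def)
      moreover have "sqrt (real_form q ((u - v) + (v - w))) \<le> sqrt (real_form q (u - v)) + sqrt (real_form q (v - w))"
        using assms vd w by (intro sqrt_Q_triangle) auto
      ultimately have "sqrt (real_form q (u - w)) < sqrt d" by (simp del: real_sqrt_less_iff)
      then show "w \<in> {v \<in> form_domain q. local_dist M U u v < e \<and> real_form q (u - v) < d}"
        using 1 w by simp
    qed
  qed auto
qed

end

section \<open>Closedness and lower semicontinuity\<close>

lemma local_dist_zero_diff: "local_dist M U 0 (u - v) = local_dist M U u v"
  unfolding local_dist_def by (simp add: abs_minus_commute)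

lemma tconv_eventually_less:
  "tconv M X f F \<Longrightarrow> U \<in> fin_sets M \<Longrightarrow> 0 < e \<Longrightarrow> \<forall>\<^sub>F i in F. local_dist M U (X i) f < e"
  unfolding tconv_def by (auto intro: order_tendstoD)

lemma dist_zero_less: "0 \<le> x \<Longrightarrow> x < e \<Longrightarrow> dist x 0 < (e :: real)"
  by simp

lemma local_dist_self [simp]: "local_dist M U f f = 0"
  by (simp add: local_dist_def)

text \<open>By the parallelogram law \<open>Q (X i - u)\<close> equals
  \<open>2 * Q (X i) + 2 * Q u - Q (X i + u)\<close>, and semicontinuity at \<open>u + u\<close>
  bounds the last value from below by almost \<open>4 * Q u\<close>; if the energies are
  asymptotically at most \<open>Q u\<close>, nothing is left. It replaces the Hilbert space fact
  that weak convergence and convergence of norms give strong convergence.\<close>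

lemma lower_semicont_strong_convergence:
  assumes qf: "quadratic_form M q" and lsc: "lower_semicont M q"
    and X: "\<And>i. X i \<in> form_domain q" and u: "u \<in> form_domain q" and conv: "tconv M X u F"
    and le: "\<forall>\<^sub>F i in F. real_form q (X i) \<le> f i" and f: "(f \<longlongrightarrow> real_form q u) F"
  shows "((\<lambda>i. real_form q (X i - u)) \<longlongrightarrow> 0) F"
proof -
  interpret quad_space "form_domain q" "real_form q" by (rule quad_space_form[OF qf])
  have Xm: "X i \<in> borel_measurable M" for i using form_domain_measurable[OF qf X] .
  have um: "u \<in> borel_measurable M" using form_domain_measurable[OF qf u] .
  have c2: "tconv M (\<lambda>i. X i + u) (u + u) F"
    by (rule tconv_add[OF conv tconv_const]) (use Xm um in auto)
  show ?thesis
  proof (rule tendstoI)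
    fix e :: real assume e: "0 < e"
    have "real_form q (u + u) = 4 * real_form q u"
      using hom[OF u, of 2] by (simp add: scaleR_2)
    moreover have "q (u + u) = ereal (real_form q (u + u))"
      by (rule form_domain_eq[OF qf mem(1)[OF u u]])
    ultimately have "ereal (4 * real_form q u - e / 2) < q (u + u)"
      using e by (metis diff_gt_0_iff_gt add.commute add_diff_cancel diff_strict_left_mono
        half_gt_zero less_ereal.simps(1) diff_zero)
    then have "\<forall>\<^sub>F i in F. ereal (4 * real_form q u - e / 2) < q (X i + u)"
      by (intro lower_semicontD[OF lsc _ _ c2]) (use Xm um in \<open>auto simp: plus_fun_def\<close>)
    moreover have "\<forall>\<^sub>F i in F. f i < real_form q u + e / 4"
      using f e by (intro order_tendstoD(2)[OF f]) auto
    ultimately show "\<forall>\<^sub>F i in F. dist (real_form q (X i - u)) 0 < e"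
      using le
    proof eventually_elim
      case (elim i)
      have m: "X i + u \<in> form_domain q" "X i - u \<in> form_domain q" using X u by auto
      have "ereal (4 * real_form q u - e / 2) < ereal (real_form q (X i + u))"
        using elim(1) form_domain_eq[OF qf m(1)] by argo
      then have "4 * real_form q u - e / 2 < real_form q (X i + u)" by simp
      then have "real_form q (X i - u) < e"
        using elim(2,3) par[OF X[of i] u] by linarith
      then show ?case by (rule dist_zero_less[OF nonneg[OF m(2)]])
    qed
  qed
qed

text \<open>With Y = X - u and energies of Y bounded by C', semicontinuity at \<open>w\<close> along
  w + t Y gives - t^2 < 2 t B(Y, w) + t^2 C' eventually. Using both t and -t bounds B(Y, w) by a
  multiple of t, and t is arbitrary.\<close>

lemma lower_semicont_weak_convergence:
  assumes qf: "quadratic_form M q" and lsc: "lower_semicont M q"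
    and X: "\<And>i. X i \<in> form_domain q" and u: "u \<in> form_domain q" and conv: "tconv M X u F"
    and le: "\<forall>\<^sub>F i in F. real_form q (X i) \<le> C" and w: "w \<in> form_domain q"
  shows "((\<lambda>i. form_bilinear q (X i) w) \<longlongrightarrow> form_bilinear q u w) F"
proof -
  interpret quad_space "form_domain q" "real_form q" by (rule quad_space_form[OF qf])
  have Xm: "X i \<in> borel_measurable M" for i using form_domain_measurable[OF qf X] .
  have um: "u \<in> borel_measurable M" using form_domain_measurable[OF qf u] .
  have wm: "w \<in> borel_measurable M" using form_domain_measurable[OF qf w] .
  define Y where "Y i = X i - u" for i
  have Y: "Y i \<in> form_domain q" for i unfolding Y_def using X u by auto
  have Ym: "Y i \<in> borel_measurable M" for i using form_domain_measurable[OF qf Y] .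
  have Yc: "tconv M Y 0 F"
    using tconv_diff[OF conv tconv_const[of M u] Xm um um um] by (simp add: Y_def[abs_def])
  define C' where "C' = 2 * C + 2 * real_form q u + 1"
  have Yle: "\<forall>\<^sub>F i in F. real_form q (Y i) \<le> C'"
    using le
  proof eventually_elim
    case (elim i)
    then show ?case using Q_diff_le[OF X[of i] u] unfolding Y_def C'_def by linarith
  qed
  have key: "\<forall>\<^sub>F i in F. - (t\<^sup>2) < 2 * t * B (Y i) w + t\<^sup>2 * C'" if t: "t \<noteq> 0" for t
  proof -
    have c: "tconv M (\<lambda>i. w + t *\<^sub>R Y i) (w + t *\<^sub>R 0) F"
      by (intro tconv_add tconv_const tconv_scale Yc)
        (use Ym wm in \<open>auto simp: zero_fun_def scaleR_fun_def\<close>)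
    have "ereal (real_form q w - t\<^sup>2) < ereal (real_form q w)" using t by simp
    then have "ereal (real_form q w - t\<^sup>2) < q (w + t *\<^sub>R 0)"
      using form_domain_eq[OF qf w] by simp
    then have "\<forall>\<^sub>F i in F. ereal (real_form q w - t\<^sup>2) < q (w + t *\<^sub>R Y i)"
      by (intro lower_semicontD[OF lsc _ _ c])
        (use Ym wm in \<open>auto simp: zero_fun_def scaleR_fun_def plus_fun_def\<close>)
    then show ?thesis using Yle
    proof eventually_elim
      case (elim i)
      have m: "w + t *\<^sub>R Y i \<in> form_domain q" using Y w by auto
      have "ereal (real_form q w - t\<^sup>2) < ereal (real_form q (w + t *\<^sub>R Y i))"
        using elim(1) form_domain_eq[OF qf m] by argo
      then have "real_form q w - t\<^sup>2 < real_form q (w + t *\<^sub>R Y i)" by simp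
      also have "\<dots> = real_form q w + 2 * (t * B (Y i) w) + t\<^sup>2 * real_form q (Y i)"
        using Q_add[OF w mem(3)[OF Y[of i]], of t] hom[OF Y[of i], of t] B_scale_right[OF w Y[of i], of t]
          B_commute[OF w Y[of i]] by simp
      also have "\<dots> \<le> real_form q w + 2 * (t * B (Y i) w) + t\<^sup>2 * C'"
        using elim(2) by (intro add_left_mono mult_left_mono) auto
      finally show ?case by simp
    qed
  qed
  have "((\<lambda>i. B (Y i) w) \<longlongrightarrow> 0) F"
  proof (rule tendstoI)
    fix e :: real assume e: "0 < e"
    \<comment> \<open>Chosen such that \<open>t * (C' + 1) \<le> e\<close>, with no sign condition
      on \<open>C'\<close>.\<close>
    define t where "t = e / (\<bar>C'\<bar> + 1)"
    have t: "0 < t" using e by (simp add: t_def)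
    have tC: "t * (C' + 1) \<le> e"
    proof -
      have "t * (C' + 1) \<le> t * (\<bar>C'\<bar> + 1)" using t by (intro mult_left_mono) auto
      also have "\<dots> = e" unfolding t_def by (simp add: field_simps)
      finally show ?thesis .
    qed
    show "\<forall>\<^sub>F i in F. dist (B (Y i) w) 0 < e"
    proof (rule eventually_mono[OF eventually_conj])
      show "\<forall>\<^sub>F i in F. - (t\<^sup>2) < 2 * t * B (Y i) w + t\<^sup>2 * C'"
        "\<forall>\<^sub>F i in F. - ((- t)\<^sup>2) < 2 * - t * B (Y i) w + (- t)\<^sup>2 * C'"
        using t by (intro key; simp)+
    next
      fix i
      assume elim: "- (t\<^sup>2) < 2 * t * B (Y i) w + t\<^sup>2 * C' \<and>
        - ((- t)\<^sup>2) < 2 * - t * B (Y i) w + (- t)\<^sup>2 * C'"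
      have "- t * t < 2 * t * B (Y i) w + t * (t * C')" "- t * t < - 2 * t * B (Y i) w + t * (t * C')"
        using elim t by (auto simp: power2_eq_square algebra_simps)
      then have "0 < t * (2 * B (Y i) w + t * (C' + 1))" "0 < t * (- 2 * B (Y i) w + t * (C' + 1))"
        by (simp_all add: algebra_simps)
      then have "0 < 2 * B (Y i) w + t * (C' + 1)" "0 < - 2 * B (Y i) w + t * (C' + 1)"
        using t by (simp_all add: zero_less_mult_iff)
      then show "dist (B (Y i) w) 0 < e" using tC e by auto
    qed
  qed
  then have "((\<lambda>i. B (Y i) w + B u w) \<longlongrightarrow> 0 + B u w) F" by (intro tendsto_intros)
  moreover have "B (Y i) w + B u w = B (X i) w" for i
    unfolding Y_def using B_diff_left[OF X[of i] w u] by simp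
  ultimately show ?thesis by (simp add: form_bilinear_eq_B[OF qf])
qed

text \<open>A Cauchy filter has a limit in L0, and semicontinuity in one argument of
  \<open>q (u - v)\<close> carries the Cauchy estimate over to that limit; the same estimate puts
  the limit into the domain.\<close>

theorem lower_semicont_imp_closed_form:
  assumes L: "localizable M" and qf: "quadratic_form M q" and lsc: "lower_semicont M q"
  shows "closed_form M q"
  unfolding closed_form_def complete_function_topology_def
proof (intro conjI allI impI qf)
  interpret quad_space "form_domain q" "real_form q" by (rule quad_space_form[OF qf])
  fix F assume C: "Cauchy_filter_in (form_topology M q) F"
  have F: "F \<noteq> bot" and FD: "\<forall>\<^sub>F u in F. u \<in> form_domain q"
    using C unfolding Cauchy_filter_in_def topspace_form_topology[OF qf] le_principal by auto
  have Fm: "\<forall>\<^sub>F u in F. u \<in> borel_measurable M"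
    using FD by eventually_elim (rule form_domain_measurable[OF qf])
  have key: "\<exists>P. eventually P F \<and> (\<forall>u v. P u \<longrightarrow> P v \<longrightarrow> local_dist M U u v < e \<and> real_form q (u - v) < e)"
    if U: "U \<in> fin_sets M" and e: "0 < e" for U e
  proof -
    let ?V = "{v \<in> form_domain q. local_dist M U 0 v < e \<and> real_form q (0 - v) < e}"
    have "openin (form_topology M q) ?V"
      by (rule openin_form_ball[OF qf _ U]) simp
    moreover have "(\<lambda>x. 0) \<in> ?V"
      using e mem(4) by (simp add: zero_fun_def[symmetric])
    ultimately have "\<forall>\<^sub>F (u, v) in F \<times>\<^sub>F F. (\<lambda>x. u x - v x) \<in> ?V"
      by (intro C[unfolded Cauchy_filter_in_def, THEN conjunct2, THEN conjunct2, rule_format] conjI)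
    then obtain P where P: "eventually P F"
      and "\<forall>u v. P u \<longrightarrow> P v \<longrightarrow> (case (u, v) of (u, v) \<Rightarrow> (\<lambda>x. u x - v x) \<in> ?V)"
      unfolding eventually_prod_same by (elim exE conjE)
    then have PP: "u - v \<in> ?V" if "P u" "P v" for u v
      using that unfolding prod.case fun_diff_def by (elim allE impE)
    show ?thesis
    proof (intro exI[of _ "\<lambda>u. P u \<and> u \<in> form_domain q"] conjI allI impI)
      show "\<forall>\<^sub>F u in F. P u \<and> u \<in> form_domain q" using P FD by (rule eventually_conj)
      fix u v assume uv: "P u \<and> u \<in> form_domain q" "P v \<and> v \<in> form_domain q"
      then have "local_dist M U 0 (u - v) < e \<and> real_form q (0 - (u - v)) < e"
        using PP[of u v] by blast
      then show "local_dist M U u v < e" "real_form q (u - v) < e"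
        using uv Q_minus_commute[of u v] by (auto simp: local_dist_zero_diff)
    qed
  qed
  obtain f where fm: "f \<in> borel_measurable M" and ft: "tconv M (\<lambda>v. v) f F"
  proof (rule L0_complete[OF L F Fm])
    fix U e assume "U \<in> fin_sets M" "0 < (e::real)"
    from key[OF this] obtain P where "eventually P F"
      "\<forall>u v. P u \<longrightarrow> P v \<longrightarrow> local_dist M U u v < e \<and> real_form q (u - v) < e"
      by (elim exE conjE)
    then show "\<exists>P. eventually P F \<and> (\<forall>f g. P f \<longrightarrow> P g \<longrightarrow> local_dist M U f g < e)"
      by (intro exI[of _ P]) simp
  qed
  have fv: "\<forall>\<^sub>F v in F. v \<in> form_domain q \<and> q (f - v) \<le> ereal e" if e: "0 < e" for e
  proof -
    from key[OF fin_sets_empty e] obtain P where P: "eventually P F"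
      and "\<forall>u v. P u \<longrightarrow> P v \<longrightarrow> local_dist M {} u v < e \<and> real_form q (u - v) < e"
      by (elim exE conjE)
    then have PP: "real_form q (u - v) < e" if "P u" "P v" for u v
      using that by blast
    show ?thesis
      using P FD
    proof eventually_elim
      case (elim v)
      have vm: "v \<in> borel_measurable M" using elim form_domain_measurable[OF qf] by blast
      \<comment> \<open>Members of the filter are measurable only eventually, while the rules for
        \<open>tconv\<close> ask for measurability at every index; 0 is a default value.\<close>
      have ae: "\<forall>\<^sub>F u in F. (if u \<in> borel_measurable M then u else 0) = u"
        using Fm by eventually_elim simp
      have "tconv M (\<lambda>u. (if u \<in> borel_measurable M then u else 0)) f F"
        unfolding tconv_def
      proof
        fix U assume "U \<in> fin_sets M"
        then have "((\<lambda>u. local_dist M U u f) \<longlongrightarrow> 0) F" using ft by (simp add: tconv_def)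
        then show "((\<lambda>u. local_dist M U (if u \<in> borel_measurable M then u else 0) f) \<longlongrightarrow> 0) F"
          by (rule Lim_transform_eventually) (use ae in eventually_elim, simp)
      qed
      then have t: "tconv M (\<lambda>u. (if u \<in> borel_measurable M then u else 0) - v) (f - v) F"
        by (rule tconv_diff[OF _ tconv_const]) (use fm vm in \<open>auto simp: zero_fun_def\<close>)
      have "q (f - v) \<le> ereal e"
      proof (rule lower_semicont_le[OF lsc _ _ t F])
        show "\<forall>\<^sub>F u in F. q ((if u \<in> borel_measurable M then u else 0) - v) \<le> ereal e"
          using P FD ae
        proof eventually_elim
          case (elim u)
          have "u - v \<in> form_domain q" using elim \<open>v \<in> form_domain q\<close> by auto
          from form_domain_eq[OF qf this] PP[OF elim(1) \<open>P v\<close>] show ?case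
            unfolding elim(3) by (metis less_ereal.simps(1) order_less_imp_le)
        qed
      qed (use fm vm in \<open>auto simp: zero_fun_def fun_diff_def\<close>)
      then show ?case using elim by simp
    qed
  qed
  have fD: "f \<in> form_domain q"
  proof -
    obtain v where v: "v \<in> form_domain q" "q (f - v) \<le> ereal 1"
      using eventually_happens'[OF F fv[of 1]] by auto
    then have "f - v \<in> form_domain q" by (auto simp: form_domain_def)
    then have "v + (f - v) \<in> form_domain q" using v by blast
    then show ?thesis by simp
  qed
  show "\<exists>u. limitin (form_topology M q) (\<lambda>v. v) u F"
    unfolding limitin_def
  proof (intro exI[of _ f] conjI allI impI)
    show "f \<in> topspace (form_topology M q)" using fD topspace_form_topology[OF qf] by simp
    fix V assume "openin (form_topology M q) V \<and> f \<in> V"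
    then obtain U e where U: "U \<in> fin_sets M" and e: "0 < e"
      and *: "\<And>v. v \<in> form_domain q \<Longrightarrow> local_dist M U f v < e \<Longrightarrow> real_form q (f - v) < e \<Longrightarrow> v \<in> V"
      unfolding openin_form_topology[OF qf] by blast
    have "\<forall>\<^sub>F v in F. local_dist M U v f < e"
      by (rule tconv_eventually_less[OF ft U e])
    moreover have "\<forall>\<^sub>F v in F. v \<in> form_domain q \<and> q (f - v) \<le> ereal (e/2)" using fv[of "e/2"] e by simp
    ultimately show "\<forall>\<^sub>F v in F. v \<in> V"
    proof eventually_elim
      case (elim v)
      have "f - v \<in> form_domain q" using fD elim by auto
      from form_domain_eq[OF qf this] elim(2) have "ereal (real_form q (f - v)) \<le> ereal (e/2)"
        by argo
      then have "real_form q (f - v) < e" using e by simp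
      then show ?case using * elim by (simp add: local_dist_commute)
    qed
  qed
qed

text \<open>
  \<open>L\<^sup>0\<close> is not locally convex, so approximating elements are replaced by sequences that converge
  almost everywhere on \<open>U\<close>: these form a convex set, and near-minimisers of \<open>q\<close> among them are
  almost Cauchy by the parallelogram law.
\<close>

theorem closed_form_imp_lower_semicont:
  assumes L: "localizable M" and cl: "closed_form M q"
  shows "lower_semicont M q"
proof (rule ccontr)
  have qf: "quadratic_form M q" using cl by (simp add: closed_form_def)
  interpret quad_space "form_domain q" "real_form q" by (rule quad_space_form[OF qf])
  let ?D = "form_domain q" and ?Q = "real_form q"
  assume "\<not> lower_semicont M q"
  then obtain u c where um: "u \<in> borel_measurable M" and c: "c < q u"
    and app: "\<And>U e. U \<in> fin_sets M \<Longrightarrow> 0 < e \<Longrightarrow>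
      \<exists>v\<in>borel_measurable M. local_dist M U u v < e \<and> q v \<le> c"
    unfolding lower_semicont_def by (meson not_le)
  obtain v0 where "q v0 \<le> c" using app[OF fin_sets_empty, of 1] by auto
  then have "0 \<le> c" using quadratic_form_nonneg[OF qf, of v0] by (rule order_trans[rotated])
  with c obtain r where r: "c = ereal r" "0 \<le> r" by (cases c) auto
  have app': "\<exists>v\<in>?D. local_dist M U u v < e \<and> ?Q v \<le> r" if U: "U \<in> fin_sets M" "0 < e" for U e
  proof -
    obtain v where v: "local_dist M U u v < e" "q v \<le> ereal r" using app[OF U] r by blast
    then have "v \<in> ?D" by (auto simp: form_domain_def)
    moreover from form_domain_eq[OF qf this] v(2) have "?Q v \<le> r"
      by (metis ereal_less_eq(3))
    ultimately show ?thesis using v by blast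
  qed
  \<comment> \<open>\<open>A U\<close> collects the energy bounds that such sequences can satisfy,
    and \<open>d U\<close> is the least energy needed to reach \<open>u\<close> on \<open>U\<close>.
    It increases with \<open>U\<close> and never exceeds \<open>r\<close>.\<close>
  define S where "S U = {w. (\<forall>k::nat. w k \<in> ?D) \<and> (AE x in M. x \<in> U \<longrightarrow> (\<lambda>k. w k x) \<longlonglongrightarrow> u x)}" for U
  define A where "A U = {a. \<exists>w\<in>S U. \<forall>k. ?Q (w k) \<le> a}" for U
  define d where "d U = Inf (A U)" for U
  have SD: "w k \<in> ?D" if "w \<in> S U" for w k U using that by (simp add: S_def)
  have Santi: "w \<in> S U" if "w \<in> S V" "U \<subseteq> V" for w U V
    using that unfolding S_def by (auto elim!: AE_mp)
  have Ar: "r \<in> A U" if U: "U \<in> fin_sets M" for U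
  proof -
    have "\<exists>v\<in>?D. local_dist M U u v < 1 / real (Suc n) \<and> ?Q v \<le> r" for n
      by (rule app'[OF U]) simp
    then obtain v where v: "\<And>n. v n \<in> ?D" "\<And>n. local_dist M U u (v n) < 1 / real (Suc n)" "\<And>n. ?Q (v n) \<le> r"
      by metis
    have "(\<lambda>n. local_dist M U (v n) u) \<longlonglongrightarrow> 0"
    proof (rule Lim_null_comparison[OF always_eventually])
      show "\<forall>n. norm (local_dist M U (v n) u) \<le> 1 / real (Suc n)"
        using v(2) local_dist_nonneg by (metis less_imp_le local_dist_commute real_norm_def abs_of_nonneg)
      show "(\<lambda>n. 1 / real (Suc n)) \<longlonglongrightarrow> 0"
        using LIMSEQ_inverse_real_of_nat by (simp add: inverse_eq_divide)
    qed
    then obtain s :: "nat \<Rightarrow> nat" where s: "AE x in M. x \<in> U \<longrightarrow> (\<lambda>n. v (s n) x) \<longlonglongrightarrow> u x"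
      by (rule local_dist_AE_subseq[OF form_domain_measurable[OF qf v(1)] um U])
    then show ?thesis using v unfolding A_def S_def by (intro CollectI bexI[of _ "\<lambda>n. v (s n)"]) auto
  qed
  have A0: "0 \<le> a" if aA: "a \<in> A U" for a U
  proof -
    obtain w where w: "w \<in> S U" "\<forall>k. ?Q (w k) \<le> a" using aA unfolding A_def by blast
    have "0 \<le> ?Q (w 0)" by (rule nonneg[OF SD[OF w(1)]])
    also have "\<dots> \<le> a" using w(2) by blast
    finally show ?thesis .
  qed
  have bdd: "bdd_below (A U)" for U by (rule bdd_belowI[of _ 0]) (rule A0)
  have d_le_r: "d U \<le> r" if "U \<in> fin_sets M" for U
    unfolding d_def using Ar[OF that] bdd by (rule cInf_lower)
  have d_mono: "d U \<le> d V" if "U \<subseteq> V" "V \<in> fin_sets M" for U V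
    unfolding d_def
  proof (rule cInf_superset_mono[OF _ bdd])
    show "A V \<noteq> {}" using Ar that by blast
    show "A V \<subseteq> A U" unfolding A_def using Santi that by blast
  qed
  have d_low: "d U \<le> a" if "w \<in> S U" "\<And>k. ?Q (w k) \<le> a" for w a U
    unfolding d_def by (rule cInf_lower[OF _ bdd]) (use that in \<open>auto simp: A_def\<close>)
  have d_app: "\<exists>w\<in>S U. \<forall>k. ?Q (w k) \<le> d U + e" if Ue: "U \<in> fin_sets M" "0 < e" for U e
  proof -
    have "Inf (A U) < d U + e" using Ue by (simp add: d_def)
    then obtain a where "a \<in> A U" "a < d U + e"
      using cInf_lessD[of "A U" "d U + e"] Ar[OF Ue(1)] by blast
    moreover from this obtain w where "w \<in> S U" "\<forall>k. ?Q (w k) \<le> a" unfolding A_def by blast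
    ultimately show ?thesis by (intro bexI[of _ w] allI) (auto intro: order_trans less_imp_le)
  qed
  \<comment> \<open>Otherwise the midpoints of far apart terms, arbitrarily late in both sequences,
    would form a sequence in \<open>S U\<close> with energies at most
    \<open>d U - \<eta>\<close>.\<close>
  have avg: "\<exists>K. \<forall>k\<ge>K. \<forall>l\<ge>K. ?Q (w k - w' l) \<le> 2 * (a + b) - 4 * d U + 4 * \<eta>"
    if w: "w \<in> S U" "w' \<in> S U" and wa: "\<And>k. ?Q (w k) \<le> a" and wb: "\<And>k. ?Q (w' k) \<le> b" and e: "0 < \<eta>"
    for w w' U a b \<eta>
  proof (rule ccontr)
    assume "\<not> ?thesis"
    then have "\<forall>K. \<exists>k l. K \<le> k \<and> K \<le> l \<and> 2 * (a + b) - 4 * d U + 4 * \<eta> < ?Q (w k - w' l)"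
      by (meson not_le)
    then obtain k l where k: "\<And>K. K \<le> k K" and l: "\<And>K. K \<le> l K"
      and big: "\<And>K. 2 * (a + b) - 4 * d U + 4 * \<eta> < ?Q (w (k K) - w' (l K))" by metis
    define z where "z K = (1/2) *\<^sub>R (w (k K) + w' (l K))" for K
    have kt: "filterlim k at_top at_top" "filterlim l at_top at_top"
      using k l by (auto intro: filterlim_at_top_mono[OF filterlim_ident])
    have "AE x in M. x \<in> U \<longrightarrow> (\<lambda>k. w k x) \<longlonglongrightarrow> u x" "AE x in M. x \<in> U \<longrightarrow> (\<lambda>k. w' k x) \<longlonglongrightarrow> u x"
      using w by (auto simp: S_def)
    then have "AE x in M. x \<in> U \<longrightarrow> (\<lambda>K. z K x) \<longlonglongrightarrow> u x"
    proof eventually_elim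
      case (elim x)
      show ?case
      proof
        assume "x \<in> U"
        then have "(\<lambda>K. (1/2) * (w (k K) x + w' (l K) x)) \<longlonglongrightarrow> (1/2) * (u x + u x)"
          using elim filterlim_compose[OF _ kt(1)] filterlim_compose[OF _ kt(2)]
          by (intro tendsto_intros) auto
        then show "(\<lambda>K. z K x) \<longlonglongrightarrow> u x" by (simp add: z_def)
      qed
    qed
    moreover have "z K \<in> ?D" for K unfolding z_def using SD w by blast
    ultimately have zS: "z \<in> S U" by (simp add: S_def)
    have "?Q (z K) \<le> d U - \<eta>" for K
    proof -
      have m: "w (k K) \<in> ?D" "w' (l K) \<in> ?D" using SD w by blast+
      have "?Q (z K) = (1/4) * ?Q (w (k K) + w' (l K))"
        unfolding z_def using hom[of "w (k K) + w' (l K)" "1/2"] m by (simp add: power2_eq_square)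
      moreover have "x \<le> y - \<eta>" if "x = 1/4 * p" "p + n = 2 * s + 2 * t"
        "2 * (a + b) - 4 * y + 4 * \<eta> < n" "s \<le> a" "t \<le> b" for x y p n s t :: real
        using that by simp
      ultimately show ?thesis using par[OF m] big[of K] wa[of "k K"] wb[of "l K"] by blast
    qed
    then have "d U \<le> d U - \<eta>" by (rule d_low[OF zS])
    then show False using e by simp
  qed
  \<comment> \<open>The witness \<open>w\<close> is kept so that candidates for different sets can
    be compared through their sequences. The 8 is what \<open>avg\<close> yields for
    \<open>a = b = d U + \<eta>\<close> with \<open>\<eta> = 1 / real (Suc n)\<close>.\<close>
  define G where "G U n v \<longleftrightarrow> v \<in> ?D \<and> ?Q v \<le> d U + 1 / real (Suc n) \<and> local_dist M U v u \<le> 1 / real (Suc n) \<and>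
    (\<exists>w\<in>S U. (\<forall>k. ?Q (w k) \<le> d U + 1 / real (Suc n)) \<and> (\<forall>\<^sub>F l in sequentially. ?Q (v - w l) \<le> 8 / real (Suc n)))"
    for U n v
  have "\<exists>v. G U n v" if U: "U \<in> fin_sets M" for U n
  proof -
    obtain w where w: "w \<in> S U" "\<And>k. ?Q (w k) \<le> d U + 1 / real (Suc n)"
      using d_app[OF U, of "1 / real (Suc n)"] by auto
    obtain K where K: "\<And>k l. k \<ge> K \<Longrightarrow> l \<ge> K \<Longrightarrow> ?Q (w k - w l) \<le>
        2 * (d U + 1 / real (Suc n) + (d U + 1 / real (Suc n))) - 4 * d U + 4 * (1 / real (Suc n))"
      using avg[OF w(1) w(1) w(2) w(2), of "1 / real (Suc n)"] by auto
    have K8: "?Q (w k - w l) \<le> 8 / real (Suc n)" if "k \<ge> K" "l \<ge> K" for k l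
      using K[OF that] by simp
    have "(\<lambda>k. local_dist M U (w k) u) \<longlonglongrightarrow> 0"
      using w(1) by (intro local_dist_tendsto_AE um U form_domain_measurable[OF qf]) (auto simp: S_def)
    then have "\<forall>\<^sub>F k in sequentially. local_dist M U (w k) u < 1 / real (Suc n)"
      by (rule order_tendstoD) simp
    then have "\<forall>\<^sub>F k in sequentially. local_dist M U (w k) u < 1 / real (Suc n) \<and> K \<le> k"
      using eventually_ge_at_top by (rule eventually_conj)
    then obtain k where k: "local_dist M U (w k) u < 1 / real (Suc n)" "K \<le> k"
      using eventually_happens' sequentially_bot by blast
    have "\<forall>\<^sub>F l in sequentially. ?Q (w k - w l) \<le> 8 / real (Suc n)"
      using eventually_ge_at_top[of K] by eventually_elim (use K8 k in blast)
    then have "G U n (w k)" unfolding G_def using w k SD[OF w(1)] by auto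
    then show ?thesis by blast
  qed
  \<comment> \<open>The value 0 at indices without a finite-measure set is a default that keeps
    \<open>v p\<close> in the domain for every \<open>p\<close>.\<close>
  then obtain v where v: "\<And>U n. U \<in> fin_sets M \<Longrightarrow> G U n (v (U, n))" and v0: "\<And>U n. U \<notin> fin_sets M \<Longrightarrow> v (U, n) = 0"
  proof -
    assume *: "\<And>U n. U \<in> fin_sets M \<Longrightarrow> \<exists>v. G U n v"
      and **: "\<And>v. (\<And>U n. U \<in> fin_sets M \<Longrightarrow> G U n (v (U, n))) \<Longrightarrow> (\<And>U n. U \<notin> fin_sets M \<Longrightarrow> v (U, n) = 0) \<Longrightarrow> thesis"
    show thesis
      by (rule **[of "\<lambda>p. if fst p \<in> fin_sets M then SOME v. G (fst p) (snd p) v else 0"])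
        (use someI_ex[OF *] in auto)
  qed
  have vD: "v p \<in> ?D" for p
    using v[of "fst p" "snd p"] v0[of "fst p" "snd p"] by (cases "fst p \<in> fin_sets M") (auto simp: G_def)
  have vm: "v p \<in> borel_measurable M" for p by (rule form_domain_measurable[OF qf vD])
  have vt: "tconv M v u (fin_filter M)"
    by (rule tconv_fin_filter[OF vm um]) (use v in \<open>auto simp: G_def\<close>)
  define s where "s = Sup (d ` fin_sets M)"
  have bddS: "bdd_above (d ` fin_sets M)" using d_le_r by (auto intro!: bdd_aboveI)
  have d_le_s: "d U \<le> s" if "U \<in> fin_sets M" for U
    unfolding s_def by (rule cSUP_upper[OF that bddS])
  have cauchy: "\<exists>U0\<in>fin_sets M. \<exists>n0. \<forall>U n U' n'. U \<in> fin_sets M \<longrightarrow> U' \<in> fin_sets M \<longrightarrow> U0 \<subseteq> U \<longrightarrow> U0 \<subseteq> U' \<longrightarrow>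
      n0 \<le> n \<longrightarrow> n0 \<le> n' \<longrightarrow> ?Q (v (U, n) - v (U', n')) < e" if e: "0 < e" for e
  proof -
    \<comment> \<open>Splitting twice with factor 2 into pieces of size 8, 12 and 8 needs 2 (2 * 8 +
      2 * 12) + 2 * 8 = 96, so 112 is a safe factor. The 12 arises from energies at most
      \<open>s + ?\<epsilon>\<close> compared with \<open>d U0 > s - ?\<epsilon>\<close>.\<close>
    obtain n0 where n0: "112 * (1 / real (Suc n0)) < e"
      using reals_Archimedean[of "e / 112"] e by (auto simp: field_simps inverse_eq_divide)
    let ?\<epsilon> = "1 / real (Suc n0)"
    have ne: "fin_sets M \<noteq> {}" using fin_sets_empty[of M] by blast
    have "s - ?\<epsilon> < s" by simp
    then have "\<exists>U0\<in>fin_sets M. s - ?\<epsilon> < d U0"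
      using less_cSUP_iff[OF ne bddS, of "s - ?\<epsilon>"] unfolding s_def by blast
    then obtain U0 where U0: "U0 \<in> fin_sets M" "s - ?\<epsilon> < d U0" by blast
    show ?thesis
    proof (intro bexI[OF _ U0(1)] exI[of _ n0] allI impI)
      fix U n U' n'
      assume a: "U \<in> fin_sets M" "U' \<in> fin_sets M" "U0 \<subseteq> U" "U0 \<subseteq> U'" "n0 \<le> n" "n0 \<le> n'"
      have nn: "1 / real (Suc n) \<le> ?\<epsilon>" "1 / real (Suc n') \<le> ?\<epsilon>" using a by (auto intro!: divide_left_mono)
      obtain w where w: "w \<in> S U" "\<And>k. ?Q (w k) \<le> d U + 1 / real (Suc n)"
        "\<forall>\<^sub>F l in sequentially. ?Q (v (U, n) - w l) \<le> 8 / real (Suc n)"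
        using v[OF a(1), of n] unfolding G_def by auto
      obtain w' where w': "w' \<in> S U'" "\<And>k. ?Q (w' k) \<le> d U' + 1 / real (Suc n')"
        "\<forall>\<^sub>F l in sequentially. ?Q (v (U', n') - w' l) \<le> 8 / real (Suc n')"
        using v[OF a(2), of n'] unfolding G_def by auto
      have wb: "?Q (w k) \<le> s + ?\<epsilon>" "?Q (w' k) \<le> s + ?\<epsilon>" for k
        using w(2)[of k] w'(2)[of k] d_le_s[OF a(1)] d_le_s[OF a(2)] nn by linarith+
      \<comment> \<open>The two sequences belong to different sets, but both converge to
        \<open>u\<close> on \<open>U0\<close>, so \<open>avg\<close> can compare them there.\<close>
      have wS: "w \<in> S U0" "w' \<in> S U0" using Santi w(1) w'(1) a by blast+
      obtain K where K: "\<forall>k\<ge>K. \<forall>l\<ge>K. ?Q (w k - w' l) \<le> 2 * (s + ?\<epsilon> + (s + ?\<epsilon>)) - 4 * d U0 + 4 * ?\<epsilon>"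
        using avg[OF wS wb(1) wb(2), of ?\<epsilon>] by auto
      have "\<forall>\<^sub>F l in sequentially. ?Q (w l - w' l) \<le> 12 * ?\<epsilon>"
        using eventually_ge_at_top[of K]
      proof eventually_elim
        case (elim l)
        have "x \<le> 12 * z" if "x \<le> 2 * (s + z + (s + z)) - 4 * y + 4 * z" "s - z < y" for x y z :: real
          using that by simp
        then show ?case using K[rule_format, OF elim elim] U0(2) by blast
      qed
      with w(3) w'(3) have "\<forall>\<^sub>F l in sequentially. ?Q (v (U, n) - w l) \<le> 8 / real (Suc n) \<and>
        ?Q (v (U', n') - w' l) \<le> 8 / real (Suc n') \<and> ?Q (w l - w' l) \<le> 12 * ?\<epsilon>"
        by eventually_elim auto
      then obtain l where l: "?Q (v (U, n) - w l) \<le> 8 / real (Suc n)"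
        "?Q (v (U', n') - w' l) \<le> 8 / real (Suc n')" "?Q (w l - w' l) \<le> 12 * ?\<epsilon>"
        using eventually_happens' sequentially_bot by blast
      have m: "v (U, n) - w l \<in> ?D" "v (U', n') - w' l \<in> ?D" "w l - w' l \<in> ?D"
        using vD SD[OF w(1)] SD[OF w'(1)] by auto
      have eq: "v (U, n) - v (U', n') = ((v (U, n) - w l) + (w l - w' l)) - (v (U', n') - w' l)"
        by simp
      have "?Q (v (U, n) - v (U', n')) \<le> 2 * ?Q ((v (U, n) - w l) + (w l - w' l)) + 2 * ?Q (v (U', n') - w' l)"
        unfolding eq by (rule Q_diff_le) (use m in blast)+
      also have "\<dots> \<le> 2 * (2 * ?Q (v (U, n) - w l) + 2 * ?Q (w l - w' l)) + 2 * ?Q (v (U', n') - w' l)"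
        using Q_add_le[OF m(1) m(3)] by simp
      also have "\<dots> \<le> 112 * ?\<epsilon>"
      proof -
        have "2 * (2 * a + 2 * b) + 2 * c \<le> 112 * z" if "a \<le> 8 * x" "c \<le> 8 * y" "b \<le> 12 * z"
          "x \<le> z" "y \<le> z" "0 \<le> z" for a b c x y z :: real
          using that by simp
        from this[of _ "1 / real (Suc n)" _ "1 / real (Suc n')", OF _ _ l(3) nn] l(1,2) show ?thesis by simp
      qed
      finally show "?Q (v (U, n) - v (U', n')) < e" using n0 by simp
    qed
  qed
  define F where "F = filtermap v (fin_filter M)"
  have F: "F \<noteq> bot" by (simp add: F_def filtermap_bot_iff)
  have "Cauchy_filter_in (form_topology M q) F"
    unfolding Cauchy_filter_in_def
  proof (intro conjI F allI impI)
    show "F \<le> principal (topspace (form_topology M q))"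
      unfolding topspace_form_topology[OF qf] le_principal F_def eventually_filtermap using vD by simp
    fix V assume "openin (form_topology M q) V \<and> (\<lambda>x. 0) \<in> V"
    then obtain U1 e where U1: "U1 \<in> fin_sets M" and e: "0 < e"
      and *: "\<And>v. v \<in> ?D \<Longrightarrow> local_dist M U1 0 v < e \<Longrightarrow> ?Q (0 - v) < e \<Longrightarrow> v \<in> V"
      unfolding openin_form_topology[OF qf] zero_fun_def[symmetric] by blast
    obtain U0 n0 where U0: "U0 \<in> fin_sets M" and n0: "\<And>U n U' n'. U \<in> fin_sets M \<Longrightarrow> U' \<in> fin_sets M \<Longrightarrow>
        U0 \<subseteq> U \<Longrightarrow> U0 \<subseteq> U' \<Longrightarrow> n0 \<le> n \<Longrightarrow> n0 \<le> n' \<Longrightarrow> ?Q (v (U, n) - v (U', n')) < e"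
      using cauchy[OF e] by blast
    have "\<forall>\<^sub>F p in fin_filter M. local_dist M U1 (v p) u < e / 2"
      by (rule tconv_eventually_less[OF vt U1]) (use e in simp)
    moreover have "\<forall>\<^sub>F p in fin_filter M. fst p \<in> fin_sets M \<and> U0 \<subseteq> fst p \<and> n0 \<le> snd p"
      unfolding eventually_fin_filter using U0 by auto
    ultimately have ev: "\<forall>\<^sub>F p in fin_filter M. local_dist M U1 (v p) u < e / 2 \<and>
        fst p \<in> fin_sets M \<and> U0 \<subseteq> fst p \<and> n0 \<le> snd p" by (rule eventually_conj)
    define R where "R f \<longleftrightarrow> (\<exists>p. f = v p \<and> local_dist M U1 (v p) u < e / 2 \<and>
        fst p \<in> fin_sets M \<and> U0 \<subseteq> fst p \<and> n0 \<le> snd p)" for f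
    have evR: "eventually R F"
      unfolding F_def eventually_filtermap
      by (rule eventually_mono[OF ev]) (unfold R_def, blast)
    have RV: "f - g \<in> V" if "R f" "R g" for f g
    proof -
      from \<open>R f\<close> obtain p where f: "f = v p" and p: "local_dist M U1 (v p) u < e / 2"
        "fst p \<in> fin_sets M" "U0 \<subseteq> fst p" "n0 \<le> snd p" unfolding R_def by blast
      from \<open>R g\<close> obtain p' where g: "g = v p'" and p': "local_dist M U1 (v p') u < e / 2"
        "fst p' \<in> fin_sets M" "U0 \<subseteq> fst p'" "n0 \<le> snd p'" unfolding R_def by blast
      show ?thesis
        unfolding f g
      proof (rule *)
        show "v p - v p' \<in> ?D" by (rule mem(2)[OF vD vD])
        have "local_dist M U1 (v p) (v p') \<le> local_dist M U1 (v p) u + local_dist M U1 u (v p')"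
          using vm um U1 by (intro local_dist_triangle) (auto simp: fin_sets_def)
        then show "local_dist M U1 0 (v p - v p') < e"
          using p(1) p'(1) by (simp add: local_dist_zero_diff local_dist_commute[of M U1 u])
        have "?Q (v (fst p', snd p') - v (fst p, snd p)) < e" using p p' by (intro n0) auto
        then show "?Q (0 - (v p - v p')) < e" by simp
      qed
    qed
    show "\<forall>\<^sub>F (f, g) in F \<times>\<^sub>F F. (\<lambda>x. f x - g x) \<in> V"
    proof (rule iffD2[OF eventually_prod_same], intro exI[of _ R] conjI allI impI)
      show "eventually R F" by (rule evR)
      fix f g assume "R f" "R g"
      from RV[OF this] show "case (f, g) of (f, g) \<Rightarrow> (\<lambda>x. f x - g x) \<in> V"
        unfolding fun_diff_def prod.case .
    qed
  qed
  then obtain f where lim: "limitin (form_topology M q) (\<lambda>v. v) f F"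
    using cl unfolding closed_form_def complete_function_topology_def by blast
  have fD: "f \<in> ?D" using lim unfolding limitin_def topspace_form_topology[OF qf] by blast
  have ball: "\<forall>\<^sub>F p in fin_filter M. local_dist M U f (v p) < e \<and> ?Q (f - v p) < e"
    if U: "U \<in> fin_sets M" and e: "0 < e" for U e
  proof -
    have "openin (form_topology M q) {v \<in> ?D. local_dist M U f v < e \<and> ?Q (f - v) < e}"
      by (rule openin_form_ball[OF qf fD U])
    moreover have "f \<in> {v \<in> ?D. local_dist M U f v < e \<and> ?Q (f - v) < e}"
      using fD e by (simp add: local_dist_def)
    ultimately have "\<forall>\<^sub>F v in F. v \<in> {v \<in> ?D. local_dist M U f v < e \<and> ?Q (f - v) < e}"
      using lim unfolding limitin_def by blast
    then show ?thesis unfolding F_def eventually_filtermap by eventually_elim blast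
  qed
  have "tconv M v f (fin_filter M)"
    unfolding tconv_def
  proof (intro ballI tendstoI)
    fix U and e :: real assume "U \<in> fin_sets M" "0 < e"
    from ball[OF this] show "\<forall>\<^sub>F p in fin_filter M. dist (local_dist M U (v p) f) 0 < e"
      by eventually_elim (metis dist_zero_less local_dist_commute local_dist_nonneg)
  qed
  then have "AE x in M. f x = u x"
    by (rule tconv_unique[OF L _ vt]) (use vm um form_domain_measurable[OF qf fD] in auto)
  then have qfu: "q f = q u"
    using um form_domain_measurable[OF qf fD] by (intro quadratic_form_cong_AE[OF qf]) auto
  have "((\<lambda>p. ?Q (v p - f)) \<longlongrightarrow> 0) (fin_filter M)"
  proof (rule tendstoI)
    fix e :: real assume "0 < e"
    from ball[OF fin_sets_empty this] show "\<forall>\<^sub>F p in fin_filter M. dist (?Q (v p - f)) 0 < e"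
    proof eventually_elim
      case (elim p)
      show ?case
        using elim Q_minus_commute[OF fD vD[of p]] by (intro dist_zero_less nonneg mem(2) vD fD) simp
    qed
  qed
  then have "((\<lambda>p. ?Q (v p)) \<longlongrightarrow> ?Q f) (fin_filter M)" by (rule tendsto_Q[OF vD fD])
  moreover have "((\<lambda>p. r + 1 / real (Suc (snd p))) \<longlongrightarrow> r + 0) (fin_filter M)"
    by (intro tendsto_intros tendsto_fin_filter_snd)
  moreover have "\<forall>\<^sub>F p in fin_filter M. ?Q (v p) \<le> r + 1 / real (Suc (snd p))"
    unfolding eventually_fin_filter
  proof (intro bexI[OF _ fin_sets_empty] exI[of _ 0] ballI allI impI)
    fix V k assume "V \<in> fin_sets M"
    then show "?Q (v (V, k)) \<le> r + 1 / real (Suc (snd (V, k)))"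
      using v[of V k] d_le_r[of V] unfolding G_def by simp
  qed
  ultimately have "?Q f \<le> r + 0" by (intro tendsto_le[OF fin_filter_not_bot])
  moreover have "c < ereal (?Q f)" using c form_domain_eq[OF qf fD] qfu by argo
  ultimately show False using r by simp
qed

section \<open>The lower semicontinuous envelope and form closures\<close>

text \<open>The largest lower semicontinuous minorant, written with basic neighbourhoods; the value
  \<infinity> off the measurable functions is the normalisation demanded of quadratic forms.\<close>

definition lsc_envelope :: "'a measure \<Rightarrow> (('a \<Rightarrow> real) \<Rightarrow> ereal) \<Rightarrow> ('a \<Rightarrow> real) \<Rightarrow> ereal" where
  "lsc_envelope M q u = (if u \<in> borel_measurable M then
     (SUP p\<in>fin_sets M \<times> {0<..}. INF v\<in>{v \<in> borel_measurable M. local_dist M (fst p) u v < snd p}. q v)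
     else \<infinity>)"

lemma lsc_envelope_le:
  assumes "u \<in> borel_measurable M"
  shows "lsc_envelope M q u \<le> q u"
  unfolding lsc_envelope_def using assms by (auto intro!: SUP_least INF_lower)

lemma less_lsc_envelope_iff:
  assumes "u \<in> borel_measurable M"
  shows "c < lsc_envelope M q u \<longleftrightarrow> (\<exists>U\<in>fin_sets M. \<exists>e>0.
    c < (INF v\<in>{v \<in> borel_measurable M. local_dist M U u v < e}. q v))"
  unfolding lsc_envelope_def using assms by (auto simp: less_SUP_iff)

lemma lsc_envelope_greatest:
  assumes "lower_semicont M p" "\<And>v. v \<in> borel_measurable M \<Longrightarrow> p v \<le> q v" "u \<in> borel_measurable M"
  shows "p u \<le> lsc_envelope M q u"
proof (rule dense_le)
  fix c assume "c < p u"
  then obtain U e where U: "U \<in> fin_sets M" "e > 0"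
    and *: "\<And>v. v \<in> borel_measurable M \<Longrightarrow> local_dist M U u v < e \<Longrightarrow> c < p v"
    using assms(1,3) unfolding lower_semicont_def by blast
  have "c \<le> (INF v\<in>{v \<in> borel_measurable M. local_dist M U u v < e}. q v)"
  proof (rule INF_greatest)
    fix v assume v: "v \<in> {v \<in> borel_measurable M. local_dist M U u v < e}"
    have "c < p v" using * v by blast
    also have "p v \<le> q v" using assms(2) v by blast
    finally show "c \<le> q v" by simp
  qed
  also have "\<dots> \<le> lsc_envelope M q u"
    unfolding lsc_envelope_def using assms(3) U
    by (auto intro!: SUP_upper2[where i = "(U, e)"])
  finally show "c \<le> lsc_envelope M q u" .
qed

lemma lower_semicont_lsc_envelope: "lower_semicont M (lsc_envelope M q)"
  unfolding lower_semicont_def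
proof (intro ballI allI impI)
  fix u c assume u: "u \<in> borel_measurable M" and c: "c < lsc_envelope M q u"
  then obtain U e where U: "U \<in> fin_sets M" "e > 0"
    and *: "c < (INF v\<in>{v \<in> borel_measurable M. local_dist M U u v < e}. q v)"
    unfolding less_lsc_envelope_iff[OF u] by blast
  show "\<exists>U\<in>fin_sets M. \<exists>e>0. \<forall>v\<in>borel_measurable M. local_dist M U u v < e \<longrightarrow> c < lsc_envelope M q v"
  proof (intro bexI[OF _ U(1)] exI[of _ "e/2"] conjI ballI impI)
    show "0 < e / 2" using U by simp
    fix v assume v: "v \<in> borel_measurable M" "local_dist M U u v < e / 2"
    have "{w \<in> borel_measurable M. local_dist M U v w < e / 2} \<subseteq> {w \<in> borel_measurable M. local_dist M U u w < e}"
    proof safe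
      fix w assume w: "w \<in> borel_measurable M" "local_dist M U v w < e / 2"
      have "local_dist M U u w \<le> local_dist M U u v + local_dist M U v w"
        using u v w U by (intro local_dist_triangle) (auto simp: fin_sets_def)
      then show "local_dist M U u w < e" using v(2) w(2) by linarith
    qed
    then have "(INF v\<in>{v \<in> borel_measurable M. local_dist M U u v < e}. q v) \<le>
      (INF w\<in>{w \<in> borel_measurable M. local_dist M U v w < e / 2}. q w)"
      by (rule INF_superset_mono) simp
    with * have "c < (INF w\<in>{w \<in> borel_measurable M. local_dist M U v w < e / 2}. q w)" by (rule less_le_trans)
    then show "c < lsc_envelope M q v"
      unfolding less_lsc_envelope_iff[OF v(1)] using U by (intro bexI[OF _ U(1)] exI[of _ "e/2"]) auto
  qed
qed

text \<open>A recovery net: one near-minimiser in each basic neighbourhood. The energies not only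
  stay asymptotically below \<open>r\<close> but converge to it, because the envelope is itself
  semicontinuous and lies below \<open>q\<close>.\<close>

lemma lsc_envelope_approx:
  assumes u: "u \<in> borel_measurable M" and r: "lsc_envelope M q u = ereal r"
  obtains v where "\<And>p. v p \<in> borel_measurable M" "\<And>p. q (v p) < \<infinity>" "tconv M v u (fin_filter M)"
    "((\<lambda>p. q (v p)) \<longlongrightarrow> ereal r) (fin_filter M)" "\<And>p. q (v p) \<le> ereal (r + 1 / real (Suc (snd p)))"
proof -
  have ex: "\<exists>v. v \<in> borel_measurable M \<and> local_dist M U u v < 1 / real (Suc n) \<and> q v < ereal (r + 1 / real (Suc n))"
    if U: "U \<in> fin_sets M" for U n
  proof -
    have "(INF v\<in>{v \<in> borel_measurable M. local_dist M U u v < 1 / real (Suc n)}. q v) \<le> lsc_envelope M q u"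
      unfolding lsc_envelope_def using u U
      by (auto intro!: SUP_upper2[where i = "(U, 1 / real (Suc n))"])
    also have "\<dots> < ereal (r + 1 / real (Suc n))" unfolding r by simp
    finally show ?thesis by (auto simp: INF_less_iff)
  qed
  have "\<exists>v. v \<in> borel_measurable M \<and> (fst p \<in> fin_sets M \<longrightarrow> local_dist M (fst p) u v < 1 / real (Suc (snd p))) \<and>
      q v < ereal (r + 1 / real (Suc (snd p)))" for p :: "'a set \<times> nat"
    using ex[of "fst p" "snd p"] ex[OF fin_sets_empty, of "snd p"] by (cases "fst p \<in> fin_sets M") auto
  then obtain v where v: "\<And>p :: 'a set \<times> nat. v p \<in> borel_measurable M"
    "\<And>p. fst p \<in> fin_sets M \<Longrightarrow> local_dist M (fst p) u (v p) < 1 / real (Suc (snd p))"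
    "\<And>p. q (v p) < ereal (r + 1 / real (Suc (snd p)))"
    by metis
  have t: "tconv M v u (fin_filter M)"
  proof (rule tconv_fin_filter[OF v(1) u])
    fix U n assume "U \<in> fin_sets M"
    then show "local_dist M U (v (U, n)) u \<le> 1 / real (Suc n)"
      using v(2)[of "(U, n)"] by (simp add: local_dist_commute[of M U u])
  qed
  have l: "((\<lambda>p. q (v p)) \<longlongrightarrow> ereal r) (fin_filter M)"
  proof (rule order_tendstoI)
    fix a assume "a < ereal r"
    then have "a < lsc_envelope M q u" by (simp add: r)
    then have "\<forall>\<^sub>F p in fin_filter M. a < lsc_envelope M q (v p)"
      using v(1) by (intro lower_semicontD[OF lower_semicont_lsc_envelope _ u t]) auto
    then show "\<forall>\<^sub>F p in fin_filter M. a < q (v p)"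
      by eventually_elim (use lsc_envelope_le[OF v(1)] less_le_trans in blast)
  next
    fix a assume a: "ereal r < a"
    have "((\<lambda>p. r + 1 / real (Suc (snd p))) \<longlongrightarrow> r + 0) (fin_filter M)"
      by (intro tendsto_intros tendsto_fin_filter_snd)
    then have "((\<lambda>p. ereal (r + 1 / real (Suc (snd p)))) \<longlongrightarrow> ereal r) (fin_filter M)"
      by simp
    then have "\<forall>\<^sub>F p in fin_filter M. ereal (r + 1 / real (Suc (snd p))) < a"
      using a by (rule order_tendstoD)
    then show "\<forall>\<^sub>F p in fin_filter M. q (v p) < a"
      by eventually_elim (use v(3) less_trans in blast)
  qed
  have "q (v p) < \<infinity>" for p using v(3)[of p] by (cases "q (v p)") auto
  then show ?thesis using that[OF v(1) _ t l] v(3) less_imp_le by blast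
qed

text \<open>The parallelogram inequality for \<open>u + v\<close> and \<open>u - v\<close>, combined
  with homogeneity, is the reverse inequality for \<open>u\<close> and \<open>v\<close>. Infima and
  limits of near-minimisers yield just one direction.\<close>

lemma quadratic_formI:
  fixes q :: "('a \<Rightarrow> real) \<Rightarrow> ereal"
  assumes nonneg: "\<And>u. 0 \<le> q u" and off: "\<And>u. u \<notin> borel_measurable M \<Longrightarrow> q u = \<infinity>"
    and cong: "\<And>u v. u \<in> borel_measurable M \<Longrightarrow> v \<in> borel_measurable M \<Longrightarrow> AE x in M. u x = v x \<Longrightarrow> q u = q v"
    and scale: "\<And>c u. u \<in> borel_measurable M \<Longrightarrow> q (c *\<^sub>R u) = ereal (c\<^sup>2) * q u"
    and par_le: "\<And>u v. u \<in> borel_measurable M \<Longrightarrow> v \<in> borel_measurable M \<Longrightarrow>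
      q (u + v) + q (u - v) \<le> 2 * q u + 2 * q v"
  shows "quadratic_form M q"
  unfolding quadratic_form_def
proof (intro conjI allI ballI impI)
  fix u v :: "'a \<Rightarrow> real" assume uv: "u \<in> borel_measurable M" "v \<in> borel_measurable M"
  have m: "u + v \<in> borel_measurable M" "u - v \<in> borel_measurable M"
    using uv by (simp_all add: plus_fun_def fun_diff_def)
  have "q ((u + v) + (u - v)) + q ((u + v) - (u - v)) \<le> 2 * q (u + v) + 2 * q (u - v)"
    by (rule par_le[OF m])
  moreover have "(u + v) + (u - v) = 2 *\<^sub>R u" "(u + v) - (u - v) = 2 *\<^sub>R v"
    by (auto simp: fun_eq_iff)
  ultimately have "4 * q u + 4 * q v \<le> 2 * q (u + v) + 2 * q (u - v)"
    using scale[OF uv(1), of 2] scale[OF uv(2), of 2] by simp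
  moreover have "q (u + v) + q (u - v) \<le> 2 * q u + 2 * q v" by (rule par_le[OF uv])
  moreover have "2 * b + 2 * c = s + d"
    if "4 * b + 4 * c \<le> 2 * s + 2 * d" "s + d \<le> 2 * b + 2 * c" "0 \<le> b" "0 \<le> c" "0 \<le> s" "0 \<le> d"
    for b c s d :: ereal
    using that by (cases b; cases c; cases s; cases d) auto
  ultimately have "2 * q u + 2 * q v = q (u + v) + q (u - v)"
    using nonneg by blast
  then show "2 * q u + 2 * q v = q (\<lambda>x. u x + v x) + q (\<lambda>x. u x - v x)"
    by (simp only: plus_fun_def fun_diff_def)
next
  fix c and u :: "'a \<Rightarrow> real" assume "u \<in> borel_measurable M"
  from scale[OF this, of c] show "q (\<lambda>x. c * u x) = ereal (\<bar>c\<bar>\<^sup>2) * q u"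
    by (simp only: scaleR_fun_def real_scaleR_def power2_abs)
qed (use assms in blast)+

lemma lsc_envelope_nonneg: "(\<And>v. 0 \<le> q v) \<Longrightarrow> 0 \<le> lsc_envelope M q u"
  unfolding lsc_envelope_def
  by (auto intro!: SUP_upper2[where i = "({}, 1)"] INF_greatest)

text \<open>Sums and differences of recovery nets for \<open>u\<close> and \<open>w\<close> are
  admissible nets for \<open>u + w\<close> and \<open>u - w\<close>; homogeneity needs one
  inequality only, as \<open>c\<close> can be replaced by \<open>1/c\<close>.\<close>

theorem quadratic_form_lsc_envelope:
  assumes qf: "quadratic_form M q"
  shows "quadratic_form M (lsc_envelope M q)"
proof (rule quadratic_formI)
  let ?r = "lsc_envelope M q"
  show nn: "0 \<le> ?r u" for u by (rule lsc_envelope_nonneg[OF quadratic_form_nonneg[OF qf]])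
  show "?r u = \<infinity>" if "u \<notin> borel_measurable M" for u using that by (simp add: lsc_envelope_def)
  have real_or_inf: "?r u = \<infinity> \<or> (\<exists>a. ?r u = ereal a)" for u
    using nn[of u] by (cases "?r u") auto
  show "?r u = ?r v" if u: "u \<in> borel_measurable M" and v: "v \<in> borel_measurable M" and ae: "AE x in M. u x = v x"
    for u v
  proof -
    have "local_dist M U u w = local_dist M U v w" if "U \<in> fin_sets M" "w \<in> borel_measurable M" for U w
      by (rule local_dist_cong_AE[OF u that(2) v that(2) that(1) ae]) simp
    then have "{w \<in> borel_measurable M. local_dist M U u w < e} = {w \<in> borel_measurable M. local_dist M U v w < e}"
      if "U \<in> fin_sets M" for U e using that by auto
    then show ?thesis unfolding lsc_envelope_def using u v by (auto intro!: SUP_cong)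
  qed
  have scale_le: "?r (c *\<^sub>R u) \<le> ereal (c\<^sup>2) * ?r u" if u: "u \<in> borel_measurable M" and c: "c \<noteq> 0" for c u
  proof (cases "?r u = \<infinity>")
    case False
    then obtain a where a: "?r u = ereal a" using real_or_inf by blast
    obtain v where v: "\<And>p. v p \<in> borel_measurable M" "tconv M v u (fin_filter M)"
      "\<And>p. q (v p) \<le> ereal (a + 1 / real (Suc (snd p)))"
      using lsc_envelope_approx[OF u a] by metis
    have cv: "c *\<^sub>R v p \<in> borel_measurable M" for p using v(1) by (simp add: scaleR_fun_def)
    have "?r (c *\<^sub>R u) \<le> ereal (c\<^sup>2 * a)"
    proof (rule lower_semicont_le[OF lower_semicont_lsc_envelope _ _ tconv_scale[OF v(2,1) u] fin_filter_not_bot])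
      show "\<forall>\<^sub>F p in fin_filter M. ?r (c *\<^sub>R v p) \<le> ereal (c\<^sup>2 * (a + 1 / real (Suc (snd p))))"
      proof (intro always_eventually allI)
        fix p
        have "?r (c *\<^sub>R v p) \<le> q (c *\<^sub>R v p)" by (rule lsc_envelope_le[OF cv])
        also have "\<dots> = ereal (c\<^sup>2) * q (v p)" by (rule quadratic_form_scale[OF qf v(1)])
        also have "\<dots> \<le> ereal (c\<^sup>2) * ereal (a + 1 / real (Suc (snd p)))"
          by (intro ereal_mult_left_mono v(3)) simp
        finally show "?r (c *\<^sub>R v p) \<le> ereal (c\<^sup>2 * (a + 1 / real (Suc (snd p))))" by simp
      qed
      have "((\<lambda>p. c\<^sup>2 * (a + 1 / real (Suc (snd p)))) \<longlongrightarrow> c\<^sup>2 * (a + 0)) (fin_filter M)"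
        by (intro tendsto_intros tendsto_fin_filter_snd)
      then show "((\<lambda>p. ereal (c\<^sup>2 * (a + 1 / real (Suc (snd p))))) \<longlongrightarrow> ereal (c\<^sup>2 * a)) (fin_filter M)"
        by simp
      show "c *\<^sub>R u \<in> borel_measurable M" using u by (simp add: scaleR_fun_def)
    qed (use cv in auto)
    then show ?thesis by (simp add: a)
  qed (use c in simp)
  have zero: "?r 0 = 0"
  proof -
    have "?r 0 \<le> q 0" by (rule lsc_envelope_le) (simp add: zero_fun_def)
    also have "q 0 = 0"
      using subspace_0[OF subspace_form_domain[OF qf]] form_domain_eq[OF qf, of 0]
        quad_space.Q_zero[OF quad_space_form[OF qf]] by (simp add: zero_ereal_def)
    finally show ?thesis using nn[of 0] by simp
  qed
  show "?r (c *\<^sub>R u) = ereal (c\<^sup>2) * ?r u" if u: "u \<in> borel_measurable M" for c u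
  proof (cases "c = 0")
    case True
    then show ?thesis using zero by (simp add: zero_ereal_def[symmetric])
  next
    case False
    have cu: "c *\<^sub>R u \<in> borel_measurable M" using u by (simp add: scaleR_fun_def)
    have "?r ((1/c) *\<^sub>R (c *\<^sub>R u)) \<le> ereal ((1/c)\<^sup>2) * ?r (c *\<^sub>R u)"
      by (rule scale_le[OF cu]) (use False in simp)
    then have "ereal (c\<^sup>2) * ?r u \<le> ereal (c\<^sup>2) * (ereal ((1/c)\<^sup>2) * ?r (c *\<^sub>R u))"
      using False by (intro ereal_mult_left_mono) auto
    also have "\<dots> = ?r (c *\<^sub>R u)"
      unfolding mult.assoc[symmetric] times_ereal.simps power_mult_distrib[symmetric] using False by simp
    finally show ?thesis using scale_le[OF u False] by (rule antisym[rotated])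
  qed
  show "?r (u + w) + ?r (u - w) \<le> 2 * ?r u + 2 * ?r w"
    if u: "u \<in> borel_measurable M" and w: "w \<in> borel_measurable M" for u w
  proof (cases "?r u = \<infinity> \<or> ?r w = \<infinity>")
    case True
    then have "2 * ?r u + 2 * ?r w = \<infinity>" using nn[of u] nn[of w] by auto
    then show ?thesis by (simp only: ereal_less_eq(1))
  next
    case False
    then obtain a b where a: "?r u = ereal a" and b: "?r w = ereal b" using real_or_inf by metis
    obtain v where v: "\<And>p. v p \<in> borel_measurable M" "tconv M v u (fin_filter M)"
      "\<And>p. q (v p) \<le> ereal (a + 1 / real (Suc (snd p)))"
      using lsc_envelope_approx[OF u a] by metis
    obtain z where z: "\<And>p. z p \<in> borel_measurable M" "tconv M z w (fin_filter M)"
      "\<And>p. q (z p) \<le> ereal (b + 1 / real (Suc (snd p)))"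
      using lsc_envelope_approx[OF w b] by metis
    let ?f = "\<lambda>p. 2 * (a + 1 / real (Suc (snd p))) + 2 * (b + 1 / real (Suc (snd p)))"
    have m: "v p + z p \<in> borel_measurable M" "v p - z p \<in> borel_measurable M" for p
      using v(1) z(1) by (simp_all add: plus_fun_def fun_diff_def)
    have m': "u + w \<in> borel_measurable M" "u - w \<in> borel_measurable M"
      using u w by (simp_all add: plus_fun_def fun_diff_def)
    have sum_le: "?r (v p + z p) + ?r (v p - z p) \<le> ereal (?f p)" for p
    proof -
      have "?r (v p + z p) + ?r (v p - z p) \<le> q (v p + z p) + q (v p - z p)"
        by (intro add_mono lsc_envelope_le m)
      also have "\<dots> = 2 * q (v p) + 2 * q (z p)" by (rule quadratic_form_parallelogram[OF qf v(1) z(1)])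
      also have "\<dots> \<le> 2 * ereal (a + 1 / real (Suc (snd p))) + 2 * ereal (b + 1 / real (Suc (snd p)))"
        by (intro add_mono ereal_mult_left_mono v(3) z(3)) auto
      finally show ?thesis by simp
    qed
    have "(?f \<longlongrightarrow> 2 * (a + 0) + 2 * (b + 0)) (fin_filter M)"
      by (intro tendsto_intros tendsto_fin_filter_snd)
    then have flim: "((\<lambda>p. ereal (?f p)) \<longlongrightarrow> ereal (2 * a + 2 * b)) (fin_filter M)" by simp
    have cadd: "tconv M (\<lambda>p. v p + z p) (u + w) (fin_filter M)"
      by (rule tconv_add[OF v(2) z(2) v(1) u z(1) w])
    have cdiff: "tconv M (\<lambda>p. v p - z p) (u - w) (fin_filter M)"
      by (rule tconv_diff[OF v(2) z(2) v(1) u z(1) w])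
    \<comment> \<open>Each term is bounded on its own to know that both are real, before the sum is
      estimated with an error split into halves.\<close>
    have "?r (u + w) \<le> ereal (2 * a + 2 * b)"
    proof (rule lower_semicont_le[OF lower_semicont_lsc_envelope _ m'(1) cadd fin_filter_not_bot _ flim])
      show "\<forall>\<^sub>F p in fin_filter M. ?r (v p + z p) \<le> ereal (?f p)"
        using sum_le nn by (intro always_eventually allI) (meson add_increasing2 order_trans order_refl)
    qed (use m in auto)
    moreover have "?r (u - w) \<le> ereal (2 * a + 2 * b)"
    proof (rule lower_semicont_le[OF lower_semicont_lsc_envelope _ m'(2) cdiff fin_filter_not_bot _ flim])
      show "\<forall>\<^sub>F p in fin_filter M. ?r (v p - z p) \<le> ereal (?f p)"
        using sum_le nn by (intro always_eventually allI) (meson add_increasing order_trans order_refl)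
    qed (use m in auto)
    ultimately obtain s d where s: "?r (u + w) = ereal s" and d: "?r (u - w) = ereal d"
      using nn[of "u + w"] nn[of "u - w"] by (cases "?r (u + w)"; cases "?r (u - w)") auto
    have "s + d \<le> 2 * a + 2 * b"
    proof (rule field_le_epsilon)
      fix e :: real assume e: "0 < e"
      have "\<forall>\<^sub>F p in fin_filter M. ereal (s - e/2) < ?r (v p + z p)"
        by (rule lower_semicontD[OF lower_semicont_lsc_envelope _ m'(1) cadd]) (use m e s in auto)
      moreover have "\<forall>\<^sub>F p in fin_filter M. ereal (d - e/2) < ?r (v p - z p)"
        by (rule lower_semicontD[OF lower_semicont_lsc_envelope _ m'(2) cdiff]) (use m e d in auto)
      ultimately have "\<forall>\<^sub>F p in fin_filter M. ereal (s + d - e) \<le> ereal (?f p)"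
      proof eventually_elim
        case (elim p)
        have "ereal (s - e/2) + ereal (d - e/2) \<le> ?r (v p + z p) + ?r (v p - z p)"
          using elim by (intro add_mono) auto
        also note sum_le[of p]
        finally show ?case by simp
      qed
      then have "ereal (s + d - e) \<le> ereal (2 * a + 2 * b)"
        by (rule tendsto_lowerbound[OF flim _ fin_filter_not_bot])
      then show "s + d \<le> 2 * a + 2 * b + e" by simp
    qed
    then show ?thesis unfolding a b s d by simp
  qed
qed

text \<open>
  Minimality: if \<open>p\<close> is a closed extension of \<open>q\<close>, then \<open>p \<le> lsc_envelope M q\<close>, so that a recovery
  sequence, which converges with respect to the envelope, also converges with respect to \<open>p\<close>.
\<close>

theorem is_form_closure_lsc_envelope:
  assumes L: "localizable M" and qf: "quadratic_form M q"
    and le: "\<And>u. u \<in> form_domain q \<Longrightarrow> q u \<le> lsc_envelope M q u"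
  shows "is_form_closure M q (lsc_envelope M q)"
proof -
  let ?r = "lsc_envelope M q"
  have rq: "quadratic_form M ?r" by (rule quadratic_form_lsc_envelope[OF qf])
  have rl: "lower_semicont M ?r" by (rule lower_semicont_lsc_envelope)
  have ext: "?r u = q u" if "u \<in> form_domain q" for u
    using le[OF that] lsc_envelope_le[OF form_domain_measurable[OF qf that]] by (rule antisym[rotated])
  show ?thesis
    unfolding is_form_closure_def
  proof (intro conjI allI impI)
    show "closed_form M ?r" by (rule lower_semicont_imp_closed_form[OF L rq rl])
    show "form_extends ?r q" unfolding form_extends_def using ext by blast
    fix p assume p: "closed_form M p \<and> form_extends p q"
    then have pq: "quadratic_form M p" by (simp add: closed_form_def)
    have pl: "lower_semicont M p" by (rule closed_form_imp_lower_semicont[OF L]) (use p in blast)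
    have pext: "p u = q u" if "u \<in> form_domain q" for u using p that unfolding form_extends_def by blast
    have ple: "p u \<le> q u" for u
      using pext[of u] by (cases "u \<in> form_domain q") (auto simp: form_domain_def)
    have pr: "p u \<le> ?r u" if "u \<in> borel_measurable M" for u
      by (rule lsc_envelope_greatest[OF pl ple that])
    show "form_extends p ?r"
      unfolding form_extends_def
    proof
      fix u assume u: "u \<in> form_domain ?r"
      have um: "u \<in> borel_measurable M" by (rule form_domain_measurable[OF rq u])
      have pu: "u \<in> form_domain p" using pr[OF um] u by (auto simp: form_domain_def)
      obtain v where vm: "\<And>i. v i \<in> borel_measurable M" and vD: "\<And>i. q (v i) < \<infinity>"
        and vt: "tconv M v u (fin_filter M)"
        and vl: "((\<lambda>i. q (v i)) \<longlongrightarrow> ereal (real_form ?r u)) (fin_filter M)"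
        by (rule lsc_envelope_approx[OF um form_domain_eq[OF rq u]], rule that)
      have vq: "v i \<in> form_domain q" for i using vD by (simp add: form_domain_def)
      have vr: "v i \<in> form_domain ?r" "v i \<in> form_domain p" for i
        using vD ext[OF vq] pext[OF vq] by (simp_all add: form_domain_def)
      have vl': "((\<lambda>i. real_form q (v i)) \<longlongrightarrow> real_form ?r u) (fin_filter M)"
        using vl by (rule lim_real_of_ereal)
      interpret r: quad_space "form_domain ?r" "real_form ?r" by (rule quad_space_form[OF rq])
      interpret p: quad_space "form_domain p" "real_form p" by (rule quad_space_form[OF pq])
      have rconv: "((\<lambda>i. real_form ?r (v i - u)) \<longlongrightarrow> 0) (fin_filter M)"
        by (rule lower_semicont_strong_convergence[OF rq rl vr(1) u vt _ vl']) (use ext[OF vq] in simp)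
      have le: "norm (real_form p (v i - u)) \<le> real_form ?r (v i - u)" for i
      proof -
        have "p (v i - u) \<le> ?r (v i - u)"
          using pr vm um by (simp add: fun_diff_def)
        moreover have "p (v i - u) = ereal (real_form p (v i - u))"
          by (rule form_domain_eq[OF pq p.mem(2)[OF vr(2) pu]])
        moreover have "?r (v i - u) = ereal (real_form ?r (v i - u))"
          by (rule form_domain_eq[OF rq r.mem(2)[OF vr(1) u]])
        ultimately have "real_form p (v i - u) \<le> real_form ?r (v i - u)"
          by (metis ereal_less_eq(3))
        then show ?thesis using p.nonneg[OF p.mem(2)[OF vr(2) pu]] by (simp only: real_norm_def abs_of_nonneg)
      qed
      have "((\<lambda>i. real_form p (v i - u)) \<longlongrightarrow> 0) (fin_filter M)"
        by (rule Lim_null_comparison[OF always_eventually[OF allI[OF le]] rconv])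
      then have "((\<lambda>i. real_form p (v i)) \<longlongrightarrow> real_form p u) (fin_filter M)"
        by (rule p.tendsto_Q[OF vr(2) pu])
      then have "((\<lambda>i. real_form q (v i)) \<longlongrightarrow> real_form p u) (fin_filter M)"
        by (simp only: pext[OF vq])
      then have "real_form p u = real_form ?r u"
        using vl' by (rule tendsto_unique[OF fin_filter_not_bot])
      then show "p u = ?r u"
        using form_domain_eq[OF pq pu] form_domain_eq[OF rq u] by metis
    qed
  qed
qed

text \<open>Turns the closure, a definite description, into an explicit function. The last premise
  is closability, expressed as semicontinuity of \<open>q\<close> at the points of its
  domain.\<close>

lemma form_closure_eq_lsc_envelope:
  assumes "localizable M" "quadratic_form M q" "\<And>u. u \<in> form_domain q \<Longrightarrow> q u \<le> lsc_envelope M q u"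
  shows "form_closure M q = lsc_envelope M q"
  unfolding form_closure_def
proof -
  have "is_form_closure M q (lsc_envelope M q)"
    using assms by (rule is_form_closure_lsc_envelope)
  from the_equality[of "is_form_closure M q", OF this is_form_closure_unique[OF _ this]]
  show "(THE p. is_form_closure M q p) = lsc_envelope M q" by simp
qed

section \<open>Moreau approximations\<close>

lemma quad_spaceI:
  fixes Q :: "'v::real_vector \<Rightarrow> real"
  assumes sub: "subspace D" and nonneg: "\<And>u. u \<in> D \<Longrightarrow> 0 \<le> Q u"
    and hom: "\<And>c u. u \<in> D \<Longrightarrow> Q (c *\<^sub>R u) = c\<^sup>2 * Q u"
    and par_le: "\<And>u v. u \<in> D \<Longrightarrow> v \<in> D \<Longrightarrow> Q (u + v) + Q (u - v) \<le> 2 * Q u + 2 * Q v"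
  shows "quad_space D Q"
proof
  fix u v assume uv: "u \<in> D" "v \<in> D"
  have "Q ((u + v) + (u - v)) + Q ((u + v) - (u - v)) \<le> 2 * Q (u + v) + 2 * Q (u - v)"
    using uv sub by (intro par_le subspace_add subspace_diff)
  moreover have "(u + v) + (u - v) = 2 *\<^sub>R u" "(u + v) - (u - v) = 2 *\<^sub>R v"
    by (simp_all add: scaleR_2)
  ultimately have "4 * Q u + 4 * Q v \<le> 2 * Q (u + v) + 2 * Q (u - v)"
    using hom[OF uv(1), of 2] hom[OF uv(2), of 2] by simp
  then show "Q (u + v) + Q (u - v) = 2 * Q u + 2 * Q v" using par_le[OF uv] by simp
qed (use assms in auto)

section \<open>Infimal convolution of quadratic forms\<close>

definition inf_conv :: "'v set \<Rightarrow> ('v \<Rightarrow> real) \<Rightarrow> 'v set \<Rightarrow> ('v \<Rightarrow> real) \<Rightarrow> 'v::real_vector \<Rightarrow> real" where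
  "inf_conv D Q X S f = (INF g\<in>D \<inter> X. Q g + S (f - g))"

context
  fixes D X :: "'v::real_vector set" and Q S :: "'v \<Rightarrow> real"
  assumes qD: "quad_space D Q" and qX: "quad_space X S"
begin

interpretation Q: quad_space D Q by (rule qD)
interpretation S: quad_space X S by (rule qX)

lemma inf_conv_nonneg_term: "f \<in> X \<Longrightarrow> g \<in> D \<inter> X \<Longrightarrow> 0 \<le> Q g + S (f - g)"
  by (intro add_nonneg_nonneg Q.nonneg S.nonneg) auto

lemma inf_conv_le: "f \<in> X \<Longrightarrow> g \<in> D \<inter> X \<Longrightarrow> inf_conv D Q X S f \<le> Q g + S (f - g)"
  unfolding inf_conv_def
  by (rule cINF_lower[OF bdd_belowI2[where m = 0]]) (rule inf_conv_nonneg_term)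

lemma inf_conv_ne: "D \<inter> X \<noteq> {}"
  using Q.mem(4) S.mem(4) by blast

lemma inf_conv_greatest: "(\<And>g. g \<in> D \<inter> X \<Longrightarrow> c \<le> Q g + S (f - g)) \<Longrightarrow> c \<le> inf_conv D Q X S f"
  unfolding inf_conv_def by (rule cINF_greatest[OF inf_conv_ne])

lemma inf_conv_approx:
  assumes "f \<in> X" "inf_conv D Q X S f < c"
  shows "\<exists>g\<in>D \<inter> X. Q g + S (f - g) < c"
  using inf_conv_greatest[of c f] assms(2) by (meson not_less)

text \<open>If \<open>g\<close> and \<open>h\<close> are nearly optimal for \<open>u\<close> and
  \<open>v\<close>, then \<open>g + h\<close> and \<open>g - h\<close> compete for
  \<open>u + v\<close> and \<open>u - v\<close>, and the parallelogram laws of \<open>Q\<close> and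
  \<open>S\<close> add up.\<close>

lemma quad_space_inf_conv: "quad_space X (inf_conv D Q X S)"
proof (rule quad_spaceI)
  let ?I = "inf_conv D Q X S"
  show "subspace X" by (rule S.sub)
  show nn: "0 \<le> ?I u" if "u \<in> X" for u
    by (rule inf_conv_greatest) (rule inf_conv_nonneg_term[OF that])
  have hom_le: "?I (c *\<^sub>R u) \<le> c\<^sup>2 * ?I u" if u: "u \<in> X" and c: "c \<noteq> 0" for c u
  proof -
    have "?I (c *\<^sub>R u) / c\<^sup>2 \<le> ?I u"
    proof (rule inf_conv_greatest)
      fix g assume g: "g \<in> D \<inter> X"
      have "?I (c *\<^sub>R u) \<le> Q (c *\<^sub>R g) + S (c *\<^sub>R u - c *\<^sub>R g)"
        using u g by (intro inf_conv_le) auto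
      also have "S (c *\<^sub>R u - c *\<^sub>R g) = c\<^sup>2 * S (u - g)"
        using S.hom[of "u - g" c] u g by (simp add: scaleR_diff_right)
      also have "Q (c *\<^sub>R g) = c\<^sup>2 * Q g" using Q.hom g by blast
      finally show "?I (c *\<^sub>R u) / c\<^sup>2 \<le> Q g + S (u - g)"
        using c by (simp add: divide_le_eq algebra_simps)
    qed
    then show ?thesis using c by (simp add: divide_le_eq mult.commute)
  qed
  show "?I (c *\<^sub>R u) = c\<^sup>2 * ?I u" if u: "u \<in> X" for c u
  proof (cases "c = 0")
    case True
    have "?I 0 \<le> Q 0 + S (0 - 0)" by (rule inf_conv_le) auto
    then show ?thesis using True nn[of 0] by simp
  next
    case False
    have "?I ((1/c) *\<^sub>R (c *\<^sub>R u)) \<le> (1/c)\<^sup>2 * ?I (c *\<^sub>R u)"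
      by (rule hom_le) (use u False in auto)
    then have "c\<^sup>2 * ?I u \<le> ?I (c *\<^sub>R u)"
      using False by (simp add: power_divide pos_le_divide_eq mult.commute)
    then show ?thesis using hom_le[OF u False] by simp
  qed
  show "?I (u + v) + ?I (u - v) \<le> 2 * ?I u + 2 * ?I v" if u: "u \<in> X" and v: "v \<in> X" for u v
  proof (rule field_le_epsilon)
    fix e :: real assume e: "0 < e"
    obtain g where g: "g \<in> D \<inter> X" "Q g + S (u - g) < ?I u + e/4"
      using inf_conv_approx[OF u, of "?I u + e/4"] e by auto
    obtain h where h: "h \<in> D \<inter> X" "Q h + S (v - h) < ?I v + e/4"
      using inf_conv_approx[OF v, of "?I v + e/4"] e by auto
    have "?I (u + v) \<le> Q (g + h) + S ((u + v) - (g + h))"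
      using u v g h by (intro inf_conv_le) auto
    moreover have "?I (u - v) \<le> Q (g - h) + S ((u - v) - (g - h))"
      using u v g h by (intro inf_conv_le) auto
    moreover have "Q (g + h) + Q (g - h) = 2 * Q g + 2 * Q h" using g h by (intro Q.par) auto
    moreover have "S ((u - g) + (v - h)) + S ((u - g) - (v - h)) = 2 * S (u - g) + 2 * S (v - h)"
      using u v g h by (intro S.par) auto
    moreover have "(u + v) - (g + h) = (u - g) + (v - h)" "(u - v) - (g - h) = (u - g) - (v - h)"
      by simp_all
    ultimately show "?I (u + v) + ?I (u - v) \<le> 2 * ?I u + 2 * ?I v + e"
      using g(2) h(2) by simp
  qed
qed

end

section \<open>Square integrals over finite-measure sets\<close>

definition square_int :: "'a measure \<Rightarrow> 'a set \<Rightarrow> ('a \<Rightarrow> real) set" where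
  "square_int M U = {f \<in> borel_measurable M. integrable M (\<lambda>x. indicator U x * (f x)\<^sup>2)}"

definition sq_norm :: "'a measure \<Rightarrow> 'a set \<Rightarrow> ('a \<Rightarrow> real) \<Rightarrow> real" where
  "sq_norm M U f = (LINT x|M. indicator U x * (f x)\<^sup>2)"

lemma square_int_measurable: "f \<in> square_int M U \<Longrightarrow> f \<in> borel_measurable M"
  by (simp add: square_int_def)

lemma square_int_dominated:
  assumes [measurable]: "f \<in> borel_measurable M" "U \<in> sets M" and g: "g \<in> square_int M U" "h \<in> square_int M U"
    and le: "\<And>x. (f x)\<^sup>2 \<le> c * (g x)\<^sup>2 + c * (h x)\<^sup>2"
  shows "f \<in> square_int M U"
  unfolding square_int_def
proof (intro CollectI conjI assms)
  have "integrable M (\<lambda>x. c * (indicator U x * (g x)\<^sup>2) + c * (indicator U x * (h x)\<^sup>2))"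
    using g by (intro Bochner_Integration.integrable_add integrable_mult_right) (auto simp: square_int_def)
  then show "integrable M (\<lambda>x. indicator U x * (f x)\<^sup>2)"
  proof (rule Bochner_Integration.integrable_bound)
    show "AE x in M. norm (indicator U x * (f x)\<^sup>2) \<le>
        norm (c * (indicator U x * (g x)\<^sup>2) + c * (indicator U x * (h x)\<^sup>2))"
    proof (rule AE_I2)
      fix x
      have "norm ((f x)\<^sup>2) \<le> norm (c * (g x)\<^sup>2 + c * (h x)\<^sup>2)"
        using le[of x] by (simp add: order_trans[OF _ abs_ge_self])
      then show "norm (indicator U x * (f x)\<^sup>2) \<le>
        norm (c * (indicator U x * (g x)\<^sup>2) + c * (indicator U x * (h x)\<^sup>2))"
        by (simp add: indicator_def)
    qed
  qed measurable
qed

lemma square_int_bounded: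
  assumes [measurable]: "f \<in> borel_measurable M" and U: "U \<in> fin_sets M" and le: "AE x in M. \<bar>f x\<bar> \<le> c"
  shows "f \<in> square_int M U" "sq_norm M U f \<le> c\<^sup>2 * measure M U"
proof -
  have [measurable]: "U \<in> sets M" by (rule fin_sets_sets[OF U])
  have i: "integrable M (\<lambda>x. c\<^sup>2 * indicator U x :: real)"
    using U by (intro integrable_mult_right) (simp add: fin_sets_def)
  have ae: "AE x in M. indicator U x * (f x)\<^sup>2 \<le> c\<^sup>2 * indicator U x"
    using le
  proof eventually_elim
    case (elim x)
    then have "(f x)\<^sup>2 \<le> c\<^sup>2" by (metis abs_ge_zero power2_abs power_mono)
    then show ?case by (simp add: indicator_def)
  qed
  have i2: "integrable M (\<lambda>x. indicator U x * (f x)\<^sup>2)"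
    by (rule Bochner_Integration.integrable_bound[OF i])
      (use ae in \<open>auto elim!: AE_mp intro!: AE_I2\<close>)
  then show "f \<in> square_int M U" by (simp add: square_int_def)
  have "sq_norm M U f \<le> (LINT x|M. c\<^sup>2 * indicator U x)"
    unfolding sq_norm_def by (rule integral_mono_AE[OF i2 i ae])
  also have "\<dots> = c\<^sup>2 * measure M U" using U by (simp add: fin_sets_def)
  finally show "sq_norm M U f \<le> c\<^sup>2 * measure M U" .
qed

lemma quad_space_sq_norm:
  assumes U: "U \<in> sets M" and w: "0 \<le> w"
  shows "quad_space (square_int M U) (\<lambda>f. w * sq_norm M U f)"
proof
  show "subspace (square_int M U)"
  proof (rule subspaceI)
    show "0 \<in> square_int M U" by (simp add: square_int_def zero_fun_def)
  next
    fix f g assume fg: "f \<in> square_int M U" "g \<in> square_int M U"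
    show "f + g \<in> square_int M U"
    proof (rule square_int_dominated[OF _ U fg, where c = 2])
      show "f + g \<in> borel_measurable M"
        using fg[THEN square_int_measurable] by (auto simp: plus_fun_def intro!: borel_measurable_add)
      show "((f + g) x)\<^sup>2 \<le> 2 * (f x)\<^sup>2 + 2 * (g x)\<^sup>2" for x
        using zero_le_power2[of "f x - g x"] by (simp add: power2_sum power2_diff)
    qed
  next
    fix c f assume f: "f \<in> square_int M U"
    then have "integrable M (\<lambda>x. c\<^sup>2 * (indicator U x * (f x)\<^sup>2))"
      by (intro integrable_mult_right) (auto simp: square_int_def)
    moreover have "(\<lambda>x. c * f x) \<in> borel_measurable M"
      using square_int_measurable[OF f] by (intro borel_measurable_times borel_measurable_const)
    ultimately show "c *\<^sub>R f \<in> square_int M U"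
      by (simp add: square_int_def scaleR_fun_def power_mult_distrib mult.left_commute)
  qed
  note sub = this
  show "0 \<le> w * sq_norm M U f" for f
    unfolding sq_norm_def using w by (intro mult_nonneg_nonneg Bochner_Integration.integral_nonneg) auto
  fix f assume f: "f \<in> square_int M U"
  show "w * sq_norm M U (c *\<^sub>R f) = c\<^sup>2 * (w * sq_norm M U f)" for c
  proof -
    have "sq_norm M U (c *\<^sub>R f) = (LINT x|M. c\<^sup>2 * (indicator U x * (f x)\<^sup>2))"
      unfolding sq_norm_def by (simp add: power_mult_distrib mult.left_commute)
    then show ?thesis by (simp add: sq_norm_def)
  qed
  fix g assume g: "g \<in> square_int M U"
  have i: "integrable M (\<lambda>x. indicator U x * (h x)\<^sup>2)" if "h \<in> square_int M U" for h
    using that by (simp add: square_int_def)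
  have "sq_norm M U (f + g) + sq_norm M U (f - g) =
      (LINT x|M. indicator U x * ((f + g) x)\<^sup>2 + indicator U x * ((f - g) x)\<^sup>2)"
    unfolding sq_norm_def
    by (rule Bochner_Integration.integral_add[OF i[OF subspace_add[OF sub f g]] i[OF subspace_diff[OF sub f g]], symmetric])
  also have "\<dots> = (LINT x|M. 2 * (indicator U x * (f x)\<^sup>2) + 2 * (indicator U x * (g x)\<^sup>2))"
    by (rule Bochner_Integration.integral_cong)
      (auto simp: power2_sum power2_diff algebra_simps)
  also have "\<dots> = (LINT x|M. 2 * (indicator U x * (f x)\<^sup>2)) + (LINT x|M. 2 * (indicator U x * (g x)\<^sup>2))"
    by (intro Bochner_Integration.integral_add integrable_mult_right i f g)
  also have "\<dots> = 2 * sq_norm M U f + 2 * sq_norm M U g" by (simp add: sq_norm_def)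
  finally have "w * (sq_norm M U (f + g) + sq_norm M U (f - g)) = w * (2 * sq_norm M U f + 2 * sq_norm M U g)"
    by simp
  then show "w * sq_norm M U (f + g) + w * sq_norm M U (f - g) =
      2 * (w * sq_norm M U f) + 2 * (w * sq_norm M U g)"
    by (simp add: algebra_simps)
qed

text \<open>Either \<open>\<bar>t\<bar> \<le> s\<close> or
  \<open>\<bar>t\<bar> \<le> t\<^sup>2 / s\<close>. With \<open>s\<close> of the order of the root
  of the square integral, both terms of the bound become small together.\<close>

lemma local_dist_le_sq_norm:
  assumes fm: "f \<in> borel_measurable M" and gm: "g \<in> borel_measurable M"
    and V: "V \<in> fin_sets M" and U: "U \<in> sets M" "V \<subseteq> U"
    and d: "f - g \<in> square_int M U" and s: "0 < s"
  shows "local_dist M V f g \<le> s * measure M V + sq_norm M U (f - g) / s"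
proof -
  have iV: "integrable M (\<lambda>x. s * indicator V x)"
    using V by (intro integrable_mult_right) (simp add: fin_sets_def)
  have iU: "integrable M (\<lambda>x. indicator U x * ((f - g) x)\<^sup>2 / s)"
    using d by (intro integrable_divide_zero) (simp add: square_int_def)
  have "local_dist M V f g \<le> (LINT x|M. s * indicator V x + indicator U x * ((f - g) x)\<^sup>2 / s)"
    unfolding local_dist_def set_lebesgue_integral_def
  proof (rule integral_mono[OF local_dist_integrable[OF fm gm V] Bochner_Integration.integrable_add[OF iV iU]])
    fix x
    have "min \<bar>t\<bar> 1 \<le> s + t\<^sup>2 / s" for t :: real
    proof (cases "\<bar>t\<bar> \<le> s")
      case True
      moreover have "0 \<le> t\<^sup>2 / s" using s by simp
      ultimately show ?thesis by linarith
    next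
      case False
      then have "\<bar>t\<bar> * s \<le> \<bar>t\<bar> * \<bar>t\<bar>" by (intro mult_left_mono) auto
      then have "\<bar>t\<bar> \<le> t\<^sup>2 / s" using s by (simp add: pos_le_divide_eq power2_eq_square)
      then show ?thesis using s by linarith
    qed
    from this[of "f x - g x"]
    show "indicator V x *\<^sub>R min \<bar>f x - g x\<bar> 1 \<le> s * indicator V x + indicator U x * ((f - g) x)\<^sup>2 / s"
      using U(2) s by (auto simp: indicator_def)
  qed
  also have "\<dots> = (LINT x|M. s * indicator V x) + (LINT x|M. indicator U x * ((f - g) x)\<^sup>2 / s)"
    by (rule Bochner_Integration.integral_add[OF iV iU])
  also have "\<dots> = s * measure M V + sq_norm M U (f - g) / s"
    using V by (simp add: sq_norm_def fin_sets_def)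
  finally show ?thesis .
qed

text \<open>
  \<open>moreau\<close> replaces the resolvent approximation of a Dirichlet form.  It needs no
  \<open>L\<^sup>2\<close>-setting, and it is finite on all bounded functions.
\<close>

definition moreau :: "'a measure \<Rightarrow> (('a \<Rightarrow> real) \<Rightarrow> ereal) \<Rightarrow> 'a set \<times> nat \<Rightarrow> ('a \<Rightarrow> real) \<Rightarrow> real" where
  "moreau M E p = inf_conv (form_domain E) (real_form E)
     (square_int M (fst p)) (\<lambda>f. real (Suc (snd p)) * sq_norm M (fst p) f)"

section \<open>The unit contraction as a uniform limit of cutoffs\<close>

definition unit_clamp :: "real \<Rightarrow> real" where "unit_clamp x = min 1 (max 0 x)"

lemma unit_clamp_measurable: "f \<in> borel_measurable M \<Longrightarrow> unit_clamp \<circ> f \<in> borel_measurable M"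
  unfolding comp_def unit_clamp_def
  by (intro borel_measurable_min borel_measurable_max borel_measurable_const)

text \<open>By monotonicity a cutoff stays between -\<epsilon> and 0 to the left of 0 and between 1
  and 1 + \<epsilon> to the right of 1.\<close>

lemma eps_cutoff_unit_clamp:
  assumes C: "eps_cutoff \<epsilon> C" and e: "0 < \<epsilon>"
  shows "\<bar>unit_clamp x - C x\<bar> \<le> \<epsilon>"
proof -
  have range: "- \<epsilon> \<le> C x" "C x \<le> 1 + \<epsilon>"
    using C unfolding eps_cutoff_def by (meson atLeastAtMost_iff rangeI subsetD)+
  have id: "C y = y" if "0 \<le> y" "y \<le> 1" for y using C that by (simp add: eps_cutoff_def)
  have mono: "mono C" using C by (simp add: eps_cutoff_def)
  consider "x < 0" | "0 \<le> x" "x \<le> 1" | "1 < x" by linarith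
  then show ?thesis
  proof cases
    case 1
    then have "C x \<le> C 0" using mono by (simp add: monoD)
    then show ?thesis using 1 range id[of 0] by (simp add: unit_clamp_def)
  next
    case 2
    then show ?thesis using id e by (simp add: unit_clamp_def)
  next
    case 3
    then have "C 1 \<le> C x" using mono by (simp add: monoD)
    then show ?thesis using 3 range id[of 1] by (simp add: unit_clamp_def)
  qed
qed

section \<open>Moreau approximations of an energy form\<close>

locale energy =
  fixes M :: "'a measure" and E :: "('a \<Rightarrow> real) \<Rightarrow> ereal"
  assumes loc: "localizable M" and energy: "energy_form M E"
begin

abbreviation D :: "('a \<Rightarrow> real) set" where "D \<equiv> form_domain E"
abbreviation Q :: "('a \<Rightarrow> real) \<Rightarrow> real" where "Q \<equiv> real_form E"

lemma qf: "quadratic_form M E"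
  using energy by (simp add: energy_form_def closed_form_def)

lemma lsc: "lower_semicont M E"
  using closed_form_imp_lower_semicont[OF loc] energy by (simp add: energy_form_def)

sublocale quad_space D Q by (rule quad_space_form[OF qf])

lemmas meas = form_domain_measurable[OF qf]

lemma E_eq: "f \<in> D \<Longrightarrow> E f = ereal (Q f)"
  by (rule form_domain_eq[OF qf])

lemma B_eq: "form_bilinear E = B"
  by (rule form_bilinear_eq_B[OF qf])

lemma E_leD: "E f \<le> ereal c \<Longrightarrow> f \<in> D \<and> Q f \<le> c"
proof -
  assume "E f \<le> ereal c"
  then have "f \<in> D" by (auto simp: form_domain_def)
  with E_eq[OF this] \<open>E f \<le> ereal c\<close> show ?thesis by (metis ereal_less_eq(3))
qed

context
  fixes p :: "'a set \<times> nat"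
  assumes p: "fst p \<in> fin_sets M"
begin

lemma moreau_sq: "quad_space (square_int M (fst p)) (\<lambda>f. real (Suc (snd p)) * sq_norm M (fst p) f)"
  by (rule quad_space_sq_norm[OF fin_sets_sets[OF p]]) simp

lemma quad_space_moreau: "quad_space (square_int M (fst p)) (moreau M E p)"
  unfolding moreau_def by (rule quad_space_inf_conv[OF quad_space_axioms moreau_sq])

interpretation m: quad_space "square_int M (fst p)" "moreau M E p" by (rule quad_space_moreau)

lemma moreau_le: "f \<in> square_int M (fst p) \<Longrightarrow> g \<in> D \<Longrightarrow> g \<in> square_int M (fst p) \<Longrightarrow>
    moreau M E p f \<le> Q g + real (Suc (snd p)) * sq_norm M (fst p) (f - g)"
  unfolding moreau_def by (rule inf_conv_le[OF quad_space_axioms moreau_sq]) auto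

lemma moreau_le_Q: "f \<in> square_int M (fst p) \<Longrightarrow> f \<in> D \<Longrightarrow> moreau M E p f \<le> Q f"
  using moreau_le[of f f] by (simp add: sq_norm_def)

lemma moreau_le_sq: "f \<in> square_int M (fst p) \<Longrightarrow> moreau M E p f \<le> real (Suc (snd p)) * sq_norm M (fst p) f"
  using moreau_le[of f 0] by simp

lemma moreau_le_bounded:
  assumes "f \<in> borel_measurable M" "AE x in M. \<bar>f x\<bar> \<le> c"
  shows "moreau M E p f \<le> real (Suc (snd p)) * (c\<^sup>2 * measure M (fst p))"
  using moreau_le_sq[OF square_int_bounded(1)[OF assms(1) p assms(2)]] square_int_bounded(2)[OF assms(1) p assms(2)]
  by (meson mult_left_mono of_nat_0_le_iff order_trans)

lemma moreau_approx:
  assumes "f \<in> square_int M (fst p)" "moreau M E p f < c"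
  shows "\<exists>g\<in>D \<inter> square_int M (fst p). Q g + real (Suc (snd p)) * sq_norm M (fst p) (f - g) < c"
  using assms unfolding moreau_def by (rule inf_conv_approx[OF quad_space_axioms moreau_sq])

lemma moreau_greatest:
  assumes "\<And>g. g \<in> D \<Longrightarrow> g \<in> square_int M (fst p) \<Longrightarrow> c \<le> Q g + real (Suc (snd p)) * sq_norm M (fst p) (f - g)"
  shows "c \<le> moreau M E p f"
  unfolding moreau_def by (rule inf_conv_greatest[OF quad_space_axioms moreau_sq]) (use assms in auto)

text \<open>Replacing a competitor \<open>g\<close> for \<open>f\<close> by the competitor
  \<open>C \<circ> g\<close> for \<open>C \<circ> f\<close> decreases both terms: the energy by
  assumption on \<open>C\<close>, the square integral because \<open>C\<close> is a contraction.
  Boundedness of \<open>C\<close> keeps the functions square integrable over the finite-measure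
  set.\<close>

lemma moreau_eps_cutoff:
  assumes C: "eps_cutoff \<epsilon> C" and CE: "\<And>f. f \<in> borel_measurable M \<Longrightarrow> E (C \<circ> f) \<le> E f"
    and f: "f \<in> square_int M (fst p)"
  shows "C \<circ> f \<in> square_int M (fst p)" "moreau M E p (C \<circ> f) \<le> moreau M E p f"
proof -
  have lip: "\<bar>C x - C y\<bar> \<le> \<bar>x - y\<bar>" for x y using C by (simp add: eps_cutoff_def)
  have mono: "mono C" using C by (simp add: eps_cutoff_def)
  have Cm: "C \<in> borel_measurable borel" by (rule borel_measurable_mono[OF mono])
  have range: "- \<epsilon> \<le> C x" "C x \<le> 1 + \<epsilon>" for x
    using C unfolding eps_cutoff_def by (meson atLeastAtMost_iff rangeI subsetD)+
  have bnd: "\<bar>C x\<bar> \<le> 1 + \<epsilon>" for x using range[of x] by simp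
  have Cf: "C \<circ> g \<in> square_int M (fst p)" if "g \<in> borel_measurable M" for g
    using that Cm bnd by (intro square_int_bounded(1)[OF _ p, where c = "1 + \<epsilon>"]) (auto simp: comp_def)
  show 1: "C \<circ> f \<in> square_int M (fst p)" using f by (intro Cf) (simp add: square_int_def)
  show "moreau M E p (C \<circ> f) \<le> moreau M E p f"
  proof (rule moreau_greatest)
    fix g assume g: "g \<in> D" "g \<in> square_int M (fst p)"
    have "E (C \<circ> g) \<le> ereal (Q g)" using CE[OF meas[OF g(1)]] E_eq[OF g(1)] by simp
    then have Cg: "C \<circ> g \<in> D" "Q (C \<circ> g) \<le> Q g" using E_leD by blast+
    have Cg2: "C \<circ> g \<in> square_int M (fst p)" by (rule Cf[OF meas[OF g(1)]])
    have fg: "f - g \<in> square_int M (fst p)" "(C \<circ> f) - (C \<circ> g) \<in> square_int M (fst p)"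
      using f g 1 Cg2 m.mem by auto
    have "sq_norm M (fst p) ((C \<circ> f) - (C \<circ> g)) \<le> sq_norm M (fst p) (f - g)"
      unfolding sq_norm_def
    proof (rule integral_mono)
      fix x
      have "(C (f x) - C (g x))\<^sup>2 \<le> (f x - g x)\<^sup>2"
        using lip by (simp add: abs_le_square_iff[symmetric])
      then show "indicator (fst p) x * (((C \<circ> f) - (C \<circ> g)) x)\<^sup>2 \<le> indicator (fst p) x * ((f - g) x)\<^sup>2"
        by (simp add: indicator_def)
    qed (use fg in \<open>simp_all add: square_int_def\<close>)
    then have "real (Suc (snd p)) * sq_norm M (fst p) ((C \<circ> f) - (C \<circ> g)) \<le>
        real (Suc (snd p)) * sq_norm M (fst p) (f - g)" by (intro mult_left_mono) auto
    then show "moreau M E p (C \<circ> f) \<le> Q g + real (Suc (snd p)) * sq_norm M (fst p) (f - g)"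
      using moreau_le[OF 1 Cg(1) Cg2] Cg(2) by linarith
  qed
qed

text \<open>Unlike \<open>E\<close>, its approximations are continuous under uniform convergence
  (\<open>moreau_le_bounded\<close>), so the cutoffs may be replaced by their uniform limit; the
  error is added by the triangle inequality for square roots.\<close>

lemma moreau_unit_clamp:
  assumes f: "f \<in> square_int M (fst p)"
  shows "moreau M E p (unit_clamp \<circ> f) \<le> moreau M E p f"
proof -
  have fm: "f \<in> borel_measurable M" using f by (simp add: square_int_def)
  have Tm: "unit_clamp \<circ> f \<in> borel_measurable M" by (rule unit_clamp_measurable[OF fm])
  have T: "unit_clamp \<circ> f \<in> square_int M (fst p)"
    by (rule square_int_bounded(1)[OF Tm p, where c = 1]) (simp add: unit_clamp_def)
  define K where "K = sqrt (real (Suc (snd p)) * measure M (fst p))"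
  have "sqrt (moreau M E p (unit_clamp \<circ> f)) \<le> sqrt (moreau M E p f) + e" if e: "0 < e" for e
  proof -
    \<comment> \<open>\<open>K * \<epsilon>\<close> bounds the square root of the form at a function
      of size \<epsilon>; adding 1 avoids division by zero.\<close>
    define \<epsilon> where "\<epsilon> = e / (K + 1)"
    have K0: "0 \<le> K" by (simp add: K_def)
    have eps: "0 < \<epsilon>" using e K0 by (simp add: \<epsilon>_def)
    obtain C where C: "eps_cutoff \<epsilon> C" and CE: "\<And>f. f \<in> borel_measurable M \<Longrightarrow> E (C \<circ> f) \<le> E f"
      using energy eps unfolding energy_form_def markovian_def by blast
    note Cf = moreau_eps_cutoff[OF C CE f]
    have dm: "(unit_clamp \<circ> f) - (C \<circ> f) \<in> square_int M (fst p)" using T Cf(1) by auto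
    have "moreau M E p ((unit_clamp \<circ> f) - (C \<circ> f)) \<le> real (Suc (snd p)) * (\<epsilon>\<^sup>2 * measure M (fst p))"
      using eps_cutoff_unit_clamp[OF C eps] by (intro moreau_le_bounded square_int_measurable[OF dm]) simp
    also have "\<dots> = (K * \<epsilon>)\<^sup>2" by (simp add: K_def power_mult_distrib)
    finally have "sqrt (moreau M E p ((unit_clamp \<circ> f) - (C \<circ> f))) \<le> K * \<epsilon>"
      using K0 eps by (intro real_le_lsqrt) auto
    moreover have "(C \<circ> f) + ((unit_clamp \<circ> f) - (C \<circ> f)) = unit_clamp \<circ> f" by simp
    with m.sqrt_Q_triangle[OF Cf(1) dm] have "sqrt (moreau M E p (unit_clamp \<circ> f)) \<le>
      sqrt (moreau M E p (C \<circ> f)) + sqrt (moreau M E p ((unit_clamp \<circ> f) - (C \<circ> f)))"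
      by (simp only:)
    moreover have "sqrt (moreau M E p (C \<circ> f)) \<le> sqrt (moreau M E p f)" using Cf(2) by simp
    moreover have "K * \<epsilon> \<le> e"
    proof -
      have "K * \<epsilon> \<le> (K + 1) * \<epsilon>" using eps by (intro mult_right_mono) auto
      also have "\<dots> = e" using K0 by (simp add: \<epsilon>_def)
      finally show ?thesis .
    qed
    ultimately show ?thesis by linarith
  qed
  then have "sqrt (moreau M E p (unit_clamp \<circ> f)) \<le> sqrt (moreau M E p f)" by (rule field_le_epsilon)
  then show ?thesis by simp
qed

end

text \<open>As long as the approximations stay bounded, the growing weight of the penalty forces
  near-minimisers to converge to \<open>f\<close> on every finite-measure set.\<close>

lemma moreau_recovery:
  assumes f: "\<And>U. U \<in> fin_sets M \<Longrightarrow> f \<in> square_int M U" and fm: "f \<in> borel_measurable M"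
    and le: "\<forall>\<^sub>F p in fin_filter M. moreau M E p f \<le> c"
  obtains v where "\<And>p. v p \<in> D" "tconv M v f (fin_filter M)"
    "\<forall>\<^sub>F p in fin_filter M. Q (v p) \<le> moreau M E p f + 1 / real (Suc (snd p))"
proof -
  have "\<exists>g. g \<in> D \<and> (fst p \<in> fin_sets M \<longrightarrow> g \<in> square_int M (fst p) \<and>
      Q g + real (Suc (snd p)) * sq_norm M (fst p) (f - g) < moreau M E p f + 1 / real (Suc (snd p)))" for p
  proof (cases "fst p \<in> fin_sets M")
    case True
    have "moreau M E p f < moreau M E p f + 1 / real (Suc (snd p))" by simp
    from moreau_approx[OF True f[OF True] this] show ?thesis by blast
  qed (use mem(4) in blast)
  then obtain v where vD: "\<And>p. v p \<in> D" and v2: "\<And>p. fst p \<in> fin_sets M \<Longrightarrow> v p \<in> square_int M (fst p)"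
    and vle: "\<And>p. fst p \<in> fin_sets M \<Longrightarrow> Q (v p) + real (Suc (snd p)) * sq_norm M (fst p) (f - v p) <
      moreau M E p f + 1 / real (Suc (snd p))"
    by metis
  have sq0: "0 \<le> sq_norm M U g" for U g unfolding sq_norm_def by (intro Bochner_Integration.integral_nonneg) auto
  have evp: "\<forall>\<^sub>F p in fin_filter M. fst p \<in> fin_sets M \<and> V \<subseteq> fst p" if "V \<in> fin_sets M" for V
    unfolding eventually_fin_filter using that by auto
  have "tconv M v f (fin_filter M)"
    unfolding tconv_def
  proof
    fix V assume V: "V \<in> fin_sets M"
    have "\<forall>\<^sub>F p in fin_filter M. norm (local_dist M V (v p) f) \<le> (measure M V + \<bar>c\<bar> + 1) * sqrt (1 / real (Suc (snd p)))"
      using le evp[OF V]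
    proof eventually_elim
      case (elim p)
      \<comment> \<open>The square integral is at most \<open>(\<bar>c\<bar> + 1) / ?n\<close>, so
        with this \<open>?s\<close> both terms of \<open>local_dist_le_sq_norm\<close> are of order
        \<open>?s\<close>.\<close>
      let ?n = "real (Suc (snd p))" and ?s = "sqrt (1 / real (Suc (snd p)))"
      have s: "0 < ?s" and ss: "?s * ?s = 1 / ?n" by simp_all
      have p: "fst p \<in> fin_sets M" "V \<subseteq> fst p" using elim by auto
      have "?n * sq_norm M (fst p) (f - v p) \<le> moreau M E p f + 1 / ?n"
        using vle[OF p(1)] nonneg[OF vD[of p]] by linarith
      also have "\<dots> \<le> \<bar>c\<bar> + 1" using elim(1) by (simp add: add_mono divide_le_eq)
      finally have "sq_norm M (fst p) (f - v p) \<le> (\<bar>c\<bar> + 1) * (?s * ?s)"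
        unfolding ss by (simp add: pos_le_divide_eq mult.commute)
      then have "sq_norm M (fst p) (f - v p) / ?s \<le> (\<bar>c\<bar> + 1) * ?s"
        using s by (subst pos_divide_le_eq) (simp_all add: mult.assoc)
      moreover have "local_dist M V f (v p) \<le> ?s * measure M V + sq_norm M (fst p) (f - v p) / ?s"
      proof (rule local_dist_le_sq_norm[OF fm meas[OF vD] V fin_sets_sets[OF p(1)] p(2) _ s])
        show "f - v p \<in> square_int M (fst p)"
          using quad_space.mem(2)[OF moreau_sq[OF p(1)] f[OF p(1)] v2[OF p(1)]] .
      qed
      ultimately have "local_dist M V f (v p) \<le> ?s * measure M V + (\<bar>c\<bar> + 1) * ?s" by linarith
      also have "\<dots> = (measure M V + \<bar>c\<bar> + 1) * ?s" by (simp add: algebra_simps)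
      finally show ?case by (simp only: real_norm_def abs_of_nonneg[OF local_dist_nonneg] local_dist_commute[of M V "v p"])
    qed
    moreover have "((\<lambda>p. (measure M V + \<bar>c\<bar> + 1) * sqrt (1 / real (Suc (snd p)))) \<longlongrightarrow> 0) (fin_filter M)"
      using tendsto_mult[OF tendsto_const tendsto_real_sqrt[OF tendsto_fin_filter_snd[of M]], of "measure M V + \<bar>c\<bar> + 1"]
      by (simp only: real_sqrt_zero mult_zero_right)
    ultimately show "((\<lambda>p. local_dist M V (v p) f) \<longlongrightarrow> 0) (fin_filter M)"
      by (rule Lim_null_comparison)
  qed
  moreover have "\<forall>\<^sub>F p in fin_filter M. Q (v p) \<le> moreau M E p f + 1 / real (Suc (snd p))"
    using evp[OF fin_sets_empty]
  proof eventually_elim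
    case (elim p)
    have "0 \<le> real (Suc (snd p)) * sq_norm M (fst p) (f - v p)" using sq0 by simp
    then show ?case using vle[of p] elim by linarith
  qed
  ultimately show ?thesis using that vD by blast
qed

text \<open>The criterion for membership in \<open>D\<close>: near-minimisers converge to
  \<open>f\<close>, and \<open>E\<close> is lower semicontinuous along them.\<close>

lemma E_le_moreau:
  assumes f: "\<And>U. U \<in> fin_sets M \<Longrightarrow> f \<in> square_int M U" and fm: "f \<in> borel_measurable M"
    and le: "\<forall>\<^sub>F p in fin_filter M. moreau M E p f \<le> c"
  shows "E f \<le> ereal c"
proof -
  obtain v where vD: "\<And>p. v p \<in> D" and vt: "tconv M v f (fin_filter M)"
    and vle: "\<forall>\<^sub>F p in fin_filter M. Q (v p) \<le> moreau M E p f + 1 / real (Suc (snd p))"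
    by (rule moreau_recovery[OF f fm le], assumption, rule that)
  show ?thesis
  proof (rule lower_semicont_le[OF lsc _ fm vt fin_filter_not_bot])
    show "\<forall>\<^sub>F p in fin_filter M. v p \<in> borel_measurable M" using meas[OF vD] by simp
    show "\<forall>\<^sub>F p in fin_filter M. E (v p) \<le> ereal (c + 1 / real (Suc (snd p)))"
      using vle le
    proof eventually_elim
      case (elim p)
      then have "Q (v p) \<le> c + 1 / real (Suc (snd p))" by linarith
      then show ?case using E_eq[OF vD[of p]] by (metis ereal_less_eq(3))
    qed
    have "((\<lambda>p. c + 1 / real (Suc (snd p))) \<longlongrightarrow> c + 0) (fin_filter M)"
      by (intro tendsto_intros tendsto_fin_filter_snd)
    then show "((\<lambda>p. ereal (c + 1 / real (Suc (snd p)))) \<longlongrightarrow> ereal c) (fin_filter M)" by simp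
  qed
qed

text \<open>\<open>f\<close> itself is a competitor, so the approximations stay below
  \<open>Q f\<close>; the lower bound is semicontinuity of \<open>E\<close> along
  near-minimisers.\<close>

lemma tendsto_moreau:
  assumes f: "\<And>U. U \<in> fin_sets M \<Longrightarrow> f \<in> square_int M U" and fD: "f \<in> D"
  shows "((\<lambda>p. moreau M E p f) \<longlongrightarrow> Q f) (fin_filter M)"
proof -
  have fm: "f \<in> borel_measurable M" by (rule meas[OF fD])
  have fin: "\<forall>\<^sub>F p in fin_filter M. fst p \<in> fin_sets M"
    unfolding eventually_fin_filter by (intro bexI[OF _ fin_sets_empty]) auto
  have le: "\<forall>\<^sub>F p in fin_filter M. moreau M E p f \<le> Q f"
    using fin by eventually_elim (use moreau_le_Q f fD in blast)
  obtain v where vD: "\<And>p. v p \<in> D" and vt: "tconv M v f (fin_filter M)"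
    and vle: "\<forall>\<^sub>F p in fin_filter M. Q (v p) \<le> moreau M E p f + 1 / real (Suc (snd p))"
    by (rule moreau_recovery[OF f fm le], assumption, rule that)
  show ?thesis
  proof (rule order_tendstoI)
    fix a assume a: "a < Q f"
    have "(a + Q f) / 2 < Q f" using a by simp
    then have "ereal ((a + Q f) / 2) < E f" using E_eq[OF fD] by (metis less_ereal.simps(1))
    then have "\<forall>\<^sub>F p in fin_filter M. ereal ((a + Q f) / 2) < E (v p)"
      by (intro lower_semicontD[OF lsc _ fm vt]) (use meas[OF vD] in auto)
    moreover have "\<forall>\<^sub>F p in fin_filter M. 1 / real (Suc (snd p)) < (Q f - a) / 2"
      using a by (intro order_tendstoD(2)[OF tendsto_fin_filter_snd]) simp
    ultimately show "\<forall>\<^sub>F p in fin_filter M. a < moreau M E p f"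
      using vle
    proof eventually_elim
      case (elim p)
      have "(a + Q f) / 2 < Q (v p)" using elim(1) E_eq[OF vD[of p]] by (metis less_ereal.simps(1))
      then show ?case using elim(2,3) by argo
    qed
  next
    fix a assume "Q f < a"
    with le show "\<forall>\<^sub>F p in fin_filter M. moreau M E p f < a" by (auto elim: eventually_mono)
  qed
qed

end

section \<open>Pointwise inequalities for Markovian forms\<close>

lemma sum_fun_apply: "(\<Sum>i\<in>I. f i) x = (\<Sum>i\<in>I. f i x :: real)"
  by (induction I rule: infinite_finite_induct) auto

text \<open>The derivative of \<open>Q (u + t *\<^sub>R v)\<close> at 0 is \<open>2 * B u v\<close>.
  The proof takes \<open>t\<close> so small that the quadratic term cannot compensate a negative
  slope.\<close>

lemma (in quad_space) B_nonneg_if_increasing: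
  assumes uv: "u \<in> D" "v \<in> D" and le: "\<And>t. 0 < t \<Longrightarrow> Q u \<le> Q (u + t *\<^sub>R v)"
  shows "0 \<le> B u v"
proof (rule ccontr)
  assume "\<not> 0 \<le> B u v"
  then have neg: "B u v < 0" by simp
  define t where "t = - B u v / (Q v + 1)"
  have Qv: "0 \<le> Q v" by (rule nonneg[OF uv(2)])
  have t: "0 < t" unfolding t_def using neg Qv by (intro divide_pos_pos) auto
  have "Q (u + t *\<^sub>R v) = Q u + 2 * (t * B u v) + t\<^sup>2 * Q v"
    using Q_add[OF uv(1) mem(3)[OF uv(2)]] B_scale_right[OF uv] hom[OF uv(2)] by simp
  with le[OF t] have "0 \<le> t * (2 * B u v + t * Q v)" by (simp add: power2_eq_square algebra_simps)
  then have 1: "0 \<le> 2 * B u v + t * Q v" using t by (simp add: zero_le_mult_iff)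
  have "t * Q v \<le> t * (Q v + 1)" using t by simp
  also have "\<dots> = - B u v" unfolding t_def using Qv by (simp add: nonzero_eq_divide_eq)
  finally show False using 1 neg by linarith
qed

text \<open>A finite cover of \<open>K\<close> by balls of radius \<open>d\<close>, made disjoint by
  assigning each point to the first ball that contains its image.\<close>

lemma finite_partition_approx:
  fixes F :: "'a \<Rightarrow> 'v::euclidean_space"
  assumes [measurable]: "F \<in> borel_measurable M" and K: "compact K" "\<And>x. x \<in> space M \<Longrightarrow> F x \<in> K" and d: "0 < d"
  obtains N :: nat and y A where "\<And>j. j < N \<Longrightarrow> y j \<in> K" "\<And>j. j < N \<Longrightarrow> A j \<in> sets M"
    "disjoint_family_on A {..<N}" "\<And>x. x \<in> space M \<Longrightarrow> \<exists>j<N. x \<in> A j"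
    "\<And>j x. j < N \<Longrightarrow> x \<in> A j \<Longrightarrow> dist (F x) (y j) < d"
proof -
  have "K \<subseteq> (\<Union>y\<in>K. ball y d)" using d by auto
  then obtain Y where Y: "Y \<subseteq> K" "finite Y" "K \<subseteq> (\<Union>y\<in>Y. ball y d)"
    by (rule compactE_image[OF K(1), rotated]) auto
  obtain h where h: "bij_betw h {0..<card Y} Y" using ex_bij_betw_nat_finite[OF Y(2)] by blast
  define A where "A j = {x \<in> space M. dist (F x) (h j) < d \<and> (\<forall>i<j. \<not> dist (F x) (h i) < d)}" for j
  show ?thesis
  proof (rule that[of "card Y" h A])
    show "h j \<in> K" if "j < card Y" for j using h Y(1) that by (auto simp: bij_betw_def)
    show "A j \<in> sets M" for j unfolding A_def by measurable
    show "disjoint_family_on A {..<card Y}"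
      unfolding disjoint_family_on_def A_def by (auto, metis linorder_neqE_nat)
    show "\<exists>j<card Y. x \<in> A j" if x: "x \<in> space M" for x
    proof -
      obtain z where "z \<in> Y" "dist (F x) z < d" using Y(3) K(2)[OF x] by (auto simp: dist_commute)
      then obtain i where i: "i < card Y" "dist (F x) (h i) < d"
        using h unfolding bij_betw_def by (metis atLeastLessThan_iff imageE)
      define j where "j = (LEAST i. dist (F x) (h i) < d)"
      have "dist (F x) (h j) < d" unfolding j_def by (rule LeastI[of _ i]) (rule i(2))
      moreover have "j \<le> i" unfolding j_def by (rule Least_le) (rule i(2))
      moreover have "\<not> dist (F x) (h k) < d" if "k < j" for k using not_less_Least that unfolding j_def by blast
      ultimately show ?thesis using x i(1) unfolding A_def by (intro exI[of _ j]) auto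
    qed
    show "dist (F x) (h j) < d" if "x \<in> A j" for j x using that by (simp add: A_def)
  qed
qed

context energy
begin

context
  fixes p :: "'a set \<times> nat"
  assumes p: "fst p \<in> fin_sets M"
begin

interpretation m: quad_space "square_int M (fst p)" "moreau M E p" by (rule quad_space_moreau[OF p])

text \<open>The Markov property gives the signs in \<open>B_step_expansion\<close>: nonpositive
  off-diagonal entries and nonnegative killing weights. With these, \<open>diag\<close> and
  \<open>off\<close> make every summand nonnegative after the sum over \<open>R\<close> has been
  moved inside.\<close>

lemma moreau_step_nonneg:
  fixes N :: nat and c :: "'r \<Rightarrow> real" and \<Phi> \<Psi> :: "'r \<Rightarrow> 'v \<Rightarrow> real"
  assumes A: "\<And>j. j < N \<Longrightarrow> A j \<in> sets M" and disj: "disjoint_family_on A {..<N}" and y: "\<And>j. j < N \<Longrightarrow> y j \<in> K"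
    and diag: "\<And>s. s \<in> K \<Longrightarrow> 0 \<le> (\<Sum>r\<in>R. c r * (\<Phi> r s * \<Psi> r s))"
    and off: "\<And>s t. s \<in> K \<Longrightarrow> t \<in> K \<Longrightarrow> 0 \<le> (\<Sum>r\<in>R. c r * ((\<Phi> r s - \<Phi> r t) * (\<Psi> r s - \<Psi> r t)))"
  shows "0 \<le> (\<Sum>r\<in>R. c r * m.B (\<Sum>j<N. \<Phi> r (y j) *\<^sub>R indicator (A j)) (\<Sum>j<N. \<Psi> r (y j) *\<^sub>R indicator (A j)))"
proof -
  define e where "e j = (indicator (A j) :: 'a \<Rightarrow> real)" for j
  have e: "e j \<in> square_int M (fst p)" if "j < N" for j
    unfolding e_def by (rule square_int_bounded(1)[OF _ p, where c = 1]) (use A[OF that] in auto)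
  have off_le: "m.B (e j) (e k) \<le> 0" if jk: "j < N" "k < N" "j \<noteq> k" for j k
  proof -
    have dj: "x \<notin> A j \<or> x \<notin> A k" for x using disj jk unfolding disjoint_family_on_def by blast
    \<comment> \<open>On disjoint sets the unit contraction removes the negative part and returns
      \<open>e j\<close>, so the form cannot decrease in the direction \<open>- e k\<close>.\<close>
    have "moreau M E p (e j) \<le> moreau M E p (e j + t *\<^sub>R - e k)" if "0 < t" for t
    proof -
      have "unit_clamp \<circ> (e j + t *\<^sub>R - e k) = e j"
        using dj that by (auto simp: fun_eq_iff unit_clamp_def e_def indicator_def)
      then show ?thesis
        using moreau_unit_clamp[OF p, of "e j + t *\<^sub>R - e k"] e[OF jk(1)] e[OF jk(2)] m.mem by (metis (no_types, lifting))
    qed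
    then have "0 \<le> m.B (e j) (- e k)" using e jk by (intro m.B_nonneg_if_increasing) auto
    then show ?thesis using m.B_minus_left[OF e[OF jk(2)] e[OF jk(1)]] m.B_commute e jk m.mem by (metis neg_0_le_iff_le)
  qed
  have sum_ge: "0 \<le> m.B (e j) (\<Sum>k<N. e k)" if j: "j < N" for j
  proof -
    have sm: "(\<Sum>k<N. e k) \<in> square_int M (fst p)" using e by (intro m.mem(5)) auto
    have sx: "(\<Sum>k<N. e k) x = indicator (\<Union>k<N. A k) x" for x
      unfolding sum_fun_apply e_def by (rule indicator_UN_disjoint[symmetric, OF finite_lessThan disj])
    \<comment> \<open>The sum is the indicator of a union, so the unit contraction undoes the
      addition of a positive multiple of \<open>e j\<close>.\<close>
    have "moreau M E p (\<Sum>k<N. e k) \<le> moreau M E p ((\<Sum>k<N. e k) + t *\<^sub>R e j)" if "0 < t" for t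
    proof -
      have "unit_clamp \<circ> ((\<Sum>k<N. e k) + t *\<^sub>R e j) = (\<Sum>k<N. e k)"
      proof
        fix x
        show "(unit_clamp \<circ> ((\<Sum>k<N. e k) + t *\<^sub>R e j)) x = (\<Sum>k<N. e k) x"
          unfolding comp_def plus_fun_apply scaleR_fun_apply sx
          using j that by (auto simp: unit_clamp_def e_def indicator_def)
      qed
      then show ?thesis
        using moreau_unit_clamp[OF p, of "(\<Sum>k<N. e k) + t *\<^sub>R e j"] sm e[OF j] m.mem by metis
    qed
    then have "0 \<le> m.B (\<Sum>k<N. e k) (e j)" using e j sm by (intro m.B_nonneg_if_increasing) auto
    then show ?thesis using m.B_commute sm e[OF j] by metis
  qed
  have exp: "m.B (\<Sum>j<N. \<Phi> r (y j) *\<^sub>R e j) (\<Sum>j<N. \<Psi> r (y j) *\<^sub>R e j) =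
    (\<Sum>j<N. \<Phi> r (y j) * \<Psi> r (y j) * m.B (e j) (\<Sum>k<N. e k)) +
    (\<Sum>j<N. \<Sum>k<N. - m.B (e j) (e k) * ((\<Phi> r (y j) - \<Phi> r (y k)) * (\<Psi> r (y j) - \<Psi> r (y k)))) / 2" for r
    by (rule m.B_step_expansion) (use e in auto)
  have "(\<Sum>r\<in>R. c r * m.B (\<Sum>j<N. \<Phi> r (y j) *\<^sub>R e j) (\<Sum>j<N. \<Psi> r (y j) *\<^sub>R e j)) =
     (\<Sum>r\<in>R. \<Sum>j<N. m.B (e j) (\<Sum>k<N. e k) * (c r * (\<Phi> r (y j) * \<Psi> r (y j)))) +
     (\<Sum>r\<in>R. \<Sum>j<N. \<Sum>k<N. - m.B (e j) (e k) * (c r * ((\<Phi> r (y j) - \<Phi> r (y k)) * (\<Psi> r (y j) - \<Psi> r (y k))))) / 2"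
    unfolding exp sum_divide_distrib sum.distrib[symmetric] distrib_left sum_distrib_left
    by (intro sum.cong arg_cong2[where f = "(+)"] refl) (simp_all add: algebra_simps)
  also have "\<dots> = (\<Sum>j<N. m.B (e j) (\<Sum>k<N. e k) * (\<Sum>r\<in>R. c r * (\<Phi> r (y j) * \<Psi> r (y j)))) +
     (\<Sum>j<N. \<Sum>k<N. - m.B (e j) (e k) * (\<Sum>r\<in>R. c r * ((\<Phi> r (y j) - \<Phi> r (y k)) * (\<Psi> r (y j) - \<Psi> r (y k))))) / 2"
  proof -
    have "(\<Sum>r\<in>R. \<Sum>j<N. f r j) = (\<Sum>j<N. \<Sum>r\<in>R. f r j)" for f :: "'r \<Rightarrow> nat \<Rightarrow> real"
      by (rule sum.swap)
    moreover have "(\<Sum>r\<in>R. \<Sum>j<N. \<Sum>k<N. f r j k) = (\<Sum>j<N. \<Sum>k<N. \<Sum>r\<in>R. f r j k)" for f :: "'r \<Rightarrow> nat \<Rightarrow> nat \<Rightarrow> real"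
      by (subst sum.swap, rule sum.cong[OF refl], rule sum.swap)
    ultimately show ?thesis by (simp only: sum_distrib_left)
  qed
  also have "0 \<le> \<dots>"
  proof (intro add_nonneg_nonneg divide_nonneg_nonneg sum_nonneg)
    fix j k assume jk: "j \<in> {..<N}" "k \<in> {..<N}"
    show "0 \<le> - m.B (e j) (e k) * (\<Sum>r\<in>R. c r * ((\<Phi> r (y j) - \<Phi> r (y k)) * (\<Psi> r (y j) - \<Psi> r (y k))))"
    proof (cases "j = k")
      case False
      then show ?thesis using off_le[of j k] jk off[OF y y, of j k] by (intro mult_nonneg_nonneg) auto
    qed simp
  qed (use sum_ge diag y in \<open>auto intro!: mult_nonneg_nonneg\<close>)
  finally show ?thesis unfolding e_def .
qed

text \<open>\<open>F\<close> is approximated uniformly by step functions with values in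
  \<open>K\<close>, and uniform convergence is enough for \<open>moreau\<close>. A vector-valued
  \<open>F\<close> lets several functions, such as \<phi> and \<open>f\<close>, be discretised on
  one partition, so that joint pointwise inequalities apply.\<close>

lemma moreau_master:
  fixes c :: "'r \<Rightarrow> real" and \<Phi> \<Psi> :: "'r \<Rightarrow> 'v::euclidean_space \<Rightarrow> real"
  assumes K: "compact K" and Fm: "F \<in> borel_measurable M" and FK: "\<And>x. x \<in> space M \<Longrightarrow> F x \<in> K"
    and cont: "\<And>r. r \<in> R \<Longrightarrow> continuous_on UNIV (\<Phi> r)" "\<And>r. r \<in> R \<Longrightarrow> continuous_on UNIV (\<Psi> r)"
    and diag: "\<And>s. s \<in> K \<Longrightarrow> 0 \<le> (\<Sum>r\<in>R. c r * (\<Phi> r s * \<Psi> r s))"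
    and off: "\<And>s t. s \<in> K \<Longrightarrow> t \<in> K \<Longrightarrow> 0 \<le> (\<Sum>r\<in>R. c r * ((\<Phi> r s - \<Phi> r t) * (\<Psi> r s - \<Psi> r t)))"
  shows "0 \<le> (\<Sum>r\<in>R. c r * m.B (\<Phi> r \<circ> F) (\<Psi> r \<circ> F))"
proof -
  have "\<exists>(Ny :: nat \<times> (nat \<Rightarrow> 'v)) A. (\<forall>j<fst Ny. snd Ny j \<in> K) \<and> (\<forall>j<fst Ny. A j \<in> sets M) \<and> disjoint_family_on A {..<fst Ny} \<and>
      (\<forall>x\<in>space M. \<exists>j<fst Ny. x \<in> A j) \<and> (\<forall>j<fst Ny. \<forall>x\<in>A j. dist (F x) (snd Ny j) < 1 / real (Suc n))" for n :: nat
  proof -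
    obtain N :: nat and y A where "\<And>j. j < N \<Longrightarrow> y j \<in> K" "\<And>j. j < N \<Longrightarrow> A j \<in> sets M"
      "disjoint_family_on A {..<N}" "\<And>x. x \<in> space M \<Longrightarrow> \<exists>j<N. x \<in> A j"
      "\<And>j x. j < N \<Longrightarrow> x \<in> A j \<Longrightarrow> dist (F x) (y j) < 1 / real (Suc n)"
      by (rule finite_partition_approx[OF Fm K FK, of "1 / real (Suc n)"]) auto
    then show ?thesis by (intro exI[of _ "(N, y)"] exI[of _ A]) auto
  qed
  then obtain Ny :: "nat \<Rightarrow> nat \<times> (nat \<Rightarrow> 'v)" and A where
    NyA: "\<And>n. (\<forall>j<fst (Ny n). snd (Ny n) j \<in> K) \<and> (\<forall>j<fst (Ny n). A n j \<in> sets M) \<and>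
      disjoint_family_on (A n) {..<fst (Ny n)} \<and> (\<forall>x\<in>space M. \<exists>j<fst (Ny n). x \<in> A n j) \<and>
      (\<forall>j<fst (Ny n). \<forall>x\<in>A n j. dist (F x) (snd (Ny n) j) < 1 / real (Suc n))"
    by metis
  define N where "N n = fst (Ny n)" for n
  define y where "y n = snd (Ny n)" for n
  have yK: "y n j \<in> K" if "j < N n" for n j using NyA[of n] that by (simp add: N_def y_def)
  have A: "A n j \<in> sets M" if "j < N n" for n j using NyA[of n] that by (simp add: N_def)
  have disj: "disjoint_family_on (A n) {..<N n}" for n using NyA[of n] by (simp add: N_def)
  have cover: "\<exists>j<N n. x \<in> A n j" if "x \<in> space M" for n x using NyA[of n] that by (simp add: N_def)
  have near: "dist (F x) (y n j) < 1 / real (Suc n)" if "j < N n" "x \<in> A n j" for n j x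
    using NyA[of n] that by (simp add: N_def y_def)
  define G where "G n h = (\<Sum>j<N n. h (y n j) *\<^sub>R indicator (A n j) :: 'a \<Rightarrow> real)" for n and h :: "'v \<Rightarrow> real"
  have G_eq: "G n h x = h (y n j)" if "j < N n" "x \<in> A n j" for n h x j
  proof -
    have "G n h x = (\<Sum>k<N n. h (y n k) * indicator (A n k) x)" by (simp add: G_def sum_fun_apply)
    also have "\<dots> = (\<Sum>k\<in>{j}. h (y n k) * indicator (A n k) x)"
    proof (rule sum.mono_neutral_right)
      show "\<forall>k\<in>{..<N n} - {j}. h (y n k) * indicator (A n k) x = 0"
        using disj[of n] that unfolding disjoint_family_on_def by (auto simp: indicator_def)
    qed (use that in auto)
    finally show ?thesis using that by simp
  qed
  have Gm: "G n h \<in> square_int M (fst p)" for n h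
    unfolding G_def
  proof (intro m.mem(5) m.mem(3))
    fix j assume "j \<in> {..<N n}"
    then show "indicator (A n j) \<in> square_int M (fst p)"
      using A[of j n] by (intro square_int_bounded(1)[OF _ p, where c = 1]) auto
  qed
  have hF: "h \<circ> F \<in> square_int M (fst p)" and hlim: "(\<lambda>n. moreau M E p (G n h - (h \<circ> F))) \<longlonglongrightarrow> 0"
    if h: "continuous_on UNIV h" for h :: "'v \<Rightarrow> real"
  proof -
    have hK: "continuous_on K h" using h continuous_on_subset by blast
    have "bounded (h ` K)" by (rule compact_imp_bounded[OF compact_continuous_image[OF hK K]])
    then obtain b where b: "\<And>s. s \<in> K \<Longrightarrow> \<bar>h s\<bar> \<le> b" unfolding bounded_iff by auto
    have hm: "h \<circ> F \<in> borel_measurable M"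
      unfolding comp_def by (rule borel_measurable_continuous_on[OF h Fm])
    show hs: "h \<circ> F \<in> square_int M (fst p)"
      by (rule square_int_bounded(1)[OF hm p, where c = b]) (use b FK in \<open>auto intro!: AE_I2\<close>)
    have dm: "G n h - (h \<circ> F) \<in> square_int M (fst p)" for n by (rule m.mem(2)[OF Gm hs])
    have uc: "uniformly_continuous_on K h" by (rule compact_uniformly_continuous[OF hK K])
    show "(\<lambda>n. moreau M E p (G n h - (h \<circ> F))) \<longlonglongrightarrow> 0"
    proof (rule tendstoI)
      fix e :: real assume e: "0 < e"
      \<comment> \<open>The factor in \<open>moreau_le_bounded\<close>: a uniform error \<epsilon>
        costs at most \<open>\<epsilon>\<^sup>2 * W\<close>.\<close>
      define W where "W = real (Suc (snd p)) * measure M (fst p)"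
      define \<epsilon> where "\<epsilon> = sqrt (e / (W + 1))"
      have W: "0 \<le> W" by (simp add: W_def)
      have eps: "0 < \<epsilon>" using e W by (simp add: \<epsilon>_def)
      have eps2: "\<epsilon>\<^sup>2 * W < e"
      proof -
        have "\<epsilon>\<^sup>2 = e / (W + 1)" using e W by (simp add: \<epsilon>_def)
        then show ?thesis using e W by (simp add: pos_divide_less_eq)
      qed
      obtain d where d: "0 < d" "\<And>s t. s \<in> K \<Longrightarrow> t \<in> K \<Longrightarrow> dist t s < d \<Longrightarrow> dist (h t) (h s) < \<epsilon>"
        using uc eps unfolding uniformly_continuous_on_def by blast
      have "\<forall>\<^sub>F n in sequentially. 1 / real (Suc n) < d"
        using order_tendstoD(2)[OF LIMSEQ_inverse_real_of_nat d(1)] by (simp add: inverse_eq_divide)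
      then show "\<forall>\<^sub>F n in sequentially. dist (moreau M E p (G n h - (h \<circ> F))) 0 < e"
      proof eventually_elim
        case (elim n)
        have "AE x in M. \<bar>(G n h - (h \<circ> F)) x\<bar> \<le> \<epsilon>"
        proof (rule AE_I2)
          fix x assume x: "x \<in> space M"
          then obtain j where j: "j < N n" "x \<in> A n j" using cover by blast
          have "dist (F x) (y n j) < d" using near[OF j] elim by simp
          then have "dist (h (F x)) (h (y n j)) < \<epsilon>" using d(2)[OF yK[OF j(1)] FK[OF x]] by blast
          then show "\<bar>(G n h - (h \<circ> F)) x\<bar> \<le> \<epsilon>" using G_eq[OF j] by (simp add: dist_real_def)
        qed
        from moreau_le_bounded[of p "G n h - (h \<circ> F)", OF p square_int_measurable[OF dm] this]
        have "moreau M E p (G n h - (h \<circ> F)) \<le> \<epsilon>\<^sup>2 * W" by (simp add: W_def mult_ac)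
        then show ?case using eps2 m.nonneg[OF dm] by (intro dist_zero_less) auto
      qed
    qed
  qed
  have "(\<lambda>n. \<Sum>r\<in>R. c r * m.B (G n (\<Phi> r)) (G n (\<Psi> r))) \<longlonglongrightarrow> (\<Sum>r\<in>R. c r * m.B (\<Phi> r \<circ> F) (\<Psi> r \<circ> F))"
    by (intro tendsto_sum tendsto_mult tendsto_const m.tendsto_B Gm hF hlim cont)
  moreover have "0 \<le> (\<Sum>r\<in>R. c r * m.B (G n (\<Phi> r)) (G n (\<Psi> r)))" for n
    unfolding G_def by (rule moreau_step_nonneg[OF A disj yK diag off])
  ultimately show ?thesis by (intro LIMSEQ_le_const) auto
qed

end

lemma continuous_compose_square_int:
  fixes h :: "'v::euclidean_space \<Rightarrow> real"
  assumes K: "compact K" and Fm: "F \<in> borel_measurable M" and FK: "\<And>x. x \<in> space M \<Longrightarrow> F x \<in> K"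
    and h: "continuous_on UNIV h" and U: "U \<in> fin_sets M"
  shows "h \<circ> F \<in> square_int M U"
proof -
  have "bounded (h ` K)"
    using continuous_on_subset[OF h] by (intro compact_imp_bounded compact_continuous_image K) auto
  then obtain b where b: "\<And>s. s \<in> K \<Longrightarrow> \<bar>h s\<bar> \<le> b" unfolding bounded_iff by auto
  have hm: "h \<circ> F \<in> borel_measurable M"
    unfolding comp_def by (rule borel_measurable_continuous_on[OF h Fm])
  show ?thesis
    by (rule square_int_bounded(1)[OF hm U, where c = b]) (use b FK in \<open>auto intro!: AE_I2\<close>)
qed

section \<open>From the approximations to the energy form\<close>

lemma E_cong_AE:
  "u \<in> borel_measurable M \<Longrightarrow> v \<in> borel_measurable M \<Longrightarrow> AE x in M. u x = v x \<Longrightarrow> E u = E v"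
  by (rule quadratic_form_cong_AE[OF qf])

lemma D_cong_AE:
  assumes "u \<in> D" "v \<in> borel_measurable M" "AE x in M. u x = v x"
  shows "v \<in> D"
  using E_cong_AE[OF meas[OF assms(1)] assms(2,3)] assms(1) by (simp add: form_domain_def)

lemma B_cong_AE:
  assumes "u \<in> D" "v \<in> D" "u' \<in> D" "v' \<in> D" "AE x in M. u x = u' x" "AE x in M. v x = v' x"
  shows "B u v = B u' v'"
proof -
  have "E (u + v) = E (u' + v')"
  proof (rule E_cong_AE)
    show "AE x in M. (u + v) x = (u' + v') x" using assms(5,6) by eventually_elim simp
  qed (use assms meas mem(1) in blast)+
  moreover have "E (u - v) = E (u' - v')"
  proof (rule E_cong_AE)
    show "AE x in M. (u - v) x = (u' - v') x" using assms(5,6) by eventually_elim simp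
  qed (use assms meas mem(2) in blast)+
  ultimately show ?thesis unfolding B_def by simp
qed

lemma retract_AE:
  fixes F :: "'a \<Rightarrow> 'v::euclidean_space"
  assumes K: "compact K" "0 \<in> K" and Fm [measurable]: "F \<in> borel_measurable M" and FK: "AE x in M. F x \<in> K"
  obtains F' where "F' \<in> borel_measurable M" "\<And>x. F' x \<in> K" "AE x in M. F' x = F x"
proof
  have [measurable]: "K \<in> sets borel" using K(1) by (simp add: borel_compact)
  show "(\<lambda>x. if F x \<in> K then F x else 0) \<in> borel_measurable M" by measurable
  show "AE x in M. (if F x \<in> K then F x else 0) = F x" using FK by eventually_elim simp
qed (use K in auto)

text \<open>The approximations converge to \<open>Q\<close> on the sums and differences that enter
  the polarisation, so the inequality survives the limit. Here every composition has to lie in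
  \<open>D\<close>; producing membership is left to \<open>energy_domination\<close>.\<close>

theorem energy_bilinear_master:
  fixes c :: "'r \<Rightarrow> real" and \<Phi> \<Psi> :: "'r \<Rightarrow> 'v::euclidean_space \<Rightarrow> real"
  assumes K: "compact K" "0 \<in> K" and Fm: "F \<in> borel_measurable M" and FK: "AE x in M. F x \<in> K"
    and cont: "\<And>r. r \<in> R \<Longrightarrow> continuous_on UNIV (\<Phi> r)" "\<And>r. r \<in> R \<Longrightarrow> continuous_on UNIV (\<Psi> r)"
    and dom: "\<And>r. r \<in> R \<Longrightarrow> \<Phi> r \<circ> F \<in> D" "\<And>r. r \<in> R \<Longrightarrow> \<Psi> r \<circ> F \<in> D"
    and diag: "\<And>s. s \<in> K \<Longrightarrow> 0 \<le> (\<Sum>r\<in>R. c r * (\<Phi> r s * \<Psi> r s))"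
    and off: "\<And>s t. s \<in> K \<Longrightarrow> t \<in> K \<Longrightarrow> 0 \<le> (\<Sum>r\<in>R. c r * ((\<Phi> r s - \<Phi> r t) * (\<Psi> r s - \<Psi> r t)))"
  shows "0 \<le> (\<Sum>r\<in>R. c r * B (\<Phi> r \<circ> F) (\<Psi> r \<circ> F))"
proof -
  obtain F' where F'm: "F' \<in> borel_measurable M" and F'K: "\<And>x. F' x \<in> K" and ae: "AE x in M. F' x = F x"
    by (rule retract_AE[OF K Fm FK], rule that)
  have comp_ae: "AE x in M. (h \<circ> F) x = (h \<circ> F') x" for h :: "'v \<Rightarrow> real"
    using ae by eventually_elim simp
  have comp_m: "h \<circ> F' \<in> borel_measurable M" if "continuous_on UNIV h" for h :: "'v \<Rightarrow> real"
    unfolding comp_def by (rule borel_measurable_continuous_on[OF that F'm])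
  have dom': "\<Phi> r \<circ> F' \<in> D" "\<Psi> r \<circ> F' \<in> D" if "r \<in> R" for r
    by (rule D_cong_AE[OF dom(1)[OF that] comp_m[OF cont(1)[OF that]] comp_ae],
        rule D_cong_AE[OF dom(2)[OF that] comp_m[OF cont(2)[OF that]] comp_ae])
  have sq: "h \<circ> F' \<in> square_int M U" if "continuous_on UNIV h" "U \<in> fin_sets M" for h :: "'v \<Rightarrow> real" and U
    by (rule continuous_compose_square_int[OF K(1) F'm F'K that])
  have fin: "\<forall>\<^sub>F p in fin_filter M. fst p \<in> fin_sets M"
    unfolding eventually_fin_filter by (intro bexI[OF _ fin_sets_empty]) auto
  have sub: "subspace (square_int M U)" if "U \<in> fin_sets M" for U
    using quad_space.sub[OF quad_space_sq_norm[OF fin_sets_sets[OF that], of 1]] by simp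
  let ?b = "\<lambda>p u v. (moreau M E p (u + v) - moreau M E p (u - v)) / 4"
  have lim: "((\<lambda>p. ?b p u v) \<longlongrightarrow> B u v) (fin_filter M)"
    if "\<And>U. U \<in> fin_sets M \<Longrightarrow> u \<in> square_int M U" "\<And>U. U \<in> fin_sets M \<Longrightarrow> v \<in> square_int M U" "u \<in> D" "v \<in> D" for u v
    unfolding B_def using that sub by (intro tendsto_intros tendsto_moreau subspace_add subspace_diff mem(1,2)) auto
  have "((\<lambda>p. \<Sum>r\<in>R. c r * ?b p (\<Phi> r \<circ> F') (\<Psi> r \<circ> F')) \<longlongrightarrow> (\<Sum>r\<in>R. c r * B (\<Phi> r \<circ> F') (\<Psi> r \<circ> F'))) (fin_filter M)"
    by (intro tendsto_sum tendsto_mult tendsto_const lim sq cont dom') auto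
  moreover have "\<forall>\<^sub>F p in fin_filter M. 0 \<le> (\<Sum>r\<in>R. c r * ?b p (\<Phi> r \<circ> F') (\<Psi> r \<circ> F'))"
    using fin
  proof eventually_elim
    case (elim p)
    from moreau_master[OF elim K(1) F'm F'K cont diag off]
    show ?case by (simp add: quad_space.B_def[OF quad_space_moreau[OF elim]])
  qed
  ultimately have "0 \<le> (\<Sum>r\<in>R. c r * B (\<Phi> r \<circ> F') (\<Psi> r \<circ> F'))"
    by (rule tendsto_lowerbound) simp
  also have "\<dots> = (\<Sum>r\<in>R. c r * B (\<Phi> r \<circ> F) (\<Psi> r \<circ> F))"
    by (intro sum.cong refl arg_cong2[where f = "(*)"] B_cong_AE[symmetric] dom dom' comp_ae)
  finally show ?thesis .
qed

text \<open>As \<open>h \<circ> F\<close> is not yet known to lie in \<open>D\<close>, the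
  inequality is established for the approximations, which are finite on all bounded functions, and
  \<open>E_le_moreau\<close> concludes.\<close>

theorem energy_domination:
  fixes c :: "'r \<Rightarrow> real" and \<Phi> :: "'r \<Rightarrow> 'v::euclidean_space \<Rightarrow> real"
  assumes K: "compact K" "0 \<in> K" and Fm: "F \<in> borel_measurable M" and FK: "AE x in M. F x \<in> K"
    and cont0: "continuous_on UNIV h" and cont: "\<And>r. r \<in> R \<Longrightarrow> continuous_on UNIV (\<Phi> r)"
    and dom: "\<And>r. r \<in> R \<Longrightarrow> \<Phi> r \<circ> F \<in> D" and c: "\<And>r. r \<in> R \<Longrightarrow> 0 \<le> c r" and R: "finite R"
    and diag: "\<And>s. s \<in> K \<Longrightarrow> (h s)\<^sup>2 \<le> (\<Sum>r\<in>R. c r * (\<Phi> r s)\<^sup>2)"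
    and off: "\<And>s t. s \<in> K \<Longrightarrow> t \<in> K \<Longrightarrow> (h s - h t)\<^sup>2 \<le> (\<Sum>r\<in>R. c r * (\<Phi> r s - \<Phi> r t)\<^sup>2)"
  shows "h \<circ> F \<in> D \<and> Q (h \<circ> F) \<le> (\<Sum>r\<in>R. c r * Q (\<Phi> r \<circ> F))"
proof -
  obtain F' where F'm: "F' \<in> borel_measurable M" and F'K: "\<And>x. F' x \<in> K" and ae: "AE x in M. F' x = F x"
    by (rule retract_AE[OF K Fm FK], rule that)
  have comp_ae: "AE x in M. (h \<circ> F) x = (h \<circ> F') x" for h :: "'v \<Rightarrow> real"
    using ae by eventually_elim simp
  have comp_m: "h \<circ> F' \<in> borel_measurable M" "h \<circ> F \<in> borel_measurable M" if "continuous_on UNIV h" for h :: "'v \<Rightarrow> real"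
    unfolding comp_def by (rule borel_measurable_continuous_on[OF that F'm], rule borel_measurable_continuous_on[OF that Fm])
  have dom': "\<Phi> r \<circ> F' \<in> D" if "r \<in> R" for r
    by (rule D_cong_AE[OF dom[OF that] comp_m(1)[OF cont[OF that]] comp_ae])
  have Q': "Q (\<Phi> r \<circ> F') = Q (\<Phi> r \<circ> F)" if "r \<in> R" for r
    using E_cong_AE[of "\<Phi> r \<circ> F" "\<Phi> r \<circ> F'", OF meas[OF dom[OF that]] meas[OF dom'[OF that]] comp_ae]
    by (simp only:)
  have sq: "h \<circ> F' \<in> square_int M U" if "continuous_on UNIV h" "U \<in> fin_sets M" for h :: "'v \<Rightarrow> real" and U
    by (rule continuous_compose_square_int[OF K(1) F'm F'K that])
  have fin: "\<forall>\<^sub>F p in fin_filter M. fst p \<in> fin_sets M"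
    unfolding eventually_fin_filter by (intro bexI[OF _ fin_sets_empty]) auto
  have "E (h \<circ> F') \<le> ereal (\<Sum>r\<in>R. c r * Q (\<Phi> r \<circ> F'))"
  proof (rule E_le_moreau[OF sq[OF cont0] comp_m(1)[OF cont0]])
    show "\<forall>\<^sub>F p in fin_filter M. moreau M E p (h \<circ> F') \<le> (\<Sum>r\<in>R. c r * Q (\<Phi> r \<circ> F'))"
      using fin
    proof eventually_elim
      case (elim p)
      interpret m: quad_space "square_int M (fst p)" "moreau M E p" by (rule quad_space_moreau[OF elim])
      \<comment> \<open>The index \<open>None\<close> carries \<open>h\<close> with coefficient -1,
        which turns domination into the nonnegativity of one combination.\<close>
      let ?R = "insert None (Some ` R)"
      let ?f = "case_option h \<Phi>" and ?c = "case_option (- 1) c"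
      have split: "(\<Sum>r\<in>?R. g r) = g None + (\<Sum>r\<in>R. g (Some r))" for g :: "'r option \<Rightarrow> real"
        using R by (subst sum.insert) (auto simp: sum.reindex)
      have "0 \<le> (\<Sum>r\<in>?R. ?c r * m.B (?f r \<circ> F') (?f r \<circ> F'))"
      proof (rule moreau_master[OF elim K(1) F'm F'K])
        show "0 \<le> (\<Sum>r\<in>?R. ?c r * (?f r s * ?f r s))" if "s \<in> K" for s
          using diag[OF that] unfolding split by (simp add: power2_eq_square)
        show "0 \<le> (\<Sum>r\<in>?R. ?c r * ((?f r s - ?f r t) * (?f r s - ?f r t)))" if "s \<in> K" "t \<in> K" for s t
          using off[OF that] unfolding split by (simp add: power2_eq_square)
      qed (use cont0 cont in auto)
      then have "m.B (h \<circ> F') (h \<circ> F') \<le> (\<Sum>r\<in>R. c r * m.B (\<Phi> r \<circ> F') (\<Phi> r \<circ> F'))"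
        unfolding split by simp
      also have "\<dots> \<le> (\<Sum>r\<in>R. c r * Q (\<Phi> r \<circ> F'))"
      proof (intro sum_mono mult_left_mono c)
        fix r assume r: "r \<in> R"
        have "\<Phi> r \<circ> F' \<in> square_int M (fst p)" by (rule sq[OF cont[OF r] elim])
        then show "m.B (\<Phi> r \<circ> F') (\<Phi> r \<circ> F') \<le> Q (\<Phi> r \<circ> F')"
          using moreau_le_Q[OF elim _ dom'[OF r]] by (simp only: m.B_self)
      qed
      finally show ?case using m.B_self[OF sq[OF cont0 elim]] by simp
    qed
  qed
  moreover have "E (h \<circ> F') = E (h \<circ> F)"
    by (rule E_cong_AE[OF comp_m[OF cont0] ]) (use ae in eventually_elim, simp)
  moreover have "(\<Sum>r\<in>R. c r * Q (\<Phi> r \<circ> F')) = (\<Sum>r\<in>R. c r * Q (\<Phi> r \<circ> F))"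
    by (intro sum.cong refl arg_cong2[where f = "(*)"] Q')
  ultimately show ?thesis using E_leD by metis
qed

end

section \<open>Contractions and products\<close>

definition truncate :: "real \<Rightarrow> real \<Rightarrow> real" where "truncate c x = max (- c) (min c x)"

lemma truncate_lipschitz: "\<bar>truncate c x - truncate c y\<bar> \<le> \<bar>x - y\<bar>"
  unfolding truncate_def by auto

lemma truncate_zero [simp]: "0 \<le> c \<Longrightarrow> truncate c 0 = 0"
  unfolding truncate_def by auto

lemma truncate_eq: "\<bar>x\<bar> \<le> c \<Longrightarrow> truncate c x = x"
  unfolding truncate_def by auto

lemma truncate_bound: "0 \<le> c \<Longrightarrow> \<bar>truncate c x\<bar> \<le> c"
  unfolding truncate_def by auto

lemma continuous_truncate: "continuous_on UNIV (truncate c)"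
  unfolding truncate_def by (intro continuous_intros)

lemma truncate_measurable: "f \<in> borel_measurable M \<Longrightarrow> truncate c \<circ> f \<in> borel_measurable M"
  unfolding comp_def by (rule borel_measurable_continuous_on[OF continuous_truncate])

lemma tendsto_truncate: "(\<lambda>n. truncate (real (Suc n)) x) \<longlonglongrightarrow> x"
proof (rule tendsto_eventually)
  obtain N where N: "\<bar>x\<bar> \<le> real N" using real_arch_simple by blast
  show "\<forall>\<^sub>F n in sequentially. truncate (real (Suc n)) x = x"
    using eventually_ge_at_top[of N]
  proof eventually_elim
    case (elim n)
    have "real N \<le> real n" using elim by simp
    then show ?case using N by (intro truncate_eq) simp
  qed
qed

lemma lipschitz_continuous:
  fixes C :: "real \<Rightarrow> real"
  assumes "\<And>x y. \<bar>C x - C y\<bar> \<le> \<bar>x - y\<bar>"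
  shows "continuous_on UNIV C"
proof (rule continuous_onI)
  fix x e :: real assume "0 < e"
  then show "\<exists>d>0. \<forall>x'\<in>UNIV. dist x' x < d \<longrightarrow> dist (C x') (C x) \<le> e"
    by (intro exI[of _ e] conjI ballI impI)
      (auto simp: dist_real_def intro: less_imp_le[OF le_less_trans[OF assms]])
qed

context energy
begin

text \<open>The transfer from numbers to energies for an explicit list of coefficients and pairs of
  functions: a concrete claim is entered as a list, and \<open>diag\<close> and \<open>off\<close>
  become inequalities between real numbers.\<close>

lemma bilinear_list:
  fixes Ps :: "(real \<times> ('v::euclidean_space \<Rightarrow> real) \<times> ('v \<Rightarrow> real)) list"
  assumes K: "compact K" "0 \<in> K" and Fm: "F \<in> borel_measurable M" and FK: "AE x in M. F x \<in> K"
    and P: "\<And>c \<Phi> \<Psi>. (c, \<Phi>, \<Psi>) \<in> set Ps \<Longrightarrow> continuous_on UNIV \<Phi> \<and> continuous_on UNIV \<Psi> \<and>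
      (\<lambda>x. \<Phi> (F x)) \<in> D \<and> (\<lambda>x. \<Psi> (F x)) \<in> D"
    and diag: "\<And>s. s \<in> K \<Longrightarrow> 0 \<le> (\<Sum>(c, \<Phi>, \<Psi>)\<leftarrow>Ps. c * (\<Phi> s * \<Psi> s))"
    and off: "\<And>s t. s \<in> K \<Longrightarrow> t \<in> K \<Longrightarrow> 0 \<le> (\<Sum>(c, \<Phi>, \<Psi>)\<leftarrow>Ps. c * ((\<Phi> s - \<Phi> t) * (\<Psi> s - \<Psi> t)))"
  shows "0 \<le> (\<Sum>(c, \<Phi>, \<Psi>)\<leftarrow>Ps. c * B (\<lambda>x. \<Phi> (F x)) (\<lambda>x. \<Psi> (F x)))"
proof -
  have conv: "(\<Sum>(c, \<Phi>, \<Psi>)\<leftarrow>Ps. g c \<Phi> \<Psi>) =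
    (\<Sum>i = 0..<length Ps. g (fst (Ps ! i)) (fst (snd (Ps ! i))) (snd (snd (Ps ! i))))" for g :: "_ \<Rightarrow> _ \<Rightarrow> _ \<Rightarrow> real"
    by (simp add: sum_list_sum_nth case_prod_beta)
  have P': "continuous_on UNIV (fst (snd (Ps ! i)))" "continuous_on UNIV (snd (snd (Ps ! i)))"
    "fst (snd (Ps ! i)) \<circ> F \<in> D" "snd (snd (Ps ! i)) \<circ> F \<in> D" if "i \<in> {0..<length Ps}" for i
    using P[of "fst (Ps ! i)" "fst (snd (Ps ! i))" "snd (snd (Ps ! i))"] that by (auto simp: comp_def)
  have "0 \<le> (\<Sum>i = 0..<length Ps. fst (Ps ! i) * B (fst (snd (Ps ! i)) \<circ> F) (snd (snd (Ps ! i)) \<circ> F))"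
    by (rule energy_bilinear_master[OF K Fm FK P']) (use diag off in \<open>simp_all add: conv\<close>)
  then show ?thesis unfolding conv comp_def .
qed

lemma domination2:
  fixes F :: "'a \<Rightarrow> 'v::euclidean_space"
  assumes K: "compact K" "0 \<in> K" and Fm: "F \<in> borel_measurable M" and FK: "AE x in M. F x \<in> K"
    and cont: "continuous_on UNIV h" "continuous_on UNIV \<Phi>" "continuous_on UNIV \<Psi>"
    and dom: "(\<lambda>x. \<Phi> (F x)) \<in> D" "(\<lambda>x. \<Psi> (F x)) \<in> D" and c: "0 \<le> a" "0 \<le> b"
    and diag: "\<And>s. s \<in> K \<Longrightarrow> (h s)\<^sup>2 \<le> a * (\<Phi> s)\<^sup>2 + b * (\<Psi> s)\<^sup>2"
    and off: "\<And>s t. s \<in> K \<Longrightarrow> t \<in> K \<Longrightarrow> (h s - h t)\<^sup>2 \<le> a * (\<Phi> s - \<Phi> t)\<^sup>2 + b * (\<Psi> s - \<Psi> t)\<^sup>2"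
  shows "(\<lambda>x. h (F x)) \<in> D" "Q (\<lambda>x. h (F x)) \<le> a * Q (\<lambda>x. \<Phi> (F x)) + b * Q (\<lambda>x. \<Psi> (F x))"
proof -
  let ?c = "\<lambda>r. if r then a else b" and ?P = "\<lambda>r. if r then \<Phi> else \<Psi>"
  have s: "(\<Sum>r\<in>UNIV. g r) = g True + g False" for g :: "bool \<Rightarrow> real" by (simp add: UNIV_bool)
  have "h \<circ> F \<in> D \<and> Q (h \<circ> F) \<le> (\<Sum>r\<in>UNIV. ?c r * Q (?P r \<circ> F))"
    by (rule energy_domination[OF K Fm FK cont(1)])
      (use cont dom c diag off in \<open>auto simp: s comp_def\<close>)
  then show "(\<lambda>x. h (F x)) \<in> D" "Q (\<lambda>x. h (F x)) \<le> a * Q (\<lambda>x. \<Phi> (F x)) + b * Q (\<lambda>x. \<Psi> (F x))"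
    unfolding s by (simp_all add: comp_def)
qed

lemma contraction_bounded:
  assumes f: "f \<in> D" and bnd: "AE x in M. \<bar>f x\<bar> \<le> b"
    and C: "\<And>x y. \<bar>C x - C y\<bar> \<le> \<bar>x - y\<bar>" "C 0 = 0"
  shows "C \<circ> f \<in> D" "Q (C \<circ> f) \<le> Q f"
proof -
  have sq: "(C s - C t)\<^sup>2 \<le> (s - t)\<^sup>2" for s t using C(1)[of s t] by (simp add: abs_le_square_iff[symmetric])
  have cont: "continuous_on UNIV C" by (rule lipschitz_continuous[OF C(1)])
  \<comment> \<open>\<open>max b 0\<close> keeps 0 in the interval even if \<open>b\<close> is
    negative.\<close>
  have ae: "AE x in M. f x \<in> {- max b 0..max b 0}"
    using bnd by eventually_elim auto
  note d = domination2[of "{- max b 0..max b 0}" f C "\<lambda>s. s" "\<lambda>s. s" 1 0, OF _ _ meas[OF f] ae cont]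
  show "C \<circ> f \<in> D" "Q (C \<circ> f) \<le> Q f"
    unfolding comp_def
    using d f sq sq[of _ 0] C(2) by auto
qed

lemma E_unit_clamp:
  assumes f: "f \<in> borel_measurable M"
  shows "E (unit_clamp \<circ> f) \<le> E f"
proof -
  have "\<exists>C. eps_cutoff (1 / real (Suc n)) C \<and> (\<forall>f\<in>borel_measurable M. E (C \<circ> f) \<le> E f)" for n
    using energy unfolding energy_form_def markovian_def by simp
  then obtain C where C: "\<And>n. eps_cutoff (1 / real (Suc n)) (C n)"
    and CE: "\<And>n f. f \<in> borel_measurable M \<Longrightarrow> E (C n \<circ> f) \<le> E f" by metis
  have Cm: "C n \<circ> f \<in> borel_measurable M" for n
  proof -
    have "mono (C n)" using C[of n] by (simp add: eps_cutoff_def)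
    then show ?thesis unfolding comp_def using borel_measurable_mono f by measurable
  qed
  have "tconv M (\<lambda>n. C n \<circ> f) (unit_clamp \<circ> f) sequentially"
  proof (rule tconv_pointwise[OF Cm unit_clamp_measurable[OF f]])
    fix x
    have le: "norm ((C n \<circ> f) x - (unit_clamp \<circ> f) x) \<le> 1 / real (Suc n)" for n
      using eps_cutoff_unit_clamp[OF C[of n], of "f x"] by (simp add: abs_minus_commute)
    have "(\<lambda>n. 1 / real (Suc n)) \<longlonglongrightarrow> 0"
      using LIMSEQ_inverse_real_of_nat by (simp add: inverse_eq_divide)
    then have "(\<lambda>n. (C n \<circ> f) x - (unit_clamp \<circ> f) x) \<longlonglongrightarrow> 0"
      by (rule Lim_null_comparison[OF always_eventually[OF allI[OF le]]])
    then show "(\<lambda>n. (C n \<circ> f) x) \<longlonglongrightarrow> (unit_clamp \<circ> f) x" by (rule LIM_zero_cancel)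
  qed
  then show ?thesis
    by (rule lower_semicont_le[OF lsc _ unit_clamp_measurable[OF f] _ sequentially_bot _ tendsto_const, rotated])
      (use Cm CE[OF f] in auto)
qed

text \<open>The unit contraction rescaled to the interval from 0 to \<open>n\<close>. It asks for no
  bound on \<open>f\<close>, in contrast to \<open>contraction_bounded\<close>, and so starts the
  passage to unbounded functions.\<close>

lemma pos_part_cut:
  assumes f: "f \<in> D" and n: "0 < n"
  shows "(\<lambda>x. min n (max 0 (f x))) \<in> D" "Q (\<lambda>x. min n (max 0 (f x))) \<le> Q f"
proof -
  have sm: "(1 / n) *\<^sub>R f \<in> D" using f by auto
  have "E (unit_clamp \<circ> ((1 / n) *\<^sub>R f)) \<le> ereal (Q ((1 / n) *\<^sub>R f))"
    using E_unit_clamp[OF meas[OF sm]] E_eq[OF sm] by metis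
  then have u: "unit_clamp \<circ> ((1 / n) *\<^sub>R f) \<in> D" "Q (unit_clamp \<circ> ((1 / n) *\<^sub>R f)) \<le> Q ((1 / n) *\<^sub>R f)"
    using E_leD by blast+
  have eq: "(\<lambda>x. min n (max 0 (f x))) = n *\<^sub>R (unit_clamp \<circ> ((1 / n) *\<^sub>R f))"
  proof
    fix x
    have "n * min 1 (max 0 (f x / n)) = min n (max 0 (f x))"
      using n by (auto simp: min_def max_def field_simps)
    then show "min n (max 0 (f x)) = (n *\<^sub>R (unit_clamp \<circ> ((1 / n) *\<^sub>R f))) x"
      by (simp add: unit_clamp_def)
  qed
  show "(\<lambda>x. min n (max 0 (f x))) \<in> D" unfolding eq by (rule mem(3)[OF u(1)])
  have "Q (n *\<^sub>R (unit_clamp \<circ> ((1 / n) *\<^sub>R f))) \<le> n\<^sup>2 * Q ((1 / n) *\<^sub>R f)"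
    unfolding hom[OF u(1)] using u(2) by (intro mult_left_mono) auto
  also have "\<dots> = Q f" using n hom[OF f, of "1/n"] by (simp add: power_divide)
  finally show "Q (\<lambda>x. min n (max 0 (f x))) \<le> Q f" unfolding eq .
qed

lemma tendsto_min_Suc: "(\<lambda>n. min (real (Suc n)) x) \<longlonglongrightarrow> x"
proof (rule tendsto_eventually)
  obtain N where N: "x \<le> real N" using real_arch_simple by blast
  show "\<forall>\<^sub>F n in sequentially. min (real (Suc n)) x = x"
    using eventually_ge_at_top[of N]
  proof eventually_elim
    case (elim n)
    have "real N \<le> real n" using elim by simp
    then show ?case using N by auto
  qed
qed

lemma pos_part:
  assumes f: "f \<in> D"
  shows "(\<lambda>x. max 0 (f x)) \<in> D" "Q (\<lambda>x. max 0 (f x)) \<le> Q f"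
    "(\<lambda>n. Q ((\<lambda>x. min (real (Suc n)) (max 0 (f x))) - (\<lambda>x. max 0 (f x)))) \<longlonglongrightarrow> 0"
proof -
  let ?v = "\<lambda>n x. min (real (Suc n)) (max 0 (f x))" and ?g = "\<lambda>x. max 0 (f x)"
  have fm: "f \<in> borel_measurable M" by (rule meas[OF f])
  have v: "?v n \<in> D" "Q (?v n) \<le> Q f" for n using pos_part_cut[OF f] by simp_all
  have gm: "?g \<in> borel_measurable M"
    using fm by (intro borel_measurable_max borel_measurable_const)
  have t: "tconv M ?v ?g sequentially"
    by (rule tconv_pointwise[OF meas[OF v(1)] gm tendsto_min_Suc])
  have "E ?g \<le> ereal (Q f)"
  proof (rule lower_semicont_le[OF lsc _ gm t sequentially_bot _ tendsto_const])
    show "\<forall>\<^sub>F n in sequentially. ?v n \<in> borel_measurable M" using meas[OF v(1)] by simp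
    show "\<forall>\<^sub>F n in sequentially. E (?v n) \<le> ereal (Q f)"
      using v(2) E_eq[OF v(1)] by (intro always_eventually allI) (metis ereal_less_eq(3))
  qed
  then show g: "?g \<in> D" "Q ?g \<le> Q f" using E_leD by blast+
  have le: "Q (?v n) \<le> Q ?g" for n
  proof -
    have "?v n = (\<lambda>x. min (real (Suc n)) (max 0 (?g x)))" by simp
    then show ?thesis using pos_part_cut(2)[OF g(1), of "real (Suc n)"] by simp
  qed
  show "(\<lambda>n. Q (?v n - ?g)) \<longlonglongrightarrow> 0"
    by (rule lower_semicont_strong_convergence[OF qf lsc v(1) g(1) t _ tendsto_const]) (use le in simp)
qed

lemma truncate_strong:
  assumes f: "f \<in> D"
  shows "truncate (real (Suc n)) \<circ> f \<in> D" "(\<lambda>n. Q ((truncate (real (Suc n)) \<circ> f) - f)) \<longlonglongrightarrow> 0"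
proof -
  have nf: "- f \<in> D" using f by auto
  let ?p = "\<lambda>n x. min (real (Suc n)) (max 0 (f x))" and ?m = "\<lambda>n x. min (real (Suc n)) (max 0 ((- f) x))"
  let ?P = "\<lambda>x. max 0 (f x)" and ?N = "\<lambda>x. max 0 ((- f) x)"
  have p: "?p n \<in> D" "?m n \<in> D" for n using pos_part_cut[OF f] pos_part_cut[OF nf] by simp_all
  have PN: "?P \<in> D" "?N \<in> D" by (rule pos_part(1)[OF f], rule pos_part(1)[OF nf])
  have eq: "truncate (real (Suc n)) \<circ> f = ?p n - ?m n" for n
    by (auto simp: fun_eq_iff truncate_def)
  show "truncate (real (Suc n)) \<circ> f \<in> D" for n unfolding eq by (rule mem(2)[OF p])
  have "(\<lambda>n. 2 * Q (?p n - ?P) + 2 * Q (?m n - ?N)) \<longlonglongrightarrow> 2 * 0 + 2 * 0"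
    by (intro tendsto_intros pos_part(3)[OF f] pos_part(3)[OF nf])
  then have lim: "(\<lambda>n. 2 * Q (?p n - ?P) + 2 * Q (?m n - ?N)) \<longlonglongrightarrow> 0" by simp
  have le: "norm (Q ((truncate (real (Suc n)) \<circ> f) - f)) \<le> 2 * Q (?p n - ?P) + 2 * Q (?m n - ?N)" for n
  proof -
    have "(truncate (real (Suc n)) \<circ> f) - f = (?p n - ?P) - (?m n - ?N)"
      by (auto simp: fun_eq_iff truncate_def min_def max_def)
    moreover have "Q ((?p n - ?P) - (?m n - ?N)) \<le> 2 * Q (?p n - ?P) + 2 * Q (?m n - ?N)"
      by (rule Q_diff_le[OF mem(2)[OF p(1) PN(1)] mem(2)[OF p(2) PN(2)]])
    moreover have "0 \<le> Q ((?p n - ?P) - (?m n - ?N))"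
      by (rule nonneg[OF mem(2)[OF mem(2)[OF p(1) PN(1)] mem(2)[OF p(2) PN(2)]]])
    ultimately show ?thesis by (simp only: real_norm_def abs_of_nonneg)
  qed
  show "(\<lambda>n. Q ((truncate (real (Suc n)) \<circ> f) - f)) \<longlonglongrightarrow> 0"
    by (rule Lim_null_comparison[OF always_eventually[OF allI[OF le]] lim])
qed

text \<open>The energies of the truncations converge to \<open>Q f\<close>, and they dominate the
  energies of the contracted truncations; semicontinuity does the rest.\<close>

theorem contraction:
  assumes f: "f \<in> D" and C: "\<And>x y. \<bar>C x - C y\<bar> \<le> \<bar>x - y\<bar>" "C 0 = 0"
  shows "C \<circ> f \<in> D" "Q (C \<circ> f) \<le> Q f"
proof -
  let ?f = "\<lambda>n. truncate (real (Suc n)) \<circ> f"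
  have cont: "continuous_on UNIV C" by (rule lipschitz_continuous[OF C(1)])
  have Cm: "C \<circ> g \<in> borel_measurable M" if "g \<in> borel_measurable M" for g
    unfolding comp_def by (rule borel_measurable_continuous_on[OF cont that])
  have bnd: "AE x in M. \<bar>?f n x\<bar> \<le> real (Suc n)" for n
    by (rule AE_I2) (simp add: truncate_bound)
  have Cf: "C \<circ> ?f n \<in> D" "Q (C \<circ> ?f n) \<le> Q (?f n)" for n
    by (rule contraction_bounded[OF truncate_strong(1)[OF f] bnd C])+
  have t: "tconv M (\<lambda>n. C \<circ> ?f n) (C \<circ> f) sequentially"
  proof (rule tconv_pointwise[OF meas[OF Cf(1)] Cm[OF meas[OF f]]])
    fix x
    have "isCont C (f x)" using cont by (simp add: continuous_on_eq_continuous_at)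
    from isCont_tendsto_compose[OF this tendsto_truncate]
    show "(\<lambda>n. (C \<circ> ?f n) x) \<longlonglongrightarrow> (C \<circ> f) x" by (simp add: comp_def)
  qed
  have lim: "(\<lambda>n. Q (?f n)) \<longlonglongrightarrow> Q f" by (rule tendsto_Q[OF truncate_strong(1)[OF f] f truncate_strong(2)[OF f]])
  have "E (C \<circ> f) \<le> ereal (Q f)"
  proof (rule lower_semicont_le[OF lsc _ Cm[OF meas[OF f]] t sequentially_bot])
    show "\<forall>\<^sub>F n in sequentially. C \<circ> ?f n \<in> borel_measurable M" using meas[OF Cf(1)] by simp
    show "\<forall>\<^sub>F n in sequentially. E (C \<circ> ?f n) \<le> ereal (Q (?f n))"
      using Cf(2) E_eq[OF Cf(1)] by (intro always_eventually allI) (metis ereal_less_eq(3))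
    show "(\<lambda>n. ereal (Q (?f n))) \<longlonglongrightarrow> ereal (Q f)" using lim by simp
  qed
  then show "C \<circ> f \<in> D" "Q (C \<circ> f) \<le> Q f" using E_leD by blast+
qed

text \<open>Contractions do not raise the energy above \<open>Q f\<close>, so pointwise convergence
  is automatically convergence in energy.\<close>

lemma contraction_approx:
  assumes f: "f \<in> D" and C: "\<And>n x y. \<bar>C n x - C n y\<bar> \<le> \<bar>x - y\<bar>" "\<And>n. C n 0 = 0"
    and lim: "\<And>x. (\<lambda>n::nat. C n x) \<longlonglongrightarrow> x"
  shows "(\<lambda>n. Q ((C n \<circ> f) - f)) \<longlonglongrightarrow> 0"
proof -
  have Cf: "C n \<circ> f \<in> D" "Q (C n \<circ> f) \<le> Q f" for n by (rule contraction[OF f C])+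
  have t: "tconv M (\<lambda>n. C n \<circ> f) f sequentially"
    by (rule tconv_pointwise[OF meas[OF Cf(1)] meas[OF f]]) (simp add: lim)
  show ?thesis
    by (rule lower_semicont_strong_convergence[OF qf lsc Cf(1) f t _ tendsto_const]) (use Cf(2) in simp)
qed

section \<open>Products with functions between 0 and 1\<close>

definition unit_fn :: "('a \<Rightarrow> real) \<Rightarrow> bool" where
  "unit_fn \<phi> \<longleftrightarrow> \<phi> \<in> D \<and> (AE x in M. 0 \<le> \<phi> x \<and> \<phi> x \<le> 1)"

lemma unit_fnD: "unit_fn \<phi> \<Longrightarrow> \<phi> \<in> D" "unit_fn \<phi> \<Longrightarrow> AE x in M. 0 \<le> \<phi> x \<and> \<phi> x \<le> 1"
  by (simp_all add: unit_fn_def)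

lemma box_AE:
  fixes f :: "'a \<Rightarrow> real"
  assumes "unit_fn \<phi>" "AE x in M. \<bar>f x\<bar> \<le> c"
  shows "AE x in M. (\<phi> x, f x) \<in> {0..1} \<times> {- c..c}"
  using unit_fnD(2)[OF assms(1)] assms(2) by eventually_elim (auto simp: abs_le_iff)

lemma zero_mem_box: "0 \<le> c \<Longrightarrow> (0 :: real \<times> real) \<in> {0..1} \<times> {- c..c}"
  by (simp add: zero_prod_def)

lemma square_add_le: "(x + y)\<^sup>2 \<le> 2 * x\<^sup>2 + 2 * y\<^sup>2" for x y :: real
  using zero_le_power2[of "x - y"] by (simp add: power2_sum power2_diff)

lemma box_compact: "compact ({0..1::real} \<times> {- c..c::real})"
  by (intro compact_Times compact_Icc)

lemma pair_measurable:
  "\<phi> \<in> borel_measurable M \<Longrightarrow> f \<in> borel_measurable M \<Longrightarrow> (\<lambda>x. (\<phi> x, f x) :: real \<times> real) \<in> borel_measurable M"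
  by (rule borel_measurable_Pair)

text \<open>The Leibniz rule for differences, a b - a' b' = b (a - a') + a' (b - b'), with
  \<open>\<bar>b\<bar> \<le> c\<close> and a' at most 1; the factors 2 come from
  \<open>square_add_le\<close>.\<close>

lemma product_mem:
  assumes \<phi>: "unit_fn \<phi>" and f: "f \<in> D" "AE x in M. \<bar>f x\<bar> \<le> c" "0 \<le> c"
  shows "(\<lambda>x. \<phi> x * f x) \<in> D" "Q (\<lambda>x. \<phi> x * f x) \<le> 2 * c\<^sup>2 * Q \<phi> + 2 * Q f"
proof -
  have off: "(a * b - a' * b')\<^sup>2 \<le> 2 * c\<^sup>2 * (a - a')\<^sup>2 + 2 * (b - b')\<^sup>2"
    if "0 \<le> a'" "a' \<le> 1" "\<bar>b\<bar> \<le> c" for a a' b b' :: real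
  proof -
    have "a * b - a' * b' = b * (a - a') + a' * (b - b')" by (simp add: algebra_simps)
    moreover have "(b * (a - a') + a' * (b - b'))\<^sup>2 \<le> 2 * (b * (a - a'))\<^sup>2 + 2 * (a' * (b - b'))\<^sup>2"
      by (rule square_add_le)
    moreover have "(b * (a - a'))\<^sup>2 \<le> c\<^sup>2 * (a - a')\<^sup>2"
      unfolding power_mult_distrib using that(3) f(3) by (intro mult_right_mono) (auto simp: abs_le_square_iff[symmetric])
    moreover have "(a' * (b - b'))\<^sup>2 \<le> 1 * (b - b')\<^sup>2"
      unfolding power_mult_distrib using that by (intro mult_right_mono) (auto simp: abs_square_le_1)
    ultimately show ?thesis by simp
  qed
  note d = domination2[of "{0..1} \<times> {- c..c}" "\<lambda>x. (\<phi> x, f x)" "\<lambda>s. fst s * snd s" fst snd "2 * c\<^sup>2" 2,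
    OF box_compact _ pair_measurable[OF meas[OF unit_fnD(1)[OF \<phi>]] meas[OF f(1)]] box_AE[OF \<phi> f(2)]]
  have "(\<lambda>x. fst (\<phi> x, f x) * snd (\<phi> x, f x)) \<in> D \<and>
    Q (\<lambda>x. fst (\<phi> x, f x) * snd (\<phi> x, f x)) \<le> 2 * c\<^sup>2 * Q (\<lambda>x. fst (\<phi> x, f x)) + 2 * Q (\<lambda>x. snd (\<phi> x, f x))"
    using f(3) off off[of 0 _ _ 0] unit_fnD(1)[OF \<phi>] f(1)
    by (intro conjI d) (auto intro!: continuous_intros zero_mem_box)
  then show "(\<lambda>x. \<phi> x * f x) \<in> D" "Q (\<lambda>x. \<phi> x * f x) \<le> 2 * c\<^sup>2 * Q \<phi> + 2 * Q f" by simp_all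
qed

text \<open>Only \<phi> and the product \<phi> f are given in \<open>D\<close>, not
  \<open>f\<close>, so differences are expressed through these two: a b^2 - a' b'^2 = (b + b') (a b
  - a' b') - b b' (a - a').\<close>

lemma product_square_mem:
  assumes \<phi>: "unit_fn \<phi>" and fm: "f \<in> borel_measurable M" and f: "(\<lambda>x. \<phi> x * f x) \<in> D" "AE x in M. \<bar>f x\<bar> \<le> c" "0 \<le> c"
  shows "(\<lambda>x. \<phi> x * (f x)\<^sup>2) \<in> D" "Q (\<lambda>x. \<phi> x * (f x)\<^sup>2) \<le> 8 * c\<^sup>2 * Q (\<lambda>x. \<phi> x * f x) + 2 * c ^ 4 * Q \<phi>"
proof -
  have off: "(a * b\<^sup>2 - a' * b'\<^sup>2)\<^sup>2 \<le> 8 * c\<^sup>2 * (a * b - a' * b')\<^sup>2 + 2 * c ^ 4 * (a - a')\<^sup>2"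
    if b: "\<bar>b\<bar> \<le> c" and b': "\<bar>b'\<bar> \<le> c" for a a' b b' :: real
  proof -
    let ?x = "a * b - a' * b'" and ?y = "a - a'"
    have "a * b\<^sup>2 - a' * b'\<^sup>2 = (b + b') * ?x - b * b' * ?y"
      by (simp add: power2_eq_square algebra_simps)
    moreover have "((b + b') * ?x - b * b' * ?y)\<^sup>2 \<le> 2 * ((b + b') * ?x)\<^sup>2 + 2 * (b * b' * ?y)\<^sup>2"
      using zero_le_power2[of "(b + b') * ?x + b * b' * ?y"] by (simp add: power2_sum power2_diff)
    moreover have "((b + b') * ?x)\<^sup>2 \<le> (2 * c)\<^sup>2 * ?x\<^sup>2"
    proof -
      have "\<bar>b + b'\<bar> \<le> \<bar>2 * c\<bar>" using that f(3) by simp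
      then have "(b + b')\<^sup>2 \<le> (2 * c)\<^sup>2" by (simp only: abs_le_square_iff)
      then show ?thesis unfolding power_mult_distrib[of "b + b'" ?x] by (rule mult_right_mono) simp
    qed
    moreover have "(b * b' * ?y)\<^sup>2 \<le> (c * c)\<^sup>2 * ?y\<^sup>2"
      unfolding power_mult_distrib[of "b * b'" ?y] using b b' f(3)
      by (intro mult_right_mono) (auto simp: abs_le_square_iff[symmetric] abs_mult intro!: mult_mono)
    moreover have "(c * c)\<^sup>2 = c ^ 4" "(2 * c)\<^sup>2 = 4 * c\<^sup>2" by (simp_all add: power2_eq_square power4_eq_xxxx)
    ultimately show ?thesis by simp
  qed
  note d = domination2[of "{0..1} \<times> {- c..c}" "\<lambda>x. (\<phi> x, f x)" "\<lambda>s. fst s * (snd s)\<^sup>2" "\<lambda>s. fst s * snd s" fst "8 * c\<^sup>2" "2 * c ^ 4",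
    OF box_compact _ pair_measurable[OF meas[OF unit_fnD(1)[OF \<phi>]] fm] box_AE[OF \<phi> f(2)]]
  have "(\<lambda>x. fst (\<phi> x, f x) * (snd (\<phi> x, f x))\<^sup>2) \<in> D \<and>
    Q (\<lambda>x. fst (\<phi> x, f x) * (snd (\<phi> x, f x))\<^sup>2) \<le> 8 * c\<^sup>2 * Q (\<lambda>x. fst (\<phi> x, f x) * snd (\<phi> x, f x)) + 2 * c ^ 4 * Q (\<lambda>x. fst (\<phi> x, f x))"
    using f(3) off off[of _ 0 _ 0] unit_fnD(1)[OF \<phi>] f(1)
    by (intro conjI d) (auto intro!: continuous_intros zero_mem_box)
  then show "(\<lambda>x. \<phi> x * (f x)\<^sup>2) \<in> D" "Q (\<lambda>x. \<phi> x * (f x)\<^sup>2) \<le> 8 * c\<^sup>2 * Q (\<lambda>x. \<phi> x * f x) + 2 * c ^ 4 * Q \<phi>" by simp_all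
qed

text \<open>For nonnegative a, multiplying \<open>truncate c b\<close> by a gives a b truncated at
  level c a. In this form it is Lipschitz in a b and a, the quantities whose energies are
  finite.\<close>

lemma product_truncate_mem:
  assumes \<phi>: "unit_fn \<phi>" and fm: "f \<in> borel_measurable M" and f: "(\<lambda>x. \<phi> x * f x) \<in> D" "AE x in M. \<bar>f x\<bar> \<le> b" "0 \<le> b" and c: "0 \<le> c"
  shows "(\<lambda>x. \<phi> x * truncate c (f x)) \<in> D"
proof -
  have eq: "a * truncate c b = max (- (c * a)) (min (c * a) (a * b))" if "0 \<le> a" for a b :: real
    using that unfolding truncate_def
    by (simp add: max_mult_distrib_left min_mult_distrib_left mult.commute)
  have off: "(a * truncate c b - a' * truncate c b')\<^sup>2 \<le> 2 * (a * b - a' * b')\<^sup>2 + 2 * c\<^sup>2 * (a - a')\<^sup>2"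
    if "0 \<le> a" "0 \<le> a'" for a a' b b' :: real
  proof -
    have "\<bar>max (- u) (min u x) - max (- v) (min v y)\<bar> \<le> \<bar>x - y\<bar> + \<bar>u - v\<bar>" for u v x y :: real
      by (auto simp: max_def min_def abs_if)
    from this[of "c * a" "a * b" "c * a'" "a' * b'"]
    have "\<bar>a * truncate c b - a' * truncate c b'\<bar> \<le> \<bar>a * b - a' * b'\<bar> + \<bar>c * a - c * a'\<bar>"
      using eq that by simp
    then have "(a * truncate c b - a' * truncate c b')\<^sup>2 \<le> (\<bar>a * b - a' * b'\<bar> + \<bar>c * a - c * a'\<bar>)\<^sup>2"
      by (simp add: abs_le_square_iff[symmetric])
    also have "\<dots> \<le> 2 * \<bar>a * b - a' * b'\<bar>\<^sup>2 + 2 * \<bar>c * a - c * a'\<bar>\<^sup>2"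
      by (rule square_add_le)
    also have "\<bar>c * a - c * a'\<bar>\<^sup>2 = c\<^sup>2 * (a - a')\<^sup>2"
      by (simp add: power_mult_distrib[symmetric] right_diff_distrib)
    finally show ?thesis by simp
  qed
  note d = domination2(1)[of "{0..1} \<times> {- b..b}" "\<lambda>x. (\<phi> x, f x)" "\<lambda>s. fst s * truncate c (snd s)" "\<lambda>s. fst s * snd s" fst 2 "2 * c\<^sup>2",
    OF box_compact _ pair_measurable[OF meas[OF unit_fnD(1)[OF \<phi>]] fm] box_AE[OF \<phi> f(2)]]
  have "(\<lambda>x. fst (\<phi> x, f x) * truncate c (snd (\<phi> x, f x))) \<in> D"
    using f(3) off off[of _ 0 _ 0] unit_fnD(1)[OF \<phi>] f(1) c
    by (intro d) (auto intro!: continuous_intros zero_mem_box simp: truncate_def)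
  then show ?thesis by simp
qed

text \<open>The increment of a maximum is bounded by one of the two increments. This is what directs
  the families of unit functions.\<close>

lemma max_unit_fn:
  assumes \<phi>: "unit_fn \<phi>" and \<eta>: "unit_fn \<eta>"
  shows "unit_fn (\<lambda>x. max (\<phi> x) (\<eta> x))"
proof -
  have ae: "AE x in M. \<bar>\<eta> x\<bar> \<le> 1" using unit_fnD(2)[OF \<eta>] by eventually_elim auto
  have off: "(max a b - max a' b')\<^sup>2 \<le> 1 * (a - a')\<^sup>2 + 1 * (b - b')\<^sup>2" for a b a' b' :: real
  proof -
    have "\<bar>max a b - max a' b'\<bar> \<le> \<bar>a - a'\<bar> \<or> \<bar>max a b - max a' b'\<bar> \<le> \<bar>b - b'\<bar>" by linarith
    then have "(max a b - max a' b')\<^sup>2 \<le> (a - a')\<^sup>2 \<or> (max a b - max a' b')\<^sup>2 \<le> (b - b')\<^sup>2"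
      by (simp only: abs_le_square_iff)
    then show ?thesis
    proof
      assume "(max a b - max a' b')\<^sup>2 \<le> (a - a')\<^sup>2"
      then show ?thesis using zero_le_power2[of "b - b'"] by linarith
    next
      assume "(max a b - max a' b')\<^sup>2 \<le> (b - b')\<^sup>2"
      then show ?thesis using zero_le_power2[of "a - a'"] by linarith
    qed
  qed
  note d = domination2(1)[of "{0..1} \<times> {- 1..1}" "\<lambda>x. (\<phi> x, \<eta> x)" "\<lambda>s. max (fst s) (snd s)" fst snd 1 1,
    OF box_compact _ pair_measurable[OF meas[OF unit_fnD(1)[OF \<phi>]] meas[OF unit_fnD(1)[OF \<eta>]]] box_AE[OF \<phi> ae]]
  have "(\<lambda>x. max (fst (\<phi> x, \<eta> x)) (snd (\<phi> x, \<eta> x))) \<in> D"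
    using off off[of _ _ 0 0] unit_fnD(1)[OF \<phi>] unit_fnD(1)[OF \<eta>]
    by (intro d) (auto intro!: continuous_intros zero_mem_box)
  moreover have "AE x in M. 0 \<le> max (\<phi> x) (\<eta> x) \<and> max (\<phi> x) (\<eta> x) \<le> 1"
    using unit_fnD(2)[OF \<phi>] unit_fnD(2)[OF \<eta>] by eventually_elim auto
  ultimately show ?thesis by (simp add: unit_fn_def)
qed

section \<open>The forms \<open>E\<^sub>\<phi>\<close>\<close>

definition pre_val :: "('a \<Rightarrow> real) \<Rightarrow> ('a \<Rightarrow> real) \<Rightarrow> real" where
  "pre_val \<phi> f = Q (\<lambda>x. \<phi> x * f x) - B (\<lambda>x. \<phi> x * (f x)\<^sup>2) \<phi>"

text \<open>The domain on which E_\<phi> is finite before closure, by \<open>pre_dom_square\<close>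
  and \<open>pre_local_form_eq\<close>.\<close>

definition pre_dom :: "('a \<Rightarrow> real) \<Rightarrow> ('a \<Rightarrow> real) set" where
  "pre_dom \<phi> = {f \<in> Linfty M. (\<lambda>x. \<phi> x * f x) \<in> D}"

lemma LinftyE:
  assumes "f \<in> Linfty M"
  obtains c where "f \<in> borel_measurable M" "AE x in M. \<bar>f x\<bar> \<le> c" "0 < c"
proof -
  obtain c where c: "f \<in> borel_measurable M" "AE x in M. \<bar>f x\<bar> \<le> c" using assms by (auto simp: Linfty_def)
  have "AE x in M. \<bar>f x\<bar> \<le> max c 1" using c(2) by eventually_elim auto
  then show ?thesis using that[of "max c 1"] c(1) by simp
qed

lemma pre_dom_square:
  assumes \<phi>: "unit_fn \<phi>" and f: "f \<in> pre_dom \<phi>"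
  shows "(\<lambda>x. \<phi> x * (f x)\<^sup>2) \<in> D"
proof -
  have "f \<in> Linfty M" using f by (simp add: pre_dom_def)
  then obtain c where c: "f \<in> borel_measurable M" "AE x in M. \<bar>f x\<bar> \<le> c" "0 < c" by (rule LinftyE)
  show ?thesis by (rule product_square_mem(1)[OF \<phi> c(1) _ c(2)]) (use f c in \<open>auto simp: pre_dom_def\<close>)
qed

lemma pre_local_form_eq:
  assumes \<phi>: "unit_fn \<phi>"
  shows "pre_local_form M E \<phi> f = (if f \<in> pre_dom \<phi> then ereal (pre_val \<phi> f) else \<infinity>)"
proof (cases "f \<in> pre_dom \<phi>")
  case True
  have s: "(\<lambda>x. \<phi> x * (f x)\<^sup>2) \<in> D" by (rule pre_dom_square[OF \<phi> True])
  have "(\<lambda>x. \<phi> x * f x) \<in> D" "f \<in> Linfty M" using True by (auto simp: pre_dom_def)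
  moreover from this obtain r where "E (\<lambda>x. \<phi> x * f x) = ereal r" using E_eq by blast
  ultimately show ?thesis
    unfolding pre_local_form_def pre_val_def B_eq[symmetric] using True s by simp
next
  case False
  then show ?thesis unfolding pre_local_form_def pre_dom_def by auto
qed

lemma bounded_mem_pre_dom:
  assumes \<phi>: "unit_fn \<phi>" and f: "f \<in> D" "AE x in M. \<bar>f x\<bar> \<le> c" "0 \<le> c"
  shows "f \<in> pre_dom \<phi>"
  using product_mem(1)[OF \<phi> f] f meas[OF f(1)] by (auto simp: pre_dom_def Linfty_def)

text \<open>The off-diagonal expression collapses to a a' (b - b')^2 and the diagonal one to
  0.\<close>

lemma pre_val_nonneg:
  assumes \<phi>: "unit_fn \<phi>" and f: "f \<in> pre_dom \<phi>"
  shows "0 \<le> pre_val \<phi> f"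
proof -
  have "f \<in> Linfty M" using f by (simp add: pre_dom_def)
  then obtain c where c: "f \<in> borel_measurable M" "AE x in M. \<bar>f x\<bar> \<le> c" "0 < c" by (rule LinftyE)
  have d: "(\<lambda>x. \<phi> x * f x) \<in> D" "(\<lambda>x. \<phi> x * (f x)\<^sup>2) \<in> D" "\<phi> \<in> D"
    using f pre_dom_square[OF \<phi> f] unit_fnD(1)[OF \<phi>] by (auto simp: pre_dom_def)
  let ?Ps = "[(1, \<lambda>s. fst s * snd s, \<lambda>s. fst s * snd s), (- 1, \<lambda>s. fst s * (snd s)\<^sup>2, fst)]
    :: (real \<times> (real \<times> real \<Rightarrow> real) \<times> (real \<times> real \<Rightarrow> real)) list"
  have "0 \<le> (\<Sum>(k, \<Phi>, \<Psi>)\<leftarrow>?Ps. k * B (\<lambda>x. \<Phi> (\<phi> x, f x)) (\<lambda>x. \<Psi> (\<phi> x, f x)))"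
  proof (rule bilinear_list[OF box_compact _ pair_measurable[OF meas[OF d(3)] c(1)] box_AE[OF \<phi> c(2)]])
    fix s t :: "real \<times> real" assume "s \<in> {0..1} \<times> {- c..c}" "t \<in> {0..1} \<times> {- c..c}"
    then obtain a b a' b' where s: "s = (a, b)" "0 \<le> a" and t: "t = (a', b')" "0 \<le> a'" by auto
    have "(a * b - a' * b') * (a * b - a' * b') - (a * b\<^sup>2 - a' * b'\<^sup>2) * (a - a') = a * a' * (b - b')\<^sup>2"
      by (simp add: power2_eq_square algebra_simps)
    moreover have "0 \<le> a * a' * (b - b')\<^sup>2" using s t by simp
    ultimately show "0 \<le> (\<Sum>(k, \<Phi>, \<Psi>)\<leftarrow>?Ps. k * ((\<Phi> s - \<Phi> t) * (\<Psi> s - \<Psi> t)))"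
      by (simp add: s t)
  qed (use d c in \<open>auto intro!: continuous_intros zero_mem_box simp: power2_eq_square algebra_simps\<close>)
  then show ?thesis using B_self[OF d(1)] by (simp add: pre_val_def)
qed

text \<open>The two jump terms carry the same weight a a', so the Lipschitz property of truncation
  decides; the killing terms vanish for both functions.\<close>

lemma pre_val_truncate:
  assumes \<phi>: "unit_fn \<phi>" and f: "f \<in> pre_dom \<phi>" and c: "0 \<le> c"
  shows "truncate c \<circ> f \<in> pre_dom \<phi>" "pre_val \<phi> (truncate c \<circ> f) \<le> pre_val \<phi> f"
proof -
  have "f \<in> Linfty M" using f by (simp add: pre_dom_def)
  then obtain b where b: "f \<in> borel_measurable M" "AE x in M. \<bar>f x\<bar> \<le> b" "0 < b" by (rule LinftyE)
  have d: "(\<lambda>x. \<phi> x * f x) \<in> D" "(\<lambda>x. \<phi> x * (f x)\<^sup>2) \<in> D" "\<phi> \<in> D"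
    using f pre_dom_square[OF \<phi> f] unit_fnD(1)[OF \<phi>] by (auto simp: pre_dom_def)
  have g: "(\<lambda>x. \<phi> x * truncate c (f x)) \<in> D"
    by (rule product_truncate_mem[OF \<phi> b(1) d(1) b(2)]) (use b c in auto)
  show cp: "truncate c \<circ> f \<in> pre_dom \<phi>"
    using g truncate_measurable[OF b(1), of c] truncate_bound[OF c] by (auto simp: pre_dom_def Linfty_def)
  have g2: "(\<lambda>x. \<phi> x * (truncate c (f x))\<^sup>2) \<in> D" using pre_dom_square[OF \<phi> cp] by simp
  let ?Ps = "[(1, \<lambda>s. fst s * snd s, \<lambda>s. fst s * snd s), (- 1, \<lambda>s. fst s * (snd s)\<^sup>2, fst),
     (- 1, \<lambda>s. fst s * truncate c (snd s), \<lambda>s. fst s * truncate c (snd s)), (1, \<lambda>s. fst s * (truncate c (snd s))\<^sup>2, fst)]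
    :: (real \<times> (real \<times> real \<Rightarrow> real) \<times> (real \<times> real \<Rightarrow> real)) list"
  have cc: "continuous_on UNIV (\<lambda>s :: real \<times> real. truncate c (snd s))"
    unfolding truncate_def by (intro continuous_intros)
  have "0 \<le> (\<Sum>(k, \<Phi>, \<Psi>)\<leftarrow>?Ps. k * B (\<lambda>x. \<Phi> (\<phi> x, f x)) (\<lambda>x. \<Psi> (\<phi> x, f x)))"
  proof (rule bilinear_list[OF box_compact _ pair_measurable[OF meas[OF d(3)] b(1)] box_AE[OF \<phi> b(2)]])
    fix s t :: "real \<times> real" assume "s \<in> {0..1} \<times> {- b..b}" "t \<in> {0..1} \<times> {- b..b}"
    then obtain a y a' y' where s: "s = (a, y)" "0 \<le> a" and t: "t = (a', y')" "0 \<le> a'" by auto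
    have id: "(a * z - a' * z') * (a * z - a' * z') - (a * z\<^sup>2 - a' * z'\<^sup>2) * (a - a') = a * a' * (z - z')\<^sup>2" for z z'
      by (simp add: power2_eq_square algebra_simps)
    have "(truncate c y - truncate c y')\<^sup>2 \<le> (y - y')\<^sup>2"
      using truncate_lipschitz by (simp add: abs_le_square_iff[symmetric])
    then have "a * a' * (truncate c y - truncate c y')\<^sup>2 \<le> a * a' * (y - y')\<^sup>2"
      using s t by (intro mult_left_mono) auto
    then show "0 \<le> (\<Sum>(k, \<Phi>, \<Psi>)\<leftarrow>?Ps. k * ((\<Phi> s - \<Phi> t) * (\<Psi> s - \<Psi> t)))"
      using id[of y y'] id[of "truncate c y" "truncate c y'"] by (simp add: s t)
  next
    show "0 \<le> (\<Sum>(k, \<Phi>, \<Psi>)\<leftarrow>?Ps. k * (\<Phi> s * \<Psi> s))" for s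
      by (simp add: power2_eq_square algebra_simps)
  qed (use d g g2 b cc in \<open>auto intro!: continuous_intros zero_mem_box\<close>)
  then show "pre_val \<phi> (truncate c \<circ> f) \<le> pre_val \<phi> f"
    using B_self[OF d(1)] B_self[OF g] by (simp add: pre_val_def comp_def)
qed

text \<open>The jump weight a a' is at most 1, and on the diagonal only the nonnegative term of
  \<open>Q f\<close> remains.\<close>

lemma pre_val_le_Q:
  assumes \<phi>: "unit_fn \<phi>" and f: "f \<in> D" "AE x in M. \<bar>f x\<bar> \<le> c" "0 \<le> c"
  shows "pre_val \<phi> f \<le> Q f"
proof -
  have fp: "f \<in> pre_dom \<phi>" by (rule bounded_mem_pre_dom[OF \<phi> f])
  have d: "(\<lambda>x. \<phi> x * f x) \<in> D" "(\<lambda>x. \<phi> x * (f x)\<^sup>2) \<in> D" "\<phi> \<in> D"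
    using fp pre_dom_square[OF \<phi> fp] unit_fnD(1)[OF \<phi>] by (auto simp: pre_dom_def)
  let ?Ps = "[(- 1, \<lambda>s. fst s * snd s, \<lambda>s. fst s * snd s), (1, \<lambda>s. fst s * (snd s)\<^sup>2, fst), (1, snd, snd)]
    :: (real \<times> (real \<times> real \<Rightarrow> real) \<times> (real \<times> real \<Rightarrow> real)) list"
  have "0 \<le> (\<Sum>(k, \<Phi>, \<Psi>)\<leftarrow>?Ps. k * B (\<lambda>x. \<Phi> (\<phi> x, f x)) (\<lambda>x. \<Psi> (\<phi> x, f x)))"
  proof (rule bilinear_list[OF box_compact _ pair_measurable[OF meas[OF d(3)] meas[OF f(1)]] box_AE[OF \<phi> f(2)]])
    fix s t :: "real \<times> real" assume "s \<in> {0..1} \<times> {- c..c}" "t \<in> {0..1} \<times> {- c..c}"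
    then obtain a b a' b' where s: "s = (a, b)" "0 \<le> a" "a \<le> 1" and t: "t = (a', b')" "0 \<le> a'" "a' \<le> 1" by auto
    have "(a * b - a' * b') * (a * b - a' * b') - (a * b\<^sup>2 - a' * b'\<^sup>2) * (a - a') = (a * a') * (b - b')\<^sup>2"
      by (simp add: power2_eq_square algebra_simps)
    moreover have "(a * a') * (b - b')\<^sup>2 \<le> 1 * (b - b')\<^sup>2"
      using s t mult_le_one[of a a'] by (intro mult_right_mono) auto
    ultimately show "0 \<le> (\<Sum>(k, \<Phi>, \<Psi>)\<leftarrow>?Ps. k * ((\<Phi> s - \<Phi> t) * (\<Psi> s - \<Psi> t)))"
      by (simp add: s t power2_eq_square)
  next
    show "0 \<le> (\<Sum>(k, \<Phi>, \<Psi>)\<leftarrow>?Ps. k * (\<Phi> s * \<Psi> s))" for s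
      by (simp add: power2_eq_square algebra_simps)
  qed (use d f in \<open>auto intro!: continuous_intros zero_mem_box\<close>)
  then show ?thesis using B_self[OF d(1)] B_self[OF f(1)] by (simp add: pre_val_def)
qed

lemma pre_val_mono:
  assumes \<phi>: "unit_fn \<phi>" and \<eta>: "unit_fn \<eta>" and le: "AE x in M. \<phi> x \<le> \<eta> x"
    and f: "f \<in> D" "AE x in M. \<bar>f x\<bar> \<le> c" "0 \<le> c"
  shows "pre_val \<phi> f \<le> pre_val \<eta> f"
proof -
  have fp: "f \<in> pre_dom \<phi>" "f \<in> pre_dom \<eta>"
    by (rule bounded_mem_pre_dom[OF \<phi> f], rule bounded_mem_pre_dom[OF \<eta> f])
  have d: "(\<lambda>x. \<phi> x * f x) \<in> D" "(\<lambda>x. \<phi> x * (f x)\<^sup>2) \<in> D" "\<phi> \<in> D"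
    using fp pre_dom_square[OF \<phi> fp(1)] unit_fnD(1)[OF \<phi>] by (auto simp: pre_dom_def)
  have d': "(\<lambda>x. \<eta> x * f x) \<in> D" "(\<lambda>x. \<eta> x * (f x)\<^sup>2) \<in> D" "\<eta> \<in> D"
    using fp pre_dom_square[OF \<eta> fp(2)] unit_fnD(1)[OF \<eta>] by (auto simp: pre_dom_def)
  \<comment> \<open>The extra constraint encodes \<phi> \<le> \<eta>. It makes the weight for \<phi>
    at most that for \<eta> at every pair of points, and being closed it preserves
    compactness.\<close>
  let ?K = "({0..1} \<times> {0..1} \<times> {- c..c}) \<inter> {s :: real \<times> real \<times> real. fst s \<le> fst (snd s)}"
  let ?Ps = "[(1, \<lambda>s. fst (snd s) * snd (snd s), \<lambda>s. fst (snd s) * snd (snd s)),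
     (- 1, \<lambda>s. fst (snd s) * (snd (snd s))\<^sup>2, \<lambda>s. fst (snd s)),
     (- 1, \<lambda>s. fst s * snd (snd s), \<lambda>s. fst s * snd (snd s)), (1, \<lambda>s. fst s * (snd (snd s))\<^sup>2, fst)]
    :: (real \<times> (real \<times> real \<times> real \<Rightarrow> real) \<times> (real \<times> real \<times> real \<Rightarrow> real)) list"
  have K: "compact ?K"
    by (intro compact_Int_closed compact_Times compact_Icc closed_Collect_le continuous_intros)
  have Fm: "(\<lambda>x. (\<phi> x, \<eta> x, f x) :: real \<times> real \<times> real) \<in> borel_measurable M"
    using meas[OF d(3)] meas[OF d'(3)] meas[OF f(1)] by (intro borel_measurable_Pair)
  have FK: "AE x in M. (\<phi> x, \<eta> x, f x) \<in> ?K"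
    using unit_fnD(2)[OF \<phi>] unit_fnD(2)[OF \<eta>] le f(2) by eventually_elim auto
  have "0 \<le> (\<Sum>(k, \<Phi>, \<Psi>)\<leftarrow>?Ps. k * B (\<lambda>x. \<Phi> (\<phi> x, \<eta> x, f x)) (\<lambda>x. \<Psi> (\<phi> x, \<eta> x, f x)))"
  proof (rule bilinear_list[OF K _ Fm FK])
    fix s t assume "s \<in> ?K" "t \<in> ?K"
    then obtain a b z a' b' z' where s: "s = (a, b, z)" "0 \<le> a" "a \<le> b" and t: "t = (a', b', z')" "0 \<le> a'" "a' \<le> b'"
      by auto
    have id: "(a * z - a' * z') * (a * z - a' * z') - (a * z\<^sup>2 - a' * z'\<^sup>2) * (a - a') = a * a' * (z - z')\<^sup>2" for a a' :: real
      by (simp add: power2_eq_square algebra_simps)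
    have "a * a' * (z - z')\<^sup>2 \<le> b * b' * (z - z')\<^sup>2"
      using s t by (intro mult_right_mono mult_mono) auto
    then show "0 \<le> (\<Sum>(k, \<Phi>, \<Psi>)\<leftarrow>?Ps. k * ((\<Phi> s - \<Phi> t) * (\<Psi> s - \<Psi> t)))"
      using id[of a a'] id[of b b'] by (simp add: s t)
  next
    show "0 \<le> (\<Sum>(k, \<Phi>, \<Psi>)\<leftarrow>?Ps. k * (\<Phi> s * \<Psi> s))" for s
      by (simp add: power2_eq_square algebra_simps)
    show "0 \<in> ?K" using f(3) by (auto simp: zero_prod_def)
  qed (use d d' in \<open>auto intro!: continuous_intros\<close>)
  then show ?thesis using B_self[OF d(1)] B_self[OF d'(1)] by (simp add: pre_val_def)
qed

end

text \<open>Young's inequality with a free weight, used to absorb an energy term into the other side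
  of an estimate.\<close>

lemma (in quad_space) B_weighted:
  assumes u: "u \<in> D" and v: "v \<in> D" and k: "0 < k"
  shows "2 * B u v \<le> k * Q u + Q v / k"
proof -
  have m: "sqrt k *\<^sub>R u \<in> D" "(1 / sqrt k) *\<^sub>R v \<in> D" using u v by auto
  have "0 \<le> Q (sqrt k *\<^sub>R u - (1 / sqrt k) *\<^sub>R v)" by (rule nonneg[OF mem(2)[OF m]])
  also have "\<dots> = (sqrt k)\<^sup>2 * Q u - 2 * (sqrt k * ((1 / sqrt k) * B u v)) + (1 / sqrt k)\<^sup>2 * Q v"
    unfolding Q_diff[OF m] B_scale_left[OF u m(2)] B_scale_right[OF u v] hom[OF u] hom[OF v] ..
  also have "\<dots> = k * Q u - 2 * B u v + Q v / k" using k by (simp add: power_divide)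
  finally show ?thesis by simp
qed

lemma (in quad_space) tendsto_B_weak_strong:
  assumes X: "\<And>i. X i \<in> D" and Y: "\<And>i. Y i \<in> D" and y: "y \<in> D"
    and bnd: "\<forall>\<^sub>F i in F. Q (X i) \<le> C" and strong: "((\<lambda>i. Q (Y i - y)) \<longlongrightarrow> 0) F"
    and weak: "((\<lambda>i. B (X i) y) \<longlongrightarrow> L) F"
  shows "((\<lambda>i. B (X i) (Y i)) \<longlongrightarrow> L) F"
proof -
  have "((\<lambda>i. sqrt \<bar>C\<bar> * sqrt (Q (Y i - y))) \<longlongrightarrow> sqrt \<bar>C\<bar> * sqrt 0) F"
    by (intro tendsto_intros strong)
  then have l: "((\<lambda>i. sqrt \<bar>C\<bar> * sqrt (Q (Y i - y))) \<longlongrightarrow> 0) F" by simp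
  have le: "\<forall>\<^sub>F i in F. norm (B (X i) (Y i - y)) \<le> sqrt \<bar>C\<bar> * sqrt (Q (Y i - y))"
    using bnd
  proof eventually_elim
    case (elim i)
    have "\<bar>B (X i) (Y i - y)\<bar> \<le> sqrt (Q (X i)) * sqrt (Q (Y i - y))"
      by (rule B_Cauchy_Schwarz[OF X mem(2)[OF Y y]])
    also have "\<dots> \<le> sqrt \<bar>C\<bar> * sqrt (Q (Y i - y))"
      using elim nonneg[OF mem(2)[OF Y y]] by (intro mult_right_mono) auto
    finally show ?case by simp
  qed
  have "((\<lambda>i. B (X i) (Y i - y) + B (X i) y) \<longlongrightarrow> 0 + L) F"
    by (intro tendsto_add weak Lim_null_comparison[OF le l])
  moreover have "B (X i) (Y i - y) + B (X i) y = B (X i) (Y i)" for i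
    using B_diff_right[OF X[of i] Y[of i] y] by simp
  ultimately show ?thesis by simp
qed

context energy
begin

lemma subspace_pre_dom:
  assumes \<phi>: "unit_fn \<phi>"
  shows "subspace (pre_dom \<phi>)"
proof (rule subspaceI)
  show "0 \<in> pre_dom \<phi>"
    using mem(4) by (auto simp: pre_dom_def Linfty_def zero_fun_def)
next
  fix f g assume f: "f \<in> pre_dom \<phi>" and g: "g \<in> pre_dom \<phi>"
  have fL: "f \<in> Linfty M" and gL: "g \<in> Linfty M" using f g by (simp_all add: pre_dom_def)
  obtain a where a: "f \<in> borel_measurable M" "AE x in M. \<bar>f x\<bar> \<le> a" "0 < a" using fL by (rule LinftyE)
  obtain b where b: "g \<in> borel_measurable M" "AE x in M. \<bar>g x\<bar> \<le> b" "0 < b" using gL by (rule LinftyE)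
  have "AE x in M. \<bar>(f + g) x\<bar> \<le> a + b" using a(2) b(2) by eventually_elim auto
  moreover have "f + g \<in> borel_measurable M" unfolding plus_fun_def using a b by (intro borel_measurable_add)
  ultimately have "f + g \<in> Linfty M" by (auto simp: Linfty_def)
  moreover have "(\<lambda>x. \<phi> x * (f + g) x) = (\<lambda>x. \<phi> x * f x) + (\<lambda>x. \<phi> x * g x)"
    by (simp add: fun_eq_iff distrib_left)
  moreover have "(\<lambda>x. \<phi> x * f x) + (\<lambda>x. \<phi> x * g x) \<in> D"
    using f g by (intro mem(1)) (auto simp: pre_dom_def)
  ultimately show "f + g \<in> pre_dom \<phi>" unfolding pre_dom_def by (simp only: mem_Collect_eq simp_thms)
next
  fix c f assume f: "f \<in> pre_dom \<phi>"
  have fL: "f \<in> Linfty M" using f by (simp add: pre_dom_def)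
  obtain a where a: "f \<in> borel_measurable M" "AE x in M. \<bar>f x\<bar> \<le> a" "0 < a" using fL by (rule LinftyE)
  have "AE x in M. \<bar>(c *\<^sub>R f) x\<bar> \<le> \<bar>c\<bar> * a" using a(2) by eventually_elim (simp add: abs_mult mult_left_mono)
  moreover have "c *\<^sub>R f \<in> borel_measurable M"
    unfolding scaleR_fun_def real_scaleR_def using a by (intro borel_measurable_times borel_measurable_const)
  ultimately have "c *\<^sub>R f \<in> Linfty M" by (auto simp: Linfty_def)
  moreover have "(\<lambda>x. \<phi> x * (c *\<^sub>R f) x) = c *\<^sub>R (\<lambda>x. \<phi> x * f x)" by (simp add: fun_eq_iff)
  moreover have "c *\<^sub>R (\<lambda>x. \<phi> x * f x) \<in> D" using f by (intro mem(3)) (auto simp: pre_dom_def)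
  ultimately show "c *\<^sub>R f \<in> pre_dom \<phi>" unfolding pre_dom_def by (simp only: mem_Collect_eq simp_thms)
qed

lemma pre_domD:
  assumes "unit_fn \<phi>" "f \<in> pre_dom \<phi>"
  shows "f \<in> borel_measurable M" "(\<lambda>x. \<phi> x * f x) \<in> D" "(\<lambda>x. \<phi> x * (f x)\<^sup>2) \<in> D"
  using assms pre_dom_square[OF assms] by (auto simp: pre_dom_def Linfty_def)

text \<open>If \<phi> f = \<phi> g then \<phi> f^2 = \<phi> g^2, since the functions agree where
  \<phi> is not 0. Hence the form sees \<open>f\<close> only there, which gives it a meaning for
  functions that are merely local.\<close>

lemma pre_val_cong:
  assumes \<phi>: "unit_fn \<phi>" and f: "f \<in> pre_dom \<phi>" and g: "g \<in> Linfty M" and ae: "AE x in M. \<phi> x * f x = \<phi> x * g x"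
  shows "g \<in> pre_dom \<phi>" "pre_val \<phi> f = pre_val \<phi> g"
proof -
  have gm: "g \<in> borel_measurable M" using g by (simp add: Linfty_def)
  have \<phi>m: "\<phi> \<in> borel_measurable M" by (rule meas[OF unit_fnD(1)[OF \<phi>]])
  have "(\<lambda>x. \<phi> x * g x) \<in> D"
    by (rule D_cong_AE[OF pre_domD(2)[OF \<phi> f] borel_measurable_times[OF \<phi>m gm] ae])
  then show gp: "g \<in> pre_dom \<phi>" using g by (simp add: pre_dom_def)
  have ae2: "AE x in M. \<phi> x * (f x)\<^sup>2 = \<phi> x * (g x)\<^sup>2" using ae by eventually_elim auto
  have "E (\<lambda>x. \<phi> x * f x) = E (\<lambda>x. \<phi> x * g x)"
    by (rule E_cong_AE[OF meas[OF pre_domD(2)[OF \<phi> f]] meas[OF pre_domD(2)[OF \<phi> gp]] ae])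
  moreover have "B (\<lambda>x. \<phi> x * (f x)\<^sup>2) \<phi> = B (\<lambda>x. \<phi> x * (g x)\<^sup>2) \<phi>"
    by (rule B_cong_AE[OF pre_domD(3)[OF \<phi> f] unit_fnD(1)[OF \<phi>] pre_domD(3)[OF \<phi> gp] unit_fnD(1)[OF \<phi>] ae2]) simp
  ultimately show "pre_val \<phi> f = pre_val \<phi> g" by (simp add: pre_val_def)
qed

text \<open>The second term is linear in \<phi> f^2, and squaring obeys the parallelogram law
  pointwise.\<close>

lemma quad_space_pre_val:
  assumes \<phi>: "unit_fn \<phi>"
  shows "quad_space (pre_dom \<phi>) (pre_val \<phi>)"
proof
  show "subspace (pre_dom \<phi>)" by (rule subspace_pre_dom[OF \<phi>])
  show "0 \<le> pre_val \<phi> u" if "u \<in> pre_dom \<phi>" for u by (rule pre_val_nonneg[OF \<phi> that])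
next
  fix f g assume f: "f \<in> pre_dom \<phi>" and g: "g \<in> pre_dom \<phi>"
  let ?p = "\<lambda>f x. \<phi> x * f x" and ?s = "\<lambda>f x. \<phi> x * (f x)\<^sup>2"
  have \<phi>D: "\<phi> \<in> D" by (rule unit_fnD(1)[OF \<phi>])
  have fg: "f + g \<in> pre_dom \<phi>" "f - g \<in> pre_dom \<phi>"
    using subspace_pre_dom[OF \<phi>] f g by (auto intro: subspace_add subspace_diff)
  have "?p (f + g) = ?p f + ?p g" "?p (f - g) = ?p f - ?p g"
    by (simp_all add: fun_eq_iff distrib_left right_diff_distrib)
  then have 1: "Q (?p (f + g)) + Q (?p (f - g)) = 2 * Q (?p f) + 2 * Q (?p g)"
    using par[OF pre_domD(2)[OF \<phi> f] pre_domD(2)[OF \<phi> g]] by (simp only:)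
  have "?s (f + g) + ?s (f - g) = 2 *\<^sub>R ?s f + 2 *\<^sub>R ?s g"
    by (simp add: fun_eq_iff power2_sum power2_diff algebra_simps)
  then have "B (?s (f + g) + ?s (f - g)) \<phi> = B (2 *\<^sub>R ?s f + 2 *\<^sub>R ?s g) \<phi>" by (simp only:)
  then have "B (?s (f + g)) \<phi> + B (?s (f - g)) \<phi> = 2 * B (?s f) \<phi> + 2 * B (?s g) \<phi>"
    using B_add_left[OF pre_domD(3)[OF \<phi> fg(1)] \<phi>D pre_domD(3)[OF \<phi> fg(2)]]
      B_add_left[OF mem(3)[OF pre_domD(3)[OF \<phi> f]] \<phi>D mem(3)[OF pre_domD(3)[OF \<phi> g]], of 2 2]
      B_scale_left[OF pre_domD(3)[OF \<phi> f] \<phi>D, of 2] B_scale_left[OF pre_domD(3)[OF \<phi> g] \<phi>D, of 2]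
    by (simp only:)
  with 1 show "pre_val \<phi> (f + g) + pre_val \<phi> (f - g) = 2 * pre_val \<phi> f + 2 * pre_val \<phi> g"
    unfolding pre_val_def right_diff_distrib by linarith
next
  fix f c assume f: "f \<in> pre_dom \<phi>"
  have "(\<lambda>x. \<phi> x * (c *\<^sub>R f) x) = c *\<^sub>R (\<lambda>x. \<phi> x * f x)"
    "(\<lambda>x. \<phi> x * ((c *\<^sub>R f) x)\<^sup>2) = c\<^sup>2 *\<^sub>R (\<lambda>x. \<phi> x * (f x)\<^sup>2)"
    by (simp_all add: fun_eq_iff power_mult_distrib)
  then show "pre_val \<phi> (c *\<^sub>R f) = c\<^sup>2 * pre_val \<phi> f"
    unfolding pre_val_def
    using hom[OF pre_domD(2)[OF \<phi> f], of c] B_scale_left[OF pre_domD(3)[OF \<phi> f] unit_fnD(1)[OF \<phi>], of "c\<^sup>2"]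
    by (simp only: right_diff_distrib)
qed

lemma quadratic_form_pre_local_form:
  assumes \<phi>: "unit_fn \<phi>"
  shows "quadratic_form M (pre_local_form M E \<phi>)"
proof -
  interpret p: quad_space "pre_dom \<phi>" "pre_val \<phi>" by (rule quad_space_pre_val[OF \<phi>])
  note eq = pre_local_form_eq[OF \<phi>]
  show ?thesis
  proof (rule quadratic_formI)
    show "0 \<le> pre_local_form M E \<phi> u" for u using p.nonneg[of u] by (simp add: eq)
    show "pre_local_form M E \<phi> u = \<infinity>" if "u \<notin> borel_measurable M" for u
      using that by (auto simp: eq pre_dom_def Linfty_def)
    show "pre_local_form M E \<phi> u = pre_local_form M E \<phi> v"
      if "u \<in> borel_measurable M" "v \<in> borel_measurable M" and ae: "AE x in M. u x = v x" for u v
    proof -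
      have L: "u \<in> Linfty M \<longleftrightarrow> v \<in> Linfty M"
      proof -
        have "(AE x in M. \<bar>u x\<bar> \<le> c) \<longleftrightarrow> (AE x in M. \<bar>v x\<bar> \<le> c)" for c
        proof
          assume "AE x in M. \<bar>u x\<bar> \<le> c"
          then show "AE x in M. \<bar>v x\<bar> \<le> c" using ae by eventually_elim auto
        next
          assume "AE x in M. \<bar>v x\<bar> \<le> c"
          then show "AE x in M. \<bar>u x\<bar> \<le> c" using ae by eventually_elim auto
        qed
        then show ?thesis using that by (simp add: Linfty_def)
      qed
      have a1: "AE x in M. \<phi> x * u x = \<phi> x * v x" and a2: "AE x in M. \<phi> x * v x = \<phi> x * u x"
        using ae by (eventually_elim, simp)+
      show ?thesis
      proof (cases "u \<in> pre_dom \<phi>")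
        case True
        then have "v \<in> Linfty M" using L by (simp add: pre_dom_def)
        from pre_val_cong[OF \<phi> True this a1] True show ?thesis by (simp add: eq)
      next
        case False
        have "v \<notin> pre_dom \<phi>"
        proof
          assume v: "v \<in> pre_dom \<phi>"
          then have "u \<in> Linfty M" using L by (simp add: pre_dom_def)
          from pre_val_cong(1)[OF \<phi> v this a2] False show False by blast
        qed
        then show ?thesis using False by (simp add: eq)
      qed
    qed
    show "pre_local_form M E \<phi> (c *\<^sub>R u) = ereal (c\<^sup>2) * pre_local_form M E \<phi> u" for c u
    proof (cases "c = 0")
      case True
      then show ?thesis by (simp add: eq zero_ereal_def[symmetric])
    next
      case False
      have "c *\<^sub>R u \<in> pre_dom \<phi> \<longleftrightarrow> u \<in> pre_dom \<phi>"
      proof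
        assume "c *\<^sub>R u \<in> pre_dom \<phi>"
        then have "(1 / c) *\<^sub>R (c *\<^sub>R u) \<in> pre_dom \<phi>" by (rule p.mem(3))
        then show "u \<in> pre_dom \<phi>" using False by simp
      qed (rule p.mem(3))
      then show ?thesis using False p.hom by (auto simp: eq)
    qed
    show "pre_local_form M E \<phi> (u + v) + pre_local_form M E \<phi> (u - v) \<le>
        2 * pre_local_form M E \<phi> u + 2 * pre_local_form M E \<phi> v" for u v
    proof (cases "u \<in> pre_dom \<phi> \<and> v \<in> pre_dom \<phi>")
      case True
      then have "u + v \<in> pre_dom \<phi>" "u - v \<in> pre_dom \<phi>" by auto
      moreover have "2 = ereal 2" by simp
      ultimately show ?thesis using True p.par[of u v] by (simp add: eq)
    next
      case False
      have "2 * pre_local_form M E \<phi> u + 2 * pre_local_form M E \<phi> v = \<infinity>"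
        using False p.nonneg[of u] p.nonneg[of v] by (auto simp: eq)
      then show ?thesis by (simp only: ereal_less_eq(1))
    qed
  qed
qed

text \<open>
  Closability.  After truncation an approximating net is uniformly bounded; then its product with
  \<open>\<phi>\<close> is bounded in energy, and \<open>E (\<phi> f\<^sup>2, \<phi>)\<close> passes to the limit by weak convergence.
\<close>

lemma pre_val_le_lsc_envelope:
  assumes \<phi>: "unit_fn \<phi>" and f: "f \<in> pre_dom \<phi>"
  shows "ereal (pre_val \<phi> f) \<le> lsc_envelope M (pre_local_form M E \<phi>) f"
proof (cases "lsc_envelope M (pre_local_form M E \<phi>) f")
  case PInf
  then show ?thesis by simp
next
  case MInf
  have "0 \<le> lsc_envelope M (pre_local_form M E \<phi>) f"
    by (rule lsc_envelope_nonneg[OF quadratic_form_nonneg[OF quadratic_form_pre_local_form[OF \<phi>]]])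
  then show ?thesis using MInf by simp
next
  case (real r)
  note eq = pre_local_form_eq[OF \<phi>]
  have \<phi>D: "\<phi> \<in> D" by (rule unit_fnD(1)[OF \<phi>])
  have \<phi>m: "\<phi> \<in> borel_measurable M" by (rule meas[OF \<phi>D])
  have "f \<in> Linfty M" using f by (simp add: pre_dom_def)
  then obtain c where c: "f \<in> borel_measurable M" "AE x in M. \<bar>f x\<bar> \<le> c" "0 < c" by (rule LinftyE)
  obtain v where vm: "\<And>p. v p \<in> borel_measurable M" and vfin: "\<And>p. pre_local_form M E \<phi> (v p) < \<infinity>"
    and vt: "tconv M v f (fin_filter M)"
    and "((\<lambda>p. pre_local_form M E \<phi> (v p)) \<longlongrightarrow> ereal r) (fin_filter M)"
    and vle: "\<And>p. pre_local_form M E \<phi> (v p) \<le> ereal (r + 1 / real (Suc (snd p)))"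
    by (rule lsc_envelope_approx[OF c(1) real], rule that)
  have vd: "v p \<in> pre_dom \<phi>" for p using vfin[of p] by (auto simp: eq split: if_splits)
  have vval: "pre_val \<phi> (v p) \<le> r + 1 / real (Suc (snd p))" for p
    using vle[of p] vd[of p] by (simp add: eq)
  \<comment> \<open>The level is a bound for \<open>f\<close>, so truncation does not move the
    limit.\<close>
  define w where "w p = truncate c \<circ> v p" for p
  have c0: "0 \<le> c" using c by simp
  have wd: "w p \<in> pre_dom \<phi>" for p unfolding w_def by (rule pre_val_truncate(1)[OF \<phi> vd c0])
  have wval: "pre_val \<phi> (w p) \<le> r + 1 / real (Suc (snd p))" for p
    unfolding w_def using pre_val_truncate(2)[OF \<phi> vd c0, of p] vval[of p] by linarith
  have wbnd: "\<bar>w p x\<bar> \<le> c" for p x unfolding w_def by (simp add: truncate_bound[OF c0])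
  have wm: "w p \<in> borel_measurable M" for p by (rule pre_domD(1)[OF \<phi> wd])
  have wt: "tconv M w f (fin_filter M)"
  proof (rule tconv_contract[OF vt vm c(1) wm c(1), where c = 1])
    show "AE x in M. \<bar>w p x - f x\<bar> \<le> 1 * \<bar>v p x - f x\<bar>" for p
      using c(2)
    proof eventually_elim
      case (elim x)
      then show ?case using truncate_lipschitz[of c "v p x" "f x"] truncate_eq[of "f x" c] by (simp add: w_def)
    qed
  qed
  let ?X = "\<lambda>p x. \<phi> x * w p x" and ?S = "\<lambda>p x. \<phi> x * (w p x)\<^sup>2"
  have XD: "?X p \<in> D" and SD: "?S p \<in> D" for p by (rule pre_domD(2)[OF \<phi> wd], rule pre_domD(3)[OF \<phi> wd])
  have fX: "(\<lambda>x. \<phi> x * f x) \<in> D" and fS: "(\<lambda>x. \<phi> x * (f x)\<^sup>2) \<in> D"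
    by (rule pre_domD(2)[OF \<phi> f], rule pre_domD(3)[OF \<phi> f])
  have SQ: "Q (?S p) \<le> 8 * c\<^sup>2 * Q (?X p) + 2 * c ^ 4 * Q \<phi>" for p
    by (rule product_square_mem(2)[OF \<phi> wm XD _ c0]) (use wbnd in simp)
  define C where "C = 2 * (r + 1) + (c\<^sup>2 / 4 + 8 * c\<^sup>2) * Q \<phi>"
  have XQ: "Q (?X p) \<le> C" for p
  proof -
    \<comment> \<open>With this weight the energy of \<phi> w enters the bound for
      \<open>2 * B (?S p) \<phi>\<close> with coefficient 1, so half of \<open>Q (?X p)\<close> is
      absorbed; solving for it yields \<open>C\<close>.\<close>
    let ?k = "1 / (8 * c\<^sup>2)"
    have k: "0 < ?k" using c(3) by simp
    have "2 * B (?S p) \<phi> \<le> ?k * Q (?S p) + Q \<phi> / ?k" by (rule B_weighted[OF SD \<phi>D k])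
    also have "?k * Q (?S p) \<le> ?k * (8 * c\<^sup>2 * Q (?X p) + 2 * c ^ 4 * Q \<phi>)"
      using k by (intro mult_left_mono SQ) simp
    also have "\<dots> = Q (?X p) + c\<^sup>2 / 4 * Q \<phi>"
      using c(3) by (simp add: field_simps power2_eq_square power4_eq_xxxx)
    also have "Q \<phi> / ?k = 8 * c\<^sup>2 * Q \<phi>" by simp
    finally have b: "2 * B (?S p) \<phi> \<le> Q (?X p) + c\<^sup>2 / 4 * Q \<phi> + 8 * c\<^sup>2 * Q \<phi>" by simp
    have "1 / real (Suc (snd p)) \<le> 1" by simp
    then have "Q (?X p) - B (?S p) \<phi> \<le> r + 1" using wval[of p] unfolding pre_val_def by linarith
    with b show ?thesis unfolding C_def by (simp add: algebra_simps)
  qed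
  have C0: "0 \<le> C" using XQ[of undefined] nonneg[OF XD[of undefined]] by linarith
  have Xt: "tconv M ?X (\<lambda>x. \<phi> x * f x) (fin_filter M)"
  proof (rule tconv_contract[OF wt wm c(1) meas[OF XD] meas[OF fX], where c = 1])
    show "AE x in M. \<bar>\<phi> x * w p x - \<phi> x * f x\<bar> \<le> 1 * \<bar>w p x - f x\<bar>" for p
      using unit_fnD(2)[OF \<phi>]
    proof eventually_elim
      case (elim x)
      have "\<bar>\<phi> x * w p x - \<phi> x * f x\<bar> = \<phi> x * \<bar>w p x - f x\<bar>"
        using elim by (simp add: right_diff_distrib[symmetric] abs_mult)
      then show ?case using elim by (simp add: mult_left_le_one_le)
    qed
  qed
  have St: "tconv M ?S (\<lambda>x. \<phi> x * (f x)\<^sup>2) (fin_filter M)"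
  proof (rule tconv_contract[OF wt wm c(1) meas[OF SD] meas[OF fS], where c = "2 * c"])
    show "AE x in M. \<bar>\<phi> x * (w p x)\<^sup>2 - \<phi> x * (f x)\<^sup>2\<bar> \<le> 2 * c * \<bar>w p x - f x\<bar>" for p
      using unit_fnD(2)[OF \<phi>] c(2)
    proof eventually_elim
      case (elim x)
      have "\<phi> x * (w p x)\<^sup>2 - \<phi> x * (f x)\<^sup>2 = \<phi> x * ((w p x + f x) * (w p x - f x))"
        by (simp add: power2_eq_square algebra_simps)
      then have "\<bar>\<phi> x * (w p x)\<^sup>2 - \<phi> x * (f x)\<^sup>2\<bar> = \<phi> x * (\<bar>w p x + f x\<bar> * \<bar>w p x - f x\<bar>)"
        using elim by (simp add: abs_mult)
      also have "\<dots> \<le> \<bar>w p x + f x\<bar> * \<bar>w p x - f x\<bar>"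
        using elim by (simp add: mult_left_le_one_le)
      also have "\<dots> \<le> 2 * c * \<bar>w p x - f x\<bar>"
        using elim wbnd[of p x] by (intro mult_right_mono) auto
      finally show ?case .
    qed
  qed
  have SQ': "Q (?S p) \<le> 8 * c\<^sup>2 * C + 2 * c ^ 4 * Q \<phi>" for p
  proof -
    have "8 * c\<^sup>2 * Q (?X p) \<le> 8 * c\<^sup>2 * C" by (intro mult_left_mono XQ) simp
    then show ?thesis using SQ[of p] by linarith
  qed
  have Blim: "((\<lambda>p. B (?S p) \<phi>) \<longlongrightarrow> B (\<lambda>x. \<phi> x * (f x)\<^sup>2) \<phi>) (fin_filter M)"
    unfolding B_eq[symmetric]
    by (rule lower_semicont_weak_convergence[OF qf lsc SD fS St _ \<phi>D, where C = "8 * c\<^sup>2 * C + 2 * c ^ 4 * Q \<phi>"])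
      (use SQ' in simp)
  have "E (\<lambda>x. \<phi> x * f x) \<le> ereal (r + B (\<lambda>x. \<phi> x * (f x)\<^sup>2) \<phi>)"
  proof (rule lower_semicont_le[OF lsc _ meas[OF fX] Xt fin_filter_not_bot])
    show "\<forall>\<^sub>F p in fin_filter M. ?X p \<in> borel_measurable M" using meas[OF XD] by simp
    show "\<forall>\<^sub>F p in fin_filter M. E (?X p) \<le> ereal (r + 1 / real (Suc (snd p)) + B (?S p) \<phi>)"
    proof (intro always_eventually allI)
      fix p
      have "Q (?X p) \<le> r + 1 / real (Suc (snd p)) + B (?S p) \<phi>" using wval[of p] unfolding pre_val_def by linarith
      then show "E (?X p) \<le> ereal (r + 1 / real (Suc (snd p)) + B (?S p) \<phi>)"
        using E_eq[OF XD[of p]] by (metis ereal_less_eq(3))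
    qed
    have "((\<lambda>p. r + 1 / real (Suc (snd p)) + B (?S p) \<phi>) \<longlongrightarrow> r + 0 + B (\<lambda>x. \<phi> x * (f x)\<^sup>2) \<phi>) (fin_filter M)"
      by (intro tendsto_intros tendsto_fin_filter_snd Blim)
    then show "((\<lambda>p. ereal (r + 1 / real (Suc (snd p)) + B (?S p) \<phi>)) \<longlongrightarrow> ereal (r + B (\<lambda>x. \<phi> x * (f x)\<^sup>2) \<phi>)) (fin_filter M)"
      by simp
  qed
  then have "Q (\<lambda>x. \<phi> x * f x) \<le> r + B (\<lambda>x. \<phi> x * (f x)\<^sup>2) \<phi>" using E_leD by blast
  then show ?thesis unfolding real pre_val_def by simp
qed

lemma local_form_eq:
  assumes \<phi>: "unit_fn \<phi>"
  shows "local_form M E \<phi> = lsc_envelope M (pre_local_form M E \<phi>)"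
  unfolding local_form_def
proof (rule form_closure_eq_lsc_envelope[OF loc quadratic_form_pre_local_form[OF \<phi>]])
  fix u assume "u \<in> form_domain (pre_local_form M E \<phi>)"
  then have "u \<in> pre_dom \<phi>" by (auto simp: form_domain_def pre_local_form_eq[OF \<phi>] split: if_splits)
  then show "pre_local_form M E \<phi> u \<le> lsc_envelope M (pre_local_form M E \<phi>) u"
    using pre_val_le_lsc_envelope[OF \<phi>] by (simp add: pre_local_form_eq[OF \<phi>])
qed

lemma quadratic_form_local_form: "unit_fn \<phi> \<Longrightarrow> quadratic_form M (local_form M E \<phi>)"
  using quadratic_form_lsc_envelope[OF quadratic_form_pre_local_form] by (simp add: local_form_eq)

lemma lower_semicont_local_form: "unit_fn \<phi> \<Longrightarrow> lower_semicont M (local_form M E \<phi>)"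
  using lower_semicont_lsc_envelope by (simp add: local_form_eq)

lemma local_form_pre_dom:
  assumes \<phi>: "unit_fn \<phi>" and f: "f \<in> pre_dom \<phi>"
  shows "local_form M E \<phi> f = ereal (pre_val \<phi> f)"
  using pre_val_le_lsc_envelope[OF assms] lsc_envelope_le[OF pre_domD(1)[OF assms], of "pre_local_form M E \<phi>"] f
  by (simp add: local_form_eq[OF \<phi>] pre_local_form_eq[OF \<phi>])

text \<open>The source of the inclusion of local functions into the domain of E_\<phi>:
  \<open>f\<close> need not lie in \<open>D\<close>, but E_\<phi> cannot distinguish it from
  \<open>g\<close>. Truncating both at the same level preserves \<phi> f = \<phi> g, and the bound
  for bounded functions passes to the limit by semicontinuity of the closure.\<close>

lemma local_form_le:
  assumes \<phi>: "unit_fn \<phi>" and fm: "f \<in> borel_measurable M" and g: "g \<in> D" and ae: "AE x in M. \<phi> x * f x = \<phi> x * g x"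
  shows "local_form M E \<phi> f \<le> ereal (Q g)"
proof (rule lower_semicont_le[OF lower_semicont_local_form[OF \<phi>] _ fm _ sequentially_bot])
  let ?f = "\<lambda>n. truncate (real (Suc n)) \<circ> f" and ?g = "\<lambda>n. truncate (real (Suc n)) \<circ> g"
  have fnm: "?f n \<in> borel_measurable M" for n by (rule truncate_measurable[OF fm])
  show "\<forall>\<^sub>F n in sequentially. ?f n \<in> borel_measurable M" using fnm by simp
  show "tconv M ?f f sequentially" by (rule tconv_pointwise[OF fnm fm]) (simp only: comp_def tendsto_truncate)
  have le: "local_form M E \<phi> (?f n) \<le> ereal (Q (?g n))" for n
  proof -
    have gD: "?g n \<in> D" by (rule truncate_strong(1)[OF g])
    have gb: "AE x in M. \<bar>?g n x\<bar> \<le> real (Suc n)" by (rule AE_I2) (simp add: truncate_bound)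
    have gp: "?g n \<in> pre_dom \<phi>" by (rule bounded_mem_pre_dom[OF \<phi> gD gb]) simp
    have fL: "?f n \<in> Linfty M"
      unfolding Linfty_def using fnm[of n] by (auto intro!: exI[of _ "real (Suc n)"] simp: truncate_bound)
    have ae': "AE x in M. \<phi> x * ?g n x = \<phi> x * ?f n x" using ae by eventually_elim auto
    have "local_form M E \<phi> (?f n) = ereal (pre_val \<phi> (?f n))"
      by (rule local_form_pre_dom[OF \<phi> pre_val_cong(1)[OF \<phi> gp fL ae']])
    also have "pre_val \<phi> (?f n) = pre_val \<phi> (?g n)" by (rule pre_val_cong(2)[OF \<phi> gp fL ae', symmetric])
    also have "ereal (pre_val \<phi> (?g n)) \<le> ereal (Q (?g n))"
      unfolding ereal_less_eq(3) by (rule pre_val_le_Q[OF \<phi> gD gb]) simp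
    finally show ?thesis .
  qed
  then show "\<forall>\<^sub>F n in sequentially. local_form M E \<phi> (?f n) \<le> ereal (Q (?g n))" by simp
  have "(\<lambda>n. Q (?g n)) \<longlonglongrightarrow> Q g" by (rule tendsto_Q[OF truncate_strong(1)[OF g] g truncate_strong(2)[OF g]])
  then show "(\<lambda>n. ereal (Q (?g n))) \<longlonglongrightarrow> ereal (Q g)" by simp
qed

section \<open>The closed forms as real-valued forms on the domain of E\<close>

definition lf :: "('a \<Rightarrow> real) \<Rightarrow> ('a \<Rightarrow> real) \<Rightarrow> real" where
  "lf \<phi> f = real_form (local_form M E \<phi>) f"

lemma local_form_D:
  assumes \<phi>: "unit_fn \<phi>" and f: "f \<in> D"
  shows "local_form M E \<phi> f = ereal (lf \<phi> f)" "lf \<phi> f \<le> Q f" "f \<in> form_domain (local_form M E \<phi>)"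
proof -
  have le: "local_form M E \<phi> f \<le> ereal (Q f)" by (rule local_form_le[OF \<phi> meas[OF f] f]) simp
  then show fd: "f \<in> form_domain (local_form M E \<phi>)" by (auto simp: form_domain_def)
  show eq: "local_form M E \<phi> f = ereal (lf \<phi> f)"
    unfolding lf_def by (rule form_domain_eq[OF quadratic_form_local_form[OF \<phi>] fd])
  show "lf \<phi> f \<le> Q f" using le unfolding eq by simp
qed

lemma quad_space_lf:
  assumes \<phi>: "unit_fn \<phi>"
  shows "quad_space D (lf \<phi>)"
proof -
  interpret l: quad_space "form_domain (local_form M E \<phi>)" "real_form (local_form M E \<phi>)"
    by (rule quad_space_form[OF quadratic_form_local_form[OF \<phi>]])
  show ?thesis
    by unfold_locales (use sub local_form_D(3)[OF \<phi>] l.nonneg l.par l.hom in \<open>auto simp: lf_def\<close>)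
qed

end

text \<open>Continuity of a dominated form under convergence in energy; this is how inequalities for
  truncated functions extend to all of \<open>D\<close>.\<close>

lemma (in quad_space) dominated_tendsto:
  assumes P: "quad_space D P" and le: "\<And>u. u \<in> D \<Longrightarrow> P u \<le> Q u"
    and X: "\<And>i. X i \<in> D" and x: "x \<in> D" and lim: "((\<lambda>i. Q (X i - x)) \<longlongrightarrow> 0) F"
  shows "((\<lambda>i. P (X i)) \<longlongrightarrow> P x) F"
proof -
  have l: "norm (P (X i - x)) \<le> Q (X i - x)" for i
    using le[OF mem(2)[OF X x]] quad_space.nonneg[OF P mem(2)[OF X x]] by simp
  have "((\<lambda>i. P (X i - x)) \<longlongrightarrow> 0) F"
    by (rule Lim_null_comparison[OF always_eventually[OF allI[OF l]] lim])
  then show ?thesis by (rule quad_space.tendsto_Q[OF P X x])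
qed

lemma (in energy) lf_mono:
  assumes \<phi>: "unit_fn \<phi>" and \<eta>: "unit_fn \<eta>" and le: "AE x in M. \<phi> x \<le> \<eta> x" and f: "f \<in> D"
  shows "lf \<phi> f \<le> lf \<eta> f"
proof -
  let ?f = "\<lambda>n. truncate (real (Suc n)) \<circ> f"
  have "lf \<phi> (?f n) \<le> lf \<eta> (?f n)" for n
  proof -
    have fD: "?f n \<in> D" by (rule truncate_strong(1)[OF f])
    have fb: "AE x in M. \<bar>?f n x\<bar> \<le> real (Suc n)" by (rule AE_I2) (simp add: truncate_bound)
    have "pre_val \<phi> (?f n) \<le> pre_val \<eta> (?f n)" by (rule pre_val_mono[OF \<phi> \<eta> le fD fb]) simp
    moreover have "?f n \<in> pre_dom \<phi>" by (rule bounded_mem_pre_dom[OF \<phi> fD fb]) simp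
    moreover have "?f n \<in> pre_dom \<eta>" by (rule bounded_mem_pre_dom[OF \<eta> fD fb]) simp
    ultimately show ?thesis
      unfolding lf_def using local_form_pre_dom[OF \<phi>, of "?f n"] local_form_pre_dom[OF \<eta>, of "?f n"]
      by (simp del: of_nat_Suc)
  qed
  moreover have "(\<lambda>n. lf \<phi> (?f n)) \<longlonglongrightarrow> lf \<phi> f"
    by (rule dominated_tendsto[OF quad_space_lf[OF \<phi>] local_form_D(2)[OF \<phi>] truncate_strong(1)[OF f] f truncate_strong(2)[OF f]])
  moreover have "(\<lambda>n. lf \<eta> (?f n)) \<longlonglongrightarrow> lf \<eta> f"
    by (rule dominated_tendsto[OF quad_space_lf[OF \<eta>] local_form_D(2)[OF \<eta>] truncate_strong(1)[OF f] f truncate_strong(2)[OF f]])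
  ultimately show ?thesis by (intro LIMSEQ_le) auto
qed

section \<open>Main part and killing part\<close>

text \<open>Directedness is essential: indices chosen separately for \<open>u + v\<close> and
  \<open>u - v\<close> are replaced by a common larger one, to which the parallelogram law
  applies.\<close>

lemma quad_space_directed_SUP:
  fixes P :: "'i \<Rightarrow> 'v::real_vector \<Rightarrow> real"
  assumes ne: "I \<noteq> {}" and P: "\<And>i. i \<in> I \<Longrightarrow> quad_space D (P i)"
    and le: "\<And>i u. i \<in> I \<Longrightarrow> u \<in> D \<Longrightarrow> P i u \<le> Q u"
    and dir: "\<And>i j. i \<in> I \<Longrightarrow> j \<in> I \<Longrightarrow> \<exists>k\<in>I. \<forall>u\<in>D. P i u \<le> P k u \<and> P j u \<le> P k u"
  shows "quad_space D (\<lambda>u. SUP i\<in>I. P i u)"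
proof (rule quad_spaceI)
  let ?S = "\<lambda>u. SUP i\<in>I. P i u"
  obtain i0 where i0: "i0 \<in> I" using ne by blast
  have bdd: "bdd_above ((\<lambda>i. P i u) ` I)" if "u \<in> D" for u
    using le that by (intro bdd_aboveI2) auto
  have upper: "P i u \<le> ?S u" if "i \<in> I" "u \<in> D" for i u
    by (rule cSUP_upper[OF that(1) bdd[OF that(2)]])
  show sub: "subspace D" by (rule quad_space.sub[OF P[OF i0]])
  show "0 \<le> ?S u" if "u \<in> D" for u
    using quad_space.nonneg[OF P[OF i0] that] upper[OF i0 that] by linarith
  have hom_le: "?S (c *\<^sub>R u) \<le> c\<^sup>2 * ?S u" if "u \<in> D" for c u
  proof (rule cSUP_least[OF ne])
    fix i assume i: "i \<in> I"
    show "P i (c *\<^sub>R u) \<le> c\<^sup>2 * ?S u"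
      unfolding quad_space.hom[OF P[OF i] that] using upper[OF i that] by (intro mult_left_mono) auto
  qed
  show "?S (c *\<^sub>R u) = c\<^sup>2 * ?S u" if u: "u \<in> D" for c u
  proof (cases "c = 0")
    case True
    have "P i 0 = 0" if "i \<in> I" for i using quad_space.Q_zero[OF P[OF that]] .
    then have "?S 0 = (SUP i\<in>I. 0)" by (intro SUP_cong) auto
    then show ?thesis using True ne by simp
  next
    case False
    have "?S ((1 / c) *\<^sub>R (c *\<^sub>R u)) \<le> (1 / c)\<^sup>2 * ?S (c *\<^sub>R u)"
      by (rule hom_le[OF subspace_scale[OF sub u]])
    then have "c\<^sup>2 * ?S u \<le> ?S (c *\<^sub>R u)"
      using False by (simp add: power_divide pos_le_divide_eq mult.commute)
    then show ?thesis using hom_le[OF u, of c] by simp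
  qed
  show "?S (u + v) + ?S (u - v) \<le> 2 * ?S u + 2 * ?S v" if u: "u \<in> D" and v: "v \<in> D" for u v
  proof -
    have uv: "u + v \<in> D" "u - v \<in> D" using u v sub by (auto intro: subspace_add subspace_diff)
    have "P i (u + v) + P j (u - v) \<le> 2 * ?S u + 2 * ?S v" if i: "i \<in> I" and j: "j \<in> I" for i j
    proof -
      obtain k where k: "k \<in> I" "P i (u + v) \<le> P k (u + v)" "P j (u - v) \<le> P k (u - v)"
        using dir[OF i j] uv by blast
      then show ?thesis
        using quad_space.par[OF P[OF k(1)] u v] upper[OF k(1) u] upper[OF k(1) v] by linarith
    qed
    then have "?S (u + v) \<le> 2 * ?S u + 2 * ?S v - P j (u - v)" if "j \<in> I" for j
      using that by (intro cSUP_least[OF ne]) (simp add: le_diff_eq)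
    then have "?S (u - v) \<le> 2 * ?S u + 2 * ?S v - ?S (u + v)"
      by (intro cSUP_least[OF ne]) (simp add: algebra_simps)
    then show ?thesis by simp
  qed
qed

text \<open>The difference has slope 1 where the absolute value lies between \<open>a\<close> and
  \<open>b\<close>, and is constant elsewhere.\<close>

lemma truncate_diff_lipschitz:
  assumes "0 \<le> a" "a \<le> b"
  shows "\<bar>(truncate b x - truncate a x) - (truncate b y - truncate a y)\<bar> \<le> \<bar>x - y\<bar>"
  using assms unfolding truncate_def by (auto simp: max_def min_def abs_if)

text \<open>The upper level makes the function bounded; the lower one makes it vanish for
  \<bar>x\<bar> \<le> 1 / (n + 1). Where \<open>band n \<circ> f\<close> is not 0, a multiple of
  \<bar>f\<bar> cut at 1 equals 1, so \<open>D\<close> contains a unit function that is 1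
  there.\<close>

definition band :: "nat \<Rightarrow> real \<Rightarrow> real" where
  "band n x = truncate (real (Suc n)) x - truncate (1 / real (Suc n)) x"

lemma band_lipschitz: "\<bar>band n x - band n y\<bar> \<le> \<bar>x - y\<bar>"
proof -
  have "1 / real (Suc n) \<le> 1" "1 \<le> real (Suc n)" by simp_all
  then have "1 / real (Suc n) \<le> real (Suc n)" by linarith
  then show ?thesis unfolding band_def by (intro truncate_diff_lipschitz) auto
qed

lemma band_zero [simp]: "band n 0 = 0"
  by (simp add: band_def)

lemma band_bound: "\<bar>band n x\<bar> \<le> real (Suc n) + 1 / real (Suc n)"
  using truncate_bound[of "real (Suc n)" x] truncate_bound[of "1 / real (Suc n)" x] unfolding band_def
  by (simp del: of_nat_Suc)

lemma truncate_minus: "0 \<le> c \<Longrightarrow> truncate c (- x) = - truncate c x"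
  unfolding truncate_def by (auto simp: max_def min_def)

lemma band_minus: "band n (- x) = - band n x"
  by (simp add: band_def truncate_minus del: of_nat_Suc)

lemma band_square_cong: "\<bar>x\<bar> = \<bar>y\<bar> \<Longrightarrow> (band n x)\<^sup>2 = (band n y)\<^sup>2"
  by (auto simp: abs_eq_iff band_minus)

lemma band_nonzero: "band n x \<noteq> 0 \<Longrightarrow> 1 \<le> real (Suc n) * \<bar>x\<bar>"
proof (rule ccontr)
  assume nz: "band n x \<noteq> 0" and "\<not> 1 \<le> real (Suc n) * \<bar>x\<bar>"
  then have x: "\<bar>x\<bar> \<le> 1 / real (Suc n)" by (simp add: field_simps del: of_nat_Suc)
  have "1 / real (Suc n) \<le> 1" "1 \<le> real (Suc n)" by simp_all
  then have "\<bar>x\<bar> \<le> real (Suc n)" using x by linarith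
  then show False using x nz by (simp add: band_def truncate_eq del: of_nat_Suc)
qed

lemma tendsto_band: "(\<lambda>n. band n x) \<longlonglongrightarrow> x"
proof -
  have "(\<lambda>n. 1 / real (Suc n)) \<longlonglongrightarrow> 0"
    using LIMSEQ_inverse_real_of_nat by (simp add: inverse_eq_divide)
  moreover have "norm (truncate (1 / real (Suc n)) x) \<le> 1 / real (Suc n)" for n
    using truncate_bound[of "1 / real (Suc n)" x] by (simp del: of_nat_Suc)
  ultimately have "(\<lambda>n. truncate (1 / real (Suc n)) x) \<longlonglongrightarrow> 0"
    by (metis (no_types, lifting) Lim_null_comparison always_eventually)
  from tendsto_diff[OF tendsto_truncate this] show ?thesis by (simp add: band_def)
qed

context energy
begin

section \<open>Suprema over directed families of unit functions\<close>

definition sup_form :: "('a \<Rightarrow> real) set \<Rightarrow> ('a \<Rightarrow> real) \<Rightarrow> real" where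
  "sup_form I f = (SUP \<phi>\<in>I. lf \<phi> f)"

text \<open>Stated for a general family because two are compared later: all unit functions, which
  define the main part, and those in the nest domain, which index the limit.\<close>

definition directed_units :: "('a \<Rightarrow> real) set \<Rightarrow> bool" where
  "directed_units I \<longleftrightarrow> I \<noteq> {} \<and> (\<forall>\<phi>\<in>I. unit_fn \<phi>) \<and> (\<forall>\<phi>\<in>I. \<forall>\<eta>\<in>I. (\<lambda>x. max (\<phi> x) (\<eta> x)) \<in> I)"

lemma lf_le_sup_form:
  assumes I: "directed_units I" and "\<phi> \<in> I" "f \<in> D"
  shows "lf \<phi> f \<le> sup_form I f"
  unfolding sup_form_def using assms local_form_D(2)
  by (intro cSUP_upper bdd_aboveI2[where M = "Q f"]) (auto simp: directed_units_def)

lemma sup_form_le: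
  assumes I: "directed_units I" and "\<And>\<phi>. \<phi> \<in> I \<Longrightarrow> lf \<phi> f \<le> c"
  shows "sup_form I f \<le> c"
  unfolding sup_form_def using assms by (intro cSUP_least) (auto simp: directed_units_def)

lemma sup_form_le_Q:
  assumes I: "directed_units I" and f: "f \<in> D"
  shows "sup_form I f \<le> Q f"
  using I local_form_D(2)[OF _ f] by (intro sup_form_le) (auto simp: directed_units_def)

lemma quad_space_sup_form:
  assumes I: "directed_units I"
  shows "quad_space D (sup_form I)"
  unfolding sup_form_def[abs_def]
proof (rule quad_space_directed_SUP)
  show "I \<noteq> {}" using I by (simp add: directed_units_def)
  show "quad_space D (lf \<phi>)" if "\<phi> \<in> I" for \<phi> using quad_space_lf I that by (simp add: directed_units_def)
  show "lf \<phi> u \<le> Q u" if "\<phi> \<in> I" "u \<in> D" for \<phi> u using local_form_D(2) I that by (simp add: directed_units_def)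
  fix \<phi> \<eta> assume \<phi>: "\<phi> \<in> I" and \<eta>: "\<eta> \<in> I"
  have u: "unit_fn \<phi>" "unit_fn \<eta>" "(\<lambda>x. max (\<phi> x) (\<eta> x)) \<in> I" "unit_fn (\<lambda>x. max (\<phi> x) (\<eta> x))"
    using I \<phi> \<eta> by (auto simp: directed_units_def)
  show "\<exists>k\<in>I. \<forall>u\<in>D. lf \<phi> u \<le> lf k u \<and> lf \<eta> u \<le> lf k u"
    using u by (intro bexI[OF _ u(3)] ballI conjI lf_mono) auto
qed

definition units :: "('a \<Rightarrow> real) set" where "units = {\<phi>. unit_fn \<phi>}"

lemma units_eq: "units = unit_functions M D"
  by (auto simp: units_def unit_fn_def unit_functions_def)

lemma unit_fn_zero: "unit_fn 0"
  using mem(4) by (simp add: unit_fn_def)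

lemma directed_units_all: "directed_units units"
  using unit_fn_zero max_unit_fn by (auto simp: directed_units_def units_def)

abbreviation main :: "('a \<Rightarrow> real) \<Rightarrow> real" where "main \<equiv> sup_form units"

lemma main_part_eq:
  assumes f: "f \<in> D"
  shows "main_part M E f = ereal (main f)"
  unfolding main_part_def units_eq[symmetric]
proof (rule antisym)
  show "(SUP \<phi>\<in>units. local_form M E \<phi> f) \<le> ereal (main f)"
  proof (rule SUP_least)
    fix \<phi> assume \<phi>: "\<phi> \<in> units"
    then have "unit_fn \<phi>" by (simp add: units_def)
    from local_form_D(1)[OF this f] lf_le_sup_form[OF directed_units_all \<phi> f]
    show "local_form M E \<phi> f \<le> ereal (main f)" by simp
  qed
  let ?S = "SUP \<phi>\<in>units. local_form M E \<phi> f"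
  have up: "ereal (lf \<phi> f) \<le> ?S" if "\<phi> \<in> units" for \<phi>
  proof -
    have "unit_fn \<phi>" using that by (simp add: units_def)
    from SUP_upper[OF that, of "\<lambda>\<phi>. local_form M E \<phi> f"] local_form_D(1)[OF this f] show ?thesis by simp
  qed
  show "ereal (main f) \<le> ?S"
  proof (cases ?S)
    case (real s)
    have "main f \<le> s" by (rule sup_form_le[OF directed_units_all]) (use up real in simp)
    then show ?thesis using real by simp
  next
    case MInf
    have "(0 :: 'a \<Rightarrow> real) \<in> units" using unit_fn_zero by (simp add: units_def)
    from up[OF this] MInf show ?thesis by simp
  qed simp
qed

section \<open>The killing part as a quadratic form\<close>

definition kill :: "('a \<Rightarrow> real) \<Rightarrow> real" where "kill f = Q f - main f"

lemma quad_space_kill: "quad_space D kill"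
proof -
  interpret m: quad_space D main by (rule quad_space_sup_form[OF directed_units_all])
  show ?thesis
  proof
    show "subspace D" by (rule sub)
    show "0 \<le> kill u" if "u \<in> D" for u using sup_form_le_Q[OF directed_units_all that] by (simp add: kill_def)
    show "kill (u + v) + kill (u - v) = 2 * kill u + 2 * kill v" if "u \<in> D" "v \<in> D" for u v
      unfolding kill_def right_diff_distrib using par[OF that] m.par[OF that] by linarith
    show "kill (c *\<^sub>R u) = c\<^sup>2 * kill u" if "u \<in> D" for u c
      unfolding kill_def right_diff_distrib hom[OF that] m.hom[OF that] ..
  qed
qed

lemma kill_le_Q: "f \<in> D \<Longrightarrow> kill f \<le> Q f"
  using quad_space.nonneg[OF quad_space_sup_form[OF directed_units_all]] by (simp add: kill_def)

lemma killing_part_eq: "f \<in> D \<Longrightarrow> killing_part M E f = ereal (kill f)"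
  unfolding killing_part_def kill_def main_part_eq by (subst E_eq) simp_all

lemma form_bilinear_killing_part:
  assumes "f \<in> D" "g \<in> D"
  shows "form_bilinear (killing_part M E) f g = quad_space.B kill f g"
  using killing_part_eq[OF mem(1)[OF assms]] killing_part_eq[OF mem(2)[OF assms]]
  unfolding form_bilinear_def quad_space.B_def[OF quad_space_kill] plus_fun_def fun_diff_def by simp

text \<open>
  Away from the zero set, \<open>\<phi>\<close> may be taken equal to \<open>1\<close> where \<open>f\<close> lives, so that
  \<open>E(f) - E\<^sub>\<phi>(f) = E(f\<^sup>2, \<phi>)\<close>, which depends on \<open>\<bar>f\<bar>\<close> only.
\<close>

lemma kill_band_le:
  assumes f: "f \<in> D" and g: "g \<in> D" and fg: "AE x in M. \<bar>f x\<bar> = \<bar>g x\<bar>"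
  shows "kill (band n \<circ> f) \<le> kill (band n \<circ> g)"
proof -
  let ?f = "band n \<circ> f" and ?g = "band n \<circ> g"
  have fD: "?f \<in> D" and gD: "?g \<in> D"
    by (rule contraction(1)[OF f band_lipschitz band_zero], rule contraction(1)[OF g band_lipschitz band_zero])
  let ?c = "real (Suc n) + 1 / real (Suc n)"
  have c0: "0 \<le> ?c" by simp
  have fb: "AE x in M. \<bar>?f x\<bar> \<le> ?c" and gb: "AE x in M. \<bar>?g x\<bar> \<le> ?c"
    using band_bound by (auto intro!: AE_I2 simp del: of_nat_Suc)
  \<comment> \<open>Equal to 1 where \<open>band n \<circ> f\<close> is not 0, and almost everywhere
    where \<open>band n \<circ> g\<close> is not 0, as it depends on \<bar>f\<bar> only.\<close>
  define \<phi>0 where "\<phi>0 = unit_clamp \<circ> (real (Suc n) *\<^sub>R (abs \<circ> f))"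
  have "abs \<circ> f \<in> D" by (rule contraction(1)[OF f]) (auto simp: abs_triangle_ineq3)
  then have "real (Suc n) *\<^sub>R (abs \<circ> f) \<in> D" by (rule mem(3))
  then have "\<phi>0 \<in> D"
    unfolding \<phi>0_def by (rule contraction(1)) (auto simp: unit_clamp_def)
  then have \<phi>0: "unit_fn \<phi>0" by (auto simp: unit_fn_def \<phi>0_def unit_clamp_def)
  \<comment> \<open>The claim with \<open>kill\<close> unfolded. Each \<phi> is first enlarged to a
    \<kappa> above \<open>\<phi>0\<close>, which can only increase the form at
    \<open>?g\<close>.\<close>
  have "main ?g \<le> Q ?g - Q ?f + main ?f"
  proof (rule sup_form_le[OF directed_units_all])
    fix \<phi> assume "\<phi> \<in> units"
    then have \<phi>: "unit_fn \<phi>" by (simp add: units_def)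
    define \<kappa> where "\<kappa> x = max (\<phi> x) (\<phi>0 x)" for x
    have \<kappa>: "unit_fn \<kappa>" unfolding \<kappa>_def[abs_def] by (rule max_unit_fn[OF \<phi> \<phi>0])
    have fp: "?f \<in> pre_dom \<kappa>" and gp: "?g \<in> pre_dom \<kappa>"
      by (rule bounded_mem_pre_dom[OF \<kappa> fD fb c0], rule bounded_mem_pre_dom[OF \<kappa> gD gb c0])
    have one: "AE x in M. \<kappa> x * ?f x = ?f x \<and> \<kappa> x * ?g x = ?g x"
      using unit_fnD(2)[OF \<kappa>] fg
    proof eventually_elim
      case (elim x)
      have "\<kappa> x = 1" if "1 \<le> real (Suc n) * \<bar>f x\<bar>"
      proof -
        have "\<phi>0 x = 1" using that by (simp add: \<phi>0_def unit_clamp_def del: of_nat_Suc)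
        then show ?thesis using elim by (simp add: \<kappa>_def)
      qed
      then show ?case using band_nonzero[of n "f x"] band_nonzero[of n "g x"] elim(2)
        by (cases "band n (f x) = 0"; cases "band n (g x) = 0") auto
    qed
    have "E (\<lambda>x. \<kappa> x * ?f x) = E ?f"
      by (rule E_cong_AE[OF meas[OF pre_domD(2)[OF \<kappa> fp]] meas[OF fD]]) (use one in eventually_elim, blast)
    moreover have "E (\<lambda>x. \<kappa> x * ?g x) = E ?g"
      by (rule E_cong_AE[OF meas[OF pre_domD(2)[OF \<kappa> gp]] meas[OF gD]]) (use one in eventually_elim, blast)
    moreover have "B (\<lambda>x. \<kappa> x * (?f x)\<^sup>2) \<kappa> = B (\<lambda>x. \<kappa> x * (?g x)\<^sup>2) \<kappa>"
    proof (rule B_cong_AE[OF pre_domD(3)[OF \<kappa> fp] unit_fnD(1)[OF \<kappa>] pre_domD(3)[OF \<kappa> gp] unit_fnD(1)[OF \<kappa>]])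
      show "AE x in M. \<kappa> x * (?f x)\<^sup>2 = \<kappa> x * (?g x)\<^sup>2"
        using fg
      proof eventually_elim
        case (elim x)
        show ?case unfolding comp_def band_square_cong[OF elim] ..
      qed
    qed simp
    ultimately have "pre_val \<kappa> ?g = Q ?g - Q ?f + pre_val \<kappa> ?f" by (simp only: pre_val_def)
    then have "lf \<kappa> ?g = Q ?g - Q ?f + lf \<kappa> ?f"
      unfolding lf_def local_form_pre_dom[OF \<kappa> fp] local_form_pre_dom[OF \<kappa> gp] real_of_ereal.simps .
    moreover have "lf \<phi> ?g \<le> lf \<kappa> ?g" by (rule lf_mono[OF \<phi> \<kappa> _ gD]) (simp add: \<kappa>_def)
    moreover have "lf \<kappa> ?f \<le> main ?f" by (rule lf_le_sup_form[OF directed_units_all _ fD]) (simp add: units_def \<kappa>)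
    ultimately show "lf \<phi> ?g \<le> Q ?g - Q ?f + main ?f" by linarith
  qed
  then show ?thesis by (simp add: kill_def)
qed

text \<open>\<open>kill\<close> is dominated by \<open>Q\<close> and the bands converge in energy,
  so the estimate for bands passes to the limit; exchanging \<open>f\<close> and \<open>g\<close>
  gives equality.\<close>

lemma kill_abs_eq:
  assumes f: "f \<in> D" and g: "g \<in> D" and fg: "AE x in M. \<bar>f x\<bar> = \<bar>g x\<bar>"
  shows "kill f = kill g"
proof -
  have "kill f \<le> kill g" if f: "f \<in> D" and g: "g \<in> D" and fg: "AE x in M. \<bar>f x\<bar> = \<bar>g x\<bar>" for f g
  proof (rule LIMSEQ_le)
    show "(\<lambda>n. kill (band n \<circ> f)) \<longlonglongrightarrow> kill f"
      by (rule dominated_tendsto[OF quad_space_kill kill_le_Q contraction(1)[OF f band_lipschitz band_zero] f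
          contraction_approx[OF f band_lipschitz band_zero tendsto_band]])
    show "(\<lambda>n. kill (band n \<circ> g)) \<longlonglongrightarrow> kill g"
      by (rule dominated_tendsto[OF quad_space_kill kill_le_Q contraction(1)[OF g band_lipschitz band_zero] g
          contraction_approx[OF g band_lipschitz band_zero tendsto_band]])
    show "\<exists>N. \<forall>n\<ge>N. kill (band n \<circ> f) \<le> kill (band n \<circ> g)" using kill_band_le[OF f g fg] by blast
  qed
  moreover have "AE x in M. \<bar>g x\<bar> = \<bar>f x\<bar>" using fg by eventually_elim simp
  ultimately show ?thesis using f g fg by (metis antisym)
qed

text \<open>If g \<psi> = 0 then \<bar>g + \<psi>\<bar> = \<bar>g - \<psi>\<bar>, and the two terms
  of the polarisation agree.\<close>

lemma kill_orthogonal: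
  assumes g: "g \<in> D" and \<psi>: "\<psi> \<in> D" and z: "AE x in M. g x * \<psi> x = 0"
  shows "quad_space.B kill g \<psi> = 0"
proof -
  have "kill (g + \<psi>) = kill (g - \<psi>)"
  proof (rule kill_abs_eq[OF mem(1)[OF g \<psi>] mem(2)[OF g \<psi>]])
    show "AE x in M. \<bar>(g + \<psi>) x\<bar> = \<bar>(g - \<psi>) x\<bar>" using z by eventually_elim auto
  qed
  then show ?thesis by (simp add: quad_space.B_def[OF quad_space_kill])
qed

lemma kill_B_cong:
  assumes g: "g \<in> D" and h: "h \<in> D" and \<psi>: "\<psi> \<in> D" and z: "AE x in M. g x * \<psi> x = h x * \<psi> x"
  shows "quad_space.B kill g \<psi> = quad_space.B kill h \<psi>"
proof -
  have "quad_space.B kill (g - h) \<psi> = 0"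
  proof (rule kill_orthogonal[OF mem(2)[OF g h] \<psi>])
    show "AE x in M. (g - h) x * \<psi> x = 0" using z by eventually_elim (simp add: left_diff_distrib)
  qed
  then show ?thesis using quad_space.B_diff_left[OF quad_space_kill g \<psi> h] by simp
qed

text \<open>Frees \<open>killing_bilinear\<close> from the choice in its definition: any admissible
  \<open>g\<close> may be used, in particular one that suits several \<psi> at once.\<close>

lemma killing_bilinear_eq:
  assumes g: "g \<in> D" and \<psi>: "\<psi> \<in> D" and z: "AE x in M. g x * \<psi> x = f x * \<psi> x"
  shows "killing_bilinear M E f \<psi> = quad_space.B kill g \<psi>"
proof -
  let ?h = "SOME g. g \<in> D \<and> (AE x in M. g x * \<psi> x = f x * \<psi> x)"
  have h: "?h \<in> D \<and> (AE x in M. ?h x * \<psi> x = f x * \<psi> x)"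
    by (rule someI[of _ g]) (use g z in blast)
  have "AE x in M. ?h x * \<psi> x = g x * \<psi> x" using conjunct2[OF h] z by eventually_elim (simp only:)
  then show ?thesis
    unfolding killing_bilinear_def form_bilinear_killing_part[OF conjunct1[OF h] \<psi>]
    by (rule kill_B_cong[OF conjunct1[OF h] g \<psi>])
qed

end

section \<open>Nests and the weak form\<close>

locale energy_nest = energy +
  fixes \<N> :: "'a set set"
  assumes nest: "nest M E \<N>"
begin

abbreviation DN :: "('a \<Rightarrow> real) set" where "DN \<equiv> nest_domain M E \<N>"
abbreviation DL :: "('a \<Rightarrow> real) set" where "DL \<equiv> local_domain M E \<N>"
abbreviation I :: "('a \<Rightarrow> real) set" where "I \<equiv> unit_functions M DN"

lemma DN_D: "f \<in> DN \<Longrightarrow> f \<in> D"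
  by (simp add: nest_domain_def)

lemma DN_support: "f \<in> DN \<Longrightarrow> \<exists>N\<in>\<N>. AE x in M. x \<notin> N \<longrightarrow> f x = 0"
proof -
  assume "f \<in> DN"
  then obtain N where N: "N \<in> \<N>" "AE x in M. f x * indicator (space M - N) x = 0"
    by (auto simp: nest_domain_def)
  have "AE x in M. x \<notin> N \<longrightarrow> f x = 0"
    using N(2) AE_space by eventually_elim (auto simp: indicator_def)
  then show ?thesis using N(1) by blast
qed

lemma DN_I: "f \<in> D \<Longrightarrow> N \<in> \<N> \<Longrightarrow> AE x in M. x \<notin> N \<longrightarrow> f x = 0 \<Longrightarrow> f \<in> DN"
proof -
  assume f: "f \<in> D" "N \<in> \<N>" and z: "AE x in M. x \<notin> N \<longrightarrow> f x = 0"
  have "AE x in M. f x * indicator (space M - N) x = 0"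
    using z by eventually_elim (auto simp: indicator_def)
  then show ?thesis using f by (auto simp: nest_domain_def)
qed

lemma L0_subspace_DN: "L0_subspace M DN"
  using nest by (simp add: nest_def)

lemma DN_add: "f \<in> DN \<Longrightarrow> g \<in> DN \<Longrightarrow> f + g \<in> DN"
  using L0_subspace_DN by (simp add: L0_subspace_def plus_fun_def)

lemma DN_contraction:
  assumes f: "f \<in> DN" and C: "\<And>x y. \<bar>C x - C y\<bar> \<le> \<bar>x - y\<bar>" "C 0 = 0"
  shows "C \<circ> f \<in> DN"
proof -
  obtain N where N: "N \<in> \<N>" "AE x in M. x \<notin> N \<longrightarrow> f x = 0" using DN_support[OF f] by blast
  have "AE x in M. x \<notin> N \<longrightarrow> (C \<circ> f) x = 0" using N(2) by eventually_elim (simp add: C(2))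
  then show ?thesis by (rule DN_I[OF contraction(1)[OF DN_D[OF f] C] N(1)])
qed

text \<open>The nest need not be directed by inclusion, but its domain is a vector space: a set that
  supports \<bar>f\<bar> + \<bar>g\<bar> supports both functions.\<close>

lemma common_support:
  assumes f: "f \<in> DN" and g: "g \<in> DN"
  shows "\<exists>N\<in>\<N>. AE x in M. x \<notin> N \<longrightarrow> f x = 0 \<and> g x = 0"
proof -
  have "abs \<circ> f \<in> DN" "abs \<circ> g \<in> DN"
    using f g by (auto intro!: DN_contraction simp: abs_triangle_ineq3)
  then obtain N where N: "N \<in> \<N>" "AE x in M. x \<notin> N \<longrightarrow> ((abs \<circ> f) + (abs \<circ> g)) x = 0"
    using DN_support[OF DN_add] by blast
  have "AE x in M. x \<notin> N \<longrightarrow> f x = 0 \<and> g x = 0"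
    using N(2) by eventually_elim auto
  then show ?thesis using N(1) by blast
qed

lemma I_unit: "\<phi> \<in> I \<Longrightarrow> unit_fn \<phi>"
  using DN_D by (auto simp: unit_functions_def unit_fn_def)

lemma I_DN: "\<phi> \<in> I \<Longrightarrow> \<phi> \<in> DN"
  by (auto simp: unit_functions_def)

lemma I_iff: "\<phi> \<in> I \<longleftrightarrow> unit_fn \<phi> \<and> \<phi> \<in> DN"
  using DN_D by (auto simp: unit_functions_def unit_fn_def)

lemma directed_units_I: "directed_units I"
  unfolding directed_units_def
proof (intro conjI ballI)
  have "0 \<in> DN" using L0_subspace_DN by (simp add: L0_subspace_def zero_fun_def)
  then show "I \<noteq> {}" using unit_fn_zero I_iff by blast
  show "unit_fn \<phi>" if "\<phi> \<in> I" for \<phi> by (rule I_unit[OF that])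
  fix \<phi> \<eta> assume \<phi>: "\<phi> \<in> I" and \<eta>: "\<eta> \<in> I"
  have m: "unit_fn (\<lambda>x. max (\<phi> x) (\<eta> x))" by (rule max_unit_fn[OF I_unit[OF \<phi>] I_unit[OF \<eta>]])
  obtain N where N: "N \<in> \<N>" "AE x in M. x \<notin> N \<longrightarrow> \<phi> x = 0 \<and> \<eta> x = 0"
    using common_support[OF I_DN[OF \<phi>] I_DN[OF \<eta>]] by blast
  have "AE x in M. x \<notin> N \<longrightarrow> max (\<phi> x) (\<eta> x) = 0" using N(2) by eventually_elim simp
  then show "(\<lambda>x. max (\<phi> x) (\<eta> x)) \<in> I"
    unfolding I_iff using m DN_I[OF unit_fnD(1)[OF m] N(1)] by blast
qed

text \<open>
  Density of the nest domain: \<open>\<phi>\<close> is approximated in energy by elements of \<open>I\<close>, along which \<open>E\<^sub>\<phi>\<close>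
  is lower semicontinuous.
\<close>

lemma unit_fn_approx:
  assumes \<phi>: "unit_fn \<phi>"
  obtains \<psi> where "\<And>p. \<psi> p \<in> I" "tconv M \<psi> \<phi> (fin_filter M)" "((\<lambda>p. Q (\<psi> p - \<phi>)) \<longlongrightarrow> 0) (fin_filter M)"
proof -
  have \<phi>D: "\<phi> \<in> D" by (rule unit_fnD(1)[OF \<phi>])
  have \<phi>m: "\<phi> \<in> borel_measurable M" by (rule meas[OF \<phi>D])
  have dense: "\<exists>v\<in>DN. local_dist M U \<phi> v < e \<and> Q (\<phi> - v) < e" if U: "U \<in> fin_sets M" and e: "0 < e" for U e
  proof -
    let ?V = "{v \<in> D. local_dist M U \<phi> v < e \<and> Q (\<phi> - v) < e}"
    have cl: "\<phi> \<in> form_topology M E closure_of DN" using nest \<phi>D by (simp add: nest_def)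
    have op: "openin (form_topology M E) ?V" by (rule openin_form_ball[OF qf \<phi>D U])
    have "\<phi> \<in> ?V" using \<phi>D e by simp
    from cl[unfolded in_closure_of, THEN conjunct2, rule_format, OF conjI[OF this op]]
    obtain v where "v \<in> DN" "v \<in> ?V" by (elim exE conjE)
    then show ?thesis by (intro bexI[of _ v]) simp_all
  qed
  have "\<exists>v\<in>DN. (fst p \<in> fin_sets M \<longrightarrow> local_dist M (fst p) \<phi> v < 1 / real (Suc (snd p))) \<and> Q (\<phi> - v) < 1 / real (Suc (snd p))"
    for p :: "'a set \<times> nat"
    using dense[of "fst p" "1 / real (Suc (snd p))"] dense[OF fin_sets_empty, of "1 / real (Suc (snd p))"]
    by (cases "fst p \<in> fin_sets M") auto
  then obtain v where v: "\<And>p :: 'a set \<times> nat. v p \<in> DN"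
    "\<And>p. fst p \<in> fin_sets M \<Longrightarrow> local_dist M (fst p) \<phi> (v p) < 1 / real (Suc (snd p))"
    "\<And>p. Q (\<phi> - v p) < 1 / real (Suc (snd p))"
    by metis
  have vD: "v p \<in> D" for p by (rule DN_D[OF v(1)])
  have vt: "tconv M v \<phi> (fin_filter M)"
  proof (rule tconv_fin_filter[OF meas[OF vD] \<phi>m])
    fix U n assume "U \<in> fin_sets M"
    then show "local_dist M U (v (U, n)) \<phi> \<le> 1 / real (Suc n)"
      using v(2)[of "(U, n)"] by (simp add: local_dist_commute[of M U \<phi>])
  qed
  have le: "norm (Q (v p - \<phi>)) \<le> 1 / real (Suc (snd p))" for p
  proof -
    have "norm (Q (v p - \<phi>)) = Q (v p - \<phi>)"
      by (simp only: real_norm_def abs_of_nonneg[OF nonneg[OF mem(2)[OF vD \<phi>D]]])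
    also have "\<dots> = Q (\<phi> - v p)" by (rule Q_minus_commute[OF vD \<phi>D])
    also have "\<dots> \<le> 1 / real (Suc (snd p))" by (rule less_imp_le[OF v(3)])
    finally show ?thesis .
  qed
  have "((\<lambda>p. Q (v p - \<phi>)) \<longlongrightarrow> 0) (fin_filter M)"
    by (rule Lim_null_comparison[OF always_eventually[OF allI[OF le]] tendsto_fin_filter_snd])
  then have Qv: "((\<lambda>p. Q (v p)) \<longlongrightarrow> Q \<phi>) (fin_filter M)" by (rule tendsto_Q[OF vD \<phi>D])
  \<comment> \<open>Clamping puts the approximants into \<open>I\<close>. As \<phi> has values in
    the unit interval, the distance to \<phi> does not grow, and energies at most
    \<open>Q (v p)\<close> then force convergence in energy.\<close>
  define \<psi> where "\<psi> p = unit_clamp \<circ> v p" for p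
  have C: "\<bar>unit_clamp x - unit_clamp y\<bar> \<le> \<bar>x - y\<bar>" "unit_clamp 0 = 0" for x y by (auto simp: unit_clamp_def)
  have \<psi>D: "\<psi> p \<in> D" and \<psi>Q: "Q (\<psi> p) \<le> Q (v p)" for p
    unfolding \<psi>_def by (rule contraction[OF vD C])+
  have \<psi>I: "\<psi> p \<in> I" for p
  proof -
    have "AE x in M. 0 \<le> \<psi> p x \<and> \<psi> p x \<le> 1" by (rule AE_I2) (simp add: \<psi>_def unit_clamp_def)
    moreover have "\<psi> p \<in> DN" unfolding \<psi>_def by (rule DN_contraction[OF v(1) C])
    ultimately show ?thesis unfolding I_iff unit_fn_def using \<psi>D by blast
  qed
  have \<psi>t: "tconv M \<psi> \<phi> (fin_filter M)"
  proof (rule tconv_contract[OF vt meas[OF vD] \<phi>m meas[OF \<psi>D] \<phi>m, where c = 1])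
    show "AE x in M. \<bar>\<psi> p x - \<phi> x\<bar> \<le> 1 * \<bar>v p x - \<phi> x\<bar>" for p
      using unit_fnD(2)[OF \<phi>] by eventually_elim (auto simp: \<psi>_def unit_clamp_def)
  qed
  have "((\<lambda>p. Q (\<psi> p - \<phi>)) \<longlongrightarrow> 0) (fin_filter M)"
    by (rule lower_semicont_strong_convergence[OF qf lsc \<psi>D \<phi>D \<psi>t _ Qv]) (use \<psi>Q in simp)
  then show ?thesis using that \<psi>I \<psi>t by blast
qed

text \<open>Along approximants \<psi> of \<phi> in energy the first term of \<open>pre_val\<close>
  is lower semicontinuous, while the second pairs a weakly convergent net with a strongly convergent
  one and therefore converges.\<close>

lemma lf_bounded_le_sup_form:
  assumes \<phi>: "unit_fn \<phi>" and f: "f \<in> D" "AE x in M. \<bar>f x\<bar> \<le> c" "0 \<le> c"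
  shows "lf \<phi> f \<le> sup_form I f"
proof -
  have \<phi>D: "\<phi> \<in> D" by (rule unit_fnD(1)[OF \<phi>])
  have fm: "f \<in> borel_measurable M" by (rule meas[OF f(1)])
  have fp: "f \<in> pre_dom \<phi>" by (rule bounded_mem_pre_dom[OF \<phi> f])
  obtain \<psi> where \<psi>I: "\<And>p. \<psi> p \<in> I" and \<psi>t: "tconv M \<psi> \<phi> (fin_filter M)"
    and \<psi>s: "((\<lambda>p. Q (\<psi> p - \<phi>)) \<longlongrightarrow> 0) (fin_filter M)"
    by (rule unit_fn_approx[OF \<phi>], rule that)
  have \<psi>u: "unit_fn (\<psi> p)" for p by (rule I_unit[OF \<psi>I])
  have \<psi>D: "\<psi> p \<in> D" for p by (rule unit_fnD(1)[OF \<psi>u])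
  have \<psi>p: "f \<in> pre_dom (\<psi> p)" for p by (rule bounded_mem_pre_dom[OF \<psi>u f])
  let ?X = "\<lambda>p x. \<psi> p x * f x" and ?S = "\<lambda>p x. \<psi> p x * (f x)\<^sup>2"
  have XD: "?X p \<in> D" and SD: "?S p \<in> D" for p by (rule pre_domD(2)[OF \<psi>u \<psi>p], rule pre_domD(3)[OF \<psi>u \<psi>p])
  have fX: "(\<lambda>x. \<phi> x * f x) \<in> D" and fS: "(\<lambda>x. \<phi> x * (f x)\<^sup>2) \<in> D"
    by (rule pre_domD(2)[OF \<phi> fp], rule pre_domD(3)[OF \<phi> fp])
  have Xt: "tconv M ?X (\<lambda>x. \<phi> x * f x) (fin_filter M)"
  proof (rule tconv_contract[OF \<psi>t meas[OF \<psi>D] meas[OF \<phi>D] meas[OF XD] meas[OF fX], where c = c])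
    show "AE x in M. \<bar>\<psi> p x * f x - \<phi> x * f x\<bar> \<le> c * \<bar>\<psi> p x - \<phi> x\<bar>" for p
      using f(2)
    proof eventually_elim
      case (elim x)
      have "\<bar>\<psi> p x * f x - \<phi> x * f x\<bar> = \<bar>f x\<bar> * \<bar>\<psi> p x - \<phi> x\<bar>"
        by (simp add: abs_mult[symmetric] algebra_simps)
      also have "\<dots> \<le> c * \<bar>\<psi> p x - \<phi> x\<bar>" using elim by (rule mult_right_mono) simp
      finally show ?case .
    qed
  qed
  have St: "tconv M ?S (\<lambda>x. \<phi> x * (f x)\<^sup>2) (fin_filter M)"
  proof (rule tconv_contract[OF \<psi>t meas[OF \<psi>D] meas[OF \<phi>D] meas[OF SD] meas[OF fS], where c = "c\<^sup>2"])
    show "AE x in M. \<bar>\<psi> p x * (f x)\<^sup>2 - \<phi> x * (f x)\<^sup>2\<bar> \<le> c\<^sup>2 * \<bar>\<psi> p x - \<phi> x\<bar>" for p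
      using f(2)
    proof eventually_elim
      case (elim x)
      then have "(f x)\<^sup>2 \<le> c\<^sup>2" by (metis abs_ge_zero power2_abs power_mono)
      then show ?case by (simp add: left_diff_distrib[symmetric] abs_mult mult.commute mult_right_mono)
    qed
  qed
  have "((\<lambda>p. Q (\<psi> p)) \<longlongrightarrow> Q \<phi>) (fin_filter M)" by (rule tendsto_Q[OF \<psi>D \<phi>D \<psi>s])
  then have "\<forall>\<^sub>F p in fin_filter M. Q (\<psi> p) < Q \<phi> + 1" by (rule order_tendstoD) simp
  then have SQ: "\<forall>\<^sub>F p in fin_filter M. Q (?S p) \<le> 8 * c\<^sup>2 * (2 * c\<^sup>2 * (Q \<phi> + 1) + 2 * Q f) + 2 * c ^ 4 * (Q \<phi> + 1)"
  proof eventually_elim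
    case (elim p)
    have "Q (?S p) \<le> 8 * c\<^sup>2 * Q (?X p) + 2 * c ^ 4 * Q (\<psi> p)"
      by (rule product_square_mem(2)[OF \<psi>u fm XD f(2,3)])
    also have "\<dots> \<le> 8 * c\<^sup>2 * (2 * c\<^sup>2 * Q (\<psi> p) + 2 * Q f) + 2 * c ^ 4 * Q (\<psi> p)"
      by (intro add_right_mono mult_left_mono product_mem(2)[OF \<psi>u f]) simp
    also have "\<dots> \<le> 8 * c\<^sup>2 * (2 * c\<^sup>2 * (Q \<phi> + 1) + 2 * Q f) + 2 * c ^ 4 * (Q \<phi> + 1)"
      using elim by (intro add_mono mult_left_mono) auto
    finally show ?case .
  qed
  have "((\<lambda>p. B (?S p) \<phi>) \<longlongrightarrow> B (\<lambda>x. \<phi> x * (f x)\<^sup>2) \<phi>) (fin_filter M)"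
    unfolding B_eq[symmetric] by (rule lower_semicont_weak_convergence[OF qf lsc SD fS St SQ \<phi>D])
  then have Blim: "((\<lambda>p. B (?S p) (\<psi> p)) \<longlongrightarrow> B (\<lambda>x. \<phi> x * (f x)\<^sup>2) \<phi>) (fin_filter M)"
    by (rule tendsto_B_weak_strong[OF SD \<psi>D \<phi>D SQ \<psi>s])
  have "pre_val \<phi> f \<le> sup_form I f"
  proof (rule field_le_epsilon)
    fix e :: real assume e: "0 < e"
    have "Q (\<lambda>x. \<phi> x * f x) - e/2 < Q (\<lambda>x. \<phi> x * f x)" using e by simp
    then have "ereal (Q (\<lambda>x. \<phi> x * f x) - e/2) < E (\<lambda>x. \<phi> x * f x)"
      using E_eq[OF fX] by (metis less_ereal.simps(1))
    then have "\<forall>\<^sub>F p in fin_filter M. ereal (Q (\<lambda>x. \<phi> x * f x) - e/2) < E (?X p)"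
      by (intro lower_semicontD[OF lsc _ meas[OF fX] Xt]) (use meas[OF XD] in simp)
    moreover have "\<forall>\<^sub>F p in fin_filter M. B (?S p) (\<psi> p) < B (\<lambda>x. \<phi> x * (f x)\<^sup>2) \<phi> + e/2"
      using Blim by (rule order_tendstoD) (use e in simp)
    ultimately have "\<forall>\<^sub>F p in fin_filter M. pre_val \<phi> f \<le> sup_form I f + e"
    proof eventually_elim
      case (elim p)
      have "Q (\<lambda>x. \<phi> x * f x) - e/2 < Q (?X p)"
        using elim(1) E_eq[OF XD[of p]] by (metis less_ereal.simps(1))
      then have "pre_val \<phi> f \<le> pre_val (\<psi> p) f + e" using elim(2) unfolding pre_val_def by linarith
      also have "pre_val (\<psi> p) f = lf (\<psi> p) f" unfolding lf_def local_form_pre_dom[OF \<psi>u \<psi>p] by simp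
      also have "\<dots> \<le> sup_form I f" by (rule lf_le_sup_form[OF directed_units_I \<psi>I f(1)])
      finally show ?case by simp
    qed
    then show "pre_val \<phi> f \<le> sup_form I f + e" by (simp add: eventually_const_iff)
  qed
  then show ?thesis unfolding lf_def local_form_pre_dom[OF \<phi> fp] by simp
qed

lemma sup_form_I_eq_main:
  assumes f: "f \<in> D"
  shows "sup_form I f = main f"
proof (rule antisym)
  show "sup_form I f \<le> main f"
    by (rule sup_form_le[OF directed_units_I])
      (use lf_le_sup_form[OF directed_units_all _ f] I_unit in \<open>auto simp: units_def\<close>)
  show "main f \<le> sup_form I f"
  proof (rule sup_form_le[OF directed_units_all])
    fix \<phi> assume "\<phi> \<in> units"
    then have \<phi>: "unit_fn \<phi>" by (simp add: units_def)
    let ?f = "\<lambda>n. truncate (real (Suc n)) \<circ> f"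
    show "lf \<phi> f \<le> sup_form I f"
    proof (rule LIMSEQ_le)
      show "(\<lambda>n. lf \<phi> (?f n)) \<longlonglongrightarrow> lf \<phi> f"
        by (rule dominated_tendsto[OF quad_space_lf[OF \<phi>] local_form_D(2)[OF \<phi>] truncate_strong(1)[OF f] f truncate_strong(2)[OF f]])
      show "(\<lambda>n. sup_form I (?f n)) \<longlonglongrightarrow> sup_form I f"
        by (rule dominated_tendsto[OF quad_space_sup_form[OF directed_units_I] sup_form_le_Q[OF directed_units_I]
            truncate_strong(1)[OF f] f truncate_strong(2)[OF f]])
      have "lf \<phi> (?f n) \<le> sup_form I (?f n)" for n
        by (rule lf_bounded_le_sup_form[OF \<phi> truncate_strong(1)[OF f], of _ "real (Suc n)"])
          (auto intro!: AE_I2 simp: truncate_bound)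
      then show "\<exists>N. \<forall>n\<ge>N. lf \<phi> (?f n) \<le> sup_form I (?f n)" by blast
    qed
  qed
qed

section \<open>Convergence along the nest\<close>

lemma eventually_nest_filter:
  "eventually P (nest_filter M E \<N>) \<longleftrightarrow> (\<exists>\<phi>0\<in>I. \<forall>\<phi>\<in>I. (AE x in M. \<phi>0 x \<le> \<phi> x) \<longrightarrow> P \<phi>)"
proof -
  have "eventually P (nest_filter M E \<N>) \<longleftrightarrow>
    (\<exists>\<phi>0\<in>I. eventually P (principal {\<phi> \<in> I. AE x in M. \<phi>0 x \<le> \<phi> x}))"
    unfolding nest_filter_def Let_def
  proof (rule eventually_INF_base)
    show "I \<noteq> {}" using directed_units_I by (simp add: directed_units_def)
    fix a b assume ab: "a \<in> I" "b \<in> I"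
    have m: "(\<lambda>x. max (a x) (b x)) \<in> I" using directed_units_I ab by (simp add: directed_units_def)
    have "{\<phi> \<in> I. AE x in M. max (a x) (b x) \<le> \<phi> x} \<subseteq>
        {\<phi> \<in> I. AE x in M. a x \<le> \<phi> x} \<inter> {\<phi> \<in> I. AE x in M. b x \<le> \<phi> x}"
      by (auto elim: AE_mp)
    then show "\<exists>x\<in>I. principal {\<phi> \<in> I. AE y in M. x y \<le> \<phi> y} \<le>
        inf (principal {\<phi> \<in> I. AE x in M. a x \<le> \<phi> x}) (principal {\<phi> \<in> I. AE x in M. b x \<le> \<phi> x})"
      by (intro bexI[OF _ m]) simp
  qed
  then show ?thesis by (simp add: eventually_principal Ball_def imp_conjL)
qed

lemma nest_filter_I: "\<forall>\<^sub>F \<phi> in nest_filter M E \<N>. \<phi> \<in> I"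
  unfolding eventually_nest_filter using directed_units_I by (auto simp: directed_units_def)

lemma nest_filter_not_bot: "nest_filter M E \<N> \<noteq> bot"
  unfolding trivial_limit_def eventually_nest_filter by auto

text \<open>A monotone net converges to its supremum, and by density of the nest domain this
  supremum is the main part.\<close>

lemma tendsto_lf_main:
  assumes f: "f \<in> D"
  shows "((\<lambda>\<phi>. lf \<phi> f) \<longlongrightarrow> main f) (nest_filter M E \<N>)"
proof (rule order_tendstoI)
  fix a assume "a < main f"
  then have "a < sup_form I f" by (simp add: sup_form_I_eq_main[OF f])
  then obtain \<phi>0 where \<phi>0: "\<phi>0 \<in> I" "a < lf \<phi>0 f"
    using sup_form_le[OF directed_units_I, of f a] by (meson not_le)
  show "\<forall>\<^sub>F \<phi> in nest_filter M E \<N>. a < lf \<phi> f"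
    unfolding eventually_nest_filter
  proof (intro bexI[OF _ \<phi>0(1)] ballI impI)
    fix \<phi> assume \<phi>: "\<phi> \<in> I" "AE x in M. \<phi>0 x \<le> \<phi> x"
    have "lf \<phi>0 f \<le> lf \<phi> f" by (rule lf_mono[OF I_unit[OF \<phi>0(1)] I_unit[OF \<phi>(1)] \<phi>(2) f])
    then show "a < lf \<phi> f" using \<phi>0(2) by simp
  qed
next
  fix a assume a: "main f < a"
  show "\<forall>\<^sub>F \<phi> in nest_filter M E \<N>. lf \<phi> f < a"
    using nest_filter_I
  proof eventually_elim
    case (elim \<phi>)
    have "lf \<phi> f \<le> sup_form I f" by (rule lf_le_sup_form[OF directed_units_I elim f])
    then show ?case using a sup_form_I_eq_main[OF f] by simp
  qed
qed

section \<open>The local form domain\<close>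

lemma DL_measurable: "f \<in> DL \<Longrightarrow> f \<in> borel_measurable M"
  by (simp add: local_domain_def)

lemma DLD:
  assumes "f \<in> DL" "N \<in> \<N>"
  shows "\<exists>g\<in>D. AE x in M. x \<in> N \<longrightarrow> f x = g x"
proof -
  obtain g where g: "g \<in> D" "AE x in M. f x * indicator N x = g x * indicator N x"
    using assms by (auto simp: local_domain_def)
  have "AE x in M. x \<in> N \<longrightarrow> f x = g x" using g(2) by eventually_elim (auto simp: indicator_def split: if_splits)
  then show ?thesis using g(1) by blast
qed

lemma DLI:
  assumes "f \<in> borel_measurable M" "\<And>N. N \<in> \<N> \<Longrightarrow> \<exists>g\<in>D. AE x in M. x \<in> N \<longrightarrow> f x = g x"
  shows "f \<in> DL"
  unfolding local_domain_def
proof (intro CollectI conjI assms(1) ballI)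
  fix N assume "N \<in> \<N>"
  then obtain g where g: "g \<in> D" "AE x in M. x \<in> N \<longrightarrow> f x = g x" using assms(2) by blast
  have "AE x in M. f x * indicator N x = g x * indicator N x" using g(2) by eventually_elim (simp add: indicator_def)
  then show "\<exists>g\<in>D. AE x in M. f x * indicator N x = g x * indicator N x" using g(1) by blast
qed

lemma D_DL: "f \<in> D \<Longrightarrow> f \<in> DL"
  using meas by (intro DLI) auto

lemma DL_cong_AE: "f \<in> DL \<Longrightarrow> g \<in> borel_measurable M \<Longrightarrow> AE x in M. f x = g x \<Longrightarrow> g \<in> DL"
proof (rule DLI)
  fix N assume f: "f \<in> DL" and fg: "AE x in M. f x = g x" and "N \<in> \<N>"
  then obtain h where h: "h \<in> D" "AE x in M. x \<in> N \<longrightarrow> f x = h x" using DLD by blast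
  have "AE x in M. x \<in> N \<longrightarrow> g x = h x" using h(2) fg by eventually_elim simp
  then show "\<exists>h\<in>D. AE x in M. x \<in> N \<longrightarrow> g x = h x" using h(1) by blast
qed

lemma subspace_DL: "subspace DL"
proof (rule subspaceI)
  show "0 \<in> DL" by (rule D_DL[OF mem(4)])
next
  fix f g assume f: "f \<in> DL" and g: "g \<in> DL"
  show "f + g \<in> DL"
  proof (rule DLI)
    show "f + g \<in> borel_measurable M"
      unfolding plus_fun_def by (intro borel_measurable_add DL_measurable f g)
    fix N assume N: "N \<in> \<N>"
    obtain u where u: "u \<in> D" "AE x in M. x \<in> N \<longrightarrow> f x = u x" using DLD[OF f N] by blast
    obtain v where v: "v \<in> D" "AE x in M. x \<in> N \<longrightarrow> g x = v x" using DLD[OF g N] by blast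
    have "AE x in M. x \<in> N \<longrightarrow> (f + g) x = (u + v) x" using u(2) v(2) by eventually_elim simp
    then show "\<exists>h\<in>D. AE x in M. x \<in> N \<longrightarrow> (f + g) x = h x" using mem(1)[OF u(1) v(1)] by blast
  qed
next
  fix c f assume f: "f \<in> DL"
  show "c *\<^sub>R f \<in> DL"
  proof (rule DLI)
    show "c *\<^sub>R f \<in> borel_measurable M"
      unfolding scaleR_fun_def real_scaleR_def
      by (intro borel_measurable_times borel_measurable_const DL_measurable f)
    fix N assume N: "N \<in> \<N>"
    obtain u where u: "u \<in> D" "AE x in M. x \<in> N \<longrightarrow> f x = u x" using DLD[OF f N] by blast
    have "AE x in M. x \<in> N \<longrightarrow> (c *\<^sub>R f) x = (c *\<^sub>R u) x" using u(2) by eventually_elim simp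
    then show "\<exists>h\<in>D. AE x in M. x \<in> N \<longrightarrow> (c *\<^sub>R f) x = h x" using mem(3)[OF u(1)] by blast
  qed
qed

lemma DL_local_form:
  assumes f: "f \<in> DL" and \<phi>: "\<phi> \<in> I"
  shows "f \<in> form_domain (local_form M E \<phi>)"
proof -
  obtain N where N: "N \<in> \<N>" "AE x in M. x \<notin> N \<longrightarrow> \<phi> x = 0" using DN_support[OF I_DN[OF \<phi>]] by blast
  obtain g where g: "g \<in> D" "AE x in M. x \<in> N \<longrightarrow> f x = g x" using DLD[OF f N(1)] by blast
  have "AE x in M. \<phi> x * f x = \<phi> x * g x" using N(2) g(2) by eventually_elim auto
  from local_form_le[OF I_unit[OF \<phi>] DL_measurable[OF f] g(1) this]
  show ?thesis by (auto simp: form_domain_def)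
qed

text \<open>Additivity in the second argument compares values defined through separately chosen
  representatives; a common supporting set provides one that serves both.\<close>

lemma common_local_representative:
  assumes f: "f \<in> DL" and w: "w \<in> DN" and z: "z \<in> DN"
  shows "\<exists>g\<in>D. (AE x in M. g x * w x = f x * w x) \<and> (AE x in M. g x * z x = f x * z x)"
proof -
  obtain N where N: "N \<in> \<N>" "AE x in M. x \<notin> N \<longrightarrow> w x = 0 \<and> z x = 0" using common_support[OF w z] by blast
  obtain g where g: "g \<in> D" "AE x in M. x \<in> N \<longrightarrow> f x = g x" using DLD[OF f N(1)] by blast
  have "AE x in M. g x * w x = f x * w x" "AE x in M. g x * z x = f x * z x"
    using N(2) g(2) by (eventually_elim, fastforce)+
  then show ?thesis using g(1) by blast
qed

section \<open>Bilinearity of the killing term on local functions\<close>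

lemma killing_bilinear_add_left:
  assumes f: "f \<in> DL" and g: "g \<in> DL" and w: "w \<in> DN"
  shows "killing_bilinear M E (f + g) w = killing_bilinear M E f w + killing_bilinear M E g w"
proof -
  have wD: "w \<in> D" by (rule DN_D[OF w])
  obtain u where u: "u \<in> D" "AE x in M. u x * w x = f x * w x" using common_local_representative[OF f w w] by blast
  obtain v where v: "v \<in> D" "AE x in M. v x * w x = g x * w x" using common_local_representative[OF g w w] by blast
  have "AE x in M. (u + v) x * w x = (f + g) x * w x"
    using u(2) v(2) by eventually_elim (simp only: plus_fun_apply distrib_right)
  then have "killing_bilinear M E (f + g) w = quad_space.B kill (u + v) w"
    by (rule killing_bilinear_eq[OF mem(1)[OF u(1) v(1)] wD])
  then show ?thesis
    using killing_bilinear_eq[OF u(1) wD u(2)] killing_bilinear_eq[OF v(1) wD v(2)]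
      quad_space.B_add_left[OF quad_space_kill u(1) wD v(1)] by simp
qed

lemma killing_bilinear_scale_left:
  assumes f: "f \<in> DL" and w: "w \<in> DN"
  shows "killing_bilinear M E (c *\<^sub>R f) w = c * killing_bilinear M E f w"
proof -
  have wD: "w \<in> D" by (rule DN_D[OF w])
  obtain u where u: "u \<in> D" "AE x in M. u x * w x = f x * w x" using common_local_representative[OF f w w] by blast
  have "AE x in M. (c *\<^sub>R u) x * w x = (c *\<^sub>R f) x * w x"
    using u(2) by eventually_elim (simp only: scaleR_fun_apply real_scaleR_def mult.assoc)
  then have "killing_bilinear M E (c *\<^sub>R f) w = quad_space.B kill (c *\<^sub>R u) w"
    by (rule killing_bilinear_eq[OF mem(3)[OF u(1)] wD])
  then show ?thesis
    using killing_bilinear_eq[OF u(1) wD u(2)] quad_space.B_scale_left[OF quad_space_kill u(1) wD] by simp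
qed

lemma killing_bilinear_add_right:
  assumes f: "f \<in> DL" and w: "w \<in> DN" and z: "z \<in> DN"
  shows "killing_bilinear M E f (w + z) = killing_bilinear M E f w + killing_bilinear M E f z"
proof -
  have wD: "w \<in> D" "z \<in> D" by (rule DN_D[OF w], rule DN_D[OF z])
  obtain u where u: "u \<in> D" "AE x in M. u x * w x = f x * w x" "AE x in M. u x * z x = f x * z x"
    using common_local_representative[OF f w z] by blast
  have "AE x in M. u x * (w + z) x = f x * (w + z) x"
    using u(2,3) by eventually_elim (simp only: plus_fun_apply distrib_left)
  then have "killing_bilinear M E f (w + z) = quad_space.B kill u (w + z)"
    by (rule killing_bilinear_eq[OF u(1) mem(1)[OF wD]])
  then show ?thesis
    using killing_bilinear_eq[OF u(1) wD(1) u(2)] killing_bilinear_eq[OF u(1) wD(2) u(3)]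
      quad_space.B_add_right[OF quad_space_kill u(1) wD] by simp
qed

lemma killing_bilinear_scale_right:
  assumes f: "f \<in> DL" and w: "w \<in> DN"
  shows "killing_bilinear M E f (c *\<^sub>R w) = c * killing_bilinear M E f w"
proof -
  have wD: "w \<in> D" by (rule DN_D[OF w])
  obtain u where u: "u \<in> D" "AE x in M. u x * w x = f x * w x" using common_local_representative[OF f w w] by blast
  have "AE x in M. u x * (c *\<^sub>R w) x = f x * (c *\<^sub>R w) x" using u(2) by eventually_elim auto
  then have "killing_bilinear M E f (c *\<^sub>R w) = quad_space.B kill u (c *\<^sub>R w)"
    by (rule killing_bilinear_eq[OF u(1) mem(3)[OF wD]])
  then show ?thesis
    using killing_bilinear_eq[OF u(1) wD u(2)] quad_space.B_scale_right[OF quad_space_kill u(1) wD] by simp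
qed

lemma killing_bilinear_cong:
  assumes "AE x in M. f x = f' x" "AE x in M. w x = w' x" and w: "w \<in> DN" "w' \<in> DN" and f: "f \<in> DL"
  shows "killing_bilinear M E f w = killing_bilinear M E f' w'"
proof -
  have wD: "w \<in> D" "w' \<in> D" by (rule DN_D[OF w(1)], rule DN_D[OF w(2)])
  obtain u where u: "u \<in> D" "AE x in M. u x * w x = f x * w x" using common_local_representative[OF f w(1) w(1)] by blast
  have u': "AE x in M. u x * w' x = f' x * w' x" using u(2) assms(1,2) by eventually_elim simp
  interpret k: quad_space D kill by (rule quad_space_kill)
  have z: "w - w' \<in> D" using wD by auto
  have "AE x in M. u x * (w - w') x = 0 * (w - w') x" using assms(2) by eventually_elim simp
  then have "AE x in M. u x * (w - w') x = 0" by simp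
  then have "k.B u (w - w') = 0" by (rule kill_orthogonal[OF u(1) z])
  then have "k.B u w = k.B u w'" using k.B_diff_right[OF u(1) wD] by simp
  then show ?thesis
    using killing_bilinear_eq[OF u(1) wD(1) u(2)] killing_bilinear_eq[OF u(1) wD(2) u'] by simp
qed

section \<open>Limits along the nest and the weak form\<close>

abbreviation LB :: "('a \<Rightarrow> real) \<Rightarrow> ('a \<Rightarrow> real) \<Rightarrow> ('a \<Rightarrow> real) \<Rightarrow> real" where
  "LB \<phi> \<equiv> form_bilinear (local_form M E \<phi>)"

abbreviation DW :: "('a \<Rightarrow> real) set" where "DW \<equiv> weak_domain M E \<N>"

lemma LB_linear:
  assumes \<phi>: "\<phi> \<in> I" and f: "f \<in> DL" and g: "g \<in> DL" and h: "h \<in> DL"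
  shows "LB \<phi> (f + g) h = LB \<phi> f h + LB \<phi> g h" "LB \<phi> (c *\<^sub>R f) h = c * LB \<phi> f h"
    "LB \<phi> h (f + g) = LB \<phi> h f + LB \<phi> h g" "LB \<phi> h (c *\<^sub>R f) = c * LB \<phi> h f"
proof -
  note q = quadratic_form_local_form[OF I_unit[OF \<phi>]]
  interpret l: quad_space "form_domain (local_form M E \<phi>)" "real_form (local_form M E \<phi>)" by (rule quad_space_form[OF q])
  have m: "f \<in> form_domain (local_form M E \<phi>)" "g \<in> form_domain (local_form M E \<phi>)" "h \<in> form_domain (local_form M E \<phi>)"
    using f g h \<phi> DL_local_form by auto
  show "LB \<phi> (f + g) h = LB \<phi> f h + LB \<phi> g h" "LB \<phi> (c *\<^sub>R f) h = c * LB \<phi> f h"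
    "LB \<phi> h (f + g) = LB \<phi> h f + LB \<phi> h g" "LB \<phi> h (c *\<^sub>R f) = c * LB \<phi> h f"
    unfolding form_bilinear_eq_B[OF q]
    by (rule l.B_add_left[OF m(1,3,2)], rule l.B_scale_left[OF m(1,3)],
        rule l.B_add_right[OF m(3,1,2)], rule l.B_scale_right[OF m(3,1)])
qed

lemma LB_cong:
  assumes \<phi>: "\<phi> \<in> I" and f: "f \<in> DL" "f' \<in> DL" and g: "g \<in> DL" "g' \<in> DL"
    and ae: "AE x in M. f x = f' x" "AE x in M. g x = g' x"
  shows "LB \<phi> f g = LB \<phi> f' g'"
proof -
  note cong = quadratic_form_cong_AE[OF quadratic_form_local_form[OF I_unit[OF \<phi>]]]
  have "local_form M E \<phi> (\<lambda>x. f x + g x) = local_form M E \<phi> (\<lambda>x. f' x + g' x)"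
    by (rule cong) (use ae f g DL_measurable in \<open>auto intro!: borel_measurable_add\<close>)
  moreover have "local_form M E \<phi> (\<lambda>x. f x - g x) = local_form M E \<phi> (\<lambda>x. f' x - g' x)"
    by (rule cong) (use ae f g DL_measurable in \<open>auto intro!: borel_measurable_diff\<close>)
  ultimately show ?thesis unfolding form_bilinear_def by simp
qed

definition wl :: "('a \<Rightarrow> real) \<Rightarrow> ('a \<Rightarrow> real) \<Rightarrow> real" where
  "wl f \<psi> = Lim (nest_filter M E \<N>) (\<lambda>\<phi>. LB \<phi> f \<psi>)"

lemma weak_form_eq: "weak_form M E \<N> f \<psi> = wl f \<psi> + killing_bilinear M E f \<psi>"
  by (simp add: weak_form_def wl_def)

lemma DW_DL: "f \<in> DW \<Longrightarrow> f \<in> DL"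
  by (simp add: weak_domain_def)

lemma wl_eq: "((\<lambda>\<phi>. LB \<phi> f \<psi>) \<longlongrightarrow> l) (nest_filter M E \<N>) \<Longrightarrow> wl f \<psi> = l"
  unfolding wl_def by (rule tendsto_Lim[OF nest_filter_not_bot])

lemma DW_tendsto:
  assumes "f \<in> DW" "\<psi> \<in> DN"
  shows "((\<lambda>\<phi>. LB \<phi> f \<psi>) \<longlongrightarrow> wl f \<psi>) (nest_filter M E \<N>)"
proof -
  obtain l where l: "((\<lambda>\<phi>. LB \<phi> f \<psi>) \<longlongrightarrow> l) (nest_filter M E \<N>)"
    using assms by (auto simp: weak_domain_def)
  then show ?thesis using wl_eq[OF l] by simp
qed

lemma DW_I: "f \<in> DL \<Longrightarrow> (\<And>\<psi>. \<psi> \<in> DN \<Longrightarrow> ((\<lambda>\<phi>. LB \<phi> f \<psi>) \<longlongrightarrow> l \<psi>) (nest_filter M E \<N>)) \<Longrightarrow> f \<in> DW"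
  unfolding weak_domain_def by blast

text \<open>Identities for E_\<phi> are available only for \<phi> in \<open>I\<close>, which is
  eventually the case along the filter.\<close>

lemma tendsto_nest_cong:
  "(f \<longlongrightarrow> l) (nest_filter M E \<N>) \<Longrightarrow> (\<And>\<phi>. \<phi> \<in> I \<Longrightarrow> f \<phi> = g \<phi>) \<Longrightarrow> (g \<longlongrightarrow> l) (nest_filter M E \<N>)" for f g :: "_ \<Rightarrow> real"
  by (rule Lim_transform_eventually[OF _ eventually_mono[OF nest_filter_I]])

lemma DN_DL: "\<psi> \<in> DN \<Longrightarrow> \<psi> \<in> DL"
  by (rule D_DL[OF DN_D])

lemma tendsto_LB_add_left:
  assumes "f \<in> DW" "g \<in> DW" "\<psi> \<in> DN"
  shows "((\<lambda>\<phi>. LB \<phi> (f + g) \<psi>) \<longlongrightarrow> wl f \<psi> + wl g \<psi>) (nest_filter M E \<N>)"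
  by (rule tendsto_nest_cong[OF tendsto_add[OF DW_tendsto[OF assms(1,3)] DW_tendsto[OF assms(2,3)]]])
    (rule LB_linear(1)[OF _ DW_DL[OF assms(1)] DW_DL[OF assms(2)] DN_DL[OF assms(3)], symmetric])

lemma tendsto_LB_scale_left:
  assumes "f \<in> DW" "\<psi> \<in> DN"
  shows "((\<lambda>\<phi>. LB \<phi> (c *\<^sub>R f) \<psi>) \<longlongrightarrow> c * wl f \<psi>) (nest_filter M E \<N>)"
  by (rule tendsto_nest_cong[OF tendsto_mult[OF tendsto_const DW_tendsto[OF assms]]])
    (rule LB_linear(2)[OF _ DW_DL[OF assms(1)] DW_DL[OF assms(1)] DN_DL[OF assms(2)], symmetric])

lemma tendsto_LB_cong:
  assumes f: "f \<in> DW" "f' \<in> DL" and \<psi>: "\<psi> \<in> DN" "\<psi>' \<in> DN" and ae: "AE x in M. f x = f' x" "AE x in M. \<psi> x = \<psi>' x"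
  shows "((\<lambda>\<phi>. LB \<phi> f' \<psi>') \<longlongrightarrow> wl f \<psi>) (nest_filter M E \<N>)"
  by (rule tendsto_nest_cong[OF DW_tendsto[OF f(1) \<psi>(1)]])
    (rule LB_cong[OF _ DW_DL[OF f(1)] f(2) DN_DL[OF \<psi>(1)] DN_DL[OF \<psi>(2)] ae])

text \<open>The polarised form of the monotone convergence to the main part; it yields existence of
  the limits that define the weak domain.\<close>

lemma tendsto_LB_D:
  assumes f: "f \<in> D" and \<psi>: "\<psi> \<in> D"
  shows "((\<lambda>\<phi>. LB \<phi> f \<psi>) \<longlongrightarrow> (main (f + \<psi>) - main (f - \<psi>)) / 4) (nest_filter M E \<N>)"
proof -
  have "((\<lambda>\<phi>. (lf \<phi> (f + \<psi>) - lf \<phi> (f - \<psi>)) / 4) \<longlongrightarrow> (main (f + \<psi>) - main (f - \<psi>)) / 4) (nest_filter M E \<N>)"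
    by (intro tendsto_intros tendsto_lf_main mem(1,2) f \<psi>) simp
  then show ?thesis by (simp only: form_bilinear_def lf_def plus_fun_def fun_diff_def)
qed

lemma D_DW: "f \<in> D \<Longrightarrow> f \<in> DW"
  by (rule DW_I[OF D_DL tendsto_LB_D[OF _ DN_D]])

text \<open>The limit is the polarised main part and the killing term the polarisation of
  \<open>Q\<close> minus the main part, so together they give \<open>B\<close>.\<close>

lemma weak_form_extends:
  assumes f: "f \<in> D" and \<psi>: "\<psi> \<in> DN"
  shows "weak_form M E \<N> f \<psi> = form_bilinear E f \<psi>"
proof -
  have \<psi>D: "\<psi> \<in> D" by (rule DN_D[OF \<psi>])
  have "killing_bilinear M E f \<psi> = quad_space.B kill f \<psi>" by (rule killing_bilinear_eq[OF f \<psi>D]) simp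
  then show ?thesis
    unfolding weak_form_eq wl_eq[OF tendsto_LB_D[OF f \<psi>D]] B_eq B_def
    by (simp add: quad_space.B_def[OF quad_space_kill] kill_def field_simps)
qed

lemma L0_subspace_DW: "L0_subspace M DW"
  unfolding L0_subspace_def
proof (intro conjI allI ballI impI)
  show "DW \<subseteq> borel_measurable M" using DL_measurable DW_DL by blast
  show "(\<lambda>x. 0) \<in> DW" using D_DW[OF mem(4)] unfolding zero_fun_def .
  show "(\<lambda>x. u x + v x) \<in> DW" if "u \<in> DW" "v \<in> DW" for u v
    using DW_I[OF subspace_add[OF subspace_DL DW_DL[OF that(1)] DW_DL[OF that(2)]] tendsto_LB_add_left[OF that]]
    unfolding plus_fun_def .
  show "(\<lambda>x. c * u x) \<in> DW" if "u \<in> DW" for c u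
    using DW_I[OF subspace_scale[OF subspace_DL DW_DL[OF that]] tendsto_LB_scale_left[OF that]]
    unfolding scaleR_fun_def real_scaleR_def .
  show "v \<in> DW" if u: "u \<in> DW" and v: "v \<in> borel_measurable M" and ae: "AE x in M. u x = v x" for u v
  proof -
    have vL: "v \<in> DL" by (rule DL_cong_AE[OF DW_DL[OF u] v ae])
    show ?thesis by (rule DW_I[OF vL tendsto_LB_cong[OF u vL _ _ ae]]) auto
  qed
qed

lemma L0_bilinear_weak_form: "L0_bilinear M DW DN (weak_form M E \<N>)"
  unfolding L0_bilinear_def
proof (intro conjI allI ballI impI)
  fix u u' w w' assume u: "u \<in> DW" "u' \<in> DW" and w: "w \<in> DN" "w' \<in> DN"
    and ae: "(AE x in M. u x = u' x) \<and> (AE x in M. w x = w' x)"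
  have "wl u' w' = wl u w"
    by (rule wl_eq[OF tendsto_LB_cong[OF u(1) DW_DL[OF u(2)] w]]) (use ae in auto)
  moreover have "killing_bilinear M E u w = killing_bilinear M E u' w'"
    by (rule killing_bilinear_cong[OF _ _ w DW_DL[OF u(1)]]) (use ae in auto)
  ultimately show "weak_form M E \<N> u w = weak_form M E \<N> u' w'" by (simp add: weak_form_eq)
next
  fix u v w assume u: "u \<in> DW" and v: "v \<in> DW" and w: "w \<in> DN"
  have "weak_form M E \<N> (u + v) w = weak_form M E \<N> u w + weak_form M E \<N> v w"
    unfolding weak_form_eq wl_eq[OF tendsto_LB_add_left[OF u v w]]
      killing_bilinear_add_left[OF DW_DL[OF u] DW_DL[OF v] w] by simp
  then show "weak_form M E \<N> (\<lambda>x. u x + v x) w = weak_form M E \<N> u w + weak_form M E \<N> v w"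
    unfolding plus_fun_def .
next
  fix c u w assume u: "u \<in> DW" and w: "w \<in> DN"
  have "weak_form M E \<N> (c *\<^sub>R u) w = c * weak_form M E \<N> u w"
    unfolding weak_form_eq wl_eq[OF tendsto_LB_scale_left[OF u w]]
      killing_bilinear_scale_left[OF DW_DL[OF u] w] by (simp add: distrib_left)
  then show "weak_form M E \<N> (\<lambda>x. c * u x) w = c * weak_form M E \<N> u w"
    unfolding scaleR_fun_def real_scaleR_def .
next
  fix u w z assume u: "u \<in> DW" and w: "w \<in> DN" and z: "z \<in> DN"
  have "((\<lambda>\<phi>. LB \<phi> u (w + z)) \<longlongrightarrow> wl u w + wl u z) (nest_filter M E \<N>)"
    by (rule tendsto_nest_cong[OF tendsto_add[OF DW_tendsto[OF u w] DW_tendsto[OF u z]]])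
      (rule LB_linear(3)[OF _ DN_DL[OF w] DN_DL[OF z] DW_DL[OF u], symmetric])
  from wl_eq[OF this] have "weak_form M E \<N> u (w + z) = weak_form M E \<N> u w + weak_form M E \<N> u z"
    unfolding weak_form_eq killing_bilinear_add_right[OF DW_DL[OF u] w z] by simp
  then show "weak_form M E \<N> u (\<lambda>x. w x + z x) = weak_form M E \<N> u w + weak_form M E \<N> u z"
    unfolding plus_fun_def .
next
  fix c u w assume u: "u \<in> DW" and w: "w \<in> DN"
  have "((\<lambda>\<phi>. LB \<phi> u (c *\<^sub>R w)) \<longlongrightarrow> c * wl u w) (nest_filter M E \<N>)"
    by (rule tendsto_nest_cong[OF tendsto_mult[OF tendsto_const DW_tendsto[OF u w]]])
      (rule LB_linear(4)[OF _ DN_DL[OF w] DN_DL[OF w] DW_DL[OF u], symmetric])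
  from wl_eq[OF this] have "weak_form M E \<N> u (c *\<^sub>R w) = c * weak_form M E \<N> u w"
    unfolding weak_form_eq killing_bilinear_scale_right[OF DW_DL[OF u] w] by (simp add: distrib_left)
  then show "weak_form M E \<N> u (\<lambda>x. c * w x) = c * weak_form M E \<N> u w"
    unfolding scaleR_fun_def real_scaleR_def .
qed

end

theorem theorem4p5:
  fixes M :: "'a measure" and E :: "('a \<Rightarrow> real) \<Rightarrow> ereal" and \<N> :: "'a set set"
  assumes "localizable M"
    and "energy_form M E"
    and "special_nest M E \<N>"
  shows "L0_subspace M (weak_domain M E \<N>) \<and>
    form_domain E \<subseteq> weak_domain M E \<N> \<and>
    L0_bilinear M (weak_domain M E \<N>) (nest_domain M E \<N>) (weak_form M E \<N>) \<and>
    (\<forall>f\<in>form_domain E. \<forall>\<psi>\<in>nest_domain M E \<N>. weak_form M E \<N> f \<psi> = form_bilinear E f \<psi>)"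
proof -
  interpret energy_nest M E \<N>
    by unfold_locales (use assms in \<open>auto simp: special_nest_def\<close>)
  show ?thesis
    using L0_subspace_DW L0_bilinear_weak_form weak_form_extends D_DW by blast
qed

end
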